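(* Let $V$ be a finite dimensional complex vector space, $G\subseteq GL(V)$ a finite subgroup, and $A_{\mathbf{t},\mathbf{c}}$ a graded Hecke algebra attached to $(V,G)$ with parameters $\mathbf{t}=(t_1,\ldots,t_N)\in\mathbb{C}^N$ and $\mathbf{c}=(c_s)_{s\in\mathcal{S}'}$. Then the following are equivalent: (a) $A_{\mathbf{t},\mathbf{c}}$ is a PI algebra; (b) $A_{\mathbf{t},\mathbf{c}}$ is a finitely generated module over its centre; (c) $t_i=0$ for all $i\in\{1,\ldots,N\}$.
   Context: Let $V$ be a finite dimensional vector space over $\mathbb{C}$ and $G$ a finite subgroup of $GL(V)$. The skew group algebra $T(V)\ast G$ is $T(V)\otimes\mathbb{C}G$ with multiplication determined by $g\,v=g(v)\,g$ for $g\in G$, $v\in V$. A bireflection is an element $s\neq id$ of $G$ with $\operatorname{rank}_V(id-s)=2$; write $V^s=\ker(id-s)$, so $V=V^s\oplus \operatorname{im}(id-s)$. Let $\mathcal{S}$ be the set of bireflections in $G$ and $\mathcal{S}'=\{s\in\mathcal{S}: \det(g|_{V/V^s})=1 \text{ for all } g\in Z_G(s)\}$, where $Z_G(s)$ is the centraliser; $\mathcal{S}'$ is closed under conjugation by $G$. For $s\in\mathcal{S}'$, $\Omega_s$ denotes a nonzero skew-symmetric bilinear form on $V$ with radical $V^s$ (unique up to scalar). These forms are chosen compatibly along conjugacy classes: $\Omega_{g^{-1}sg}(v,w)=\Omega_s(g(v),g(w))$ for all $g\in G$, $v,w\in V$ (this is well defined on $\mathcal{S}'$). Let $b_1,\ldots,b_N$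 be a $\mathbb{C}$-basis of $((\bigwedge^2V)^{\ast})^G$, the space of $G$-invariant skew-symmetric bilinear forms on $V$. For $\mathbf{t}=(t_1,\ldots,t_N)\in\mathbb{C}^N$ and a $G$-conjugation-invariant function $\mathbf{c}:\mathcal{S}'\to\mathbb{C}$, $s\mapsto c_s$, put $\kappa(v,w)=\sum_{i=1}^N t_ib_i(v,w)\,id+\sum_{s\in\mathcal{S}'}c_s\Omega_s(v,w)\,s\in\mathbb{C}G$. The graded Hecke algebra is $A_{\mathbf{t},\mathbf{c}}=(T(V)\ast G)/\langle vw-wv-\kappa(v,w): v,w\in V\rangle$. By a known theorem (Drinfeld, Ram–Shepler), these are exactly the algebras of the form $A=(T(V)\ast G)/\langle vw-wv-\kappa(v,w)\rangle$, with $\kappa:V\times V\to\mathbb{C}G$ skew-symmetric bilinear, for which the natural surjection $S(V)\ast G\to \operatorname{gr}A$ is an isomorphism of graded algebras, where $A$ has the filtration $F^0=\mathbb{C}G$, $F^1=\mathbb{C}G+V\mathbb{C}G$, $F^i=(F^1)^i$. A PI algebra is an algebra satisfying a (monic) polynomial identity. *)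

theory Defs
  imports
    Complex_Main
    "HOL-Algebra.QuotRing"
    "HOL-Algebra.Module"
    "Jordan_Normal_Form.Determinant"
begin

text \<open>
  Associative complex algebras are represented by the record type \<^typ>\<open>(complex, 'a) module\<close>:
  a (not necessarily commutative) ring together with a scalar multiplication by complex numbers.
  (The locale \<^locale>\<open>algebra\<close> of the library is for commutative algebras only.)
\<close>

text \<open>
  Quotient by a two-sided ideal. On a unital algebra every ring ideal is closed under scalars,
  so the scalar multiplication descends to cosets.
\<close>

definition quotient_algebra ::
  "(complex, 'a) module \<Rightarrow> 'a set \<Rightarrow> (complex, 'a set) module" where
  "quotient_algebra R I =
     \<lparr>carrier = carrier (R Quot I), monoid.mult = monoid.mult (R Quot I), one = monoid.one (R Quot I),
      zero = ring.zero (R Quot I), add = ring.add (R Quot I),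
      module.smult = (\<lambda>z X. \<Union>x\<in>X. I +>\<^bsub>R\<^esub> (z \<odot>\<^bsub>R\<^esub> x))\<rparr>"

text \<open>
  The free associative algebra on the type of letters \<open>'x\<close>: an element is given by its
  finitely supported family of coefficients, indexed by words. The product sums over all
  factorisations of a word into two factors.
\<close>

definition free_algebra :: "(complex, 'x list \<Rightarrow> complex) module" where
  "free_algebra =
     \<lparr>carrier = {f. finite {w. f w \<noteq> 0}},
      monoid.mult = (\<lambda>f g w. \<Sum>i\<le>length w. f (take i w) * g (drop i w)),
      one = (\<lambda>w. if w = [] then 1 else 0),
      zero = (\<lambda>w. 0),
      add = (\<lambda>f g w. f w + g w),
      module.smult = (\<lambda>z f w. z * f w)\<rparr>"

definition letter :: "'x \<Rightarrow> 'x list \<Rightarrow> complex" where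
  "letter x = (\<lambda>w. if w = [x] then 1 else 0)"


subsection \<open>Polynomial identities and centres\<close>

definition word_eval :: "(complex, 'a) module \<Rightarrow> (nat \<Rightarrow> 'a) \<Rightarrow> nat list \<Rightarrow> 'a" where
  "word_eval A a w = foldr (\<lambda>i x. a i \<otimes>\<^bsub>A\<^esub> x) w \<one>\<^bsub>A\<^esub>"

definition nc_poly_eval ::
  "(complex, 'a) module \<Rightarrow> (nat list \<Rightarrow> complex) \<Rightarrow> (nat \<Rightarrow> 'a) \<Rightarrow> 'a" where
  "nc_poly_eval A f a = (\<Oplus>\<^bsub>A\<^esub> w \<in> {w. f w \<noteq> 0}. f w \<odot>\<^bsub>A\<^esub> word_eval A a w)"

text \<open>Some monomial of highest degree has coefficient one.\<close>

definition nc_monic :: "(nat list \<Rightarrow> complex) \<Rightarrow> bool" where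
  "nc_monic f \<longleftrightarrow> (\<exists>w. f w = 1 \<and> (\<forall>u. f u \<noteq> 0 \<longrightarrow> length u \<le> length w))"

definition PI_algebra :: "(complex, 'a) module \<Rightarrow> bool" where
  "PI_algebra A \<longleftrightarrow>
     (\<exists>f \<in> carrier free_algebra. nc_monic f \<and>
        (\<forall>a. (\<forall>i. a i \<in> carrier A) \<longrightarrow> nc_poly_eval A f a = \<zero>\<^bsub>A\<^esub>))"

definition ring_centre :: "('a, 'm) ring_scheme \<Rightarrow> 'a set" where
  "ring_centre R = {z \<in> carrier R. \<forall>x \<in> carrier R. z \<otimes>\<^bsub>R\<^esub> x = x \<otimes>\<^bsub>R\<^esub> z}"

definition finite_over_centre :: "('a, 'm) ring_scheme \<Rightarrow> bool" where
  "finite_over_centre R \<longleftrightarrow>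
     (\<exists>S. finite S \<and> S \<subseteq> carrier R \<and>
        (\<forall>x \<in> carrier R. \<exists>z \<in> S \<rightarrow> ring_centre R. x = (\<Oplus>\<^bsub>R\<^esub> y \<in> S. z y \<otimes>\<^bsub>R\<^esub> y)))"


subsection \<open>Tensor algebra and skew group algebra\<close>

text \<open>
  Throughout, \<open>sc\<close> is the scalar multiplication of the complex vector space \<open>V\<close>, whose
  underlying set is all of the type \<open>'v\<close>.
\<close>

definition GL :: "(complex \<Rightarrow> 'v \<Rightarrow> 'v) \<Rightarrow> ('v::ab_group_add \<Rightarrow> 'v) monoid" where
  "GL sc = \<lparr>carrier = {g. Vector_Spaces.linear sc sc g \<and> bij g}, monoid.mult = (\<circ>), one = id\<rparr>"

text \<open>
  The tensor algebra is the free algebra on the underlying set of \<open>V\<close> modulo the relations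
  saying that the canonical map from \<open>V\<close> is linear.
\<close>

definition linearity_ideal ::
  "(complex \<Rightarrow> 'v \<Rightarrow> 'v) \<Rightarrow> ('v::ab_group_add list \<Rightarrow> complex) set" where
  "linearity_ideal sc = Idl\<^bsub>free_algebra\<^esub>
     ({letter (v + w) \<ominus>\<^bsub>free_algebra\<^esub> (letter v \<oplus>\<^bsub>free_algebra\<^esub> letter w) | v w. True} \<union>
      {letter (sc z v) \<ominus>\<^bsub>free_algebra\<^esub> (z \<odot>\<^bsub>free_algebra\<^esub> letter v) | z v. True})"

definition tensor_algebra ::
  "(complex \<Rightarrow> 'v \<Rightarrow> 'v) \<Rightarrow> (complex, ('v::ab_group_add list \<Rightarrow> complex) set) module" where
  "tensor_algebra sc = quotient_algebra free_algebra (linearity_ideal sc)"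

definition tensor_vec ::
  "(complex \<Rightarrow> 'v \<Rightarrow> 'v) \<Rightarrow> 'v::ab_group_add \<Rightarrow> ('v list \<Rightarrow> complex) set" where
  "tensor_vec sc v = linearity_ideal sc +>\<^bsub>free_algebra\<^esub> letter v"

text \<open>
  The algebra automorphism of the tensor algebra extending \<open>g\<close>. On the free algebra, \<open>g\<close> moves
  the coefficient of a word \<open>u\<close> to the word \<open>map g u\<close>; this automorphism preserves the linearity
  ideal, so it maps cosets to cosets.
\<close>

definition tensor_act ::
  "('v \<Rightarrow> 'v) \<Rightarrow> ('v list \<Rightarrow> complex) set \<Rightarrow> ('v list \<Rightarrow> complex) set" where
  "tensor_act g X = (\<lambda>f w. f (map (inv_into UNIV g) w)) ` X"

text \<open>
  The skew group algebra of a finite group \<open>K\<close> acting on an algebra \<open>R\<close>. As a vector space it is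
  the tensor product of \<open>R\<close> with the group algebra: a function \<open>f\<close> stands for the sum of
  the elements \<open>f g \<otimes> g\<close> over \<open>g\<close> in \<open>K\<close>. The product is determined by
  \<open>(a \<otimes> g) (b \<otimes> h) = a g(b) \<otimes> g h\<close>.
\<close>

definition skew_group_algebra ::
  "(complex, 'a) module \<Rightarrow> 'g monoid \<Rightarrow> ('g \<Rightarrow> 'a \<Rightarrow> 'a) \<Rightarrow> (complex, 'g \<Rightarrow> 'a) module" where
  "skew_group_algebra R K act =
     \<lparr>carrier = carrier K \<rightarrow>\<^sub>E carrier R,
      monoid.mult = (\<lambda>f h. \<lambda>k\<in>carrier K.
        \<Oplus>\<^bsub>R\<^esub> g \<in> carrier K. f g \<otimes>\<^bsub>R\<^esub> act g (h (inv\<^bsub>K\<^esub> g \<otimes>\<^bsub>K\<^esub> k))),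
      one = (\<lambda>k\<in>carrier K. if k = \<one>\<^bsub>K\<^esub> then \<one>\<^bsub>R\<^esub> else \<zero>\<^bsub>R\<^esub>),
      zero = (\<lambda>k\<in>carrier K. \<zero>\<^bsub>R\<^esub>),
      add = (\<lambda>f h. \<lambda>k\<in>carrier K. f k \<oplus>\<^bsub>R\<^esub> h k),
      module.smult = (\<lambda>z f. \<lambda>k\<in>carrier K. z \<odot>\<^bsub>R\<^esub> f k)\<rparr>"

definition skew_tensor_algebra ::
  "(complex \<Rightarrow> 'v \<Rightarrow> 'v) \<Rightarrow> ('v::ab_group_add \<Rightarrow> 'v) set \<Rightarrow>
   (complex, ('v \<Rightarrow> 'v) \<Rightarrow> ('v list \<Rightarrow> complex) set) module" where
  "skew_tensor_algebra sc G =
     skew_group_algebra (tensor_algebra sc) (GL sc\<lparr>carrier := G\<rparr>) tensor_act"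

definition skew_vec ::
  "(complex \<Rightarrow> 'v \<Rightarrow> 'v) \<Rightarrow> ('v::ab_group_add \<Rightarrow> 'v) set \<Rightarrow> 'v \<Rightarrow>
   ('v \<Rightarrow> 'v) \<Rightarrow> ('v list \<Rightarrow> complex) set" where
  "skew_vec sc G v = (\<lambda>k\<in>G. if k = id then tensor_vec sc v else \<zero>\<^bsub>tensor_algebra sc\<^esub>)"

definition skew_grp ::
  "(complex \<Rightarrow> 'v \<Rightarrow> 'v) \<Rightarrow> ('v::ab_group_add \<Rightarrow> 'v) set \<Rightarrow> ('v \<Rightarrow> 'v) \<Rightarrow>
   ('v \<Rightarrow> 'v) \<Rightarrow> ('v list \<Rightarrow> complex) set" where
  "skew_grp sc G g =
     (\<lambda>k\<in>G. if k = g then \<one>\<^bsub>tensor_algebra sc\<^esub> else \<zero>\<^bsub>tensor_algebra sc\<^esub>)"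


subsection \<open>Bireflections\<close>

definition fixed_space :: "('v::ab_group_add \<Rightarrow> 'v) \<Rightarrow> 'v set" where
  "fixed_space s = {v. v - s v = 0}"

definition bireflections ::
  "(complex \<Rightarrow> 'v \<Rightarrow> 'v) \<Rightarrow> ('v::ab_group_add \<Rightarrow> 'v) set \<Rightarrow> ('v \<Rightarrow> 'v) set" where
  "bireflections sc G =
     {s \<in> G. s \<noteq> id \<and> vector_space.dim sc (range (\<lambda>v. v - s v)) = 2}"

text \<open>The cosets of the vectors in the list \<open>xs\<close> form an (ordered) basis of \<open>V / W\<close>.\<close>

definition basis_mod ::
  "(complex \<Rightarrow> 'v \<Rightarrow> 'v) \<Rightarrow> 'v::ab_group_add set \<Rightarrow> 'v list \<Rightarrow> bool" where
  "basis_mod sc W xs \<longleftrightarrow>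
     (\<forall>a. (\<Sum>i<length xs. sc (a i) (xs ! i)) \<in> W \<longrightarrow> (\<forall>i<length xs. a i = 0)) \<and>
     (\<forall>v. \<exists>a. v - (\<Sum>i<length xs. sc (a i) (xs ! i)) \<in> W)"

text \<open>\<open>M\<close> is the matrix, in the basis \<open>xs\<close> of \<open>V / W\<close>, of the endomorphism induced by \<open>g\<close>.\<close>

definition matrix_mod ::
  "(complex \<Rightarrow> 'v \<Rightarrow> 'v) \<Rightarrow> 'v::ab_group_add set \<Rightarrow> 'v list \<Rightarrow> ('v \<Rightarrow> 'v) \<Rightarrow> complex mat \<Rightarrow> bool"
  where
  "matrix_mod sc W xs g M \<longleftrightarrow>
     M \<in> carrier_mat (length xs) (length xs) \<and>
     (\<forall>j<length xs. g (xs ! j) - (\<Sum>i<length xs. sc (M $$ (i, j)) (xs ! i)) \<in> W)"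

text \<open>
  The determinant of the endomorphism of \<open>V / W\<close> induced by a linear map \<open>g\<close> that preserves
  the subspace \<open>W\<close>. The value does not depend on the basis, so the description is definite.
\<close>

definition det_mod ::
  "(complex \<Rightarrow> 'v \<Rightarrow> 'v) \<Rightarrow> 'v::ab_group_add set \<Rightarrow> ('v \<Rightarrow> 'v) \<Rightarrow> complex" where
  "det_mod sc W g =
     (THE d. \<exists>xs M. basis_mod sc W xs \<and> matrix_mod sc W xs g M \<and> d = Determinant.det M)"

definition centraliser :: "('v \<Rightarrow> 'v) set \<Rightarrow> ('v \<Rightarrow> 'v) \<Rightarrow> ('v \<Rightarrow> 'v) set" where
  "centraliser G s = {g \<in> G. g \<circ> s = s \<circ> g}"

definition special_bireflections ::
  "(complex \<Rightarrow> 'v \<Rightarrow> 'v) \<Rightarrow> ('v::ab_group_add \<Rightarrow> 'v) set \<Rightarrow> ('v \<Rightarrow> 'v) set" where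
  "special_bireflections sc G =
     {s \<in> bireflections sc G. \<forall>g \<in> centraliser G s. det_mod sc (fixed_space s) g = 1}"


subsection \<open>Skew-symmetric forms\<close>

definition skew_form ::
  "(complex \<Rightarrow> 'v \<Rightarrow> 'v) \<Rightarrow> ('v::ab_group_add \<Rightarrow> 'v \<Rightarrow> complex) \<Rightarrow> bool" where
  "skew_form sc B \<longleftrightarrow>
     (\<forall>v. Vector_Spaces.linear sc (*) (B v)) \<and>
     (\<forall>w. Vector_Spaces.linear sc (*) (\<lambda>v. B v w)) \<and>
     (\<forall>v w. B v w = - B w v)"

definition form_radical :: "('v \<Rightarrow> 'v \<Rightarrow> complex) \<Rightarrow> 'v set" where
  "form_radical B = {v. \<forall>w. B v w = 0}"

definition invariant_skew_forms ::
  "(complex \<Rightarrow> 'v \<Rightarrow> 'v) \<Rightarrow> ('v::ab_group_add \<Rightarrow> 'v) set \<Rightarrow> ('v \<Rightarrow> 'v \<Rightarrow> complex) set" where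
  "invariant_skew_forms sc G =
     {B. skew_form sc B \<and> (\<forall>g\<in>G. \<forall>v w. B (g v) (g w) = B v w)}"

text \<open>\<open>b 1, \<dots>, b N\<close> is a basis of the space of invariant skew-symmetric bilinear forms.\<close>

definition invariant_form_basis ::
  "(complex \<Rightarrow> 'v \<Rightarrow> 'v) \<Rightarrow> ('v::ab_group_add \<Rightarrow> 'v) set \<Rightarrow> nat \<Rightarrow>
   (nat \<Rightarrow> 'v \<Rightarrow> 'v \<Rightarrow> complex) \<Rightarrow> bool" where
  "invariant_form_basis sc G N b \<longleftrightarrow>
     (\<forall>i\<in>{1..N}. b i \<in> invariant_skew_forms sc G) \<and>
     (\<forall>a. (\<forall>v w. (\<Sum>i=1..N. a i * b i v w) = 0) \<longrightarrow> (\<forall>i\<in>{1..N}. a i = 0)) \<and>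
     (\<forall>B\<in>invariant_skew_forms sc G. \<exists>a. \<forall>v w. B v w = (\<Sum>i=1..N. a i * b i v w))"

definition compatible_forms ::
  "(complex \<Rightarrow> 'v \<Rightarrow> 'v) \<Rightarrow> ('v::ab_group_add \<Rightarrow> 'v) set \<Rightarrow>
   (('v \<Rightarrow> 'v) \<Rightarrow> 'v \<Rightarrow> 'v \<Rightarrow> complex) \<Rightarrow> bool" where
  "compatible_forms sc G \<Omega> \<longleftrightarrow>
     (\<forall>s \<in> special_bireflections sc G.
        skew_form sc (\<Omega> s) \<and> (\<exists>v w. \<Omega> s v w \<noteq> 0) \<and> form_radical (\<Omega> s) = fixed_space s \<and>
        (\<forall>g\<in>G. \<forall>v w. \<Omega> (inv_into UNIV g \<circ> s \<circ> g) v w = \<Omega> s (g v) (g w)))"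

definition conjugation_invariant ::
  "(complex \<Rightarrow> 'v \<Rightarrow> 'v) \<Rightarrow> ('v::ab_group_add \<Rightarrow> 'v) set \<Rightarrow> (('v \<Rightarrow> 'v) \<Rightarrow> complex) \<Rightarrow> bool"
  where
  "conjugation_invariant sc G c \<longleftrightarrow>
     (\<forall>s \<in> special_bireflections sc G. \<forall>g\<in>G. c (inv_into UNIV g \<circ> s \<circ> g) = c s)"


subsection \<open>Graded Hecke algebras\<close>

text \<open>
  The form \<open>\<kappa>\<close> takes values in the group algebra, which is regarded as a subalgebra of the
  skew group algebra.
\<close>

definition hecke_kappa ::
  "(complex \<Rightarrow> 'v \<Rightarrow> 'v) \<Rightarrow> ('v::ab_group_add \<Rightarrow> 'v) set \<Rightarrow> nat \<Rightarrow>
   (nat \<Rightarrow> 'v \<Rightarrow> 'v \<Rightarrow> complex) \<Rightarrow> (('v \<Rightarrow> 'v) \<Rightarrow> 'v \<Rightarrow> 'v \<Rightarrow> complex) \<Rightarrow>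
   (nat \<Rightarrow> complex) \<Rightarrow> (('v \<Rightarrow> 'v) \<Rightarrow> complex) \<Rightarrow> 'v \<Rightarrow> 'v \<Rightarrow>
   ('v \<Rightarrow> 'v) \<Rightarrow> ('v list \<Rightarrow> complex) set" where
  "hecke_kappa sc G N b \<Omega> t c v w =
     ((\<Sum>i=1..N. t i * b i v w) \<odot>\<^bsub>skew_tensor_algebra sc G\<^esub> skew_grp sc G id)
     \<oplus>\<^bsub>skew_tensor_algebra sc G\<^esub>
     (\<Oplus>\<^bsub>skew_tensor_algebra sc G\<^esub> s \<in> special_bireflections sc G.
        (c s * \<Omega> s v w) \<odot>\<^bsub>skew_tensor_algebra sc G\<^esub> skew_grp sc G s)"

definition graded_hecke_algebra ::
  "(complex \<Rightarrow> 'v \<Rightarrow> 'v) \<Rightarrow> ('v::ab_group_add \<Rightarrow> 'v) set \<Rightarrow> nat \<Rightarrow>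
   (nat \<Rightarrow> 'v \<Rightarrow> 'v \<Rightarrow> complex) \<Rightarrow> (('v \<Rightarrow> 'v) \<Rightarrow> 'v \<Rightarrow> 'v \<Rightarrow> complex) \<Rightarrow>
   (nat \<Rightarrow> complex) \<Rightarrow> (('v \<Rightarrow> 'v) \<Rightarrow> complex) \<Rightarrow>
   (complex, (('v \<Rightarrow> 'v) \<Rightarrow> ('v list \<Rightarrow> complex) set) set) module" where
  "graded_hecke_algebra sc G N b \<Omega> t c =
     (let T = skew_tensor_algebra sc G; x = skew_vec sc G in
      quotient_algebra T
        (Idl\<^bsub>T\<^esub> {(x v \<otimes>\<^bsub>T\<^esub> x w \<ominus>\<^bsub>T\<^esub> x w \<otimes>\<^bsub>T\<^esub> x v)
                   \<ominus>\<^bsub>T\<^esub> hecke_kappa sc G N b \<Omega> t c v w | v w. True}))"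

end

theory Submission
  imports Defs "HOL-Library.Poly_Mapping" "HOL-Computational_Algebra.Polynomial"
    "HOL-Computational_Algebra.Fundamental_Theorem_Algebra" "HOL-Combinatorics.Permutations"
begin

text \<open>
  The algebra is a quotient \<open>FG / J\<close> of a monoid algebra on words with group elements. The PBW theorem is
  used through functionals on words that vanish on \<open>J\<close>: they give each element of degree \<open>n\<close> a symbol, a
  polynomial function of degree \<open>n\<close> for every group element, and the symbol determines the element up to
  lower degree.

  A \<open>G\<close>-invariant function of degree \<open>m\<close> lifts to an element \<open>P\<close> that commutes with \<open>G\<close>, and the symbols of
  the commutators of \<open>P\<close> form a Poisson bracket; the bracket of degree \<open>-2\<close> is the one given by the scalar
  part \<open>\<kappa> id\<close> of \<open>\<kappa>\<close>. If the scalar part is zero, the leading brackets have degree at most \<open>-3\<close>, and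
  such a bracket vanishes: restricted to a generic line, its quotient by a suitable product of linear forms
  is a rational function without poles that tends to zero at infinity. So every
  invariant function has a central lift, and the algebra is finite over its centre. An algebra that is
  finite over its centre satisfies a standard identity.

  If \<open>\<omega> = \<kappa> id\<close> is nonzero, choose \<open>l\<close> with \<open>\<chi> = \<omega>(l, -)\<close> nonzero, and an invariant function whose
  Hamiltonian vector field at \<open>\<chi>\<close> is a nonzero multiple of \<open>\<chi>\<close>. Modulo the left ideal generated by a lift
  \<open>W\<close> of it, \<open>W\<close> acts on elements of degree \<open>n\<close>, evaluated at \<open>\<chi>\<close>, as a multiple of \<open>n\<close>, like an Euler
  operator. Products of shifts of \<open>W\<close> pick out single degrees, and substituting such products into a monic
  polynomial isolates one of its leading monomials.
\<close>

subsection \<open>The monoid algebra of words with group elements\<close>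

text \<open>PBW enters as the existence of enough functionals. They are built by sorting words;
  equivariance and the Jacobi identity of \<kappa> make all orders of sorting agree. The symbol of
  [P, v] has components at all group elements. Those at \<open>h \<noteq> id\<close> are of the form
  \<open>q * (v - h v)\<close> and are removed by a correction of \<open>P\<close> of lower degree;
  only the identity component is an obstruction. A bracket of degree -k, read as a skew form on
  gradients, has coefficients of degree 2 - k, so k = 3 is the first case in which absence of poles
  forces zero. Poles can occur only where gradients of invariants do not span. A generic line meets
  this set at points whose stabiliser moves vectors along one direction \<alpha>; the gradients
  there span the fixed vectors, and \<beta>(\<alpha>, \<alpha>) = 0 controls the missing direction.
  Conversely, the degree of an element must be detected by multiplication. Commutators with
  \<open>W\<close> detect it; modulo the left ideal of \<open>W\<close>, the product
  \<open>W * x\<close> becomes [W, x]. Values at \<chi> survive this quotient because the symbol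
  \<open>f\<close> of \<open>W\<close> vanishes at \<chi>.\<close>

datatype 'v skw = SK (wd: "'v list") (gp: "'v \<Rightarrow> 'v")

text \<open>Written additively because the product of \<open>Poly_Mapping\<close> convolves over the
  addition of the index type. Any function acts on words through \<open>map\<close>, so this is a
  monoid for arbitrary group parts; the restriction to a group is imposed later, by
  \<open>FG\<close>.\<close>

instantiation skw :: (type) monoid_add
begin
definition zero_skw :: "'a skw" where "zero_skw = SK [] id"
definition plus_skw :: "'a skw \<Rightarrow> 'a skw \<Rightarrow> 'a skw" where
  "plus_skw k l = SK (wd k @ map (gp k) (wd l)) (gp k \<circ> gp l)"
instance
  by standard (auto simp: zero_skw_def plus_skw_def comp_assoc)
end

lemma SK_add: "SK u g + SK v h = SK (u @ map g v) (g \<circ> h)"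
  by (simp add: plus_skw_def)

type_synonym 'v sk = "'v skw \<Rightarrow>\<^sub>0 complex"

abbreviation lookup :: "('a \<Rightarrow>\<^sub>0 'b::zero) \<Rightarrow> 'a \<Rightarrow> 'b" where "lookup \<equiv> Poly_Mapping.lookup"
abbreviation keys :: "('a \<Rightarrow>\<^sub>0 'b::zero) \<Rightarrow> 'a set" where "keys \<equiv> Poly_Mapping.keys"

abbreviation MM :: "'v list \<Rightarrow> ('v \<Rightarrow> 'v) \<Rightarrow> 'v sk" where
  "MM w g \<equiv> Poly_Mapping.single (SK w g) 1"

text \<open>Scalars are multiples of the unit, so linearity is expressed by multiplication with the
  central elements \<open>CC z\<close>.\<close>

definition CC :: "complex \<Rightarrow> 'v sk" where "CC z = Poly_Mapping.single 0 z"

lemma MM_mult: "MM u g * MM v h = MM (u @ map g v) (g \<circ> h)"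
  by (simp add: mult_single SK_add)

lemma MM_one: "MM [] id = 1"
  by (metis single_one zero_skw_def)

lemma CC_mult_lookup: "lookup (CC z * a) k = z * lookup a k"
  by (simp add: CC_def mult_map_scale_conv_mult[symmetric] Poly_Mapping.map.rep_eq when_def)

lemma CC_central: "CC z * a = a * CC z"
proof -
  have e: "b = (\<Sum>k\<in>keys b. Poly_Mapping.single k (lookup b k))" for b :: "'a sk"
    by (rule poly_mapping_eqI) (auto simp: lookup_sum lookup_single when_def in_keys_iff)
  have "Poly_Mapping.single 0 z * a = a * Poly_Mapping.single (0::'a skw) z"
    by (subst (1 2) e[of a]) (simp add: sum_distrib_left sum_distrib_right mult_single mult.commute)
  then show ?thesis by (simp add: CC_def)
qed

lemma CC_0 [simp]: "CC 0 = 0" by (simp add: CC_def)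
lemma CC_1 [simp]: "CC 1 = 1" by (simp add: CC_def)
lemma CC_add: "CC (x + y) = CC x + CC y" by (simp add: CC_def single_add)
lemma CC_uminus: "CC (- x) = - CC x" by (simp add: CC_def single_uminus)
lemma CC_mult: "CC (x * y) = CC x * CC y" by (simp add: CC_def mult_single)

lemma single_CC: "Poly_Mapping.single k z = CC z * Poly_Mapping.single k 1"
  by (simp add: CC_def mult_single)

lemma sk_expand: "(a::'v sk) = (\<Sum>k\<in>keys a. CC (lookup a k) * MM (wd k) (gp k))"
proof -
  have "a = (\<Sum>k\<in>keys a. Poly_Mapping.single k (lookup a k))"
    by (rule poly_mapping_eqI) (auto simp: lookup_sum lookup_single when_def in_keys_iff)
  then show ?thesis by (simp add: single_CC[symmetric])
qed

definition lext :: "('k \<Rightarrow> complex) \<Rightarrow> ('k \<Rightarrow>\<^sub>0 complex) \<Rightarrow> complex" where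
  "lext f a = (\<Sum>k\<in>keys a. lookup a k * f k)"

lemma lext_superset: "finite A \<Longrightarrow> keys a \<subseteq> A \<Longrightarrow> lext f a = (\<Sum>k\<in>A. lookup a k * f k)"
  unfolding lext_def by (rule sum.mono_neutral_left) (auto simp: in_keys_iff)

lemma lext_0 [simp]: "lext f 0 = 0" by (simp add: lext_def)

lemma lext_add: "lext f (a + b) = lext f a + lext f b"
proof -
  let ?A = "keys a \<union> keys b"
  have "lext f (a + b) = (\<Sum>k\<in>?A. lookup (a + b) k * f k)"
    by (rule lext_superset) (auto simp: keys_add)
  also have "\<dots> = (\<Sum>k\<in>?A. lookup a k * f k) + (\<Sum>k\<in>?A. lookup b k * f k)"
    by (simp add: lookup_add algebra_simps sum.distrib)
  also have "\<dots> = lext f a + lext f b"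
    by (simp add: lext_superset[of ?A])
  finally show ?thesis .
qed

lemma lext_uminus: "lext f (- a) = - lext f a"
  using lext_add[of f a "- a"] by (simp add: eq_neg_iff_add_eq_0 add.commute)
lemma lext_diff: "lext f (a - b) = lext f a - lext f b"
  using lext_add[of f a "- b"] by (simp add: lext_uminus)
lemma lext_sum: "lext f (sum g A) = (\<Sum>i\<in>A. lext f (g i))"
  by (induction A rule: infinite_finite_induct) (auto simp: lext_add)
lemma lext_single [simp]: "lext f (Poly_Mapping.single k z) = z * f k"
  by (simp add: lext_def)
lemma lext_CC: "lext f (CC z * a) = z * lext f a"
proof -
  have "lext f (CC z * a) = (\<Sum>k\<in>keys a. lookup (CC z * a) k * f k)"
    by (rule lext_superset) (auto simp: in_keys_iff CC_mult_lookup)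
  then show ?thesis by (simp add: CC_mult_lookup lext_def sum_distrib_left mult.assoc)
qed

subsection \<open>Sorting words with correction terms\<close>

text \<open>The termination measure of sorting: a letter counts \<open>f\<close> times the number of
  letters after it, so exchanging a descent lowers the total by the difference of the two
  values.\<close>

primrec wt :: "('a \<Rightarrow> nat) \<Rightarrow> 'a list \<Rightarrow> nat" where
  "wt f [] = 0"
| "wt f (x # xs) = f x * length xs + wt f xs"

lemma wt_append: "wt f (xs @ ys) = wt f xs + wt f ys + (\<Sum>x\<leftarrow>xs. f x) * length ys"
  by (induction xs) (auto simp: algebra_simps)

lemma wt_swap: "f y < f x \<Longrightarrow> wt f (xs @ y # x # ys) < wt f (xs @ x # y # ys)"
  by (simp add: wt_append algebra_simps)

text \<open>The hexagon of two overlapping descents: two routes of three exchanges lead to the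
  common word with value \<open>z\<close>, and the corrections along them have equal sums.\<close>

lemma cocycle_aux3:
  fixes a :: complex
  assumes "a = b + p2" "b = z + p3" "a' = b' + q2" "b' = z + q3" "p1 + p2 + p3 = q1 + q2 + q3"
  shows "a + p1 = a' + q1"
proof -
  have "a + p1 = z + (p1 + p2 + p3)" using assms(1,2) by simp
  also have "\<dots> = a' + q1" unfolding assms(5) using assms(3,4) by simp
  finally show ?thesis .
qed

lemma cocycle_aux2:
  fixes a :: complex
  assumes "a = z + p2" "a' = z + q2" "p1 + p2 = q1 + q2"
  shows "a + p1 = a' + q1"
  using cocycle_aux3[of a z p2 z 0 a' z q2 0 p1 q1] assms by simp

text \<open>A diamond lemma for sorting. The corrections \<psi> form a cocycle on the graph of
  adjacent exchanges; \<open>far\<close> and \<open>braid\<close> say that it closes up around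
  squares and hexagons, as in the Coxeter relations of the symmetric group. Hence \<psi> is the
  difference of a function on words.\<close>

lemma sorting_cocycle:
  fixes \<psi> :: "'a list \<Rightarrow> 'a \<Rightarrow> 'a \<Rightarrow> 'a list \<Rightarrow> complex" and f :: "'a \<Rightarrow> nat"
  assumes inj: "inj_on f X"
    and skew: "\<And>xs x y ys. \<psi> xs y x ys = - \<psi> xs x y ys"
    and far: "\<And>xs x y ys z u zs. length (xs @ x # y # ys @ z # u # zs) = n \<Longrightarrow>
      \<psi> xs x y (ys @ z # u # zs) + \<psi> (xs @ y # x # ys) z u zs
      = \<psi> (xs @ x # y # ys) z u zs + \<psi> xs x y (ys @ u # z # zs)"
    and braid: "\<And>xs x y z zs. length (xs @ x # y # z # zs) = n \<Longrightarrow>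
      \<psi> xs x y (z # zs) + \<psi> (xs @ [y]) x z zs + \<psi> xs y z (x # zs)
      = \<psi> (xs @ [x]) y z zs + \<psi> xs x z (y # zs) + \<psi> (xs @ [z]) x y zs"
  shows "\<exists>L. \<forall>xs x y ys. set (xs @ x # y # ys) \<subseteq> X \<longrightarrow> length (xs @ x # y # ys) = n \<longrightarrow>
     L (xs @ x # y # ys) = L (xs @ y # x # ys) + \<psi> xs x y ys"
proof -
  define P where "P w = (\<lambda>(xs,x,y,ys). w = xs @ x # y # ys \<and> f y < f x)" for w
  define D where "D w = (SOME d. P w d)" for w
  \<comment> \<open>Recursion along an arbitrarily chosen descent; words without descents get the
    value 0.\<close>
  define L where "L = wfrec (measure (wt f))
    (\<lambda>F w. if \<exists>d. P w d then (case D w of (xs,x,y,ys) \<Rightarrow> F (xs @ y # x # ys) + \<psi> xs x y ys) else 0)"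
  have L: "L w = L (xs @ y # x # ys) + \<psi> xs x y ys" if "P w d" "D w = (xs,x,y,ys)" for w d xs x y ys
  proof -
    have PD: "P w (D w)" unfolding D_def by (rule someI[of "P w", OF that(1)])
    then have "w = xs @ x # y # ys" "f y < f x" using that(2) by (auto simp: P_def)
    then have mem: "(xs @ y # x # ys, w) \<in> measure (wt f)" by (simp add: wt_swap)
    have ex: "\<exists>d. P w d" using that(1) by blast
    have "L w = (if \<exists>d. P w d then (case D w of (xs,x,y,ys) \<Rightarrow>
      cut L (measure (wt f)) w (xs @ y # x # ys) + \<psi> xs x y ys) else 0)"
      by (rule def_wfrec[OF eq_reflection[OF L_def]]) simp
    then show ?thesis by (simp only: if_P[OF ex] that(2) prod.case cut_apply[OF mem])
  qed
  have main: "L w = L (xs @ y # x # ys) + \<psi> xs x y ys"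
    if "w = xs @ x # y # ys" "f y < f x" "length w = n" for w xs x y ys
    using that
  proof (induction "wt f w" arbitrary: w xs x y ys rule: less_induct)
    case less
    note IH = less.hyps
    \<comment> \<open>Independence of the chosen descent: two descents of \<open>w\<close> coincide,
      overlap in one letter or are disjoint, and the last two cases are settled by
      \<open>braid\<close> and \<open>far\<close>.\<close>
    have key: "L (as @ b # a # bs) + \<psi> as a b bs = L (cs @ d # c # ds) + \<psi> cs c d ds"
      if w1: "w = as @ a # b # bs" and ba: "f b < f a" and w2: "w = cs @ c # d # ds" and dc: "f d < f c"
        and le: "length as \<le> length cs" for as a b bs cs c d ds
    proof -
      have IH': "L v = L (xs @ y # x # ys) + \<psi> xs x y ys"
        if "v = xs @ x # y # ys" "f y < f x" "wt f v < wt f w" "length v = length w" for v xs x y ys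
        using IH[of v xs x y ys] that less.prems by simp
      obtain es where es: "cs = as @ es" "a # b # bs = es @ c # d # ds"
      proof -
        have eq: "as @ a # b # bs = cs @ c # d # ds" using w1 w2 by simp
        then have "cs = as @ drop (length as) cs"
          using le by (metis append_eq_append_conv_if append_take_drop_id)
        then show thesis using that eq by (metis append.assoc same_append_eq)
      qed
      show ?thesis
      proof (cases es)
        case Nil then show ?thesis using es by simp
      next
        case (Cons e es')
        show ?thesis
        proof (cases es')
          case Nil
          then have *: "cs = as @ [a]" "b = c" "bs = d # ds" using es Cons by auto
          have w: "w = as @ a # b # d # ds" using w1 * by simp
          have 1: "wt f (as @ b # a # d # ds) < wt f w" unfolding w using ba by (rule wt_swap)
          have 2: "wt f (as @ b # d # a # ds) < wt f (as @ b # a # d # ds)"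
            using wt_swap[of f d a "as @ [b]" ds] ba dc * by simp
          have 3: "wt f (as @ a # d # b # ds) < wt f w" unfolding w
            using wt_swap[of f d b "as @ [a]" ds] ba dc * by simp
          have 4: "wt f (as @ d # a # b # ds) < wt f (as @ a # d # b # ds)"
            using wt_swap[of f d a "as" "b # ds"] ba dc * by simp
          have "L (as @ b # a # d # ds) = L (as @ b # d # a # ds) + \<psi> (as @ [b]) a d ds"
            using IH'[of "as @ b # a # d # ds" "as @ [b]" a d ds] 1 ba dc * w by simp
          moreover have "L (as @ b # d # a # ds) = L (as @ d # b # a # ds) + \<psi> as b d (a # ds)"
            using IH'[of "as @ b # d # a # ds" "as" b d "a # ds"] 1 2 ba dc * w by simp
          moreover have "L (as @ a # d # b # ds) = L (as @ d # a # b # ds) + \<psi> as a d (b # ds)"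
            using IH'[of "as @ a # d # b # ds" "as" a d "b # ds"] 3 ba dc * w by simp
          moreover have "L (as @ d # a # b # ds) = L (as @ d # b # a # ds) + \<psi> (as @ [d]) a b ds"
            using IH'[of "as @ d # a # b # ds" "as @ [d]" a b "ds"] 3 4 ba dc * w by simp
          moreover have "\<psi> as a b (d # ds) + \<psi> (as @ [b]) a d ds + \<psi> as b d (a # ds)
              = \<psi> (as @ [a]) b d ds + \<psi> as a d (b # ds) + \<psi> (as @ [d]) a b ds"
            by (rule braid) (use w less.prems(3) in auto)
          ultimately have "L (as @ b # a # d # ds) + \<psi> as a b (d # ds) = L (as @ a # d # b # ds) + \<psi> (as @ [a]) b d ds"
            by (rule cocycle_aux3)
          then show ?thesis using * by simp
        next
          case (Cons e' fs)
          then have *: "cs = as @ a # b # fs" "bs = fs @ c # d # ds" using es \<open>es = e # es'\<close> by auto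
          have w: "w = as @ a # b # fs @ c # d # ds" using w1 * by simp
          have 1: "wt f (as @ b # a # fs @ c # d # ds) < wt f w" unfolding w using ba by (rule wt_swap)
          have 2: "wt f (as @ a # b # fs @ d # c # ds) < wt f w" unfolding w
            using wt_swap[of f d c "as @ a # b # fs" ds] dc by simp
          have "L (as @ b # a # fs @ c # d # ds) = L (as @ b # a # fs @ d # c # ds) + \<psi> (as @ b # a # fs) c d ds"
            using IH'[of "as @ b # a # fs @ c # d # ds" "as @ b # a # fs" c d ds] 1 dc w by simp
          moreover have "L (as @ a # b # fs @ d # c # ds) = L (as @ b # a # fs @ d # c # ds) + \<psi> as a b (fs @ d # c # ds)"
            using IH'[of "as @ a # b # fs @ d # c # ds" as a b "fs @ d # c # ds"] 2 ba w by simp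
          moreover have "\<psi> as a b (fs @ c # d # ds) + \<psi> (as @ b # a # fs) c d ds
            = \<psi> (as @ a # b # fs) c d ds + \<psi> as a b (fs @ d # c # ds)"
            by (rule far) (use w less.prems(3) in auto)
          ultimately have "L (as @ b # a # fs @ c # d # ds) + \<psi> as a b (fs @ c # d # ds)
             = L (as @ a # b # fs @ d # c # ds) + \<psi> (as @ a # b # fs) c d ds"
            by (rule cocycle_aux2)
          then show ?thesis using * by simp
        qed
      qed
    qed
    obtain cs c d ds where D: "D w = (cs,c,d,ds)" by (cases "D w")
    have ex: "P w (xs,x,y,ys)" using less.prems by (simp add: P_def)
    have PD: "P w (D w)" unfolding D_def by (rule someI[of "P w", OF ex])
    then have w2: "w = cs @ c # d # ds" "f d < f c" using D by (auto simp: P_def)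
    have "L w = L (cs @ d # c # ds) + \<psi> cs c d ds" by (rule L[OF ex D])
    also have "\<dots> = L (xs @ y # x # ys) + \<psi> xs x y ys"
    proof (cases "length xs \<le> length cs")
      case True
      show ?thesis by (rule key[OF less.prems(1,2) w2 True, symmetric])
    next
      case False
      then show ?thesis by (intro key[OF w2 less.prems(1,2)]) simp
    qed
    finally show ?case .
  qed
  have "L (xs @ x # y # ys) = L (xs @ y # x # ys) + \<psi> xs x y ys"
    if X: "set (xs @ x # y # ys) \<subseteq> X" and n: "length (xs @ x # y # ys) = n" for xs x y ys
  proof (cases "f y < f x")
    case True then show ?thesis using main n by blast
  next
    case False
    show ?thesis
    proof (cases "f x < f y")
      case True
      have "L (xs @ y # x # ys) = L (xs @ x # y # ys) + \<psi> xs y x ys"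
        using main[OF refl True] n by simp
      then show ?thesis by (simp add: skew[of xs y x ys])
    next
      case f: False
      then have "x = y" using inj X \<open>\<not> f y < f x\<close> by (auto dest: inj_onD)
      then show ?thesis using skew[of xs x x ys] by simp
    qed
  qed
  then show ?thesis by blast
qed

abbreviation giv :: "('a \<Rightarrow> 'a) \<Rightarrow> 'a \<Rightarrow> 'a" where "giv \<equiv> inv_into UNIV"

subsection \<open>Multilinear functions of words\<close>

text \<open>\<open>\<kappa> s v w\<close> is the coefficient of \<open>s\<close> in \<kappa>(v, w).
  The last two assumptions are the PBW conditions: compatibility with conjugation by G, and the
  coefficient of \<open>s\<close> in the Jacobi identity, where the commutator of \<open>s\<close>
  with \<open>w\<close> is (s w - w) s.\<close>

locale hecke_data = finite_dimensional_vector_space sc Basis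
  for sc :: "complex \<Rightarrow> 'v::ab_group_add \<Rightarrow> 'v" and Basis +
  fixes G :: "('v \<Rightarrow> 'v) set" and \<kappa> :: "('v \<Rightarrow> 'v) \<Rightarrow> 'v \<Rightarrow> 'v \<Rightarrow> complex"
  assumes finite_G: "finite G" and id_G [simp]: "id \<in> G"
    and comp_G: "g \<in> G \<Longrightarrow> h \<in> G \<Longrightarrow> g \<circ> h \<in> G"
    and inv_G: "g \<in> G \<Longrightarrow> giv g \<in> G" and bij_G: "g \<in> G \<Longrightarrow> bij g"
    and G_add: "g \<in> G \<Longrightarrow> g (u + v) = g u + g v"
    and G_sc: "g \<in> G \<Longrightarrow> g (sc z v) = sc z (g v)"
    and \<kappa>_add: "s \<in> G \<Longrightarrow> \<kappa> s (u + v) w = \<kappa> s u w + \<kappa> s v w"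
    and \<kappa>_sc: "s \<in> G \<Longrightarrow> \<kappa> s (sc z v) w = z * \<kappa> s v w"
    and \<kappa>_skew: "s \<in> G \<Longrightarrow> \<kappa> s v w = - \<kappa> s w v"
    and \<kappa>_equiv: "s \<in> G \<Longrightarrow> g \<in> G \<Longrightarrow> \<kappa> (g \<circ> s \<circ> giv g) (g v) (g w) = \<kappa> s v w"
    and \<kappa>_jacobi: "s \<in> G \<Longrightarrow>
      sc (\<kappa> s u v) (s w - w) + sc (\<kappa> s v w) (s u - u) + sc (\<kappa> s w u) (s v - v) = 0"
begin

lemma \<kappa>_add2: "s \<in> G \<Longrightarrow> \<kappa> s w (u + v) = \<kappa> s w u + \<kappa> s w v"
  by (subst (1 2 3) \<kappa>_skew) (auto simp: \<kappa>_add)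
lemma \<kappa>_sc2: "s \<in> G \<Longrightarrow> \<kappa> s w (sc z v) = z * \<kappa> s w v"
  by (subst (1 2) \<kappa>_skew) (auto simp: \<kappa>_sc)

definition lin1 :: "('v \<Rightarrow> complex) \<Rightarrow> bool" where
  "lin1 f \<longleftrightarrow> (\<forall>z u v. f (sc z u + v) = z * f u + f v)"

text \<open>On words of each fixed length these are the multilinear forms, that is, the linear
  functionals of the tensor algebra degree by degree.\<close>

definition mlin :: "('v list \<Rightarrow> complex) \<Rightarrow> bool" where
  "mlin f \<longleftrightarrow> (\<forall>xs ys. lin1 (\<lambda>v. f (xs @ v # ys)))"

lemma lin1_0: "lin1 f \<Longrightarrow> f 0 = 0"
proof -
  assume "lin1 f"
  then have "f (sc (-1) 0 + 0) = (-1) * f 0 + f 0" unfolding lin1_def by blast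
  then show ?thesis by simp
qed
lemma lin1_add: "lin1 f \<Longrightarrow> f (u + v) = f u + f v"
  unfolding lin1_def by (metis mult_1 scale_one)
lemma lin1_sc: "lin1 f \<Longrightarrow> f (sc z v) = z * f v"
  using lin1_0[of f] unfolding lin1_def by (metis add.right_neutral)
lemma lin1_uminus: "lin1 f \<Longrightarrow> f (- v) = - f v"
  using lin1_sc[of f "-1" v] by simp
lemma lin1_diff: "lin1 f \<Longrightarrow> f (u - v) = f u - f v"
  using lin1_add[of f u "- v"] by (simp add: lin1_uminus)
lemma lin1_sum: "lin1 f \<Longrightarrow> f (\<Sum>i\<in>A. h i) = (\<Sum>i\<in>A. f (h i))"
  by (induction A rule: infinite_finite_induct) (auto simp: lin1_0 lin1_add)
lemma lin1_I: "(\<And>u v. f (u + v) = f u + f v) \<Longrightarrow> (\<And>z v. f (sc z v) = z * f v) \<Longrightarrow> lin1 f"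
  by (simp add: lin1_def)

lemma basis_expand: "v = (\<Sum>b\<in>Basis. sc (representation Basis v b) b)"
  by (rule sum_representation_eq[symmetric]) (use independent_Basis span_Basis finite_Basis in auto)

lemma lin1_expand: "lin1 f \<Longrightarrow> f v = (\<Sum>b\<in>Basis. representation Basis v b * f b)"
  by (subst basis_expand) (simp add: lin1_sum lin1_sc)

lemma lin1_rep: "lin1 (\<lambda>v. representation Basis v b)"
  by (rule lin1_I) (use independent_Basis span_Basis in \<open>auto simp: representation_add representation_scale\<close>)

lemma rep_Basis: "b \<in> Basis \<Longrightarrow> representation Basis b c = (if b = c then 1 else 0)"
  by (simp add: representation_basis independent_Basis)

lemma lin1_zero: "lin1 f \<Longrightarrow> (\<And>b. b \<in> Basis \<Longrightarrow> f b = 0) \<Longrightarrow> f v = 0"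
  by (subst lin1_expand) auto

lemma mlin_zero:
  assumes "mlin f" "\<And>w. set w \<subseteq> Basis \<Longrightarrow> length w = n \<Longrightarrow> f w = 0" "length w = n"
  shows "f w = 0"
proof -
  have "set xs \<subseteq> Basis \<Longrightarrow> length (xs @ ys) = n \<Longrightarrow> f (xs @ ys) = 0" for xs ys
  proof (induction ys arbitrary: xs)
    case Nil then show ?case using assms(2) by simp
  next
    case (Cons y ys)
    have "lin1 (\<lambda>v. f (xs @ v # ys))" using assms(1) by (auto simp: mlin_def)
    then show ?case
    proof (rule lin1_zero)
      fix b assume "b \<in> Basis"
      then show "f (xs @ b # ys) = 0" using Cons.IH[of "xs @ [b]"] Cons.prems by simp
    qed
  qed
  from this[of "[]" w] show ?thesis using assms(3) by simp
qed

lemma lin1_cmult: "lin1 f \<Longrightarrow> lin1 (\<lambda>v. c * f v)" by (simp add: lin1_def algebra_simps)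
lemma lin1_diff': "lin1 f \<Longrightarrow> lin1 g \<Longrightarrow> lin1 (\<lambda>v. f v - g v)" by (simp add: lin1_def algebra_simps)
lemma lin1_sum': "(\<And>i. i \<in> A \<Longrightarrow> lin1 (f i)) \<Longrightarrow> lin1 (\<lambda>v. \<Sum>i\<in>A. f i v)"
  by (simp add: lin1_def sum_distrib_left sum.distrib)
lemma lin1_G: "lin1 f \<Longrightarrow> g \<in> G \<Longrightarrow> lin1 (\<lambda>v. f (g v))"
  by (simp add: lin1_def G_add G_sc)
lemma lin1_mult: "lin1 f \<Longrightarrow> lin1 (\<lambda>v. f v * c)" by (simp add: lin1_def algebra_simps)

lemma mlinD: "mlin f \<Longrightarrow> lin1 (\<lambda>v. f (xs @ v # ys))" by (simp add: mlin_def)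
lemma mlin_pre: "mlin f \<Longrightarrow> mlin (\<lambda>w. f (us @ w))"
  using mlinD[of f "us @ xs" ys for xs ys] by (simp add: mlin_def)
lemma mlin_post: "mlin f \<Longrightarrow> mlin (\<lambda>w. f (w @ us))"
  using mlinD[of f xs "ys @ us" for xs ys] by (simp add: mlin_def)
lemma mlin_cmult: "mlin f \<Longrightarrow> mlin (\<lambda>w. c * f w)" by (simp add: mlin_def lin1_cmult)
lemma mlin_diff: "mlin f \<Longrightarrow> mlin g \<Longrightarrow> mlin (\<lambda>w. f w - g w)" by (simp add: mlin_def lin1_diff')
lemma mlin_sum: "(\<And>i. i \<in> A \<Longrightarrow> mlin (f i)) \<Longrightarrow> mlin (\<lambda>w. \<Sum>i\<in>A. f i w)"
  unfolding mlin_def by (intro allI lin1_sum') auto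
lemma mlin_map: "mlin f \<Longrightarrow> g \<in> G \<Longrightarrow> mlin (\<lambda>w. f (map g w))"
proof (unfold mlin_def, intro allI)
  fix xs ys assume f: "\<forall>xs ys. lin1 (\<lambda>v. f (xs @ v # ys))" and g: "g \<in> G"
  have "lin1 (\<lambda>v. f (map g xs @ v # map g ys))" using f by blast
  from lin1_G[OF this g] show "lin1 (\<lambda>v. f (map g (xs @ v # ys)))" by simp
qed

fun mext :: "'v list \<Rightarrow> ('v list \<Rightarrow> complex) \<Rightarrow> complex" where
  "mext [] L = L []"
| "mext (v # vs) L = (\<Sum>b\<in>Basis. representation Basis v b * mext vs (\<lambda>w. L (b # w)))"

lemma mext_basis: "set w \<subseteq> Basis \<Longrightarrow> mext w L = L w"
proof (induction w arbitrary: L)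
  case (Cons v vs)
  then have "mext (v # vs) L = (\<Sum>b\<in>Basis. if v = b then L (b # vs) else 0)"
    by (auto simp: rep_Basis intro!: sum.cong)
  then show ?case using Cons.prems finite_Basis by simp
qed simp

lemma mext_mlin: "lin1 (\<lambda>v. mext (xs @ v # ys) L)"
proof (induction xs arbitrary: L)
  case Nil
  show ?case by (simp add: lin1_sum' lin1_mult lin1_rep)
next
  case (Cons x xs)
  show ?case by (simp add: lin1_sum' lin1_cmult Cons)
qed

subsection \<open>Existence of normal-form functionals\<close>

text \<open>What the relation [x, y] = \<kappa>(x, y) demands between a functional in degree
  \<open>n\<close> and one in degree \<open>n - 2\<close>. Moving \<open>s\<close> to the right past
  \<open>ys\<close> turns the tail into \<open>map s ys\<close> and the group part into
  \<open>s \<circ> g\<close>.\<close>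

definition comrel :: "nat \<Rightarrow> ('v list \<Rightarrow> ('v \<Rightarrow> 'v) \<Rightarrow> complex) \<Rightarrow> ('v list \<Rightarrow> ('v \<Rightarrow> 'v) \<Rightarrow> complex) \<Rightarrow> bool" where
  "comrel n \<Lambda> \<Lambda>' \<longleftrightarrow> (\<forall>g\<in>G. \<forall>xs x y ys. length (xs @ x # y # ys) = n \<longrightarrow>
     \<Lambda> (xs @ x # y # ys) g - \<Lambda> (xs @ y # x # ys) g = (\<Sum>s\<in>G. \<kappa> s x y * \<Lambda>' (xs @ map s ys) (s \<circ> g)))"

lemma comrelD: "comrel n \<Lambda> \<Lambda>' \<Longrightarrow> g \<in> G \<Longrightarrow> length (xs @ x # y # ys) = n \<Longrightarrow>
     \<Lambda> (xs @ x # y # ys) g - \<Lambda> (xs @ y # x # ys) g = (\<Sum>s\<in>G. \<kappa> s x y * \<Lambda>' (xs @ map s ys) (s \<circ> g))"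
  unfolding comrel_def by blast

lemma inv_comp_G: "g \<in> G \<Longrightarrow> giv g \<circ> g = id" "g \<in> G \<Longrightarrow> g \<circ> giv g = id"
  using bij_G by (auto simp: bij_is_inj bij_is_surj surj_iff[symmetric])

lemma conj_bij: "g \<in> G \<Longrightarrow> bij_betw (\<lambda>s. g \<circ> s \<circ> giv g) G G"
proof (rule bij_betwI[where g = "\<lambda>s. giv g \<circ> s \<circ> g"])
  assume g: "g \<in> G"
  show "(\<lambda>s. g \<circ> s \<circ> giv g) \<in> G \<rightarrow> G" "(\<lambda>s. giv g \<circ> s \<circ> g) \<in> G \<rightarrow> G"
    using g by (auto intro!: comp_G inv_G)
  show "giv g \<circ> (g \<circ> x \<circ> giv g) \<circ> g = x" for x
    using inv_comp_G[OF g] by (metis comp_assoc comp_id id_comp)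
  show "g \<circ> (giv g \<circ> x \<circ> g) \<circ> giv g = x" for x
    using inv_comp_G[OF g] by (metis comp_assoc comp_id id_comp)
qed

text \<open>The correction of an exchange is read off from \<open>\<Lambda>'\<close>. Disjoint
  exchanges are compatible because \<open>\<Lambda>'\<close> satisfies its own relation and \<kappa>
  is equivariant; the braid condition is the Jacobi identity. Only basis words are sorted;
  multilinear extension does the rest.\<close>

lemma comrel_step:
  assumes lin: "\<And>g. mlin (\<lambda>w. \<Lambda>' w g)" and rel: "comrel (n - 2) \<Lambda>' \<Lambda>''"
  shows "\<exists>\<Lambda>. (\<forall>g. mlin (\<lambda>w. \<Lambda> w g)) \<and> (\<forall>w g. length w \<noteq> n \<longrightarrow> \<Lambda> w g = 0) \<and> comrel n \<Lambda> \<Lambda>'"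
proof -
  obtain f :: "'v \<Rightarrow> nat" where f: "inj_on f Basis"
    using finite_Basis finite_imp_inj_to_nat_seg by blast
  define \<psi> where "\<psi> g xs x y ys = (\<Sum>s\<in>G. \<kappa> s x y * \<Lambda>' (xs @ map s ys) (s \<circ> g))" for g xs x y ys
  have pre: "lin1 (\<lambda>v. \<Lambda>' (xs @ v # ys) g)" for xs ys g by (rule mlinD[OF lin])
  have ex: "\<exists>L. \<forall>xs x y ys. set (xs @ x # y # ys) \<subseteq> Basis \<longrightarrow> length (xs @ x # y # ys) = n \<longrightarrow>
     L (xs @ x # y # ys) = L (xs @ y # x # ys) + \<psi> g xs x y ys" if g: "g \<in> G" for g
  proof (rule sorting_cocycle[OF f])
    show "\<psi> g xs y x ys = - \<psi> g xs x y ys" for xs x y ys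
      unfolding \<psi>_def sum_negf[symmetric] by (rule sum.cong) (simp_all add: \<kappa>_skew[of _ y x])
  next
    fix xs ys zs :: "'v list" and x y z u
    assume len: "length (xs @ x # y # ys @ z # u # zs) = n"
    \<comment> \<open>After \<open>s\<close> has passed, the second exchange concerns
      \<open>s z\<close> and \<open>s u\<close>. Conjugating the summation index by \<open>s\<close>
      turns its coefficient back into \<open>\<kappa> r z u\<close>, so both orders of exchange give
      the same double sum.\<close>
    have 1: "\<psi> g xs x y (ys @ z # u # zs) - \<psi> g xs x y (ys @ u # z # zs)
      = (\<Sum>s\<in>G. \<Sum>r\<in>G. \<kappa> s x y * \<kappa> r z u * \<Lambda>'' (xs @ map s ys @ map s (map r zs)) (s \<circ> r \<circ> g))"
    proof -
      have "\<Lambda>' (xs @ map s (ys @ z # u # zs)) (s \<circ> g) - \<Lambda>' (xs @ map s (ys @ u # z # zs)) (s \<circ> g)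
        = (\<Sum>r\<in>G. \<kappa> r z u * \<Lambda>'' (xs @ map s ys @ map s (map r zs)) (s \<circ> r \<circ> g))"
        (is "?l = ?r") if s: "s \<in> G" for s
      proof -
        have "?l = \<Lambda>' ((xs @ map s ys) @ s z # s u # map s zs) (s \<circ> g) - \<Lambda>' ((xs @ map s ys) @ s u # s z # map s zs) (s \<circ> g)"
          by simp
        also have "\<dots> = (\<Sum>r\<in>G. \<kappa> r (s z) (s u) * \<Lambda>'' ((xs @ map s ys) @ map r (map s zs)) (r \<circ> (s \<circ> g)))"
          by (rule comrelD[OF rel comp_G[OF s g]]) (use len in simp)
        also have "\<dots> = (\<Sum>r\<in>G. \<kappa> (s \<circ> r \<circ> giv s) (s z) (s u) * \<Lambda>'' ((xs @ map s ys) @ map (s \<circ> r \<circ> giv s) (map s zs)) ((s \<circ> r \<circ> giv s) \<circ> (s \<circ> g)))"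
          by (rule sum.reindex_bij_betw[OF conj_bij[OF s], symmetric])
        also have "\<dots> = ?r"
        proof (rule sum.cong[OF refl])
          fix r assume r: "r \<in> G"
          have a: "(s \<circ> r \<circ> giv s) \<circ> (s \<circ> g) = s \<circ> r \<circ> g"
            using inv_comp_G[OF s] by (metis comp_assoc comp_id)
          have b: "map (s \<circ> r \<circ> giv s) (map s zs) = map s (map r zs)"
            using inv_comp_G(1)[OF s] by (simp add: comp_def fun_eq_iff)
          show "\<kappa> (s \<circ> r \<circ> giv s) (s z) (s u) * \<Lambda>'' ((xs @ map s ys) @ map (s \<circ> r \<circ> giv s) (map s zs)) ((s \<circ> r \<circ> giv s) \<circ> (s \<circ> g))
            = \<kappa> r z u * \<Lambda>'' (xs @ map s ys @ map s (map r zs)) (s \<circ> r \<circ> g)"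
            unfolding a b \<kappa>_equiv[OF r s] by simp
        qed
        finally show ?thesis .
      qed
      then show ?thesis unfolding \<psi>_def sum_subtractf[symmetric] right_diff_distrib[symmetric]
        by (simp add: sum_distrib_left mult.assoc)
    qed
    have 2: "\<psi> g (xs @ x # y # ys) z u zs - \<psi> g (xs @ y # x # ys) z u zs
      = (\<Sum>r\<in>G. \<Sum>s\<in>G. \<kappa> s x y * \<kappa> r z u * \<Lambda>'' (xs @ map s ys @ map s (map r zs)) (s \<circ> r \<circ> g))"
    proof -
      have "\<Lambda>' ((xs @ x # y # ys) @ map r zs) (r \<circ> g) - \<Lambda>' ((xs @ y # x # ys) @ map r zs) (r \<circ> g)
        = (\<Sum>s\<in>G. \<kappa> s x y * \<Lambda>'' (xs @ map s ys @ map s (map r zs)) (s \<circ> r \<circ> g))"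
        if r: "r \<in> G" for r
        using comrelD[OF rel comp_G[OF r g], of xs x y "ys @ map r zs"] len
        by (simp add: comp_assoc del: map_map)
      then show ?thesis unfolding \<psi>_def sum_subtractf[symmetric] right_diff_distrib[symmetric]
        by (simp add: sum_distrib_left mult_ac)
    qed
    have "\<psi> g xs x y (ys @ z # u # zs) - \<psi> g xs x y (ys @ u # z # zs)
      = \<psi> g (xs @ x # y # ys) z u zs - \<psi> g (xs @ y # x # ys) z u zs"
      unfolding 1 2 by (rule sum.swap)
    then show "\<psi> g xs x y (ys @ z # u # zs) + \<psi> g (xs @ y # x # ys) z u zs
        = \<psi> g (xs @ x # y # ys) z u zs + \<psi> g xs x y (ys @ u # z # zs)"
      by (simp add: algebra_simps)
  next
    fix xs zs :: "'v list" and x y z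
    have "\<psi> g xs x y (z # zs) + \<psi> g (xs @ [y]) x z zs + \<psi> g xs y z (x # zs)
        - (\<psi> g (xs @ [x]) y z zs + \<psi> g xs x z (y # zs) + \<psi> g (xs @ [z]) x y zs)
      = (\<Sum>s\<in>G. \<kappa> s x y * (\<Lambda>' (xs @ s z # map s zs) (s \<circ> g) - \<Lambda>' (xs @ z # map s zs) (s \<circ> g))
          + \<kappa> s y z * (\<Lambda>' (xs @ s x # map s zs) (s \<circ> g) - \<Lambda>' (xs @ x # map s zs) (s \<circ> g))
          - \<kappa> s x z * (\<Lambda>' (xs @ s y # map s zs) (s \<circ> g) - \<Lambda>' (xs @ y # map s zs) (s \<circ> g)))"
      unfolding \<psi>_def by (simp add: sum.distrib sum_subtractf algebra_simps)
    also have "\<dots> = (\<Sum>s\<in>G. \<Lambda>' (xs @ (sc (\<kappa> s x y) (s z - z) + sc (\<kappa> s y z) (s x - x) + sc (\<kappa> s z x) (s y - y)) # map s zs) (s \<circ> g))"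
    proof (rule sum.cong[OF refl])
      fix s assume s: "s \<in> G"
      show "\<kappa> s x y * (\<Lambda>' (xs @ s z # map s zs) (s \<circ> g) - \<Lambda>' (xs @ z # map s zs) (s \<circ> g))
          + \<kappa> s y z * (\<Lambda>' (xs @ s x # map s zs) (s \<circ> g) - \<Lambda>' (xs @ x # map s zs) (s \<circ> g))
          - \<kappa> s x z * (\<Lambda>' (xs @ s y # map s zs) (s \<circ> g) - \<Lambda>' (xs @ y # map s zs) (s \<circ> g))
        = \<Lambda>' (xs @ (sc (\<kappa> s x y) (s z - z) + sc (\<kappa> s y z) (s x - x) + sc (\<kappa> s z x) (s y - y)) # map s zs) (s \<circ> g)"
        unfolding lin1_add[OF pre] lin1_sc[OF pre] lin1_diff[OF pre] by (simp add: \<kappa>_skew[OF s, of z x])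
    qed
    also have "\<dots> = 0" using lin1_0[OF pre] by (simp add: \<kappa>_jacobi)
    finally show "\<psi> g xs x y (z # zs) + \<psi> g (xs @ [y]) x z zs + \<psi> g xs y z (x # zs)
        = \<psi> g (xs @ [x]) y z zs + \<psi> g xs x z (y # zs) + \<psi> g (xs @ [z]) x y zs"
      by simp
  qed
  then obtain L where L: "\<And>g xs x y ys. g \<in> G \<Longrightarrow> set (xs @ x # y # ys) \<subseteq> Basis \<Longrightarrow> length (xs @ x # y # ys) = n \<Longrightarrow>
     L g (xs @ x # y # ys) = L g (xs @ y # x # ys) + \<psi> g xs x y ys"
    by metis
  define \<Lambda> where "\<Lambda> w g = (if length w = n then mext w (L g) else 0)" for w g
  have ml: "mlin (\<lambda>w. \<Lambda> w g)" for g
    unfolding mlin_def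
  proof (intro allI)
    fix xs ys
    show "lin1 (\<lambda>v. \<Lambda> (xs @ v # ys) g)"
    proof (cases "Suc (length xs + length ys) = n")
      case True then show ?thesis by (simp add: \<Lambda>_def mext_mlin)
    next
      case False then show ?thesis by (simp add: \<Lambda>_def lin1_def)
    qed
  qed
  have "comrel n \<Lambda> \<Lambda>'"
    unfolding comrel_def
  proof (intro ballI allI impI)
    fix g and xs ys :: "'v list" and x y assume g: "g \<in> G" and len: "length (xs @ x # y # ys) = n"
    \<comment> \<open>The defect of the relation is linear in every letter, so it suffices that it
      vanishes on basis words.\<close>
    let ?F = "\<lambda>xs x y ys. \<Lambda> (xs @ x # y # ys) g - \<Lambda> (xs @ y # x # ys) g - \<psi> g xs x y ys"
    have lx: "lin1 (\<lambda>x. ?F xs x y ys)" for xs y ys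
      unfolding \<psi>_def
      by (intro lin1_diff' lin1_sum' lin1_mult mlinD[OF ml])
        (auto simp: lin1_def \<kappa>_add \<kappa>_sc intro: mlinD[OF ml, of "xs @ [y]" ys g, simplified, unfolded lin1_def, rule_format])
    have ly: "lin1 (\<lambda>y. ?F xs x y ys)" for xs x ys
      unfolding \<psi>_def
      by (intro lin1_diff' lin1_sum' lin1_mult mlinD[OF ml])
        (auto simp: lin1_def \<kappa>_add2 \<kappa>_sc2 intro: mlinD[OF ml, of "xs @ [x]" ys g, simplified, unfolded lin1_def, rule_format])
    have lxs: "mlin (\<lambda>xs. ?F xs x y ys)" for x y ys
      unfolding \<psi>_def
      by (intro mlin_diff mlin_sum mlin_cmult mlin_post[OF ml] mlin_post[OF lin])
    have lys: "mlin (\<lambda>ys. ?F xs x y ys)" for xs x y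
    proof -
      have "mlin (\<lambda>ys. \<Lambda> ((xs @ [x, y]) @ ys) g - \<Lambda> ((xs @ [y, x]) @ ys) g - (\<Sum>s\<in>G. \<kappa> s x y * \<Lambda>' (xs @ map s ys) (s \<circ> g)))"
        by (intro mlin_diff mlin_sum mlin_cmult mlin_pre[OF ml] mlin_map[OF mlin_pre[OF lin]])
      then show ?thesis by (simp add: \<psi>_def)
    qed
    have len': "n = length xs + length ys + 2" using len by simp
    have base: "?F xs x y ys = 0" if "set xs \<subseteq> Basis" "x \<in> Basis" "y \<in> Basis" "set ys \<subseteq> Basis"
      "length xs + length ys + 2 = n" for xs x y ys
      using L[OF g, of xs x y ys] that by (simp add: \<Lambda>_def mext_basis)
    have "?F us x y ys = 0" if us: "set us \<subseteq> Basis" "length us = length xs" for us and x y :: 'v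
    proof (rule lin1_zero[OF lx[of us y ys]])
      fix x :: 'v assume x: "x \<in> Basis"
      show "?F us x y ys = 0"
      proof (rule lin1_zero[OF ly[of us x ys]])
        fix y :: 'v assume y: "y \<in> Basis"
        show "?F us x y ys = 0"
          by (rule mlin_zero[OF lys[of us x y], of "length ys"]) (use base us x y len' in auto)
      qed
    qed
    then have "?F xs x y ys = 0"
      by (rule mlin_zero[OF lxs[of x y ys], of "length xs"]) simp_all
    then show "\<Lambda> (xs @ x # y # ys) g - \<Lambda> (xs @ y # x # ys) g = (\<Sum>s\<in>G. \<kappa> s x y * \<Lambda>' (xs @ map s ys) (s \<circ> g))"
      by (simp add: \<psi>_def)
  qed
  then show ?thesis using ml by (intro exI[of _ \<Lambda>]) (auto simp: \<Lambda>_def)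
qed

section \<open>Functionals that respect all defining relations\<close>

definition admissible :: "('v list \<Rightarrow> ('v \<Rightarrow> 'v) \<Rightarrow> complex) \<Rightarrow> bool" where
  "admissible \<Lambda> \<longleftrightarrow> (\<forall>g. mlin (\<lambda>w. \<Lambda> w g)) \<and> (\<forall>n. comrel n \<Lambda> \<Lambda>)"

text \<open>A point \<open>p\<close> of the dual space is given by its values on
  \<open>Basis\<close>; values elsewhere do not matter. Elements of S(V) become functions of
  \<open>p\<close>, and \<open>pair v\<close> is the linear function of the vector
  \<open>v\<close>.\<close>

definition pair :: "'v \<Rightarrow> ('v \<Rightarrow> complex) \<Rightarrow> complex" where
  "pair v p = (\<Sum>b\<in>Basis. representation Basis v b * p b)"

lemma pair_lin1: "lin1 (\<lambda>v. pair v p)"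
  unfolding pair_def by (intro lin1_sum' lin1_mult lin1_rep)

text \<open>The evaluation at \<open>p\<close> of the component at \<open>h\<close> of S(V) * G in
  degree \<open>j\<close>. It is symmetric in the letters, hence compatible with the zero functional
  two degrees below.\<close>

definition ptop :: "nat \<Rightarrow> ('v \<Rightarrow> 'v) \<Rightarrow> ('v \<Rightarrow> complex) \<Rightarrow> 'v list \<Rightarrow> ('v \<Rightarrow> 'v) \<Rightarrow> complex" where
  "ptop j h p w g = (if length w = j \<and> g = h then \<Prod>v\<leftarrow>w. pair v p else 0)"

lemma ptop_mlin: "mlin (\<lambda>w. ptop j h p w g)"
  unfolding mlin_def
proof (intro allI)
  fix xs ys
  have "lin1 (\<lambda>v. (\<Prod>v\<leftarrow>xs. pair v p) * (pair v p * (\<Prod>v\<leftarrow>ys. pair v p)))"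
    by (intro lin1_cmult lin1_mult pair_lin1)
  then show "lin1 (\<lambda>v. ptop j h p (xs @ v # ys) g)"
    by (cases "Suc (length xs + length ys) = j \<and> g = h") (auto simp: ptop_def lin1_def)
qed

text \<open>PBW in dual form: evaluation of commutative monomials of degree \<open>j\<close>, zero
  below that degree, extends upwards to a functional that respects the relations.\<close>

theorem normal_form_functional:
  "\<exists>\<Lambda>. admissible \<Lambda> \<and> (\<forall>w g. length w \<le> j \<longrightarrow> \<Lambda> w g = ptop j h p w g)"
proof -
  define OK where "OK n \<Lambda> \<longleftrightarrow> (\<forall>g. mlin (\<lambda>w. \<Lambda> w g)) \<and> (\<forall>w g. length w \<noteq> n \<longrightarrow> \<Lambda> w g = 0)
    \<and> (n \<le> j \<longrightarrow> \<Lambda> = ptop j h p \<or> n < j \<and> (\<forall>w g. \<Lambda> w g = 0))" for n and \<Lambda> :: "'v list \<Rightarrow> ('v \<Rightarrow> 'v) \<Rightarrow> complex"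
  \<comment> \<open>Two consecutive degrees are carried along because a relation links
    \<open>n + 2\<close> to \<open>n\<close>. That each functional has some partner two degrees
    below is the hypothesis of \<open>comrel_step\<close> for the next lift.\<close>
  have "\<exists>F. \<forall>n. (OK n (fst (F n)) \<and> OK (Suc n) (snd (F n)) \<and> (\<exists>\<Lambda>'. comrel n (fst (F n)) \<Lambda>')
      \<and> (\<exists>\<Lambda>'. comrel (Suc n) (snd (F n)) \<Lambda>'))
     \<and> (fst (F (Suc n)) = snd (F n) \<and> comrel (Suc (Suc n)) (snd (F (Suc n))) (fst (F n)))"
  proof (rule dependent_nat_choice)
    define a where "a n = (if n < j then (\<lambda>w g. 0) else ptop j h p)" for n
    have zero: "OK n (\<lambda>w g. 0)" if "n < j" for n using that by (auto simp: OK_def mlin_def lin1_def)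
    have top: "OK j (ptop j h p)" unfolding OK_def using ptop_mlin by (simp add: ptop_def)
    have triv: "OK n (\<lambda>w g. 0)" if "n > j" for n using that by (auto simp: OK_def mlin_def lin1_def)
    have cz: "comrel n (\<lambda>w g. 0) (\<lambda>w g. 0)" for n by (simp add: comrel_def)
    have ct: "comrel n (ptop j h p) (\<lambda>w g. 0)" for n
      by (auto simp: comrel_def ptop_def mult_ac)
    have "\<exists>\<Lambda>. OK n \<Lambda> \<and> (\<exists>\<Lambda>'. comrel n \<Lambda> \<Lambda>')" for n
      using zero[of n] top triv[of n] cz ct by (metis linorder_neqE_nat)
    then obtain A B where "OK 0 A" "\<exists>\<Lambda>'. comrel 0 A \<Lambda>'" "OK (Suc 0) B" "\<exists>\<Lambda>'. comrel (Suc 0) B \<Lambda>'" by blast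
    then show "\<exists>x. OK 0 (fst x) \<and> OK (Suc 0) (snd x) \<and> (\<exists>\<Lambda>'. comrel 0 (fst x) \<Lambda>') \<and> (\<exists>\<Lambda>'. comrel (Suc 0) (snd x) \<Lambda>')"
      by (intro exI[of _ "(A,B)"]) simp
    fix x n
    assume *: "OK n (fst x) \<and> OK (Suc n) (snd x) \<and> (\<exists>\<Lambda>'. comrel n (fst x) \<Lambda>') \<and> (\<exists>\<Lambda>'. comrel (Suc n) (snd x) \<Lambda>')"
    have "\<exists>C. OK (Suc (Suc n)) C \<and> comrel (Suc (Suc n)) C (fst x)"
    proof (cases "Suc (Suc n) \<le> j")
      case True
      have "fst x w g = 0" for w g
      proof (cases "length w = n")
        case l: True
        have "fst x = ptop j h p \<or> (\<forall>w g. fst x w g = 0)" using * True by (auto simp: OK_def)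
        then show ?thesis using l True by (auto simp: ptop_def)
      qed (use * in \<open>auto simp: OK_def\<close>)
      then have f0: "fst x = (\<lambda>w g. 0)" by blast
      show ?thesis
      proof (cases "Suc (Suc n) = j")
        case True then show ?thesis using top ct f0 by metis
      next
        case False then show ?thesis using zero[of "Suc (Suc n)"] True cz f0 by (metis le_neq_implies_less)
      qed
    next
      case False
      obtain \<Lambda>' where "comrel n (fst x) \<Lambda>'" using * by blast
      then have "\<exists>\<Lambda>. (\<forall>g. mlin (\<lambda>w. \<Lambda> w g)) \<and> (\<forall>w g. length w \<noteq> Suc (Suc n) \<longrightarrow> \<Lambda> w g = 0) \<and> comrel (Suc (Suc n)) \<Lambda> (fst x)"
        using comrel_step[of "fst x" "Suc (Suc n)" \<Lambda>'] * by (auto simp: OK_def)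
      then show ?thesis using False by (auto simp: OK_def)
    qed
    then obtain C where "OK (Suc (Suc n)) C" "comrel (Suc (Suc n)) C (fst x)" by blast
    then show "\<exists>y. (OK (Suc n) (fst y) \<and> OK (Suc (Suc n)) (snd y) \<and> (\<exists>\<Lambda>'. comrel (Suc n) (fst y) \<Lambda>') \<and> (\<exists>\<Lambda>'. comrel (Suc (Suc n)) (snd y) \<Lambda>'))
      \<and> (fst y = snd x \<and> comrel (Suc (Suc n)) (snd y) (fst x))"
      using * by (intro exI[of _ "(snd x, C)"]) auto
  qed
  then obtain F where F: "\<And>n. OK n (fst (F n))" "\<And>n. fst (F (Suc n)) = snd (F n)"
    "\<And>n. comrel (Suc (Suc n)) (snd (F (Suc n))) (fst (F n))" by blast
  define \<Lambda> where "\<Lambda> w g = fst (F (length w)) w g" for w g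
  have low: "\<Lambda> w g = ptop j h p w g" if "length w \<le> j" for w g
    using F(1)[of "length w"] that by (auto simp: OK_def \<Lambda>_def ptop_def)
  have ml: "mlin (\<lambda>w. \<Lambda> w g)" for g
    using F(1) unfolding mlin_def \<Lambda>_def OK_def by simp
  have "comrel n \<Lambda> \<Lambda>" for n
  proof (cases "n < 2")
    case True then show ?thesis by (auto simp: comrel_def)
  next
    case False
    then obtain m where n: "n = Suc (Suc m)" by (metis less_2_cases_iff not0_implies_Suc One_nat_def)
    have "comrel (Suc (Suc m)) (fst (F (Suc (Suc m)))) (fst (F m))" using F(2,3) by metis
    then show ?thesis unfolding n comrel_def \<Lambda>_def by auto
  qed
  then show ?thesis using ml low unfolding admissible_def by (intro exI[of _ \<Lambda>]) blast
qed

end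

subsection \<open>Independence of monomials\<close>

text \<open>Induction on the variables. Replacing the coordinate \<open>b\<close> by a variable
  \<open>z\<close> gives a polynomial in \<open>z\<close> that is identically zero; each coefficient
  collects the monomials with one exponent of \<open>b\<close>.\<close>

lemma monomials_independent:
  assumes "finite B" "finite M" "\<And>m. m \<in> M \<Longrightarrow> set_mset m \<subseteq> B"
    and "\<And>p. (\<Sum>m\<in>M. c m * (\<Prod>b\<in>#m. p b)) = (0::complex)" and "m \<in> M"
  shows "c m = 0"
  using assms
proof (induction B arbitrary: M c m rule: finite_induct)
  case empty
  then have "M = {{#}}" by (auto simp: subset_antisym)
  then show ?case using empty.prems(3)[of "\<lambda>_. 0"] empty.prems(4) by auto
next
  case (insert b B)
  let ?q = "\<lambda>k p. \<Sum>m\<in>{m\<in>M. count m b = k}. c m * (\<Prod>x\<in>#filter_mset (\<lambda>x. x \<noteq> b) m. p x)"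
  let ?K = "Max ((\<lambda>m. count m b) ` M)"
  have prod: "(\<Prod>x\<in>#m. (p(b := z)) x) = z ^ count m b * (\<Prod>x\<in>#filter_mset (\<lambda>x. x \<noteq> b) m. p x)"
    for m and p :: "_ \<Rightarrow> complex" and z
    by (induction m) auto
  have q0: "?q k p = 0" for k p
  proof -
    define P where "P = (\<Sum>m\<in>M. Polynomial.monom (c m * (\<Prod>x\<in>#filter_mset (\<lambda>x. x \<noteq> b) m. p x)) (count m b))"
    have "poly P z = 0" for z
    proof -
      have "poly P z = (\<Sum>m\<in>M. c m * (\<Prod>x\<in>#m. (p(b := z)) x))"
        unfolding P_def poly_sum prod by (simp add: poly_monom mult_ac)
      then show ?thesis using insert.prems(3) by simp
    qed
    then have "P = 0" using poly_all_0_iff_0 by blast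
    then have "Polynomial.coeff P k = 0" by simp
    then show ?thesis unfolding P_def Polynomial.coeff_sum Polynomial.coeff_monom
      using insert.prems(1) by (simp add: sum.If_cases Int_def)
  qed
  let ?k = "count m b"
  let ?Mk = "{m\<in>M. count m b = ?k}"
  let ?f = "filter_mset (\<lambda>x. x \<noteq> b)"
  have inj: "inj_on ?f ?Mk"
  proof (rule inj_onI)
    fix x y assume *: "x \<in> ?Mk" "y \<in> ?Mk" and eq: "?f x = ?f y"
    show "x = y"
    proof (rule multiset_eqI)
      fix a
      have "count (?f x) a = count (?f y) a" using eq by simp
      then show "count x a = count y a" using * by (cases "a = b") auto
    qed
  qed
  define c' where "c' m' = c (inv_into ?Mk ?f m')" for m'
  have c': "c' (?f m) = c m" if "m \<in> ?Mk" for m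
    unfolding c'_def using inv_into_f_f[OF inj that] by simp
  have "c' (?f m) = 0"
  proof (rule insert.IH)
    show "finite (?f ` ?Mk)" using insert.prems(1) by simp
    show "set_mset m' \<subseteq> B" if "m' \<in> ?f ` ?Mk" for m' using insert.prems(2) that by fastforce
    show "?f m \<in> ?f ` ?Mk" using insert.prems(4) by blast
    show "(\<Sum>m\<in>?f ` ?Mk. c' m * (\<Prod>b\<in>#m. p b)) = 0" for p
    proof -
      have "(\<Sum>m\<in>?f ` ?Mk. c' m * (\<Prod>b\<in>#m. p b)) = (\<Sum>m\<in>?Mk. c' (?f m) * (\<Prod>b\<in>#?f m. p b))"
        by (simp add: sum.reindex[OF inj])
      also have "\<dots> = ?q ?k p" by (rule sum.cong[OF refl]) (simp add: c' del: mem_Collect_eq)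
      finally show ?thesis using q0 by simp
    qed
  qed
  then show ?case using c' insert.prems(4) by simp
qed

subsection \<open>The filtration and its symbols\<close>

lemma CC_move: "x * (CC z * y) = CC z * (x * y)"
proof -
  have "x * (CC z * y) = (x * CC z) * y" by (simp add: mult.assoc)
  also have "x * CC z = CC z * x" by (rule CC_central[symmetric])
  finally show ?thesis by (simp add: mult.assoc)
qed

lemma MM_CC: "Poly_Mapping.single k 1 * (CC z * y) = CC z * (Poly_Mapping.single k 1 * y)"
  by (rule CC_move)

context hecke_data
begin

text \<open>The type \<open>sk\<close> admits arbitrary functions as group parts; this is the
  subalgebra over G.\<close>

definition FG :: "'v sk set" where "FG = {a. \<forall>k\<in>keys a. gp k \<in> G}"

lemma FG_0 [simp]: "0 \<in> FG" by (simp add: FG_def)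
lemma FG_add: "a \<in> FG \<Longrightarrow> b \<in> FG \<Longrightarrow> a + b \<in> FG"
  unfolding FG_def using keys_add[of a b] by blast
lemma FG_uminus: "a \<in> FG \<Longrightarrow> - a \<in> FG"
  by (auto simp: FG_def in_keys_iff)
lemma FG_diff: "a \<in> FG \<Longrightarrow> b \<in> FG \<Longrightarrow> a - b \<in> FG"
  using FG_add[of a "- b"] FG_uminus by simp
lemma FG_MM: "g \<in> G \<Longrightarrow> MM w g \<in> FG" by (auto simp: FG_def)
lemma FG_CC: "CC z \<in> FG" by (auto simp: FG_def CC_def zero_skw_def)
lemma FG_1: "1 \<in> FG" using FG_CC[of 1] by simp
lemma FG_mult: "a \<in> FG \<Longrightarrow> b \<in> FG \<Longrightarrow> a * b \<in> FG"
proof -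
  assume ab: "a \<in> FG" "b \<in> FG"
  have "gp k \<in> G" if k: "k \<in> keys (a * b)" for k
  proof -
    obtain x y where "k = x + y" "x \<in> keys a" "y \<in> keys b" using k keys_mult[of a b] by blast
    then show ?thesis using ab comp_G by (auto simp: FG_def plus_skw_def)
  qed
  then show ?thesis by (simp add: FG_def)
qed
lemma FG_sum: "(\<And>i. i \<in> A \<Longrightarrow> f i \<in> FG) \<Longrightarrow> sum f A \<in> FG"
  by (induction A rule: infinite_finite_induct) (auto intro: FG_add)

text \<open>The transpose of \<open>g\<close> on points. Functions transform by
  \<open>f (act g p)\<close>, and composition is reversed.\<close>

definition act :: "('v \<Rightarrow> 'v) \<Rightarrow> ('v \<Rightarrow> complex) \<Rightarrow> 'v \<Rightarrow> complex" where
  "act g p = (\<lambda>b. pair (g b) p)"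

lemma pair_act: "g \<in> G \<Longrightarrow> pair v (act g p) = pair (g v) p"
proof -
  assume "g \<in> G"
  from lin1_expand[OF lin1_G[OF pair_lin1 this], of v p] show ?thesis
    unfolding act_def by (simp add: pair_def)
qed

lemma pair_Basis: "b \<in> Basis \<Longrightarrow> pair b p = p b"
proof -
  assume b: "b \<in> Basis"
  then have "pair b p = (\<Sum>c\<in>Basis. if b = c then p c else 0)"
    unfolding pair_def by (intro sum.cong) (auto simp: rep_Basis)
  then show ?thesis using b finite_Basis by simp
qed

definition NF :: "nat \<Rightarrow> ('v \<Rightarrow> 'v) \<Rightarrow> ('v \<Rightarrow> complex) \<Rightarrow> 'v list \<Rightarrow> ('v \<Rightarrow> 'v) \<Rightarrow> complex" where
  "NF j h p = (SOME \<Lambda>. admissible \<Lambda> \<and> (\<forall>w g. length w \<le> j \<longrightarrow> \<Lambda> w g = ptop j h p w g))"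

lemma NF_adm: "admissible (NF j h p)" and NF_low: "length w \<le> j \<Longrightarrow> NF j h p w g = ptop j h p w g"
  using someI_ex[OF normal_form_functional[of j h p]] unfolding NF_def by blast+

definition sg :: "int \<Rightarrow> 'v sk \<Rightarrow> ('v \<Rightarrow> 'v) \<Rightarrow> ('v \<Rightarrow> complex) \<Rightarrow> complex" where
  "sg n a h p = (if n < 0 then 0 else lext (\<lambda>k. NF (nat n) h p (wd k) (gp k)) a)"

lemma sg_0 [simp]: "sg n 0 h p = 0" by (simp add: sg_def)
lemma sg_add: "sg n (a + b) h p = sg n a h p + sg n b h p" by (simp add: sg_def lext_add)
lemma sg_uminus: "sg n (- a) h p = - sg n a h p" by (simp add: sg_def lext_uminus)
lemma sg_diff: "sg n (a - b) h p = sg n a h p - sg n b h p" by (simp add: sg_def lext_diff)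
lemma sg_CC: "sg n (CC z * a) h p = z * sg n a h p" by (simp add: sg_def lext_CC)
lemma sg_sum: "sg n (sum f A) h p = (\<Sum>i\<in>A. sg n (f i) h p)" by (simp add: sg_def lext_sum)
lemma sg_MM: "int (length w) \<le> n \<Longrightarrow>
  sg n (MM w g) h p = (if int (length w) = n \<and> g = h then \<Prod>v\<leftarrow>w. pair v p else 0)"
  by (auto simp: sg_def NF_low ptop_def)

section \<open>Homogeneous polynomial functions on the dual space\<close>

inductive hp :: "int \<Rightarrow> (('v \<Rightarrow> complex) \<Rightarrow> complex) \<Rightarrow> bool" where
  hp_zero: "hp n (\<lambda>p. 0)"
| hp_prod: "hp (int (length w)) (\<lambda>p. \<Prod>v\<leftarrow>w. pair v p)"
| hp_add: "hp n f \<Longrightarrow> hp n g \<Longrightarrow> hp n (\<lambda>p. f p + g p)"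
| hp_cmult: "hp n f \<Longrightarrow> hp n (\<lambda>p. z * f p)"

lemma hp_neg: "hp n f \<Longrightarrow> n < 0 \<Longrightarrow> f p = 0"
  by (induction rule: hp.induct) auto
lemma hp_uminus: "hp n f \<Longrightarrow> hp n (\<lambda>p. - f p)" using hp_cmult[of n f "-1"] by simp
lemma hp_diff: "hp n f \<Longrightarrow> hp n g \<Longrightarrow> hp n (\<lambda>p. f p - g p)"
  using hp_add[OF _ hp_uminus] by fastforce
lemma hp_sum: "(\<And>i. i \<in> A \<Longrightarrow> hp n (f i)) \<Longrightarrow> hp n (\<lambda>p. \<Sum>i\<in>A. f i p)"
  by (induction A rule: infinite_finite_induct) (auto intro: hp_zero hp_add)
lemma hp_pair: "hp 1 (pair v)" using hp_prod[of "[v]"] by simp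
lemma hp_const: "hp 0 (\<lambda>p. z)" using hp_cmult[OF hp_prod[of "[]"], of z] by simp
lemma hp_mult: "hp m f \<Longrightarrow> hp n g \<Longrightarrow> hp (m + n) (\<lambda>p. f p * g p)"
proof (induction rule: hp.induct)
  case (hp_zero n') then show ?case by (simp add: hp.hp_zero)
next
  case (hp_prod w)
  from this show ?case
  proof (induction rule: hp.induct)
    case (hp_zero n) then show ?case by (simp add: hp.hp_zero)
  next
    case (hp_prod w') then show ?case using hp.hp_prod[of "w @ w'"] by simp
  next
    case (hp_add n f g) then show ?case by (auto simp: distrib_left intro: hp.hp_add)
  next
    case (hp_cmult n f z) then show ?case using hp.hp_cmult[of _ _ z] by (simp add: mult.left_commute)
  qed
next
  case (hp_add n f g) then show ?case by (auto simp: distrib_right intro: hp.hp_add)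
next
  case (hp_cmult n f z) then show ?case using hp.hp_cmult[of _ _ z] by (simp add: mult.assoc)
qed
lemma hp_power: "hp m f \<Longrightarrow> hp (int k * m) (\<lambda>p. f p ^ k)"
proof (induction k)
  case 0 then show ?case using hp_const[of 1] by simp
next
  case (Suc k) then show ?case using hp_mult[of m f "int k * m" "\<lambda>p. f p ^ k"] by (simp add: algebra_simps)
qed
lemma hp_pair_power: "hp (int k) (\<lambda>p. pair v p ^ k)" using hp_power[OF hp_pair, of k] by simp
lemma hp_setprod: "finite A \<Longrightarrow> (\<And>i. i \<in> A \<Longrightarrow> hp m (f i)) \<Longrightarrow> hp (int (card A) * m) (\<lambda>p. \<Prod>i\<in>A. f i p)"
proof (induction A rule: finite_induct)
  case empty then show ?case using hp_const[of 1] by simp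
next
  case (insert x A) then show ?case
    using hp_mult[of m "f x" "int (card A) * m" "\<lambda>p. \<Prod>i\<in>A. f i p"] by (simp add: algebra_simps)
qed
lemma hp_act: "hp n f \<Longrightarrow> g \<in> G \<Longrightarrow> hp n (\<lambda>p. f (act g p))"
proof (induction rule: hp.induct)
  case (hp_prod w) then show ?case using hp.hp_prod[of "map g w"] by (simp add: pair_act comp_def)
qed (auto intro: hp.intros)

end

text \<open>The algebra is \<open>FG\<close> modulo \<open>J\<close>. The relations
  \<open>J_lin\<close> and \<open>J_com\<close> bound \<open>J\<close> from below;
  \<open>J_adm\<close> bounds it from above and is the form in which PBW enters.\<close>

locale hecke_alg = hecke_data sc Basis G \<kappa>
  for sc :: "complex \<Rightarrow> 'v::ab_group_add \<Rightarrow> 'v" and Basis G \<kappa> +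
  fixes J :: "'v sk set"
  assumes J_FG: "J \<subseteq> FG" and J_0 [simp]: "0 \<in> J" and J_diff: "a \<in> J \<Longrightarrow> b \<in> J \<Longrightarrow> a - b \<in> J"
    and J_left: "x \<in> FG \<Longrightarrow> a \<in> J \<Longrightarrow> x * a \<in> J" and J_right: "x \<in> FG \<Longrightarrow> a \<in> J \<Longrightarrow> a * x \<in> J"
    and J_lin: "MM [sc z u + v] id - (CC z * MM [u] id + MM [v] id) \<in> J"
    and J_com: "MM [u] id * MM [v] id - MM [v] id * MM [u] id - (\<Sum>s\<in>G. CC (\<kappa> s u v) * MM [] s) \<in> J"
    and J_adm: "admissible \<Lambda> \<Longrightarrow> a \<in> J \<Longrightarrow> lext (\<lambda>k. \<Lambda> (wd k) (gp k)) a = 0"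
begin

lemma J_uminus: "a \<in> J \<Longrightarrow> - a \<in> J" using J_diff[of 0 a] by simp
lemma J_add: "a \<in> J \<Longrightarrow> b \<in> J \<Longrightarrow> a + b \<in> J" using J_diff[of a "- b"] J_uminus by simp
lemma J_sum: "(\<And>i. i \<in> A \<Longrightarrow> f i \<in> J) \<Longrightarrow> sum f A \<in> J"
  by (induction A rule: infinite_finite_induct) (auto intro: J_add)
lemma J_CC: "a \<in> J \<Longrightarrow> CC z * a \<in> J" by (intro J_left FG_CC)

lemma sg_J: "a \<in> J \<Longrightarrow> sg n a h p = 0"
  by (simp add: sg_def J_adm NF_adm)

text \<open>Degrees are counted modulo \<open>J\<close>, and integer indices make a negative degree
  mean membership in \<open>J\<close>; this is how centrality is finally reached.\<close>

definition F :: "int \<Rightarrow> 'v sk set" where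
  "F n = {a \<in> FG. \<exists>b\<in>J. \<forall>k\<in>keys (a - b). int (length (wd k)) \<le> n}"

lemma F_FG: "a \<in> F n \<Longrightarrow> a \<in> FG" by (simp add: F_def)

lemma F_MM: "g \<in> G \<Longrightarrow> int (length w) \<le> n \<Longrightarrow> MM w g \<in> F n"
  unfolding F_def using FG_MM by (auto intro: bexI[OF _ J_0])

lemma J_F: "a \<in> J \<Longrightarrow> a \<in> F n"
  unfolding F_def using J_FG by (auto intro!: bexI[of _ a])

lemma F_neg: "n < 0 \<Longrightarrow> F n = J"
proof -
  assume n: "n < 0"
  have "a \<in> J" if a: "a \<in> F n" for a
  proof -
    obtain b where b: "b \<in> J" "\<forall>k\<in>keys (a - b). int (length (wd k)) \<le> n" using a by (auto simp: F_def)
    then have "keys (a - b) = {}" using n by fastforce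
    then have "a - b = 0" by simp
    then show ?thesis using b by simp
  qed
  then show ?thesis using J_F by blast
qed

lemma F_add: "a \<in> F n \<Longrightarrow> b \<in> F n \<Longrightarrow> a + b \<in> F n"
proof -
  assume "a \<in> F n" "b \<in> F n"
  then obtain x y where x: "x \<in> J" "\<forall>k\<in>keys (a - x). int (length (wd k)) \<le> n"
    and y: "y \<in> J" "\<forall>k\<in>keys (b - y). int (length (wd k)) \<le> n" and ab: "a \<in> FG" "b \<in> FG"
    by (auto simp: F_def)
  have "a + b - (x + y) = (a - x) + (b - y)" by simp
  then have "keys (a + b - (x + y)) \<subseteq> keys (a - x) \<union> keys (b - y)"
    using keys_add[of "a - x" "b - y"] by (simp only:)
  then have "\<forall>k\<in>keys (a + b - (x + y)). int (length (wd k)) \<le> n"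
    using x y by blast
  then show ?thesis using J_add[OF x(1) y(1)] ab FG_add unfolding F_def by blast
qed

lemma keys_CC_mult: "keys (CC z * a) \<subseteq> keys a" by (auto simp: in_keys_iff CC_mult_lookup)

lemma F_CC: "a \<in> F n \<Longrightarrow> CC z * a \<in> F n"
proof -
  assume "a \<in> F n"
  then obtain x where x: "x \<in> J" "\<forall>k\<in>keys (a - x). int (length (wd k)) \<le> n" and a: "a \<in> FG"
    by (auto simp: F_def)
  have "CC z * a - CC z * x = CC z * (a - x)" by (simp add: algebra_simps)
  then have "\<forall>k\<in>keys (CC z * a - CC z * x). int (length (wd k)) \<le> n"
    using x keys_CC_mult[of z "a - x"] by auto
  then show ?thesis using J_CC[OF x(1)] a FG_mult[OF FG_CC] unfolding F_def by blast
qed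

lemma F_uminus: "a \<in> F n \<Longrightarrow> - a \<in> F n" using F_CC[of a n "-1"] by (simp add: CC_uminus)
lemma F_diff: "a \<in> F n \<Longrightarrow> b \<in> F n \<Longrightarrow> a - b \<in> F n" using F_add[of a n "- b"] F_uminus by simp
lemma F_sum: "(\<And>i. i \<in> A \<Longrightarrow> f i \<in> F n) \<Longrightarrow> sum f A \<in> F n"
  by (induction A rule: infinite_finite_induct) (auto intro: F_add J_F)
lemma F_mono: "a \<in> F m \<Longrightarrow> m \<le> n \<Longrightarrow> a \<in> F n"
  unfolding F_def by fastforce

lemma F_induct [consumes 1, case_names J add MM]:
  assumes "a \<in> F n" "\<And>b. b \<in> J \<Longrightarrow> P b"
    and add: "\<And>x y. x \<in> F n \<Longrightarrow> y \<in> F n \<Longrightarrow> P x \<Longrightarrow> P y \<Longrightarrow> P (x + y)"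
    and mm: "\<And>z w g. g \<in> G \<Longrightarrow> int (length w) \<le> n \<Longrightarrow> P (CC z * MM w g)"
  shows "P a"
proof -
  obtain b where b: "b \<in> J" "\<forall>k\<in>keys (a - b). int (length (wd k)) \<le> n" and a: "a \<in> FG"
    using assms(1) by (auto simp: F_def)
  have "a - b \<in> FG" using a b J_FG FG_diff by blast
  let ?f = "\<lambda>k. CC (lookup (a - b) k) * MM (wd k) (gp k)"
  have *: "sum ?f A \<in> F n \<and> P (sum ?f A)" if "finite A" "A \<subseteq> keys (a - b)" for A
    using that
  proof (induction A rule: finite_induct)
    case empty then show ?case using assms(2)[OF J_0] J_F by simp
  next
    case (insert k A)
    then have k: "gp k \<in> G" "int (length (wd k)) \<le> n" using b \<open>a - b \<in> FG\<close> by (auto simp: FG_def)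
    have fk: "?f k \<in> F n" and Pk: "P (?f k)" using F_CC[OF F_MM[OF k]] mm[OF k] by blast+
    then have "?f k + sum ?f A \<in> F n \<and> P (?f k + sum ?f A)"
      using insert F_add[OF fk] add[OF fk _ Pk] by blast
    then show ?case using insert.hyps by simp
  qed
  have "P (b + (a - b))"
    by (subst sk_expand[of "a - b"]) (use * assms(2) b J_F in \<open>auto intro!: add\<close>)
  then show ?thesis by simp
qed

lemma F_mult: "a \<in> F m \<Longrightarrow> b \<in> F n \<Longrightarrow> a * b \<in> F (m + n)"
proof (induction rule: F_induct)
  case (J a) then show ?case using J_right F_FG J_F by blast
next
  case (add x y) then show ?case by (simp add: distrib_right F_add)
next
  case (MM z w g)
  from MM(3) show ?case
  proof (induction rule: F_induct)
    case (J b) then show ?case using J_left[of "CC z * MM w g"] MM(1) J_F FG_mult[OF FG_CC FG_MM] by blast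
  next
    case (add x y) then show ?case by (simp add: distrib_left F_add)
  next
    case MM': (MM z' w' g')
    have "CC z * MM w g * (CC z' * MM w' g') = CC z * (CC z' * (MM w g * MM w' g'))"
      by (simp add: mult.assoc MM_CC)
    then show ?case unfolding MM_mult using MM MM' by (simp add: F_CC F_MM comp_G)
  qed
qed

lemma sg_low: "a \<in> F m \<Longrightarrow> m < n \<Longrightarrow> sg n a h p = 0"
  by (induction rule: F_induct) (auto simp: sg_J sg_add sg_CC sg_MM)

lemma sg_notG: "a \<in> F n \<Longrightarrow> h \<notin> G \<Longrightarrow> sg n a h p = 0"
  by (induction rule: F_induct) (auto simp: sg_J sg_add sg_CC sg_MM)

lemma sg_hp: "a \<in> F n \<Longrightarrow> hp n (sg n a h)"
proof (induction rule: F_induct)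
  case (J b)
  then have "sg n b h = (\<lambda>p. 0)" by (simp add: fun_eq_iff sg_J)
  then show ?case by (simp add: hp_zero)
next
  case (add x y) then show ?case using hp_add[OF add(3,4)] by (simp add: sg_add[abs_def])
next
  case (MM z w g)
  have "sg n (CC z * MM w g) h = (\<lambda>p. z * (if int (length w) = n \<and> g = h then \<Prod>v\<leftarrow>w. pair v p else 0))"
    using MM by (simp add: fun_eq_iff sg_CC sg_MM)
  moreover have "hp n (\<lambda>p. (if int (length w) = n \<and> g = h then \<Prod>v\<leftarrow>w. pair v p else 0))"
    using hp_prod[of w] hp_zero by (cases "int (length w) = n \<and> g = h") auto
  ultimately show ?case by (simp add: hp_cmult)
qed

text \<open>The product of the skew group algebra S(V) * G: the component at \<open>g\<close> of the
  first factor acts on the second before the functions are multiplied. On words this is the passage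
  of \<open>g\<close> through the second word.\<close>

lemma sg_mult:
  "a \<in> F m \<Longrightarrow> b \<in> F n \<Longrightarrow>
   sg (m + n) (a * b) h p = (\<Sum>g\<in>G. sg m a g p * sg n b (giv g \<circ> h) (act g p))"
proof (induction rule: F_induct)
  case (J a) then show ?case using J_right[of b a] F_FG by (simp add: sg_J)
next
  case (add x y) then show ?case by (simp add: distrib_right sg_add sum.distrib)
next
  case (MM z w g)
  have one: "(\<Sum>g'\<in>G. sg m (CC z * MM w g) g' p * X g') = sg m (CC z * MM w g) g p * X g" for X
  proof -
    have "(\<Sum>g'\<in>G. sg m (CC z * MM w g) g' p * X g') = (\<Sum>g'\<in>G. if g = g' then sg m (CC z * MM w g) g p * X g else 0)"
      using MM by (intro sum.cong) (auto simp: sg_CC sg_MM)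
    then show ?thesis using MM(1) finite_G by simp
  qed
  from MM(3) show ?case unfolding one
  proof (induction rule: F_induct)
    case (J b) then show ?case using J_left[of "CC z * MM w g"] MM(1) FG_mult[OF FG_CC FG_MM] by (simp add: sg_J)
  next
    case (add x y) then show ?case by (simp add: distrib_left sg_add)
  next
    case MM': (MM z' w' g')
    have eq: "CC z * MM w g * (CC z' * MM w' g') = CC z * (CC z' * (MM (w @ map g w') (g \<circ> g')))"
      by (simp add: mult.assoc MM_CC MM_mult)
    have gh: "g \<circ> g' = h \<longleftrightarrow> g' = giv g \<circ> h"
      using inv_comp_G[OF MM(1)] by (metis comp_assoc id_comp)
    have pr: "(\<Prod>v\<leftarrow>map g w'. pair v p) = (\<Prod>v\<leftarrow>w'. pair v (act g p))"
      using MM(1) by (simp add: comp_def pair_act)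
    have 1: "sg (m + n) (MM (w @ map g w') (g \<circ> g')) h p = (if int (length w) = m \<and> int (length w') = n \<and> g' = giv g \<circ> h
        then (\<Prod>v\<leftarrow>w. pair v p) * (\<Prod>v\<leftarrow>w'. pair v (act g p)) else 0)"
      using MM MM' by (subst sg_MM) (auto simp: gh pr simp del: map_map list.map_comp)
    show ?case unfolding eq sg_CC 1 using MM MM'
      by (simp add: sg_MM)
  qed
qed

section \<open>Normal forms of words up to lower degree\<close>

lemma J_mlin: "g \<in> G \<Longrightarrow> MM (xs @ (sc z u + v) # ys) g - (CC z * MM (xs @ u # ys) g + MM (xs @ v # ys) g) \<in> J"
proof -
  assume g: "g \<in> G"
  have "MM xs id * (MM [sc z u + v] id - (CC z * MM [u] id + MM [v] id)) * MM ys g \<in> J"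
    using J_lin g FG_MM by (intro J_left J_right) auto
  moreover have "MM xs id * (MM [sc z u + v] id - (CC z * MM [u] id + MM [v] id)) * MM ys g
    = MM (xs @ (sc z u + v) # ys) g - (CC z * MM (xs @ u # ys) g + MM (xs @ v # ys) g)"
    by (simp add: left_diff_distrib right_diff_distrib distrib_left distrib_right MM_CC mult.assoc MM_mult)
  ultimately show ?thesis by simp
qed

lemma J_swap: "g \<in> G \<Longrightarrow> MM (xs @ x # y # ys) g - MM (xs @ y # x # ys) g
   - (\<Sum>s\<in>G. CC (\<kappa> s x y) * MM (xs @ map s ys) (s \<circ> g)) \<in> J"
proof -
  assume g: "g \<in> G"
  have "MM xs id * (MM [x] id * MM [y] id - MM [y] id * MM [x] id - (\<Sum>s\<in>G. CC (\<kappa> s x y) * MM [] s)) * MM ys g \<in> J"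
    using J_com g FG_MM by (intro J_left J_right) auto
  then show ?thesis
    by (simp add: left_diff_distrib right_diff_distrib sum_distrib_left sum_distrib_right MM_CC mult.assoc MM_mult)
qed

lemma F_swap: "g \<in> G \<Longrightarrow> int (length (xs @ x # y # ys)) - 1 \<le> n \<Longrightarrow> MM (xs @ x # y # ys) g - MM (xs @ y # x # ys) g \<in> F n"
proof -
  assume g: "g \<in> G" and n: "int (length (xs @ x # y # ys)) - 1 \<le> n"
  have "(\<Sum>s\<in>G. CC (\<kappa> s x y) * MM (xs @ map s ys) (s \<circ> g)) \<in> F n"
    using g n by (intro F_sum F_CC F_MM comp_G) auto
  from F_add[OF J_F[OF J_swap[OF g, of xs x y ys]] this] show ?thesis by simp
qed

lemma F_move: "g \<in> G \<Longrightarrow> int (length (pre @ as @ x # bs)) - 1 \<le> n \<Longrightarrow>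
  MM (pre @ as @ x # bs) g - MM (pre @ x # as @ bs) g \<in> F n"
proof (induction as arbitrary: pre)
  case Nil then show ?case by (simp add: J_F)
next
  case (Cons a as)
  have "MM ((pre @ [a]) @ as @ x # bs) g - MM ((pre @ [a]) @ x # as @ bs) g \<in> F n"
    by (rule Cons.IH) (use Cons.prems in auto)
  moreover have "MM (pre @ a # x # as @ bs) g - MM (pre @ x # a # as @ bs) g \<in> F n"
    by (rule F_swap) (use Cons.prems in auto)
  ultimately have "(MM ((pre @ [a]) @ as @ x # bs) g - MM ((pre @ [a]) @ x # as @ bs) g)
     + (MM (pre @ a # x # as @ bs) g - MM (pre @ x # a # as @ bs) g) \<in> F n" by (rule F_add)
  then show ?case by simp
qed

lemma F_perm: "mset w = mset w' \<Longrightarrow> g \<in> G \<Longrightarrow> int (length (pre @ w)) - 1 \<le> n \<Longrightarrow>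
  MM (pre @ w) g - MM (pre @ w') g \<in> F n"
proof (induction w arbitrary: pre w')
  case Nil then show ?case by (simp add: J_F)
next
  case (Cons x xs)
  have "x \<in> set w'" using Cons.prems(1) by (metis list.set_intros(1) set_mset_mset)
  then obtain as bs where w': "w' = as @ x # bs" by (meson split_list)
  have 1: "MM ((pre @ [x]) @ xs) g - MM ((pre @ [x]) @ as @ bs) g \<in> F n"
    by (rule Cons.IH) (use Cons.prems w' in auto)
  have "length (x # xs) = length w'" using Cons.prems(1) by (metis size_mset)
  then have 2: "MM (pre @ as @ x # bs) g - MM (pre @ x # as @ bs) g \<in> F n"
    by (intro F_move) (use Cons.prems w' in auto)
  from F_diff[OF 1 2] show ?case by (simp add: w')
qed

definition mons :: "nat \<Rightarrow> 'v multiset set" where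
  "mons n = mset ` {w. set w \<subseteq> Basis \<and> length w = n}"

definition mword :: "'v multiset \<Rightarrow> 'v list" where "mword m = (SOME w. mset w = m)"

lemma mset_mword: "mset (mword m) = m"
  unfolding mword_def by (rule someI_ex) (rule ex_mset)

lemma finite_mons: "finite (mons n)"
  unfolding mons_def using finite_lists_length_eq[OF finite_Basis] by simp

lemma sum_single_index: "finite A \<Longrightarrow> m \<in> A \<Longrightarrow> (\<Sum>x\<in>A. CC (if x = m then z else 0) * f x) = CC z * f m"
  by (subst sum.remove[of _ m]) (auto intro!: sum.neutral)

text \<open>Letters are expanded in the basis modulo \<open>J\<close>, and basis words are reordered
  at the cost of lower degree, so one representative \<open>mword m\<close> for each multiset is
  enough.\<close>

lemma F_normal_form:
  assumes "a \<in> F (int n)"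
  shows "\<exists>c. a - (\<Sum>g\<in>G. \<Sum>m\<in>mons n. CC (c g m) * MM (mword m) g) \<in> F (int n - 1)"
proof -
  define T where "T = {a. \<exists>c. a - (\<Sum>g\<in>G. \<Sum>m\<in>mons n. CC (c g m) * MM (mword m) g) \<in> F (int n - 1)}"
  have T_F: "a \<in> T" if "a \<in> F (int n - 1)" for a
    unfolding T_def using that by (intro CollectI exI[of _ "\<lambda>g m. 0"]) simp
  have T_add: "a + b \<in> T" if "a \<in> T" "b \<in> T" for a b
  proof -
    obtain c d where "a - (\<Sum>g\<in>G. \<Sum>m\<in>mons n. CC (c g m) * MM (mword m) g) \<in> F (int n - 1)"
      "b - (\<Sum>g\<in>G. \<Sum>m\<in>mons n. CC (d g m) * MM (mword m) g) \<in> F (int n - 1)"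
      using \<open>a \<in> T\<close> \<open>b \<in> T\<close> unfolding T_def by blast
    from F_add[OF this] show ?thesis unfolding T_def
      by (intro CollectI exI[of _ "\<lambda>g m. c g m + d g m"])
        (simp add: CC_add distrib_right sum.distrib algebra_simps)
  qed
  have T_CC: "CC z * a \<in> T" if a: "a \<in> T" for a z
  proof -
    obtain c where "a - (\<Sum>g\<in>G. \<Sum>m\<in>mons n. CC (c g m) * MM (mword m) g) \<in> F (int n - 1)"
      using a unfolding T_def by blast
    from F_CC[OF this, of z] show ?thesis unfolding T_def
      by (intro CollectI exI[of _ "\<lambda>g m. z * c g m"])
        (simp add: CC_mult right_diff_distrib sum_distrib_left mult.assoc)
  qed
  have T_sum: "sum f A \<in> T" if "\<And>i. i \<in> A \<Longrightarrow> f i \<in> T" for f and A :: "'v set"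
    using that T_F[OF J_F[OF J_0]] by (induction A rule: infinite_finite_induct) (auto intro: T_add)
  have basis: "MM w g \<in> T" if "g \<in> G" "set w \<subseteq> Basis" "length w = n" for g w
  proof -
    have m: "mset w \<in> mons n" using that by (auto simp: mons_def)
    have "(\<Sum>g'\<in>G. \<Sum>m\<in>mons n. CC (if g' = g then if m = mset w then 1 else 0 else 0) * MM (mword m) g')
      = (\<Sum>g'\<in>G. CC (if g' = g then 1 else 0) * MM (mword (mset w)) g')"
      by (intro sum.cong refl) (auto simp: sum_single_index[OF finite_mons m])
    also have "\<dots> = MM (mword (mset w)) g"
      using sum_single_index[OF finite_G \<open>g \<in> G\<close>, of 1 "\<lambda>g'. MM (mword (mset w)) g'"] by simp
    finally have eq: "(\<Sum>g'\<in>G. \<Sum>m\<in>mons n. CC (if g' = g then if m = mset w then 1 else 0 else 0) * MM (mword m) g')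
      = MM (mword (mset w)) g" .
    have "MM ([] @ w) g - MM ([] @ mword (mset w)) g \<in> F (int n - 1)"
      by (rule F_perm) (use that mset_mword in auto)
    then show ?thesis unfolding T_def
      by (intro CollectI exI[of _ "\<lambda>g' m. if g' = g then if m = mset w then 1 else 0 else 0"]) (simp add: eq)
  qed
  have word: "MM (xs @ ys) g \<in> T" if "g \<in> G" "set xs \<subseteq> Basis" "length (xs @ ys) = n" for g xs ys
    using that(2,3)
  proof (induction ys arbitrary: xs)
    case Nil then show ?case using basis[OF that(1)] by simp
  next
    case (Cons y ys)
    have zero: "MM (xs @ 0 # ys) g \<in> J"
      using J_uminus[OF J_mlin[OF that(1), of xs 1 0 0 ys]] by simp
    have lin: "MM (xs @ (\<Sum>b\<in>B. sc (r b) b) # ys) g - (\<Sum>b\<in>B. CC (r b) * MM (xs @ b # ys) g) \<in> J"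
      if "finite B" for r and B :: "'v set"
      using that
    proof (induction B rule: finite_induct)
      case empty then show ?case using zero by simp
    next
      case (insert b B)
      from J_add[OF J_mlin[OF \<open>g \<in> G\<close>, of xs "r b" b "\<Sum>b\<in>B. sc (r b) b" ys] insert.IH]
      show ?case using insert.hyps by (simp add: algebra_simps)
    qed
    have "MM (xs @ y # ys) g - (\<Sum>b\<in>Basis. CC (representation Basis y b) * MM (xs @ b # ys) g) \<in> J"
      using lin[OF finite_Basis, of "representation Basis y"] by (simp only: basis_expand[of y, symmetric])
    then have "MM (xs @ y # ys) g - (\<Sum>b\<in>Basis. CC (representation Basis y b) * MM (xs @ b # ys) g) \<in> T"
      by (intro T_F J_F)
    moreover have "(\<Sum>b\<in>Basis. CC (representation Basis y b) * MM (xs @ b # ys) g) \<in> T"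
      using Cons.IH[of "xs @ [b]" for b] Cons.prems by (intro T_sum T_CC) auto
    ultimately show ?case using T_add by fastforce
  qed
  have "a \<in> T" using assms
  proof (induction rule: F_induct)
    case (J b) then show ?case using T_F J_F by blast
  next
    case (add x y) then show ?case using T_add by blast
  next
    case (MM z w g)
    show ?case
    proof (cases "length w = n")
      case True then show ?thesis using word[of g "[]" w] MM T_CC by simp
    next
      case False then show ?thesis using MM by (intro T_F F_CC F_MM) auto
    qed
  qed
  then show ?thesis by (simp add: T_def)
qed

text \<open>For a normal form, the symbol at \<open>h\<close> is the polynomial with coefficients
  \<open>c h m\<close>. Monomials are independent as functions, so a zero symbol leaves only terms
  of lower degree.\<close>

theorem symbol_kernel:
  assumes a: "a \<in> F n" and zero: "\<And>h p. h \<in> G \<Longrightarrow> sg n a h p = 0"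
  shows "a \<in> F (n - 1)"
proof (cases "n < 0")
  case True then show ?thesis using a F_neg by simp
next
  case False
  then obtain k where n: "n = int k" by (metis int_nat_eq linorder_not_less)
  obtain c where c: "a - (\<Sum>g\<in>G. \<Sum>m\<in>mons k. CC (c g m) * MM (mword m) g) \<in> F (int k - 1)"
    using F_normal_form a unfolding n by blast
  have c0: "c h m = 0" if h: "h \<in> G" and m: "m \<in> mons k" for h m
  proof (rule monomials_independent[OF finite_Basis finite_mons _ _ m])
    show "set_mset m' \<subseteq> Basis" if "m' \<in> mons k" for m' using that by (auto simp: mons_def)
    fix p :: "'v \<Rightarrow> complex"
    have mm: "sg n (MM (mword m') g) h p = (if g = h then \<Prod>b\<in>#m'. p b else 0)" if m': "m' \<in> mons k" for m' g
    proof -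
      obtain w where w: "m' = mset w" "set w \<subseteq> Basis" "length w = k" using m' by (auto simp: mons_def)
      have l: "length (mword m') = k" using mset_mword[of m'] w by (metis size_mset)
      have "set (mword m') \<subseteq> Basis" using mset_mword[of m'] w by (metis set_mset_mset)
      then have "(\<Prod>v\<leftarrow>mword m'. pair v p) = (\<Prod>v\<leftarrow>mword m'. p v)"
        by (intro arg_cong[of _ _ prod_list] map_cong refl) (auto simp: pair_Basis)
      also have "\<dots> = (\<Prod>b\<in>#m'. p b)" by (metis mset_map mset_mword prod_mset_prod_list)
      finally show ?thesis using l by (simp add: sg_MM n)
    qed
    have "0 = sg n a h p - sg n (a - (\<Sum>g\<in>G. \<Sum>m\<in>mons k. CC (c g m) * MM (mword m) g)) h p"
      using zero[OF h] sg_low[OF c] n by simp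
    also have "\<dots> = (\<Sum>g\<in>G. \<Sum>m\<in>mons k. c g m * sg n (MM (mword m) g) h p)"
      by (simp add: sg_diff sg_sum sg_CC)
    also have "\<dots> = (\<Sum>g\<in>G. if g = h then \<Sum>m\<in>mons k. c h m * (\<Prod>b\<in>#m. p b) else 0)"
      by (intro sum.cong refl) (auto simp: mm intro!: sum.neutral)
    also have "\<dots> = (\<Sum>m\<in>mons k. c h m * (\<Prod>b\<in>#m. p b))" using h finite_G by simp
    finally show "(\<Sum>m\<in>mons k. c h m * (\<Prod>b\<in>#m. p b)) = 0" by simp
  qed
  then have "(\<Sum>g\<in>G. \<Sum>m\<in>mons k. CC (c g m) * MM (mword m) g) = 0"
    by (intro sum.neutral ballI) simp
  then show ?thesis using c n by simp
qed

end

subsection \<open>Gradients of polynomial functions\<close>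

context hecke_data
begin

definition ptl :: "('v \<Rightarrow> complex) \<Rightarrow> complex \<Rightarrow> ('v \<Rightarrow> complex) \<Rightarrow> 'v \<Rightarrow> complex" where
  "ptl p z q = (\<lambda>b. p b + z * q b)"

lemma pair_ptl: "pair v (ptl p z q) = pair v p + z * pair v q"
  by (simp add: pair_def ptl_def distrib_left sum.distrib sum_distrib_left mult_ac)

lemma ptl_0 [simp]: "ptl p 0 q = p" by (simp add: ptl_def)

lemma act_ptl: "act g (ptl p z q) = ptl (act g p) z (act g q)"
  unfolding act_def pair_ptl by (simp add: ptl_def)

lemma pair_eqI: assumes "\<And>q. pair v q = pair w q" shows "v = w"
proof -
  have "representation Basis v b = representation Basis w b" if b: "b \<in> Basis" for b
  proof -
    have "pair u (\<lambda>c. if c = b then 1 else 0) = representation Basis u b" for u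
    proof -
      have "pair u (\<lambda>c. if c = b then 1 else 0) = (\<Sum>c\<in>Basis. if c = b then representation Basis u c else 0)"
        unfolding pair_def by (intro sum.cong) auto
      then show ?thesis using b finite_Basis by simp
    qed
    then show ?thesis using assms by metis
  qed
  then have "(\<Sum>b\<in>Basis. sc (representation Basis v b) b) = (\<Sum>b\<in>Basis. sc (representation Basis w b) b)"
    by simp
  then show ?thesis using basis_expand by metis
qed

lemma pair_nonzero: "v \<noteq> 0 \<Longrightarrow> \<exists>q. pair v q \<noteq> 0"
  using pair_eqI[of v 0] lin1_0[OF pair_lin1] by auto

lemma pair_independent:
  assumes "v \<noteq> 0" "\<And>z. w \<noteq> sc z v"
  shows "\<exists>q. pair v q = 0 \<and> pair w q \<noteq> 0"
proof (rule ccontr)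
  assume neg: "\<nexists>q. pair v q = 0 \<and> pair w q \<noteq> 0"
  obtain q0 where q0: "pair v q0 \<noteq> 0" using pair_nonzero assms(1) by blast
  have "pair w q = pair (sc (pair w q0 / pair v q0) v) q" for q
  proof -
    have "pair v (ptl q (- (pair v q / pair v q0)) q0) = 0" using q0 by (simp add: pair_ptl)
    then have "pair w (ptl q (- (pair v q / pair v q0)) q0) = 0" using neg by blast
    then show ?thesis by (simp add: pair_ptl lin1_sc[OF pair_lin1])
  qed
  then have "w = sc (pair w q0 / pair v q0) v" by (rule pair_eqI)
  then show False using assms(2) by blast
qed

text \<open>The differential at a point is a linear form on points, hence a vector of V. It is
  tested by one-variable derivatives along all lines, so V itself carries no topology.\<close>

definition has_grad :: "(('v \<Rightarrow> complex) \<Rightarrow> complex) \<Rightarrow> ('v \<Rightarrow> complex) \<Rightarrow> 'v \<Rightarrow> bool" where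
  "has_grad f p v \<longleftrightarrow> (\<forall>q. ((\<lambda>z. f (ptl p z q)) has_field_derivative pair v q) (at 0))"

definition grad :: "(('v \<Rightarrow> complex) \<Rightarrow> complex) \<Rightarrow> ('v \<Rightarrow> complex) \<Rightarrow> 'v" where
  "grad f p = (SOME v. has_grad f p v)"

lemma gradI: "has_grad f p v \<Longrightarrow> grad f p = v"
proof -
  assume v: "has_grad f p v"
  then have "has_grad f p (grad f p)" unfolding grad_def by (rule someI)
  then show ?thesis using v by (intro pair_eqI) (auto simp: has_grad_def intro: DERIV_unique)
qed

lemma has_grad_const: "has_grad (\<lambda>p. z) p 0"
  by (simp add: has_grad_def lin1_0[OF pair_lin1])
lemma has_grad_pair: "has_grad (pair v) p v"
  unfolding has_grad_def pair_ptl by (auto intro!: derivative_eq_intros)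
lemma has_grad_add: "has_grad f p v \<Longrightarrow> has_grad g p w \<Longrightarrow> has_grad (\<lambda>p. f p + g p) p (v + w)"
  unfolding has_grad_def lin1_add[OF pair_lin1] by (auto intro!: derivative_eq_intros)
lemma has_grad_cmult: "has_grad f p v \<Longrightarrow> has_grad (\<lambda>p. z * f p) p (sc z v)"
  unfolding has_grad_def lin1_sc[OF pair_lin1] by (auto intro!: derivative_eq_intros)
lemma has_grad_mult: "has_grad f p v \<Longrightarrow> has_grad g p w \<Longrightarrow> has_grad (\<lambda>p. f p * g p) p (sc (g p) v + sc (f p) w)"
  unfolding has_grad_def lin1_add[OF pair_lin1] lin1_sc[OF pair_lin1]
  by (auto intro!: derivative_eq_intros simp: mult_ac)
lemma has_grad_act: "g \<in> G \<Longrightarrow> has_grad f (act g p) v \<Longrightarrow> has_grad (\<lambda>p. f (act g p)) p (g v)"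
  unfolding has_grad_def act_ptl by (simp add: pair_act[symmetric])
lemma has_grad_sum: "(\<And>i. i \<in> A \<Longrightarrow> has_grad (f i) p (v i)) \<Longrightarrow> has_grad (\<lambda>p. \<Sum>i\<in>A. f i p) p (\<Sum>i\<in>A. v i)"
  by (induction A rule: infinite_finite_induct) (auto intro: has_grad_const has_grad_add)

lemma hp_has_grad_Euler: "hp n f \<Longrightarrow> \<exists>v. has_grad f p v \<and> pair v p = of_int n * f p"
proof (induction rule: hp.induct)
  case (hp_zero n) then show ?case using has_grad_const lin1_0[OF pair_lin1] by fastforce
next
  case (hp_prod w)
  show ?case
  proof (induction w)
    case Nil then show ?case using has_grad_const[of 1 p] lin1_0[OF pair_lin1] by fastforce
  next
    case (Cons u w)
    then obtain v where v: "has_grad (\<lambda>p. \<Prod>v\<leftarrow>w. pair v p) p v" "pair v p = of_int (int (length w)) * (\<Prod>v\<leftarrow>w. pair v p)"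
      by blast
    from has_grad_mult[OF has_grad_pair[of u p] v(1)] show ?case
      using v(2) by (intro exI conjI) (auto simp: lin1_add[OF pair_lin1] lin1_sc[OF pair_lin1] algebra_simps)
  qed
next
  case (hp_add n f g)
  then obtain v w where "has_grad f p v" "pair v p = of_int n * f p" "has_grad g p w" "pair w p = of_int n * g p" by blast
  then show ?case using has_grad_add[of f p v g w] by (intro exI[of _ "v + w"]) (auto simp: lin1_add[OF pair_lin1] algebra_simps)
next
  case (hp_cmult n f z)
  then obtain v where "has_grad f p v" "pair v p = of_int n * f p" by blast
  then show ?case using has_grad_cmult[of f p v z] by (intro exI[of _ "sc z v"]) (auto simp: lin1_sc[OF pair_lin1] algebra_simps)
qed

lemma hp_has_grad: "hp n f \<Longrightarrow> has_grad f p (grad f p)"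
  using hp_has_grad_Euler gradI by metis
lemma Euler: "hp n f \<Longrightarrow> pair (grad f p) p = of_int n * f p"
  using hp_has_grad_Euler gradI by metis

lemma grad_zero: "grad (\<lambda>p. 0) p = 0" by (rule gradI) (rule has_grad_const)
lemma grad_add: "hp n f \<Longrightarrow> hp n g \<Longrightarrow> grad (\<lambda>p. f p + g p) p = grad f p + grad g p"
  by (intro gradI has_grad_add hp_has_grad)
lemma grad_cmult: "hp n f \<Longrightarrow> grad (\<lambda>p. z * f p) p = sc z (grad f p)"
  by (intro gradI has_grad_cmult hp_has_grad)
lemma grad_Cons: "grad (\<lambda>p. pair v p * (\<Prod>v\<leftarrow>w. pair v p)) p
   = sc (\<Prod>v\<leftarrow>w. pair v p) v + sc (pair v p) (grad (\<lambda>p. \<Prod>v\<leftarrow>w. pair v p) p)"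
  by (intro gradI has_grad_mult has_grad_pair hp_has_grad[OF hp_prod])

section \<open>Restriction to lines, cancellation and division by linear forms\<close>

lemma hp_cong_pair: "hp n f \<Longrightarrow> (\<And>v. pair v p = pair v q) \<Longrightarrow> f p = f q"
  by (induction rule: hp.induct) auto
lemma hp_act_id: "hp n f \<Longrightarrow> f (act id p) = f p"
  by (erule hp_cong_pair) (simp add: pair_act)

text \<open>The coefficient \<open>f q\<close> in degree \<open>n\<close> is the value in the
  direction of the line; it fixes the exact degree whenever it is nonzero.\<close>

lemma hp_line: "hp n f \<Longrightarrow> \<exists>P. (\<forall>z. poly P z = f (ptl p z q)) \<and> (n \<ge> 0 \<longrightarrow> Polynomial.degree P \<le> nat n \<and> Polynomial.coeff P (nat n) = f q)"
proof (induction rule: hp.induct)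
  case (hp_zero n) then show ?case by (intro exI[of _ 0]) simp
next
  case (hp_prod w)
  show ?case
  proof (induction w)
    case Nil then show ?case by (intro exI[of _ 1]) simp
  next
    case (Cons v w)
    then obtain P where P: "\<forall>z. poly P z = (\<Prod>v\<leftarrow>w. pair v (ptl p z q))"
      "Polynomial.degree P \<le> length w" "Polynomial.coeff P (length w) = (\<Prod>v\<leftarrow>w. pair v q)" by auto
    let ?Q = "[:pair v p, pair v q:] * P"
    have 1: "Polynomial.degree ?Q \<le> length (v # w)"
      using degree_mult_le[of "[:pair v p, pair v q:]" P] P(2) by (auto split: if_splits)
    have "Polynomial.coeff P (Suc (length w)) = 0" using P(2) by (intro coeff_eq_0) simp
    then have 2: "Polynomial.coeff ?Q (length (v # w)) = (\<Prod>v\<leftarrow>v # w. pair v q)"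
      using P(3) by simp
    show ?case
    proof (intro exI[of _ ?Q] conjI allI impI)
      show "poly ?Q z = (\<Prod>v\<leftarrow>v # w. pair v (ptl p z q))" for z
        using P(1) by (simp add: pair_ptl algebra_simps)
      show "Polynomial.degree ?Q \<le> nat (int (length (v # w)))" unfolding nat_int by (rule 1)
      show "Polynomial.coeff ?Q (nat (int (length (v # w)))) = (\<Prod>v\<leftarrow>v # w. pair v q)" unfolding nat_int by (rule 2)
    qed
  qed
next
  case (hp_add n f g)
  then obtain P Q where "\<forall>z. poly P z = f (ptl p z q)" "n \<ge> 0 \<longrightarrow> Polynomial.degree P \<le> nat n \<and> Polynomial.coeff P (nat n) = f q"
    "\<forall>z. poly Q z = g (ptl p z q)" "n \<ge> 0 \<longrightarrow> Polynomial.degree Q \<le> nat n \<and> Polynomial.coeff Q (nat n) = g q" by blast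
  then show ?case by (intro exI[of _ "P + Q"]) (auto intro: degree_add_le)
next
  case (hp_cmult n f z)
  then obtain P where "\<forall>z. poly P z = f (ptl p z q)" "n \<ge> 0 \<longrightarrow> Polynomial.degree P \<le> nat n \<and> Polynomial.coeff P (nat n) = f q" by blast
  then show ?case by (intro exI[of _ "Polynomial.smult z P"]) (auto intro: order_trans[OF degree_smult_le])
qed

lemma line_cancel:
  assumes "hp m f" "hp n g" "\<And>z. f (ptl p z q) * g (ptl p z q) = 0" "g (ptl p z1 q) \<noteq> 0"
  shows "f p = 0"
proof -
  obtain P Q where P: "\<forall>z. poly P z = f (ptl p z q)" and Q: "\<forall>z. poly Q z = g (ptl p z q)"
    using hp_line[OF assms(1)] hp_line[OF assms(2)] by meson
  then have "poly (P * Q) z = 0" for z using assms(3) by simp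
  then have "P * Q = 0" using poly_all_0_iff_0 by blast
  moreover have "Q \<noteq> 0" using Q assms(4) by auto
  ultimately have "P = 0" by simp
  then show ?thesis using P[rule_format, of 0] by simp
qed

lemma hp_cancel:
  assumes "hp m f" "hp n g" "\<And>p. f p * g p = 0" "g p1 \<noteq> 0"
  shows "f p = 0"
proof (rule line_cancel[OF assms(1,2)])
  show "f (ptl p z (\<lambda>b. p1 b - p b)) * g (ptl p z (\<lambda>b. p1 b - p b)) = 0" for z by (rule assms(3))
  show "g (ptl p 1 (\<lambda>b. p1 b - p b)) \<noteq> 0" using assms(4) by (simp add: ptl_def)
qed

text \<open>\<open>\<rho>\<close> projects points along \<open>p0\<close> onto the hyperplane where
  \<alpha> vanishes. The difference of \<open>f\<close> and its pullback along \<open>\<rho>\<close>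
  is divisible by \<alpha>, factor by factor, and the pullback is zero by hypothesis.\<close>

lemma hp_divide:
  assumes f: "hp n f" and \<alpha>: "\<alpha> \<noteq> 0" and van: "\<And>p. pair \<alpha> p = 0 \<Longrightarrow> f p = 0"
  shows "\<exists>q. hp (n - 1) q \<and> (\<forall>p. f p = pair \<alpha> p * q p)"
proof -
  obtain p0 where p0: "pair \<alpha> p0 \<noteq> 0" using pair_nonzero[OF \<alpha>] by blast
  define \<rho> where "\<rho> p = ptl p (- (pair \<alpha> p / pair \<alpha> p0)) p0" for p
  have pr: "pair v (\<rho> p) = pair (v - sc (pair v p0 / pair \<alpha> p0) \<alpha>) p" for v p
    by (simp add: \<rho>_def pair_ptl lin1_diff[OF pair_lin1] lin1_sc[OF pair_lin1])
  have "\<exists>q. hp (n - 1) q \<and> (\<forall>p. f p - f (\<rho> p) = pair \<alpha> p * q p)"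
    using f
  proof (induction rule: hp.induct)
    case (hp_zero n) then show ?case by (intro exI[of _ "\<lambda>p. 0"]) (auto intro: hp.hp_zero)
  next
    case (hp_prod w)
    show ?case
    proof (induction w)
      case Nil then show ?case by (intro exI[of _ "\<lambda>p. 0"]) (auto intro: hp.hp_zero)
    next
      case (Cons v w)
      then obtain q where q: "hp (int (length w) - 1) q"
        "\<And>p. (\<Prod>v\<leftarrow>w. pair v p) - (\<Prod>v\<leftarrow>w. pair v (\<rho> p)) = pair \<alpha> p * q p" by blast
      let ?c = "pair v p0 / pair \<alpha> p0"
      let ?q = "\<lambda>p. pair v p * q p + ?c * (\<Prod>v\<leftarrow>w. pair v (\<rho> p))"
      have "hp (int (length w)) (\<lambda>p. \<Prod>v\<leftarrow>w. pair v (\<rho> p))"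
        using hp.hp_prod[of "map (\<lambda>v. v - sc (pair v p0 / pair \<alpha> p0) \<alpha>) w"] by (simp add: pr comp_def)
      then have "hp (int (length (v # w)) - 1) ?q"
        using hp_mult[OF hp_pair[of v] q(1)] by (intro hp.hp_add hp.hp_cmult) simp_all
      moreover have "(\<Prod>v\<leftarrow>v # w. pair v p) - (\<Prod>v\<leftarrow>v # w. pair v (\<rho> p)) = pair \<alpha> p * ?q p" for p
      proof -
        have v: "pair v (\<rho> p) = pair v p - ?c * pair \<alpha> p"
          by (simp add: pr lin1_diff[OF pair_lin1] lin1_sc[OF pair_lin1])
        have "(\<Prod>v\<leftarrow>v # w. pair v p) - (\<Prod>v\<leftarrow>v # w. pair v (\<rho> p))
          = pair v p * ((\<Prod>v\<leftarrow>w. pair v p) - (\<Prod>v\<leftarrow>w. pair v (\<rho> p))) + ?c * pair \<alpha> p * (\<Prod>v\<leftarrow>w. pair v (\<rho> p))"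
          by (simp add: v algebra_simps)
        also have "\<dots> = pair \<alpha> p * ?q p" unfolding q(2) by (simp add: algebra_simps)
        finally show ?thesis .
      qed
      ultimately show ?case by blast
    qed
  next
    case (hp_add n f g)
    then obtain q r where qr: "hp (n - 1) q" "\<And>p. f p - f (\<rho> p) = pair \<alpha> p * q p"
      "hp (n - 1) r" "\<And>p. g p - g (\<rho> p) = pair \<alpha> p * r p" by blast
    have "f p + g p - (f (\<rho> p) + g (\<rho> p)) = pair \<alpha> p * (q p + r p)" for p
      unfolding distrib_left qr(2,4)[symmetric] by simp
    then show ?case using hp.hp_add[OF qr(1,3)] by blast
  next
    case (hp_cmult n f z)
    then obtain q where q: "hp (n - 1) q" "\<And>p. f p - f (\<rho> p) = pair \<alpha> p * q p" by blast
    have "z * f p - z * f (\<rho> p) = pair \<alpha> p * (z * q p)" for p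
      unfolding right_diff_distrib[symmetric] q(2) by simp
    then show ?case using hp.hp_cmult[OF q(1), of z] by blast
  qed
  moreover have "f (\<rho> p) = 0" for p
    by (rule van) (use p0 in \<open>simp add: \<rho>_def pair_ptl\<close>)
  ultimately show ?thesis by simp
qed

end

subsection \<open>Lifting invariant functions\<close>

context hecke_alg
begin

section \<open>Averaging over G and symbols of products with generators\<close>

abbreviation brk :: "'v sk \<Rightarrow> 'v \<Rightarrow> 'v sk" where "brk a v \<equiv> a * MM [v] id - MM [v] id * a"

definition comG :: "'v sk \<Rightarrow> bool" where "comG a \<longleftrightarrow> (\<forall>g\<in>G. MM [] g * a - a * MM [] g \<in> J)"

definition conj :: "('v \<Rightarrow> 'v) \<Rightarrow> 'v sk \<Rightarrow> 'v sk" where "conj g a = MM [] g * a * MM [] (giv g)"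

definition avg :: "'v sk \<Rightarrow> 'v sk" where "avg a = CC (1 / of_nat (card G)) * (\<Sum>g\<in>G. conj g a)"

lemma card_G: "of_nat (card G) \<noteq> (0::complex)" using finite_G id_G by (metis card_0_eq empty_iff of_nat_eq_0_iff)

lemma MM_giv: "g \<in> G \<Longrightarrow> MM [] g * MM [] (giv g) = 1" "g \<in> G \<Longrightarrow> MM [] (giv g) * MM [] g = 1"
  by (simp_all add: MM_mult inv_comp_G MM_one)

lemma F_conj: "a \<in> F n \<Longrightarrow> g \<in> G \<Longrightarrow> conj g a \<in> F n"
  using F_mult[OF F_mult[OF F_MM[of g "[]" 0]], of a n "MM [] (giv g)" 0] F_MM[of "giv g" "[]" 0] inv_G
  by (simp add: conj_def)

lemma giv_giv: "g \<in> G \<Longrightarrow> giv (giv g) = g" using bij_G inv_inv_eq by blast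

lemma sg_left_grp: "a \<in> F n \<Longrightarrow> g \<in> G \<Longrightarrow> sg n (MM [] g * a) h p = sg n a (giv g \<circ> h) (act g p)"
proof -
  assume a: "a \<in> F n" and g: "g \<in> G"
  have "sg (0 + n) (MM [] g * a) h p = (\<Sum>g'\<in>G. sg 0 (MM [] g) g' p * sg n a (giv g' \<circ> h) (act g' p))"
    by (rule sg_mult) (use a g F_MM in auto)
  also have "\<dots> = (\<Sum>g'\<in>G. if g' = g then sg n a (giv g \<circ> h) (act g p) else 0)"
    by (intro sum.cong) (auto simp: sg_MM)
  finally show ?thesis using g finite_G by simp
qed

lemma sg_right_word: "a \<in> F n \<Longrightarrow> g \<in> G \<Longrightarrow> h \<in> G \<Longrightarrow>
  sg (n + int (length w)) (a * MM w g) h p = sg n a (h \<circ> giv g) p * (\<Prod>v\<leftarrow>w. pair v (act (h \<circ> giv g) p))"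
proof -
  assume a: "a \<in> F n" and g: "g \<in> G" and h: "h \<in> G"
  have eq: "g = giv g' \<circ> h \<longleftrightarrow> g' = h \<circ> giv g" if g': "g' \<in> G" for g'
    using inv_comp_G[OF g'] inv_comp_G[OF g] by (metis comp_assoc comp_id id_comp)
  have "sg (n + int (length w)) (a * MM w g) h p
     = (\<Sum>g'\<in>G. sg n a g' p * sg (int (length w)) (MM w g) (giv g' \<circ> h) (act g' p))"
    by (rule sg_mult) (use a g F_MM in auto)
  also have "\<dots> = (\<Sum>g'\<in>G. if g' = h \<circ> giv g then sg n a (h \<circ> giv g) p * (\<Prod>v\<leftarrow>w. pair v (act (h \<circ> giv g) p)) else 0)"
    by (intro sum.cong) (auto simp: sg_MM eq)
  finally show ?thesis using comp_G[OF h inv_G[OF g]] finite_G by simp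
qed

lemma sg_right_grp: "a \<in> F n \<Longrightarrow> g \<in> G \<Longrightarrow> h \<in> G \<Longrightarrow> sg n (a * MM [] g) h p = sg n a (h \<circ> giv g) p"
  using sg_right_word[of a n g h "[]" p] by simp

lemma sg_left_vec: "a \<in> F n \<Longrightarrow> sg (n + 1) (MM [v] id * a) h p = pair v p * sg n a h p"
proof -
  assume a: "a \<in> F n"
  have "sg (1 + n) (MM [v] id * a) h p = (\<Sum>g'\<in>G. sg 1 (MM [v] id) g' p * sg n a (giv g' \<circ> h) (act g' p))"
    by (rule sg_mult) (use a F_MM in auto)
  also have "\<dots> = (\<Sum>g'\<in>G. if g' = id then pair v p * sg n a h p else 0)"
    by (intro sum.cong) (auto simp: sg_MM hp_act_id[OF sg_hp[OF a]])
  finally show ?thesis using finite_G by (simp add: add.commute)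
qed

lemma sg_right_vec: "a \<in> F n \<Longrightarrow> h \<in> G \<Longrightarrow> sg (n + 1) (a * MM [v] id) h p = sg n a h p * pair (h v) p"
  using sg_right_word[of a n id h "[v]" p] by (simp add: pair_act)

lemma sg_conj: "a \<in> F n \<Longrightarrow> g \<in> G \<Longrightarrow> h \<in> G \<Longrightarrow> sg n (conj g a) h p = sg n a (giv g \<circ> h \<circ> g) (act g p)"
proof -
  assume a: "a \<in> F n" and g: "g \<in> G" and h: "h \<in> G"
  have m: "MM [] g * a \<in> F n" using F_mult[OF F_MM[of g "[]" 0] a] g by simp
  show ?thesis unfolding conj_def sg_right_grp[OF m inv_G[OF g] h] sg_left_grp[OF a g] giv_giv[OF g]
    by (simp add: comp_assoc)
qed

lemma avg_F: "a \<in> F n \<Longrightarrow> avg a \<in> F n"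
  unfolding avg_def by (intro F_CC F_sum F_conj)

lemma sg_avg: "a \<in> F n \<Longrightarrow> h \<in> G \<Longrightarrow>
  sg n (avg a) h p = (\<Sum>g\<in>G. sg n a (giv g \<circ> h \<circ> g) (act g p)) / of_nat (card G)"
  by (simp add: avg_def sg_CC sg_sum sg_conj)

lemma left_bij: "g \<in> G \<Longrightarrow> bij_betw (\<lambda>s. g \<circ> s) G G"
  by (rule bij_betwI[where g = "\<lambda>s. giv g \<circ> s"])
    (auto intro: comp_G inv_G simp: inv_comp_G comp_assoc[symmetric] simp del: o_apply)

lemma MM_grp_mult: "MM [] g * (MM [] h * a) = MM [] (g \<circ> h) * a"
  by (simp add: mult.assoc[symmetric] MM_mult)

lemma avg_comG: "comG (avg a)"
  unfolding comG_def
proof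
  fix h assume h: "h \<in> G"
  have "MM [] h * conj g a = conj (h \<circ> g) a * MM [] h" if g: "g \<in> G" for g
  proof -
    have "giv (h \<circ> g) \<circ> h = giv g"
      using g h bij_G o_inv_distrib[of h g] inv_comp_G[OF h] by (metis comp_assoc comp_id)
    then show ?thesis by (simp add: conj_def mult.assoc MM_grp_mult) (simp add: MM_mult)
  qed
  then have "MM [] h * (\<Sum>g\<in>G. conj g a) = (\<Sum>g\<in>G. conj (h \<circ> g) a) * MM [] h"
    by (simp add: sum_distrib_left sum_distrib_right)
  also have "(\<Sum>g\<in>G. conj (h \<circ> g) a) = (\<Sum>g\<in>G. conj g a)"
    by (rule sum.reindex_bij_betw[OF left_bij[OF h]])
  finally have "MM [] h * avg a = avg a * MM [] h"
    by (simp add: avg_def MM_CC mult.assoc)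
  then show "MM [] h * avg a - avg a * MM [] h \<in> J" by simp
qed

lemma brk_avg: "brk (avg a) v = CC (1 / of_nat (card G)) * (\<Sum>g\<in>G. conj g (brk a (giv g v)))"
proof -
  have "brk (conj g a) v = conj g (brk a (giv g v))" if g: "g \<in> G" for g
  proof -
    have gv: "g (giv g v) = v" using bij_G[OF g] by (simp add: bij_is_surj surj_f_inv_f)
    have 1: "MM [] (giv g) * MM [v] id = MM [giv g v] id * MM [] (giv g)" by (simp add: MM_mult)
    have 2: "MM [v] id * MM [] g = MM [] g * MM [giv g v] id" by (simp add: MM_mult gv)
    have "conj g a * MM [v] id = MM [] g * (a * MM [giv g v] id) * MM [] (giv g)"
      using 1 by (simp add: conj_def mult.assoc)
    moreover have "MM [v] id * conj g a = MM [] g * (MM [giv g v] id * a) * MM [] (giv g)"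
      unfolding conj_def mult.assoc[symmetric] 2 ..
    ultimately show ?thesis by (simp add: conj_def left_diff_distrib right_diff_distrib)
  qed
  then have "(\<Sum>g\<in>G. conj g (brk a (giv g v))) = (\<Sum>g\<in>G. brk (conj g a) v)"
    by (intro sum.cong) simp_all
  then have "(\<Sum>g\<in>G. conj g (brk a (giv g v))) = brk (\<Sum>g\<in>G. conj g a) v"
    by (simp add: sum_distrib_left sum_distrib_right sum_subtractf)
  then show ?thesis by (simp add: avg_def MM_CC right_diff_distrib mult.assoc)
qed

lemma brk_avg_F: "(\<And>v. brk a v \<in> F n) \<Longrightarrow> brk (avg a) v \<in> F n"
  unfolding brk_avg by (intro F_CC F_sum F_conj)

lemma sg_brk_avg: "(\<And>v. brk a v \<in> F n) \<Longrightarrow> h \<in> G \<Longrightarrow> sg n (brk (avg a) v) h p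
  = (\<Sum>g\<in>G. sg n (brk a (giv g v)) (giv g \<circ> h \<circ> g) (act g p)) / of_nat (card G)"
  unfolding brk_avg by (simp add: sg_CC sg_sum sg_conj)

lemma hp_lift: "hp n f \<Longrightarrow> h \<in> G \<Longrightarrow> \<exists>a\<in>F n. \<forall>g p. sg n a g p = (if g = h then f p else 0)"
proof (induction rule: hp.induct)
  case (hp_zero n) then show ?case by (intro bexI[of _ 0]) (auto intro: J_F)
next
  case (hp_prod w) then show ?case by (intro bexI[of _ "MM w h"]) (auto simp: sg_MM intro: F_MM)
next
  case (hp_add n f g)
  then obtain a b where "a \<in> F n" "\<forall>g p. sg n a g p = (if g = h then f p else 0)"
    "b \<in> F n" "\<forall>g' p. sg n b g' p = (if g' = h then g p else 0)" by blast
  then show ?case by (intro bexI[of _ "a + b"]) (auto simp: sg_add intro: F_add)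
next
  case (hp_cmult n f z)
  then obtain a where "a \<in> F n" "\<forall>g p. sg n a g p = (if g = h then f p else 0)" by blast
  then show ?case by (intro bexI[of _ "CC z * a"]) (auto simp: sg_CC intro: F_CC)
qed

lemma com_vec_F: "brk (MM [u] id) v \<in> F 0"
  and sg_com_vec: "h \<in> G \<Longrightarrow> sg 0 (brk (MM [u] id) v) h p = \<kappa> h u v"
proof -
  have S: "(\<Sum>s\<in>G. CC (\<kappa> s u v) * MM [] s) \<in> F 0" by (intro F_sum F_CC F_MM) auto
  from F_add[OF J_F[OF J_com[of u v]] S] show 1: "brk (MM [u] id) v \<in> F 0" by simp
  assume h: "h \<in> G"
  have 1: "sg 0 (brk (MM [u] id) v) h p = sg 0 (\<Sum>s\<in>G. CC (\<kappa> s u v) * MM [] s) h p"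
    using sg_J[OF J_com[of u v], of 0 h p] unfolding sg_diff by (simp only: right_minus_eq)
  have 2: "sg 0 (\<Sum>s\<in>G. CC (\<kappa> s u v) * MM [] s) h p = (\<Sum>s\<in>G. if s = h then \<kappa> h u v else 0)"
    unfolding sg_sum sg_CC by (intro sum.cong) (auto simp: sg_MM)
  show "sg 0 (brk (MM [u] id) v) h p = \<kappa> h u v" unfolding 1 2 using h finite_G by (simp only: sum.delta if_True)
qed

lemma lin1_\<kappa>: "s \<in> G \<Longrightarrow> lin1 (\<lambda>u. \<kappa> s u v)" by (rule lin1_I) (auto simp: \<kappa>_add \<kappa>_sc)

text \<open>The Leibniz rule: the identity component of the leading symbol of [w, v] is the Poisson
  bracket defined by \<open>\<kappa> id\<close>, applied to the monomial of
  \<open>w\<close>.\<close>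

lemma brk_word:
  assumes e: "e = id"
  shows "MM w e * MM [v] e - MM [v] e * MM w e \<in> F (int (length w) - 1) \<and>
    (\<forall>p. sg (int (length w) - 1) (MM w e * MM [v] e - MM [v] e * MM w e) e p = \<kappa> e (grad (\<lambda>p. \<Prod>v\<leftarrow>w. pair v p) p) v)"
proof (induction w)
  case Nil
  have "grad (\<lambda>p. 1) p = 0" for p by (rule gradI) (rule has_grad_const)
  moreover have "\<kappa> e 0 v = 0" unfolding e by (rule lin1_0[OF lin1_\<kappa>[OF id_G]])
  moreover have "MM [] e = 1" unfolding e by (rule MM_one)
  ultimately show ?case by (simp add: J_F)
next
  case (Cons u w)
  note IH1 = conjunct1[OF Cons.IH] and IH2 = conjunct2[OF Cons.IH, rule_format]
  have eG: "e \<in> G" using e by simp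
  have eq: "MM (u # w) e * MM [v] e - MM [v] e * MM (u # w) e = MM [u] e * (MM w e * MM [v] e - MM [v] e * MM w e)
      + (MM [u] e * MM [v] e - MM [v] e * MM [u] e) * MM w e"
  proof -
    have "MM (u # w) e = MM [u] e * MM w e" by (simp add: MM_mult e)
    then show ?thesis by (simp only:) (simp add: algebra_simps)
  qed
  have c: "MM [u] e * MM [v] e - MM [v] e * MM [u] e \<in> F 0" unfolding e by (rule com_vec_F)
  have 1: "MM [u] e * (MM w e * MM [v] e - MM [v] e * MM w e) \<in> F (int (length w))"
    using F_mult[OF F_MM[OF eG, of "[u]" 1] IH1] by simp
  have 2: "(MM [u] e * MM [v] e - MM [v] e * MM [u] e) * MM w e \<in> F (int (length w))"
    using F_mult[OF c F_MM[OF eG, of w "int (length w)"]] by simp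
  have s1: "sg (int (length w)) (MM [u] e * (MM w e * MM [v] e - MM [v] e * MM w e)) e p
     = pair u p * \<kappa> e (grad (\<lambda>p. \<Prod>v\<leftarrow>w. pair v p) p) v" for p
    using sg_left_vec[OF IH1, of u e p, folded e] unfolding IH2 by simp
  have s2: "sg (int (length w)) ((MM [u] e * MM [v] e - MM [v] e * MM [u] e) * MM w e) e p = \<kappa> e u v * (\<Prod>v\<leftarrow>w. pair v p)" for p
    using sg_right_word[OF com_vec_F[of u v], of id id w p] unfolding e by (simp add: sg_com_vec pair_act)
  have l: "int (length (u # w)) - 1 = int (length w)" by simp
  show ?case
    unfolding eq l using F_add[OF 1 2]
    by (simp add: sg_add s1 s2 grad_Cons lin1_add[OF lin1_\<kappa>[OF eG]] lin1_sc[OF lin1_\<kappa>[OF eG]])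
qed

lemma hp_lift_brk: "hp m f \<Longrightarrow> \<exists>a\<in>F m. (\<forall>g p. sg m a g p = (if g = id then f p else 0))
  \<and> (\<forall>v. brk a v \<in> F (m - 1) \<and> (\<forall>p. sg (m - 1) (brk a v) id p = \<kappa> id (grad f p) v))"
proof (induction rule: hp.induct)
  case (hp_zero n)
  have z: "\<kappa> id 0 v = 0" for v by (rule lin1_0[OF lin1_\<kappa>[OF id_G]])
  show ?case
  proof (intro bexI[of _ 0] conjI allI)
    show "sg (n - 1) (brk 0 v) id p = \<kappa> id (grad (\<lambda>p. 0) p) v" for v p
      unfolding grad_zero z by simp
  qed (auto intro: J_F)
next
  case (hp_prod w)
  have "sg (int (length w)) (MM w id) g p = (if g = id then \<Prod>v\<leftarrow>w. pair v p else 0)" for g p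
    by (auto simp: sg_MM)
  then show ?case using brk_word[OF refl, of w] F_MM[OF id_G, of w "int (length w)"] by blast
next
  case (hp_add n f g)
  then obtain a b where a: "a \<in> F n" "\<forall>g p. sg n a g p = (if g = id then f p else 0)"
     "\<forall>v. brk a v \<in> F (n - 1) \<and> (\<forall>p. sg (n - 1) (brk a v) id p = \<kappa> id (grad f p) v)"
    and b: "b \<in> F n" "\<forall>g' p. sg n b g' p = (if g' = id then g p else 0)"
     "\<forall>v. brk b v \<in> F (n - 1) \<and> (\<forall>p. sg (n - 1) (brk b v) id p = \<kappa> id (grad g p) v)" by blast
  have eq: "brk (a + b) v = brk a v + brk b v" for v by (simp add: algebra_simps)
  show ?case
  proof (intro bexI[of _ "a + b"] conjI allI)
    show "sg n (a + b) g' p = (if g' = id then f p + g p else 0)" for g' p using a b by (simp add: sg_add)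
    show "brk (a + b) v \<in> F (n - 1)" for v unfolding eq using a b by (blast intro: F_add)
    show "sg (n - 1) (brk (a + b) v) id p = \<kappa> id (grad (\<lambda>p. f p + g p) p) v" for v p
      unfolding eq sg_add grad_add[OF hp_add.hyps] \<kappa>_add[OF id_G] using a b by simp
    show "a + b \<in> F n" using a b by (blast intro: F_add)
  qed
next
  case (hp_cmult n f z)
  then obtain a where a: "a \<in> F n" "\<forall>g p. sg n a g p = (if g = id then f p else 0)"
     "\<forall>v. brk a v \<in> F (n - 1) \<and> (\<forall>p. sg (n - 1) (brk a v) id p = \<kappa> id (grad f p) v)" by blast
  have eq: "brk (CC z * a) v = CC z * brk a v" for v by (simp add: MM_CC mult.assoc right_diff_distrib)
  show ?case
  proof (intro bexI[of _ "CC z * a"] conjI allI)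
    show "sg n (CC z * a) g' p = (if g' = id then z * f p else 0)" for g' p using a by (simp add: sg_CC)
    show "brk (CC z * a) v \<in> F (n - 1)" for v unfolding eq using a by (blast intro: F_CC)
    show "sg (n - 1) (brk (CC z * a) v) id p = \<kappa> id (grad (\<lambda>p. z * f p) p) v" for v p
      unfolding eq sg_CC grad_cmult[OF hp_cmult.hyps] \<kappa>_sc[OF id_G] using a by simp
    show "CC z * a \<in> F n" using a by (blast intro: F_CC)
  qed
qed

section \<open>Lifts of invariants that are central up to lower degree\<close>

definition Ginv :: "(('v \<Rightarrow> complex) \<Rightarrow> complex) \<Rightarrow> bool" where
  "Ginv f \<longleftrightarrow> (\<forall>g\<in>G. \<forall>p. f (act g p) = f p)"

text \<open>\<open>plift k m f P\<close>: the element \<open>P\<close> lifts the function \<open>f\<close> and is central up to terms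
  of degree \<open>k\<close> less than expected.\<close>

definition plift :: "int \<Rightarrow> int \<Rightarrow> (('v \<Rightarrow> complex) \<Rightarrow> complex) \<Rightarrow> 'v sk \<Rightarrow> bool" where
  "plift k m f P \<longleftrightarrow> P \<in> F m \<and> comG P \<and> (\<forall>h p. sg m P h p = (if h = id then f p else 0))
     \<and> (\<forall>v. brk P v \<in> F (m + 1 - k))"

text \<open>Beyond \<open>plift\<close>, the leading symbols of the commutators with vectors live at
  the identity only. \<open>D v\<close> is then a bracket {f, v} of degree -k.\<close>

definition good :: "int \<Rightarrow> int \<Rightarrow> (('v \<Rightarrow> complex) \<Rightarrow> complex) \<Rightarrow> 'v sk \<Rightarrow> ('v \<Rightarrow> ('v \<Rightarrow> complex) \<Rightarrow> complex) \<Rightarrow> bool" where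
  "good k m f P D \<longleftrightarrow> plift k m f P \<and> (\<forall>v h p. sg (m + 1 - k) (brk P v) h p = (if h = id then D v p else 0))"

lemma pliftD: assumes "plift k m f P"
  shows "P \<in> F m" "comG P" "brk P v \<in> F (m + 1 - k)" "sg m P h p = (if h = id then f p else 0)"
proof -
  note c = assms[unfolded plift_def]
  show "P \<in> F m" by (rule conjunct1[OF c])
  show "comG P" by (rule conjunct1[OF conjunct2[OF c]])
  show "brk P v \<in> F (m + 1 - k)" by (rule spec[OF conjunct2[OF conjunct2[OF conjunct2[OF c]]]])
  show "sg m P h p = (if h = id then f p else 0)"
    by (rule spec[OF spec[OF conjunct1[OF conjunct2[OF conjunct2[OF c]]]]])
qed

lemma goodD: assumes "good k m f P D"
  shows "P \<in> F m" "comG P" "brk P v \<in> F (m + 1 - k)"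
    "sg (m + 1 - k) (brk P v) h p = (if h = id then D v p else 0)"
    "sg m P h p = (if h = id then f p else 0)"
proof -
  note c = assms[unfolded good_def]
  show "sg (m + 1 - k) (brk P v) h p = (if h = id then D v p else 0)"
    by (rule spec[OF spec[OF spec[OF conjunct2[OF c]]]])
qed (fact pliftD[OF conjunct1[OF assms[unfolded good_def]]])+

lemma conj_id: "g \<in> G \<Longrightarrow> giv g \<circ> h \<circ> g = id \<longleftrightarrow> h = id"
  using inv_comp_G by (metis comp_assoc comp_id id_comp)

text \<open>The start of all corrections: k = 2 because a commutator of two vectors has degree 0
  instead of 2. Averaging keeps the symbol since \<open>f\<close> is invariant, and keeps the
  bracket since \<open>\<kappa> id\<close> and the gradient of \<open>f\<close> are
  equivariant.\<close>

lemma plift2: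
  assumes f: "hp m f" and inv: "Ginv f"
  shows "\<exists>P. plift 2 m f P \<and> (\<forall>v p. sg (m - 1) (brk P v) id p = \<kappa> id (grad f p) v)"
proof -
  obtain a where a: "a \<in> F m" "\<And>g p. sg m a g p = (if g = id then f p else 0)"
    "\<And>v. brk a v \<in> F (m - 1)" "\<And>v p. sg (m - 1) (brk a v) id p = \<kappa> id (grad f p) v"
    using hp_lift_brk[OF f] by blast
  have fi: "f (act g p) = f p" if "g \<in> G" for g p using inv that by (auto simp: Ginv_def)
  have "sg m (avg a) h p = (if h = id then f p else 0)" for h p
  proof (cases "h \<in> G")
    case True
    have "sg m (avg a) h p = (\<Sum>g\<in>G. if h = id then f p else 0) / of_nat (card G)"
      unfolding sg_avg[OF a(1) True] a(2) by (intro arg_cong2[of _ _ _ _ "(/)"] sum.cong) (auto simp: conj_id fi)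
    then show ?thesis using card_G by simp
  next
    case False then show ?thesis using sg_notG[OF avg_F[OF a(1)]] by auto
  qed
  moreover have "sg (m - 1) (brk (avg a) v) id p = \<kappa> id (grad f p) v" for v p
  proof -
    have "\<kappa> id (grad f (act g p)) (giv g v) = \<kappa> id (grad f p) v" if g: "g \<in> G" for g
    proof -
      have "grad (\<lambda>p. f (act g p)) p = g (grad f (act g p))"
        by (intro gradI has_grad_act g hp_has_grad[OF f])
      then have "grad f p = g (grad f (act g p))" using fi[OF g] by simp
      moreover have "v = g (giv g v)" using bij_G[OF g] by (simp add: bij_is_surj surj_f_inv_f)
      moreover have "\<kappa> (g \<circ> id \<circ> giv g) (g (grad f (act g p))) (g (giv g v)) = \<kappa> id (grad f (act g p)) (giv g v)"
        by (rule \<kappa>_equiv[OF id_G g])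
      ultimately show ?thesis using inv_comp_G[OF g] by simp
    qed
    then have "sg (m - 1) (brk (avg a) v) id p = (\<Sum>g\<in>G. \<kappa> id (grad f p) v) / of_nat (card G)"
      unfolding sg_brk_avg[OF a(3) id_G] by (intro arg_cong2[of _ _ _ _ "(/)"] sum.cong) (auto simp: inv_comp_G a(4))
    then show ?thesis using card_G by simp
  qed
  ultimately show ?thesis unfolding plift_def using avg_F[OF a(1)] avg_comG brk_avg_F[OF a(3)]
    by (intro exI[of _ "avg a"]) simp
qed

lemma brk_add: "brk (a + b) v = brk a v + brk b v" by (simp add: algebra_simps)

section \<open>Commutator components away from the identity\<close>

lemma brk_J_lin: "P \<in> FG \<Longrightarrow> brk P (sc z u + v) - (CC z * brk P u + brk P v) \<in> J"
proof -
  assume P: "P \<in> FG"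
  let ?r = "MM [sc z u + v] id - (CC z * MM [u] id + MM [v] id)"
  have "brk P (sc z u + v) - (CC z * brk P u + brk P v) = P * ?r - ?r * P"
    by (simp add: algebra_simps CC_move)
  then show ?thesis using J_left[OF P J_lin] J_right[OF P J_lin] J_diff by metis
qed

lemma sg_brk_lin1: "P \<in> FG \<Longrightarrow> lin1 (\<lambda>v. sg n (brk P v) h p)"
  unfolding lin1_def
proof (intro allI)
  fix z u v assume "P \<in> FG"
  from sg_J[OF brk_J_lin[OF this, of z u v], of n h p]
  show "sg n (brk P (sc z u + v)) h p = z * sg n (brk P u) h p + sg n (brk P v) h p"
    by (simp only: sg_diff sg_add sg_CC) simp
qed

text \<open>Modulo \<open>J\<close>, [v, w] lies in the group algebra and so commutes with
  \<open>P\<close>; the Jacobi identity gives [[P, v], w] = [[P, w], v]. At the component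
  \<open>h\<close>, a commutator with \<open>w\<close> multiplies the symbol by
  \<open>h w - w\<close>.\<close>

lemma sg_brk_relation:
  assumes P: "P \<in> F m" "comG P" and b: "\<And>v. brk P v \<in> F n" and h: "h \<in> G"
  shows "sg n (brk P v) h p * pair (w - h w) p = sg n (brk P w) h p * pair (v - h v) p"
proof -
  have "P * brk (MM [v] id) w - brk (MM [v] id) w * P \<in> J"
  proof -
    let ?S = "\<Sum>s\<in>G. CC (\<kappa> s v w) * MM [] s"
    let ?r = "brk (MM [v] id) w - ?S"
    have "P * ?r - ?r * P \<in> J" 
      using J_diff[OF J_left[OF F_FG[OF P(1)] J_com] J_right[OF F_FG[OF P(1)] J_com]] .
    moreover have "?S * P - P * ?S \<in> J"
    proof -
      have "?S * P - P * ?S = (\<Sum>s\<in>G. CC (\<kappa> s v w) * (MM [] s * P - P * MM [] s))"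
        by (simp add: sum_distrib_left sum_distrib_right sum_subtractf right_diff_distrib mult.assoc CC_move)
      then show ?thesis using P(2) by (auto simp: comG_def intro!: J_sum J_CC)
    qed
    ultimately have "(P * ?r - ?r * P) - (?S * P - P * ?S) \<in> J" by (rule J_diff)
    then show ?thesis by (simp add: left_diff_distrib right_diff_distrib)
  qed
  moreover have "P * brk (MM [v] id) w - brk (MM [v] id) w * P = brk (brk P v) w - brk (brk P w) v"
    by (simp add: algebra_simps)
  ultimately have "sg (n + 1) (brk (brk P v) w - brk (brk P w) v) h p = 0" using sg_J by metis
  then show ?thesis
    unfolding sg_diff sg_right_vec[OF b h] sg_left_vec[OF b] lin1_diff[OF pair_lin1]
    by (simp add: algebra_simps)
qed

lemma sg_brk_equiv:
  assumes P: "P \<in> FG" "comG P" and b: "\<And>v. brk P v \<in> F n" and g: "g \<in> G" and h: "h \<in> G"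
  shows "sg n (brk P v) h p = sg n (brk P (giv g v)) (giv g \<circ> h \<circ> g) (act g p)"
proof -
  have gv: "g (giv g v) = v" using bij_G[OF g] by (simp add: bij_is_surj surj_f_inv_f)
  let ?g = "MM [] g" and ?i = "MM [] (giv g)" and ?v = "MM [v] id"
  have c: "?g * P - P * ?g \<in> J" using P(2) g by (auto simp: comG_def)
  have eq: "conj g (brk P (giv g v)) - brk P v = (?g * P - P * ?g) * ?i * ?v - ?v * ((?g * P - P * ?g) * ?i)"
  proof -
    have 1: "MM [giv g v] id * ?i = ?i * ?v" by (simp add: MM_mult)
    have 2: "?g * MM [giv g v] id = ?v * ?g" by (simp add: MM_mult gv)
    have 3: "P * ?g * ?i = P" using MM_giv[OF g] by (simp add: mult.assoc)
    have "conj g (brk P (giv g v)) = ?g * P * (MM [giv g v] id * ?i) - (?g * MM [giv g v] id) * P * ?i"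
      by (simp add: conj_def left_diff_distrib right_diff_distrib mult.assoc)
    also have "\<dots> = ?g * P * ?i * ?v - ?v * (?g * P * ?i)" unfolding 1 2 by (simp add: mult.assoc)
    finally show ?thesis using 3 by (simp add: left_diff_distrib right_diff_distrib)
  qed
  have c': "(?g * P - P * ?g) * ?i \<in> J" using g by (intro J_right[OF FG_MM c] inv_G)
  have "conj g (brk P (giv g v)) - brk P v \<in> J" unfolding eq
    by (rule J_diff[OF J_right[OF FG_MM[OF id_G] c'] J_left[OF FG_MM[OF id_G] c']])
  then have "sg n (conj g (brk P (giv g v))) h p = sg n (brk P v) h p"
    using sg_J[of _ n h p] by (metis eq_iff_diff_eq_0 sg_diff)
  then show ?thesis by (simp add: sg_conj[OF b g h])
qed

text \<open>With l_v = v - h v, the relation d_v l_w = d_w l_v says that d_v / l_v does not depend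
  on \<open>v\<close>; the point is that this quotient is a polynomial. If two of the l_v are
  independent, they are coprime. If \<open>h\<close> moves vectors along a single line, the relation
  says nothing on its mirror, and equivariance under \<open>h\<close> itself is used.\<close>

lemma symbol_divisible:
  assumes P: "P \<in> F m" "comG P" and b: "\<And>v. brk P v \<in> F n" and h: "h \<in> G" "h \<noteq> id"
  shows "\<exists>q. hp (n - 1) q \<and> (\<forall>v p. sg n (brk P v) h p = q p * pair (v - h v) p)"
proof -
  let ?d = "\<lambda>v p. sg n (brk P v) h p"
  let ?l = "\<lambda>v. v - h v"
  have hd: "hp n (?d v)" for v by (rule sg_hp[OF b])
  have rel: "?d v p * pair (?l w) p = ?d w p * pair (?l v) p" for v w p
    by (rule sg_brk_relation[OF P b h(1)])
  have dl: "lin1 (\<lambda>v. ?d v p)" for p by (rule sg_brk_lin1[OF F_FG[OF P(1)]])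
  \<comment> \<open>One nonzero form is enough: the quotient found for \<open>v0\<close> serves
    every \<open>v\<close> by the relation.\<close>
  have fin: "\<exists>q. hp (n - 1) q \<and> (\<forall>v p. ?d v p = q p * pair (?l v) p)"
    if nz: "?l v0 \<noteq> 0" and van: "\<And>p. pair (?l v0) p = 0 \<Longrightarrow> ?d v0 p = 0" for v0
  proof -
    obtain q where q: "hp (n - 1) q" "\<And>p. ?d v0 p = pair (?l v0) p * q p"
      using hp_divide[OF hd nz van] by blast
    obtain p1 where p1: "pair (?l v0) p1 \<noteq> 0" using pair_nonzero[OF nz] by blast
    have "?d v p = q p * pair (?l v) p" for v p
    proof -
      have hq: "hp n (\<lambda>p. q p * pair (?l v) p)" using hp_mult[OF q(1) hp_pair] by simp
      have "(\<lambda>p. ?d v p - q p * pair (?l v) p) p = 0"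
      proof (rule hp_cancel[OF hp_diff[OF hd hq] hp_pair _ p1])
        fix p
        show "(?d v p - q p * pair (?l v) p) * pair (?l v0) p = 0"
          using rel[of v p v0] q(2)[of p] by (simp add: algebra_simps)
      qed
      then show ?thesis by simp
    qed
    then show ?thesis using q(1) by blast
  qed
  obtain v0 where v0: "?l v0 \<noteq> 0" using h(2) by (metis eq_id_iff eq_iff_diff_eq_0)
  show ?thesis
  proof (cases "\<exists>w. \<forall>z. ?l w \<noteq> sc z (?l v0)")
    case True
    then obtain w where w: "\<And>z. ?l w \<noteq> sc z (?l v0)" by blast
    obtain p1 where p1: "pair (?l v0) p1 = 0" "pair (?l w) p1 \<noteq> 0" using pair_independent[OF v0 w] by blast
    show ?thesis
    proof (rule fin[OF v0])
      fix p assume p: "pair (?l v0) p = 0"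
      show "?d v0 p = 0"
      proof (cases "pair (?l w) p = 0")
        \<comment> \<open>Where both forms vanish, the point is moved along \<open>p1\<close>, which
          stays in the first hyperplane and leaves the second.\<close>
        case True
        show ?thesis
        proof (rule line_cancel[OF hd hp_pair, of _ _ p1])
          show "?d v0 (ptl p z p1) * pair (?l w) (ptl p z p1) = 0" for z
            using rel[of v0 "ptl p z p1" w] p p1(1) by (simp add: pair_ptl)
          show "pair (?l w) (ptl p 1 p1) \<noteq> 0" using p1(2) True by (simp add: pair_ptl)
        qed
      next
        case False then show ?thesis using rel[of v0 p w] p by simp
      qed
    qed
  next
    case False
    define \<alpha> where "\<alpha> = ?l v0"
    have \<alpha>: "\<alpha> \<noteq> 0" using v0 by (simp add: \<alpha>_def)
    obtain c where c: "\<And>v. ?l v = sc (c v) \<alpha>" using False unfolding \<alpha>_def by metis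
    have c1: "c v0 = 1" using c[of v0] \<alpha> by (metis \<alpha>_def scale_cancel_right scale_one)
    have hv: "h v = v - sc (c v) \<alpha>" for v using c[of v] by (simp add: algebra_simps)
    have dv: "?d v p = c v * ?d v0 p" for v p
    proof -
      obtain p1 where p1: "pair \<alpha> p1 \<noteq> 0" using pair_nonzero[OF \<alpha>] by blast
      have "(\<lambda>p. ?d v p - c v * ?d v0 p) p = 0"
      proof (rule hp_cancel[OF hp_diff[OF hd hp_cmult[OF hd]] hp_pair _ p1])
        fix p show "(?d v p - c v * ?d v0 p) * pair \<alpha> p = 0"
          using rel[of v p v0] unfolding c lin1_sc[OF pair_lin1] c1 by (simp add: algebra_simps)
      qed
      then show ?thesis by simp
    qed
    \<comment> \<open>Otherwise \<open>h\<close> would be a transvection, whose powers are pairwise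
      distinct.\<close>
    have c\<alpha>: "c \<alpha> \<noteq> 0"
    proof
      assume "c \<alpha> = 0"
      then have ha: "h \<alpha> = \<alpha>" using hv[of \<alpha>] by simp
      have pow: "(h ^^ n) v0 = v0 - sc (of_nat n) \<alpha>" for n
      proof (induction n)
        case (Suc n)
        have "h (v0 - sc (of_nat n) \<alpha>) = h v0 - sc (of_nat n) (h \<alpha>)"
          using G_add[OF h(1), of "v0 - sc (of_nat n) \<alpha>" "sc (of_nat n) \<alpha>"] G_sc[OF h(1)] by simp
        have "(h ^^ Suc n) v0 = h v0 - sc (of_nat n) \<alpha>"
          using \<open>h (v0 - sc (of_nat n) \<alpha>) = h v0 - sc (of_nat n) (h \<alpha>)\<close> Suc ha by simp
        then show ?case using hv[of v0] c1 by (simp add: algebra_simps)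
      qed simp
      have "inj (\<lambda>n. h ^^ n)"
      proof (rule injI)
        fix i j assume "h ^^ i = h ^^ j"
        then have "sc (of_nat i) \<alpha> = sc (of_nat j) \<alpha>" using pow by (metis diff_left_imp_eq)
        then show "i = j" using \<alpha> by simp
      qed
      moreover have "range (\<lambda>n. h ^^ n) \<subseteq> G"
      proof -
        have "h ^^ n \<in> G" for n
        proof (induction n)
          case (Suc n) show ?case unfolding funpow.simps(2) by (rule comp_G[OF h(1) Suc])
        qed (simp only: funpow.simps(1) id_G)
        then show ?thesis by blast
      qed
      ultimately show False using finite_G finite_subset range_inj_infinite by blast
    qed
    \<comment> \<open>On the mirror \<open>h\<close> fixes the point, so equivariance equates the
      symbols for \<open>h v0\<close> and \<open>v0\<close>; linearity in the vector makes them
      differ by the factor 1 - c(\<alpha>).\<close>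
    show ?thesis
    proof (rule fin[OF v0])
      fix p assume p: "pair (?l v0) p = 0"
      have "pair v (act h p) = pair v p" for v
        unfolding pair_act[OF h(1)] hv[of v] lin1_diff[OF pair_lin1] lin1_sc[OF pair_lin1]
        using p by (simp add: \<alpha>_def[symmetric])
      then have "?d v0 (act h p) = ?d v0 p" by (rule hp_cong_pair[OF hd])
      moreover have "giv h (h v0) = v0" using bij_G[OF h(1)] by (simp add: bij_is_inj)
      then have "?d (h v0) p = ?d v0 (act h p)"
        using sg_brk_equiv[OF F_FG[OF P(1)] P(2) b h(1) h(1), of "h v0" p] inv_comp_G[OF h(1)] by simp
      moreover have "?d (h v0) p = ?d v0 p - c \<alpha> * ?d v0 p"
        unfolding hv[of v0] lin1_diff[OF dl] lin1_sc[OF dl] c1 using dv[of \<alpha> p] by simp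
      ultimately show "?d v0 p = 0" using c\<alpha> by simp
    qed
  qed
qed

end

context hecke_alg
begin

text \<open>An element with symbol \<open>q\<close> at \<open>h\<close> has commutators with symbol
  \<open>- q * (v - h v)\<close> there. Adding such elements of degree m - k < m cancels the
  components at \<open>h \<noteq> id\<close> and changes neither the symbol \<open>f\<close> nor the
  identity component; averaging restores commutation with G.\<close>

theorem plift_good:
  assumes P: "plift k m f P" and k: "k \<ge> 1"
  shows "\<exists>P'. good k m f P' (\<lambda>v p. sg (m + 1 - k) (brk P v) id p)"
proof -
  let ?n = "m + 1 - k"
  have PF: "P \<in> F m" "comG P" "\<And>v. brk P v \<in> F ?n" "\<And>h p. sg m P h p = (if h = id then f p else 0)"
    by (fact pliftD[OF P])+
  have "\<forall>h\<in>G - {id}. \<exists>a\<in>F (m - k). (\<forall>g p. g \<noteq> h \<longrightarrow> sg (m - k) a g p = 0) \<and>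
      (\<forall>v p. sg ?n (brk P v) h p = sg (m - k) a h p * pair (v - h v) p)"
  proof
    fix h assume h: "h \<in> G - {id}"
    obtain q where q: "hp (?n - 1) q" "\<forall>v p. sg ?n (brk P v) h p = q p * pair (v - h v) p"
      using symbol_divisible[OF PF(1-3), of h] h by blast
    then obtain a where "a \<in> F (m - k)" "\<forall>g p. sg (m - k) a g p = (if g = h then q p else 0)"
      using hp_lift[of "m - k" q h] h by auto
    then show "\<exists>a\<in>F (m - k). (\<forall>g p. g \<noteq> h \<longrightarrow> sg (m - k) a g p = 0) \<and>
      (\<forall>v p. sg ?n (brk P v) h p = sg (m - k) a h p * pair (v - h v) p)"
      using q(2) by (intro bexI[of _ a]) auto
  qed
  then obtain A where A: "\<And>h. h \<in> G - {id} \<Longrightarrow> A h \<in> F (m - k)"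
    "\<And>h g p. h \<in> G - {id} \<Longrightarrow> g \<noteq> h \<Longrightarrow> sg (m - k) (A h) g p = 0"
    "\<And>h v p. h \<in> G - {id} \<Longrightarrow> sg ?n (brk P v) h p = sg (m - k) (A h) h p * pair (v - h v) p"
    by metis
  define Q where "Q = (\<Sum>h\<in>G - {id}. A h)"
  have QF: "Q \<in> F (m - k)" unfolding Q_def by (intro F_sum A(1))
  have sQ: "sg (m - k) Q h p = (if h \<in> G - {id} then sg (m - k) (A h) h p else 0)" for h p
  proof -
    have "sg (m - k) Q h p = (\<Sum>h'\<in>G - {id}. if h' = h then sg (m - k) (A h) h p else 0)"
      unfolding Q_def sg_sum using A(2) by (intro sum.cong) auto
    then show ?thesis using finite_G by simp
  qed
  have n: "m - k + 1 = ?n" by simp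
  have bQ: "brk Q v \<in> F ?n" for v
  proof -
    have "MM [v] id \<in> F 1" by (rule F_MM) auto
    from F_diff[OF F_mult[OF QF this] F_mult[OF this QF, unfolded add.commute[of 1]]] show ?thesis
      unfolding n .
  qed
  have sbQ: "sg ?n (brk Q v) h p = (if h = id then 0 else - sg ?n (brk P v) h p)" if h: "h \<in> G" for v h p
  proof -
    have "sg ?n (brk Q v) h p = - (sg (m - k) Q h p * pair (v - h v) p)"
      unfolding n[symmetric] sg_diff sg_right_vec[OF QF h] sg_left_vec[OF QF] lin1_diff[OF pair_lin1]
      by (simp add: algebra_simps)
    then show ?thesis using h A(3)[of h v p] by (simp add: sQ)
  qed
  have savg: "sg ?n (brk (avg Q) v) h p = (if h = id then 0 else - sg ?n (brk P v) h p)" if h: "h \<in> G" for v h p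
  proof -
    have "sg ?n (brk (avg Q) v) h p = (\<Sum>g\<in>G. if h = id then 0 else - sg ?n (brk P v) h p) / of_nat (card G)"
      unfolding sg_brk_avg[OF bQ h]
    proof (intro arg_cong2[of _ _ _ _ "(/)"] sum.cong refl)
      fix g assume g: "g \<in> G"
      have "giv g \<circ> h \<circ> g \<in> G" using g h by (intro comp_G inv_G)
      then show "sg ?n (brk Q (giv g v)) (giv g \<circ> h \<circ> g) (act g p) = (if h = id then 0 else - sg ?n (brk P v) h p)"
        using sg_brk_equiv[OF F_FG[OF PF(1)] PF(2,3) g h, of v p] conj_id[OF g, of h]
        by (simp add: sbQ)
    qed
    then show ?thesis using card_G by simp
  qed
  have "good k m f (P + avg Q) (\<lambda>v p. sg ?n (brk P v) id p)"
    unfolding good_def plift_def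
  proof (intro conjI allI)
    have aF: "avg Q \<in> F (m - k)" by (rule avg_F[OF QF])
    show "P + avg Q \<in> F m" using PF(1) F_mono[OF aF, of m] k by (intro F_add) auto
    show "comG (P + avg Q)" using PF(2) avg_comG[of Q] unfolding comG_def
      by (auto simp: distrib_left distrib_right add_diff_add intro: J_add)
    show "sg m (P + avg Q) h p = (if h = id then f p else 0)" for h p
      using PF(4) sg_low[OF aF, of m h p] k by (simp add: sg_add)
    show bb: "brk (P + avg Q) v \<in> F ?n" for v
      unfolding brk_add by (intro F_add PF(3) brk_avg_F bQ)
    show "sg ?n (brk (P + avg Q) v) h p = (if h = id then sg ?n (brk P v) id p else 0)" for v h p
    proof (cases "h \<in> G")
      case True then show ?thesis unfolding brk_add sg_add savg[OF True] by simp
    next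
      case False then show ?thesis using sg_notG[OF bb False] by auto
    qed
  qed
  then show ?thesis by blast
qed

subsection \<open>Commutators with good lifts\<close>

text \<open>[P, -] is a derivation. It leaves the group part alone, since \<open>P\<close> commutes
  with G and its commutators with vectors have leading symbols at the identity; on functions it is
  \<open>D\<close> applied to the gradient.\<close>

theorem good_commutator:
  assumes P: "good k m f P D" and x: "x \<in> F n"
  shows "P * x - x * P \<in> F (m + n - k) \<and> (\<forall>h p. sg (m + n - k) (P * x - x * P) h p = D (grad (sg n x h) p) p)"
proof -
  have PF: "P \<in> F m" "comG P" "\<And>v. brk P v \<in> F (m + 1 - k)"
    "\<And>v h p. sg (m + 1 - k) (brk P v) h p = (if h = id then D v p else 0)"
    by (fact goodD[OF P])+
  have D1: "lin1 (\<lambda>v. D v p)" for p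
    using sg_brk_lin1[OF F_FG[OF PF(1)], of "m + 1 - k" id p] by (simp add: PF(4))
  have word: "P * MM w g - MM w g * P \<in> F (m + int (length w) - k) \<and>
     (\<forall>h p. sg (m + int (length w) - k) (P * MM w g - MM w g * P) h p
       = (if g = h then D (grad (\<lambda>p. \<Prod>v\<leftarrow>w. pair v p) p) p else 0))" if g: "g \<in> G" for w g
  proof (induction w)
    case Nil
    have "MM [] g * P - P * MM [] g \<in> J" using PF(2) g by (auto simp: comG_def)
    from J_uminus[OF this] have "P * MM [] g - MM [] g * P \<in> J" by simp
    moreover have "grad (\<lambda>p. 1) p = 0" for p by (rule gradI) (rule has_grad_const)
    ultimately show ?case using lin1_0[OF D1] by (simp add: J_F sg_J)
  next
    case (Cons v w)
    have eq: "P * MM (v # w) g - MM (v # w) g * P = brk P v * MM w g + MM [v] id * (P * MM w g - MM w g * P)"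
    proof -
      have "MM (v # w) g = MM [v] id * MM w g" by (simp add: MM_mult)
      then show ?thesis by (simp only:) (simp add: algebra_simps)
    qed
    have n: "m + 1 - k + int (length w) = m + int (length (v # w)) - k"
      "m + int (length w) - k + 1 = m + int (length (v # w)) - k" by simp_all
    have 1: "brk P v * MM w g \<in> F (m + int (length (v # w)) - k)"
      using F_mult[OF PF(3)[of v] F_MM[OF g, of w "int (length w)"]] unfolding n by simp
    have 2: "MM [v] id * (P * MM w g - MM w g * P) \<in> F (m + int (length (v # w)) - k)"
      using F_mult[OF F_MM[of id "[v]" 1] conjunct1[OF Cons.IH]] unfolding n(2)[symmetric] by (simp add: add.commute)
    have s2: "sg (m + int (length (v # w)) - k) (MM [v] id * (P * MM w g - MM w g * P)) h p
       = pair v p * (if g = h then D (grad (\<lambda>p. \<Prod>v\<leftarrow>w. pair v p) p) p else 0)" for h p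
      using sg_left_vec[OF conjunct1[OF Cons.IH], of v h p] Cons.IH unfolding n by simp
    have s1: "sg (m + int (length (v # w)) - k) (brk P v * MM w g) h p
       = (if g = h then D v p * (\<Prod>v\<leftarrow>w. pair v p) else 0)" for h p
    proof (cases "h \<in> G")
      case True
      have hg: "h \<circ> giv g = id \<longleftrightarrow> g = h"
        using inv_comp_G[OF g] by (metis comp_assoc comp_id id_comp)
      show ?thesis using sg_right_word[OF PF(3)[of v] g True, of w p] unfolding n PF(4) hg
        by (auto simp: hg inv_comp_G[OF g] inv_comp_G[OF True] pair_act)
    next
      case False then show ?thesis using sg_notG[OF 1 False] g by auto
    qed
    show ?case unfolding eq
    proof (intro conjI allI)
      fix h p
      show "sg (m + int (length (v # w)) - k) (brk P v * MM w g + MM [v] id * (P * MM w g - MM w g * P)) h p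
        = (if g = h then D (grad (\<lambda>p. \<Prod>v\<leftarrow>v # w. pair v p) p) p else 0)"
        unfolding sg_add s1 s2 by (simp add: grad_Cons lin1_add[OF D1] lin1_sc[OF D1])
    qed (rule F_add[OF 1 2])
  qed
  show ?thesis using x
  proof (induction rule: F_induct)
    case (J b)
    then have "P * b - b * P \<in> J" using F_FG[OF PF(1)] by (intro J_diff J_left J_right)
    moreover have "sg n b h = (\<lambda>p. 0)" for h using J by (simp add: fun_eq_iff sg_J)
    ultimately show ?case using lin1_0[OF D1] by (simp add: J_F sg_J grad_zero)
  next
    case (add x y)
    have eq: "P * (x + y) - (x + y) * P = (P * x - x * P) + (P * y - y * P)" by (simp add: algebra_simps)
    have "sg n (x + y) h = (\<lambda>p. sg n x h p + sg n y h p)" for h by (simp add: fun_eq_iff sg_add)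
    then show ?case unfolding eq using add F_add
      by (auto simp: sg_add grad_add[OF sg_hp sg_hp] lin1_add[OF D1])
  next
    case (MM z w g)
    have eq: "P * (CC z * MM w g) - CC z * MM w g * P = CC z * (P * MM w g - MM w g * P)"
      by (simp add: CC_move right_diff_distrib mult.assoc)
    show ?case
    proof (cases "int (length w) = n")
      case True
      have "sg n (CC z * MM w g) h = (\<lambda>p. z * (if g = h then \<Prod>v\<leftarrow>w. pair v p else 0))" for h
        using True by (simp add: fun_eq_iff sg_CC sg_MM)
      then have G1: "D (grad (sg n (CC z * MM w g) h) p) p = z * (if g = h then D (grad (\<lambda>p. \<Prod>v\<leftarrow>w. pair v p) p) p else 0)" for h p
        using grad_cmult[OF hp_prod[of w], of z p] lin1_sc[OF D1] lin1_0[OF D1] by (cases "g = h") (auto simp: grad_zero)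
      show ?thesis unfolding eq G1 unfolding sg_CC
        using word[OF MM(1), of w] True F_CC[of "P * MM w g - MM w g * P" "m + n - k" z] by simp
    next
      case False
      then have l: "int (length w) < n" using MM(2) by simp
      have "sg n (CC z * MM w g) h = (\<lambda>p. 0)" for h using l by (simp add: fun_eq_iff sg_CC sg_MM)
      moreover have *: "P * MM w g - MM w g * P \<in> F (m + int (length w) - k)" using word[OF MM(1), of w] by blast
      ultimately show ?thesis unfolding eq
        using sg_low[OF *, of "m + n - k"] F_mono[OF *, of "m + n - k"] l lin1_0[OF D1]
        by (simp add: F_CC sg_CC grad_zero)
    qed
  qed
qed

lemma good_D: assumes "good k m f P D" shows "hp (m + 1 - k) (D v)" "lin1 (\<lambda>v. D v p)"
proof -
  have PF: "P \<in> F m" "\<And>v. brk P v \<in> F (m + 1 - k)"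
    "\<And>v h p. sg (m + 1 - k) (brk P v) h p = (if h = id then D v p else 0)"
    by (fact goodD[OF assms])+
  show "lin1 (\<lambda>v. D v p)"
    using sg_brk_lin1[OF F_FG[OF PF(1)], of "m + 1 - k" id p] by (simp add: PF(3))
  have "sg (m + 1 - k) (brk P v) id = D v" by (simp add: PF(3) fun_eq_iff)
  then show "hp (m + 1 - k) (D v)" using sg_hp[OF PF(2)] by metis
qed

text \<open>Both sides compute the identity symbol of [P, Q] in degree m + n - k.\<close>

lemma good_skew:
  assumes P: "good k m f P D" and Q: "good k n e Q E"
  shows "D (grad e p) p = - E (grad f p) p"
proof -
  have PF: "P \<in> F m" "sg m P id = f" and QF: "Q \<in> F n" "sg n Q id = e"
    using goodD(1,5)[OF P] goodD(1,5)[OF Q] by (simp_all add: fun_eq_iff)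
  have "D (grad e p) p = sg (m + n - k) (P * Q - Q * P) id p"
    using good_commutator[OF P QF(1)] QF(2) by simp
  also have "\<dots> = - sg (n + m - k) (Q * P - P * Q) id p"
    unfolding sg_uminus[symmetric] by (simp add: add.commute)
  also have "\<dots> = - E (grad f p) p"
    using good_commutator[OF Q PF(1)] PF(2) by simp
  finally show ?thesis .
qed

lemma good_zero_plift:
  assumes P: "good k m f P D" and D: "\<And>v p. D v p = 0"
  shows "plift (k + 1) m f P"
  unfolding plift_def
proof (intro conjI allI)
  fix v
  have "brk P v \<in> F (m + 1 - k - 1)"
    by (rule symbol_kernel[OF goodD(3)[OF P]]) (simp add: goodD(4)[OF P] D)
  then show "brk P v \<in> F (m + 1 - (k + 1))" by (simp add: algebra_simps)
qed (fact goodD[OF P])+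

end

subsection \<open>Vanishing of brackets of degree at most -3\<close>

context hecke_data
begin

lemma hp_grad: "hp n f \<Longrightarrow> lin1 \<phi> \<Longrightarrow> hp (n - 1) (\<lambda>p. \<phi> (grad f p))"
proof (induction rule: hp.induct)
  case (hp_zero n) then show ?case by (simp add: grad_zero lin1_0 hp.hp_zero)
next
  case (hp_prod w)
  show ?case
  proof (induction w)
    case Nil
    have "grad (\<lambda>p. 1) p = 0" for p by (rule gradI) (rule has_grad_const)
    then show ?case using hp_prod by (simp add: lin1_0 hp.hp_zero)
  next
    case (Cons v w)
    have "\<phi> (grad (\<lambda>p. \<Prod>v\<leftarrow>v # w. pair v p) p)
      = \<phi> v * (\<Prod>v\<leftarrow>w. pair v p) + pair v p * \<phi> (grad (\<lambda>p. \<Prod>v\<leftarrow>w. pair v p) p)" for p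
      by (simp add: grad_Cons lin1_add[OF hp_prod] lin1_sc[OF hp_prod])
    moreover have "hp (int (length w)) (\<lambda>p. \<phi> v * (\<Prod>v\<leftarrow>w. pair v p) + pair v p * \<phi> (grad (\<lambda>p. \<Prod>v\<leftarrow>w. pair v p) p))"
      using hp_mult[OF hp_pair[of v] Cons.IH] by (intro hp.hp_add hp.hp_cmult hp.hp_prod) simp
    ultimately show ?case by simp
  qed
next
  case (hp_add n f g) then show ?case
    by (simp add: grad_add[OF hp_add.hyps] lin1_add hp.hp_add)
next
  case (hp_cmult n f z) then show ?case
    by (simp add: grad_cmult[OF hp_cmult.hyps] lin1_sc hp.hp_cmult)
qed

lemma hp_cont: "hp n f \<Longrightarrow> ((\<lambda>z. f (ptl p z q)) \<longlongrightarrow> f (ptl p z0 q)) (at z0)"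
proof -
  assume "hp n f"
  then obtain P where P: "\<And>z. poly P z = f (ptl p z q)" using hp_line by meson
  have "(poly P \<longlongrightarrow> poly P z0) (at z0)" using tendsto_poly[OF tendsto_ident_at] by blast
  then show ?thesis unfolding P[abs_def, symmetric] P[symmetric] by (simp add: P[symmetric] cong: filterlim_cong)
qed

lemma hp_bounded: "hp n f \<Longrightarrow> \<exists>C. eventually (\<lambda>z. norm (f (ptl p z q)) \<le> C) (at z0)"
proof -
  assume "hp n f"
  from tendsto_norm[OF hp_cont[OF this]]
  have "eventually (\<lambda>z. norm (f (ptl p z q)) < norm (f (ptl p z0 q)) + 1) (at z0)"
    by (rule order_tendstoD) simp
  then show ?thesis by (intro exI[of _ "norm (f (ptl p z0 q)) + 1"]) (auto elim: eventually_mono)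
qed

section \<open>Points and vectors in general position\<close>

lemma avoid_points:
  assumes "finite A" "0 \<notin> A"
  shows "\<exists>p. \<forall>l\<in>A. pair l p \<noteq> 0"
proof -
  have "\<exists>p. (\<Prod>l\<in>A. pair l p) \<noteq> 0" using assms
  proof (induction A rule: finite_induct)
    case (insert l A)
    then obtain p where p: "(\<Prod>l\<in>A. pair l p) \<noteq> 0" by auto
    obtain p1 where p1: "pair l p1 \<noteq> 0" using pair_nonzero[of l] insert.prems by auto
    show ?case
    proof (rule ccontr)
      assume "\<nexists>p. (\<Prod>l\<in>insert l A. pair l p) \<noteq> 0"
      then have "(\<Prod>l\<in>A. pair l q) * pair l q = 0" for q using insert.hyps by (simp add: mult.commute)
      then have "(\<lambda>q. \<Prod>l\<in>A. pair l q) p = 0"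
        by (rule hp_cancel[OF hp_setprod[OF insert.hyps(1) hp_pair] hp_pair _ p1])
      then show False using p by simp
    qed
  qed simp
  then show ?thesis using assms(1) by auto
qed

lemma avoid_scalars: "finite S \<Longrightarrow> \<exists>z::complex. z \<notin> S"
  using ex_new_if_finite infinite_UNIV_char_0 by blast

lemma avoid_vectors:
  assumes "finite A" "\<And>\<phi>. \<phi> \<in> A \<Longrightarrow> lin1 \<phi>" "\<And>\<phi>. \<phi> \<in> A \<Longrightarrow> \<exists>v. \<phi> v \<noteq> 0"
  shows "\<exists>u. \<forall>\<phi>\<in>A. \<phi> u \<noteq> 0"
  using assms
proof (induction A rule: finite_induct)
  case (insert \<phi> A)
  then obtain u where u: "\<forall>\<psi>\<in>A. \<psi> u \<noteq> 0" by blast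
  obtain w where w: "\<phi> w \<noteq> 0" using insert.prems(2) by blast
  obtain z where z: "z \<notin> (\<lambda>\<psi>. - \<psi> w / \<psi> u) ` A \<union> {- \<phi> w / \<phi> u}"
    using avoid_scalars[of "(\<lambda>\<psi>. - \<psi> w / \<psi> u) ` A \<union> {- \<phi> w / \<phi> u}"] insert.hyps by auto
  have "\<psi> (sc z u + w) \<noteq> 0" if p: "\<psi> \<in> insert \<phi> A" for \<psi>
  proof
    assume 0: "\<psi> (sc z u + w) = 0"
    have l: "lin1 \<psi>" using insert.prems(1) p by blast
    have eq: "z * \<psi> u + \<psi> w = 0" using 0 by (simp add: lin1_add[OF l] lin1_sc[OF l])
    show False
    proof (cases "\<psi> u = 0")
      case True
      then have "\<psi> = \<phi>" using u p by blast
      then show ?thesis using True eq w by simp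
    next
      case False
      then have "z = - \<psi> w / \<psi> u" using eq by (simp add: field_simps add_eq_0_iff)
      then show ?thesis using z p by blast
    qed
  qed
  then show ?case by blast
qed simp

text \<open>A basis vector may lie in the kernel of one of the forms, so each is shifted by a
  multiple of a generic \<open>u0\<close>. Together with \<open>u0\<close> the shifted vectors still
  span V.\<close>

lemma generic_family:
  assumes "finite A" "\<And>\<phi>. \<phi> \<in> A \<Longrightarrow> lin1 \<phi>" "\<And>\<phi>. \<phi> \<in> A \<Longrightarrow> \<exists>v. \<phi> v \<noteq> 0"
  shows "\<exists>u0 \<tau>. \<forall>\<phi>\<in>A. \<phi> u0 \<noteq> 0 \<and> (\<forall>b\<in>Basis. \<phi> (b + sc (\<tau> b) u0) \<noteq> 0)"
proof -
  obtain u0 where u0: "\<forall>\<phi>\<in>A. \<phi> u0 \<noteq> 0" using avoid_vectors[OF assms] by blast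
  have "\<exists>t. \<forall>\<phi>\<in>A. \<phi> (b + sc t u0) \<noteq> 0" for b
  proof -
    obtain t where t: "t \<notin> (\<lambda>\<phi>. - \<phi> b / \<phi> u0) ` A"
      using avoid_scalars[of "(\<lambda>\<phi>. - \<phi> b / \<phi> u0) ` A"] assms(1) by auto
    have "\<phi> (b + sc t u0) \<noteq> 0" if p: "\<phi> \<in> A" for \<phi>
    proof
      assume "\<phi> (b + sc t u0) = 0"
      then have "\<phi> b + t * \<phi> u0 = 0" using assms(2)[OF p] by (simp add: lin1_add lin1_sc)
      then have "t = - \<phi> b / \<phi> u0" using u0 p by (simp add: field_simps add_eq_0_iff)
      then show False using t p by blast
    qed
    then show ?thesis by blast
  qed
  then obtain \<tau> where "\<And>b. \<forall>\<phi>\<in>A. \<phi> (b + sc (\<tau> b) u0) \<noteq> 0" by metis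
  then show ?thesis using u0 by blast
qed

lemma family_zero:
  assumes f: "lin1 f" and "f u0 = 0" "\<And>b. b \<in> Basis \<Longrightarrow> f (b + sc (\<tau> b) u0) = 0"
  shows "f v = 0"
proof (rule lin1_zero[OF f])
  fix b assume "b \<in> Basis"
  from assms(3)[OF this] show "f b = 0" using assms(2) by (simp add: lin1_add[OF f] lin1_sc[OF f])
qed

section \<open>Power sums of an orbit and interpolation\<close>

definition powf :: "'v \<Rightarrow> nat \<Rightarrow> ('v \<Rightarrow> complex) \<Rightarrow> complex" where
  "powf u j p = (\<Sum>g\<in>G. pair (g u) p ^ j)"

lemma powf_hp: "hp (int j) (powf u j)"
  unfolding powf_def[abs_def] by (intro hp_sum hp_pair_power)

lemma powf_grad: "grad (powf u (Suc j)) p = (\<Sum>g\<in>G. sc (of_nat (Suc j) * pair (g u) p ^ j) (g u))"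
proof -
  have "has_grad (\<lambda>p. pair v p ^ Suc j) p (sc (of_nat (Suc j) * pair v p ^ j) v)" for v
    unfolding has_grad_def pair_ptl lin1_sc[OF pair_lin1]
  proof
    fix q
    have f: "((\<lambda>z. pair v p + z * pair v q) has_field_derivative pair v q) (at 0)"
      by (auto intro!: derivative_eq_intros)
    from DERIV_power[OF f, of "Suc j"]
    show "((\<lambda>z. (pair v p + z * pair v q) ^ Suc j) has_field_derivative of_nat (Suc j) * pair v p ^ j * pair v q) (at 0)"
      by (simp add: mult_ac del: of_nat_Suc power_Suc)
  qed
  then show ?thesis unfolding powf_def[abs_def] by (intro gradI has_grad_sum)
qed

lemma left_bij': "g \<in> G \<Longrightarrow> bij_betw (\<lambda>s. g \<circ> s) G G"
  by (rule bij_betwI[where g = "\<lambda>s. giv g \<circ> s"])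
    (auto intro: comp_G inv_G simp: inv_comp_G comp_assoc[symmetric] simp del: o_apply)

lemma powf_inv: "g \<in> G \<Longrightarrow> powf u j (act g p) = powf u j p"
proof -
  assume g: "g \<in> G"
  have "powf u j (act g p) = (\<Sum>h\<in>G. pair ((g \<circ> h) u) p ^ j)" by (simp add: powf_def pair_act[OF g])
  also have "\<dots> = powf u j p" unfolding powf_def
    by (rule sum.reindex_bij_betw[OF left_bij'[OF g], of "\<lambda>h. pair (h u) p ^ j"])
  finally show ?thesis .
qed

text \<open>Coefficients of the polynomial whose roots are the values of \<open>g u\<close> for
  \<open>g \<noteq> id\<close>; its value at that of \<open>u\<close> is
  \<open>nrm u p\<close>.\<close>

definition rcf :: "'v \<Rightarrow> nat \<Rightarrow> ('v \<Rightarrow> complex) \<Rightarrow> complex" where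
  "rcf u j p = Polynomial.coeff (\<Prod>g\<in>G - {id}. [:- pair (g u) p, 1:]) j"

definition nrm :: "'v \<Rightarrow> ('v \<Rightarrow> complex) \<Rightarrow> complex" where
  "nrm u p = (\<Prod>g\<in>G - {id}. pair (u - g u) p)"

lemma card_G_id: "int (card (G - {id})) = int (card G) - 1"
proof -
  have "card G > 0" using finite_G id_G card_gt_0_iff by blast
  then show ?thesis using finite_G by (simp add: card_Diff_singleton of_nat_diff Suc_leI)
qed

lemma coeff_hp:
  "finite S \<Longrightarrow> hp (int (card S) - int j) (\<lambda>p. Polynomial.coeff (\<Prod>g\<in>S. [:- pair (g u) p, 1:]) j)"
proof (induction S arbitrary: j rule: finite_induct)
  case empty
  show ?case using hp_const[of 1] hp_zero[of "- int j"] by (cases "j = 0") (simp_all add: coeff_1)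
next
  case (insert h S)
  let ?Q = "\<lambda>p. \<Prod>g\<in>S. [:- pair (g u) p, 1:]"
  have 1: "hp (int (card S) + 1 - int j) (\<lambda>p. - (pair (h u) p * Polynomial.coeff (?Q p) j))"
    using hp_uminus[OF hp_mult[OF hp_pair insert.IH[of j]]] by (simp add: algebra_simps)
  have 2: "hp (int (card S) + 1 - int j) (\<lambda>p. if j = 0 then 0 else Polynomial.coeff (?Q p) (j - 1))"
    using insert.IH[of "j - 1"] by (cases "j = 0") (auto simp: hp_zero algebra_simps of_nat_diff)
  have "Polynomial.coeff (\<Prod>g\<in>insert h S. [:- pair (g u) p, 1:]) j
    = - (pair (h u) p * Polynomial.coeff (?Q p) j) + (if j = 0 then 0 else Polynomial.coeff (?Q p) (j - 1))" for p
    using insert.hyps by (cases j) simp_all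
  then show ?case using hp_add[OF 1 2] insert.hyps by (simp add: algebra_simps)
qed

lemma rcf_hp: "hp (int (card G) - 1 - int j) (rcf u j)"
  using coeff_hp[of "G - {id}" j u] finite_G unfolding rcf_def[abs_def] card_G_id by simp

text \<open>Lagrange interpolation: in the combination of gradients, \<open>g u\<close> is weighted
  by the interpolating polynomial at the value of \<open>g u\<close>, which is zero unless
  \<open>g = id\<close>. Hence, off the zeros of \<open>nrm u\<close>, the vector \<open>u\<close>
  is a combination of gradients of invariants.\<close>

lemma nrm_vec: "sc (nrm u p) u = (\<Sum>j<card G. sc (rcf u j p / of_nat (Suc j)) (grad (powf u (Suc j)) p))"
proof -
  let ?R = "\<Prod>g\<in>G - {id}. [:- pair (g u) p, 1:]"
  have c: "card G > 0" using finite_G id_G card_gt_0_iff by blast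
  have "Polynomial.degree ?R \<le> card (G - {id})"
    using degree_prod_sum_le[of "G - {id}" "\<lambda>g. [:- pair (g u) p, 1:]"] finite_G by simp
  also have "\<dots> = card G - 1" using finite_G by (simp add: card_Diff_singleton)
  finally have deg: "Polynomial.degree ?R < card G" using c by linarith
  have pR: "poly ?R z = (\<Sum>j<card G. rcf u j p * z ^ j)" for z
  proof -
    have "poly ?R z = (\<Sum>j\<le>Polynomial.degree ?R. Polynomial.coeff ?R j * z ^ j)" by (rule poly_altdef)
    also have "\<dots> = (\<Sum>j<card G. Polynomial.coeff ?R j * z ^ j)"
      using deg by (intro sum.mono_neutral_left) (auto simp: coeff_eq_0)
    finally show ?thesis by (simp add: rcf_def)
  qed
  have root: "poly ?R (pair (g u) p) = (if g = id then nrm u p else 0)" if g: "g \<in> G" for g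
  proof (cases "g = id")
    case True then show ?thesis by (simp add: poly_prod nrm_def lin1_diff[OF pair_lin1])
  next
    case False then show ?thesis using g finite_G by (auto simp: poly_prod)
  qed
  have "(\<Sum>j<card G. sc (rcf u j p / of_nat (Suc j)) (grad (powf u (Suc j)) p))
    = (\<Sum>j<card G. \<Sum>g\<in>G. sc (rcf u j p * pair (g u) p ^ j) (g u))"
    unfolding powf_grad scale_sum_right by (intro sum.cong refl) (simp del: of_nat_Suc)
  also have "\<dots> = (\<Sum>g\<in>G. sc (poly ?R (pair (g u) p)) (g u))"
    unfolding pR by (subst sum.swap) (simp add: scale_sum_left)
  also have "\<dots> = (\<Sum>g\<in>G. if g = id then sc (nrm u p) u else 0)"
    by (intro sum.cong refl) (simp add: root)
  also have "\<dots> = sc (nrm u p) u" using finite_G by simp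
  finally show ?thesis by simp
qed

lemma nrm_hp: "hp (int (card G) - 1) (nrm u)"
proof -
  have "hp (int (card (G - {id})) * 1) (nrm u)" unfolding nrm_def[abs_def]
    by (intro hp_setprod hp_pair) (use finite_G in auto)
  then show ?thesis unfolding card_G_id by simp
qed

section \<open>Divisibility of complex polynomials from bounds near the roots\<close>

lemma eventually_poly_nonzero: "(Q :: complex poly) \<noteq> 0 \<Longrightarrow> eventually (\<lambda>z. poly Q z \<noteq> 0) (at z0)"
proof -
  let ?F = "{z. poly Q z = 0} - {z0}"
  assume "Q \<noteq> 0"
  then have "finite ?F" using poly_roots_finite by blast
  then have "open (- ?F)" by (intro open_Compl finite_imp_closed)
  then have "eventually (\<lambda>z. z \<in> - ?F) (nhds z0)" by (rule eventually_nhds_in_open) blast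
  then show ?thesis unfolding eventually_at_filter by (rule eventually_mono) blast
qed

text \<open>At a root of \<open>Q\<close> the bound makes \<open>P\<close> vanish too. Cancelling
  the common linear factor preserves the bound at every remaining root, even at the same point,
  because limits are taken off the point.\<close>

lemma poly_bounded_dvd:
  fixes P Q :: "complex poly"
  assumes "Q \<noteq> 0" "\<And>z0. poly Q z0 = 0 \<Longrightarrow> \<exists>C. eventually (\<lambda>z. norm (poly P z) \<le> C * norm (poly Q z)) (at z0)"
  shows "Q dvd P"
  using assms
proof (induction "Polynomial.degree Q" arbitrary: P Q)
  case 0
  then show ?case using is_unit_iff_degree[of Q] by (simp add: unit_imp_dvd)
next
  case (Suc n)
  then obtain z0 where z0: "poly Q z0 = 0" using fundamental_theorem_of_algebra[of Q] constant_degree[of Q] by auto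
  obtain C where C: "eventually (\<lambda>z. norm (poly P z) \<le> C * norm (poly Q z)) (at z0)"
    using Suc.prems(2)[OF z0] by blast
  have lP: "((\<lambda>z. norm (poly P z)) \<longlongrightarrow> norm (poly P z0)) (at z0)"
    by (intro tendsto_norm tendsto_poly tendsto_ident_at)
  have lQ: "((\<lambda>z. C * norm (poly Q z)) \<longlongrightarrow> C * norm (poly Q z0)) (at z0)"
    by (intro tendsto_mult tendsto_norm tendsto_const tendsto_poly tendsto_ident_at)
  have "norm (poly P z0) \<le> C * norm (poly Q z0)"
    by (rule tendsto_le[OF _ lQ lP C]) simp
  then have "poly P z0 = 0" using z0 by simp
  then obtain P' Q' where PQ: "P = [:- z0, 1:] * P'" "Q = [:- z0, 1:] * Q'"
    using z0 unfolding poly_eq_0_iff_dvd by (auto elim!: dvdE)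
  have Q'0: "Q' \<noteq> 0" using PQ Suc.prems(1) by auto
  have "Q' dvd P'"
  proof (rule Suc.hyps(1))
    show "n = Polynomial.degree Q'" using Suc.hyps(2) Q'0 unfolding PQ(2) by (subst (asm) degree_mult_eq) auto
    show "Q' \<noteq> 0" by (rule Q'0)
    fix z1 assume "poly Q' z1 = 0"
    then have "poly Q z1 = 0" unfolding PQ(2) by simp
    then obtain C where C: "eventually (\<lambda>z. norm (poly P z) \<le> C * norm (poly Q z)) (at z1)"
      using Suc.prems(2) by blast
    have nz: "eventually (\<lambda>z. poly [:- z0, 1:] z \<noteq> 0) (at z1)" by (rule eventually_poly_nonzero) simp
    from C nz have "eventually (\<lambda>z. norm (poly P' z) \<le> C * norm (poly Q' z)) (at z1)"
    proof eventually_elim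
      case (elim z)
      let ?c = "norm (poly [:- z0, 1:] z)"
      have "?c * norm (poly P' z) \<le> ?c * (C * norm (poly Q' z))"
        using elim(1) unfolding PQ poly_mult norm_mult by (simp only: mult_ac)
      moreover have "?c > 0" using elim(2) by simp
      ultimately show ?case using mult_le_cancel_left_pos by blast
    qed
    then show "\<exists>C. eventually (\<lambda>z. norm (poly P' z) \<le> C * norm (poly Q' z)) (at z1)" by blast
  qed
  then show ?case unfolding PQ by (rule mult_dvd_mono[OF dvd_refl])
qed

end

context hecke_alg
begin

context
  fixes k :: int
  assumes k3: "k \<ge> 3" and ex_good: "\<And>m f. hp m f \<Longrightarrow> Ginv f \<Longrightarrow> \<exists>P D. good k m f P D"
begin

text \<open>The bracket with the power sum of degree \<open>j + 1\<close>. The index is shifted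
  because gradients of power sums of positive degree are what interpolation uses.\<close>

definition DD :: "'v \<Rightarrow> nat \<Rightarrow> 'v \<Rightarrow> ('v \<Rightarrow> complex) \<Rightarrow> complex" where
  "DD u j = (SOME D. \<exists>P. good k (int (Suc j)) (powf u (Suc j)) P D)"

lemma DD: "\<exists>P. good k (int (Suc j)) (powf u (Suc j)) P (DD u j)"
proof -
  have "\<exists>P D. good k (int (Suc j)) (powf u (Suc j)) P D"
    by (intro ex_good powf_hp) (simp add: Ginv_def powf_inv)
  then have "\<exists>D. \<exists>P. good k (int (Suc j)) (powf u (Suc j)) P D" by blast
  then show ?thesis unfolding DD_def by (rule someI_ex)
qed

lemma DD_lin: "lin1 (\<lambda>v. DD u j v p)" using DD good_D(2) by blast
lemma DD_hp: "hp (int (Suc j) + 1 - k) (DD u j v)" using DD good_D(1) by blast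
lemma DD_skew: "good k m f P D \<Longrightarrow> D (grad (powf u (Suc j)) p) p = - DD u j (grad f p) p"
  using DD[where u = u and j = j] good_skew by blast

text \<open>Interpolation applied to brackets, with the sign of skew-symmetry. The quotient
  \<open>XX u w / nrm u\<close> is the coefficient of the bracket; numerator and denominator have
  degrees |G| + 1 - k and |G| - 1, so it has degree 2 - k < 0.\<close>

definition XX :: "'v \<Rightarrow> 'v \<Rightarrow> ('v \<Rightarrow> complex) \<Rightarrow> complex" where
  "XX u w p = (\<Sum>j<card G. (- 1 / of_nat (Suc j)) * (rcf u j p * DD u j w p))"

lemma XX_hp: "hp (int (card G) + 1 - k) (XX u w)"
proof -
  have "hp (int (card G) + 1 - k) (\<lambda>p. rcf u j p * DD u j w p)" for j
    using hp_mult[OF rcf_hp[where u = u and j = j] DD_hp[where u = u and j = j and v = w]] by (simp add: algebra_simps)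
  then show ?thesis unfolding XX_def[abs_def] by (intro hp_sum hp_cmult)
qed

lemma XX_lin: "lin1 (\<lambda>w. XX u w p)"
  unfolding XX_def by (intro lin1_sum' lin1_cmult DD_lin)

text \<open>Skew-symmetry trades \<open>D\<close> at the gradients of power sums for
  \<open>DD\<close> at the gradient of \<open>f\<close>, so one formula expresses the brackets of
  all invariants through their gradients.\<close>

lemma nrm_D:
  assumes P: "good k m f P D"
  shows "nrm u p * D u p = XX u (grad f p) p"
proof -
  have l: "lin1 (\<lambda>v. D v p)" using good_D(2)[OF P] .
  have "nrm u p * D u p = D (sc (nrm u p) u) p" by (simp add: lin1_sc[OF l])
  also have "\<dots> = (\<Sum>j<card G. rcf u j p / of_nat (Suc j) * D (grad (powf u (Suc j)) p) p)"
    unfolding nrm_vec lin1_sum[OF l] lin1_sc[OF l] ..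
  also have "\<dots> = XX u (grad f p) p"
    unfolding XX_def DD_skew[OF P] by (intro sum.cong refl) (simp add: field_simps)
  finally show ?thesis .
qed

lemma span_grads:
  assumes f: "lin1 f" and z: "\<And>u j. f (grad (powf u (Suc j)) p) = 0"
    and u0: "nrm u0 p \<noteq> 0" and ub: "\<And>b. b \<in> Basis \<Longrightarrow> nrm (b + sc (\<tau> b) u0) p \<noteq> 0"
  shows "f v = 0"
proof -
  have "f u = 0" if u: "nrm u p \<noteq> 0" for u
  proof -
    have "nrm u p * f u = f (sc (nrm u p) u)" by (simp add: lin1_sc[OF f])
    also have "\<dots> = 0" unfolding nrm_vec lin1_sum[OF f] lin1_sc[OF f] z by simp
    finally show ?thesis using u by simp
  qed
  then show ?thesis using family_zero[OF f, of u0 \<tau>] u0 ub by blast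
qed

text \<open>At a point whose stabiliser moves vectors only along one line, the gradients of invariant
  functions span a hyperplane or everything; skew-symmetry then bounds the bracket.\<close>

lemma bracket_bounded:
  fixes \<beta> :: "complex \<Rightarrow> 'v \<Rightarrow> 'v \<Rightarrow> complex"
  assumes lin: "\<And>z v. lin1 (\<lambda>w. \<beta> z w v)" "\<And>z w. lin1 (\<lambda>v. \<beta> z w v)"
    and skew: "eventually (\<lambda>z. \<forall>v w. \<beta> z v w = - \<beta> z w v) (at z0)"
    and pw: "eventually (\<lambda>z. \<forall>u j v. \<beta> z (grad (powf u (Suc j)) (ptl p z q)) v = DD u j v (ptl p z q)) (at z0)"
    and line: "\<And>h v. h \<in> G \<Longrightarrow> (\<And>v. pair (h v) (ptl p z0 q) = pair v (ptl p z0 q)) \<Longrightarrow> \<exists>c. v - h v = sc c \<alpha>"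
  shows "\<exists>C. eventually (\<lambda>z. norm (\<beta> z v w) \<le> C) (at z0)"
proof -
  let ?p = "ptl p z0 q"
  define H where "H = {h\<in>G. \<forall>v. pair (h v) ?p = pair v ?p}"
  have idH: "id \<in> H" and finH: "finite H" using finite_G by (auto simp: H_def)
  then have cH: "of_nat (card H) \<noteq> (0::complex)" by auto
  \<comment> \<open>The projection onto the vectors fixed by the stabiliser \<open>H\<close> of the
    point; it changes a vector only along \<alpha>.\<close>
  define av where "av v = sc (1 / of_nat (card H)) (\<Sum>h\<in>H. h v)" for v
  have "\<exists>c. v - av v = sc c \<alpha>" for v
  proof -
    have "\<forall>h\<in>H. \<exists>c. v - h v = sc c \<alpha>" using line by (auto simp: H_def)
    then obtain c where c: "\<And>h. h \<in> H \<Longrightarrow> v - h v = sc (c h) \<alpha>" by metis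
    have "v - av v = sc (1 / of_nat (card H)) (\<Sum>h\<in>H. v - h v)"
    proof -
      have "sc (1 / of_nat (card H)) (\<Sum>h\<in>H. v) = v"
        using cH by (simp add: sum_constant_scale)
      then show ?thesis by (simp add: av_def sum_subtractf scale_right_diff_distrib)
    qed
    also have "(\<Sum>h\<in>H. v - h v) = sc (\<Sum>h\<in>H. c h) \<alpha>" by (simp add: c scale_sum_left)
    finally show ?thesis by auto
  qed
  then obtain c where c: "\<And>v. v - av v = sc (c v) \<alpha>" by metis
  have av_add: "av (u + v) = av u + av v" for u v
    by (simp add: av_def H_def G_add sum.distrib scale_right_distrib)
  have av_sc: "av (sc z v) = sc z (av v)" for z v
    by (simp add: av_def H_def G_sc scale_sum_right scale_left_commute)
  \<comment> \<open>\<open>Q w\<close>: the vector \<open>w\<close> is the value at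
    \<open>z0\<close> of a family that is continuous there and against which \<beta> stays bounded.
    Gradients of invariants are such families, and linear combinations preserve the
    property.\<close>
  define Q where "Q w \<longleftrightarrow> (\<exists>f. f z0 = w \<and> (\<forall>\<phi>. lin1 \<phi> \<longrightarrow> ((\<lambda>z. \<phi> (f z)) \<longlongrightarrow> \<phi> w) (at z0))
     \<and> (\<forall>v. \<exists>C. eventually (\<lambda>z. norm (\<beta> z (f z) v) \<le> C) (at z0)))" for w
  have Q_0: "Q 0" unfolding Q_def
    by (intro exI[of _ "\<lambda>z. 0"] conjI allI impI exI[of _ 0]) (simp_all add: lin1_0[OF lin(1)])
  have Q_add: "Q (u + v)" if "Q u" "Q v" for u v
  proof -
    obtain f where f: "f z0 = u" "\<And>\<phi>. lin1 \<phi> \<Longrightarrow> ((\<lambda>z. \<phi> (f z)) \<longlongrightarrow> \<phi> u) (at z0)"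
      "\<And>v. \<exists>C. eventually (\<lambda>z. norm (\<beta> z (f z) v) \<le> C) (at z0)" using \<open>Q u\<close> unfolding Q_def by blast
    obtain g where g: "g z0 = v" "\<And>\<phi>. lin1 \<phi> \<Longrightarrow> ((\<lambda>z. \<phi> (g z)) \<longlongrightarrow> \<phi> v) (at z0)"
      "\<And>v. \<exists>C. eventually (\<lambda>z. norm (\<beta> z (g z) v) \<le> C) (at z0)" using \<open>Q v\<close> unfolding Q_def by blast
    show ?thesis unfolding Q_def
    proof (intro exI[of _ "\<lambda>z. f z + g z"] conjI allI impI)
      show "f z0 + g z0 = u + v" using f(1) g(1) by simp
      show "((\<lambda>z. \<phi> (f z + g z)) \<longlongrightarrow> \<phi> (u + v)) (at z0)" if \<phi>: "lin1 \<phi>" for \<phi>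
        unfolding lin1_add[OF \<phi>] by (intro tendsto_add f(2) g(2) \<phi>)
      fix w
      obtain C D where C: "eventually (\<lambda>z. norm (\<beta> z (f z) w) \<le> C) (at z0)"
        and D: "eventually (\<lambda>z. norm (\<beta> z (g z) w) \<le> D) (at z0)" using f(3) g(3) by blast
      have "eventually (\<lambda>z. norm (\<beta> z (f z + g z) w) \<le> C + D) (at z0)"
        using C D
      proof eventually_elim
        case (elim z)
        then show ?case unfolding lin1_add[OF lin(1)]
          using norm_triangle_ineq[of "\<beta> z (f z) w" "\<beta> z (g z) w"] by linarith
      qed
      then show "\<exists>C. eventually (\<lambda>z. norm (\<beta> z (f z + g z) w) \<le> C) (at z0)" by blast
    qed
  qed
  have Q_sc: "Q (sc c v)" if "Q v" for c v
  proof -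
    obtain f where f: "f z0 = v" "\<And>\<phi>. lin1 \<phi> \<Longrightarrow> ((\<lambda>z. \<phi> (f z)) \<longlongrightarrow> \<phi> v) (at z0)"
      "\<And>v. \<exists>C. eventually (\<lambda>z. norm (\<beta> z (f z) v) \<le> C) (at z0)" using \<open>Q v\<close> unfolding Q_def by blast
    show ?thesis unfolding Q_def
    proof (intro exI[of _ "\<lambda>z. sc c (f z)"] conjI allI impI)
      show "sc c (f z0) = sc c v" using f(1) by simp
      show "((\<lambda>z. \<phi> (sc c (f z))) \<longlongrightarrow> \<phi> (sc c v)) (at z0)" if \<phi>: "lin1 \<phi>" for \<phi>
        unfolding lin1_sc[OF \<phi>] by (intro tendsto_mult tendsto_const f(2) \<phi>)
      fix w
      obtain C where C: "eventually (\<lambda>z. norm (\<beta> z (f z) w) \<le> C) (at z0)" using f(3) by blast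
      have "eventually (\<lambda>z. norm (\<beta> z (sc c (f z)) w) \<le> norm c * C) (at z0)"
        using C by eventually_elim (simp add: lin1_sc[OF lin(1)] norm_mult mult_left_mono)
      then show "\<exists>C. eventually (\<lambda>z. norm (\<beta> z (sc c (f z)) w) \<le> C) (at z0)" by blast
    qed
  qed
  have Q_sum: "Q (\<Sum>i\<in>A. f i)" if "\<And>i. i \<in> A \<Longrightarrow> Q (f i)" for f and A :: "nat set"
    using that by (induction A rule: infinite_finite_induct) (auto intro: Q_0 Q_add)
  have Q_grad: "Q (grad (powf u (Suc j)) ?p)" for u j
    unfolding Q_def
  proof (intro exI[of _ "\<lambda>z. grad (powf u (Suc j)) (ptl p z q)"] conjI allI impI refl)
    show "((\<lambda>z. \<phi> (grad (powf u (Suc j)) (ptl p z q))) \<longlongrightarrow> \<phi> (grad (powf u (Suc j)) ?p)) (at z0)"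
      if "lin1 \<phi>" for \<phi>
      by (rule hp_cont[OF hp_grad[OF powf_hp that]])
    fix v
    obtain C where C: "eventually (\<lambda>z. norm (DD u j v (ptl p z q)) \<le> C) (at z0)"
      using hp_bounded[OF DD_hp] by blast
    have "eventually (\<lambda>z. norm (\<beta> z (grad (powf u (Suc j)) (ptl p z q)) v) \<le> C) (at z0)"
      using C pw by eventually_elim simp
    then show "\<exists>C. eventually (\<lambda>z. norm (\<beta> z (grad (powf u (Suc j)) (ptl p z q)) v) \<le> C) (at z0)" by blast
  qed
  \<comment> \<open>Interpolation at a point with stabiliser: \<open>R\<close> vanishes at the
    values of \<open>g u\<close> for \<open>g\<close> outside \<open>H\<close> and not at the value
    of \<open>u\<close>, so the whole sum over \<open>H\<close> is selected.\<close>
  have Q_gen: "Q (av u)" if u: "\<And>g. g \<in> G - H \<Longrightarrow> pair (u - g u) ?p \<noteq> 0" for u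
  proof -
    let ?T = "(\<lambda>g. pair (g u) ?p) ` (G - H)"
    define R where "R = (\<Prod>t\<in>?T. [:- t, 1:])"
    have fT: "finite ?T" using finite_G by simp
    have R0: "poly R (pair u ?p) \<noteq> 0"
      unfolding R_def poly_prod using fT u by (auto simp: lin1_diff[OF pair_lin1])
    have RT: "poly R t = 0" if "t \<in> ?T" for t
      unfolding R_def poly_prod using that fT by (intro prod_zero) auto
    have val: "poly R (pair (g u) ?p) = (if g \<in> H then poly R (pair u ?p) else 0)" if "g \<in> G" for g
      using RT that by (auto simp: H_def)
    have "(\<Sum>j\<le>Polynomial.degree R. sc (Polynomial.coeff R j / of_nat (Suc j)) (grad (powf u (Suc j)) ?p))
      = (\<Sum>j\<le>Polynomial.degree R. \<Sum>g\<in>G. sc (Polynomial.coeff R j * pair (g u) ?p ^ j) (g u))"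
      unfolding powf_grad scale_sum_right by (intro sum.cong refl) (simp del: of_nat_Suc)
    also have "\<dots> = (\<Sum>g\<in>G. sc (poly R (pair (g u) ?p)) (g u))"
      unfolding poly_altdef by (subst sum.swap) (simp add: scale_sum_left)
    also have "\<dots> = (\<Sum>g\<in>G. if g \<in> H then sc (poly R (pair u ?p)) (g u) else 0)"
      by (intro sum.cong refl) (simp add: val)
    also have "\<dots> = (\<Sum>g\<in>{g\<in>G. g \<in> H}. sc (poly R (pair u ?p)) (g u))"
      by (rule sum.inter_filter[OF finite_G, symmetric])
    also have "{g\<in>G. g \<in> H} = H" by (auto simp: H_def)
    finally have eq: "(\<Sum>j\<le>Polynomial.degree R. sc (Polynomial.coeff R j / of_nat (Suc j)) (grad (powf u (Suc j)) ?p))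
      = sc (poly R (pair u ?p)) (\<Sum>g\<in>H. g u)" by (simp add: scale_sum_right)
    have "Q (sc (poly R (pair u ?p)) (\<Sum>g\<in>H. g u))"
      unfolding eq[symmetric] by (intro Q_sum Q_sc Q_grad)
    from Q_sc[OF this, of "1 / of_nat (card H) * inverse (poly R (pair u ?p))"] show ?thesis
      using R0 by (simp add: av_def)
  qed
  have Q_basis: "Q (av b)" if b: "b \<in> Basis" for b
  proof -
    let ?A = "(\<lambda>g u. pair (u - g u) ?p) ` (G - H)"
    have "\<exists>u0 \<tau>. \<forall>\<phi>\<in>?A. \<phi> u0 \<noteq> 0 \<and> (\<forall>b\<in>Basis. \<phi> (b + sc (\<tau> b) u0) \<noteq> 0)"
    proof (rule generic_family)
      show "finite ?A" using finite_G by simp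
      fix \<phi> assume "\<phi> \<in> ?A"
      then obtain g where g: "g \<in> G - H" "\<phi> = (\<lambda>u. pair (u - g u) ?p)" by blast
      show "lin1 \<phi>" unfolding g(2) lin1_diff[OF pair_lin1] using g(1)
        by (intro lin1_diff' pair_lin1 lin1_G[OF pair_lin1]) auto
      obtain v where "pair (g v) ?p \<noteq> pair v ?p" using g(1) by (auto simp: H_def)
      then show "\<exists>v. \<phi> v \<noteq> 0" unfolding g(2) lin1_diff[OF pair_lin1] by (intro exI[of _ v]) simp
    qed
    then obtain u0 \<tau> where u': "\<forall>\<phi>\<in>?A. \<phi> u0 \<noteq> 0 \<and> (\<forall>b\<in>Basis. \<phi> (b + sc (\<tau> b) u0) \<noteq> 0)"
      by (elim exE)
    have u: "pair (u0 - g u0) ?p \<noteq> 0" "pair ((b + sc (\<tau> b) u0) - g (b + sc (\<tau> b) u0)) ?p \<noteq> 0" if "g \<in> G - H" for g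
      using bspec[OF u' imageI[OF that]] b by simp_all
    have "Q (av (b + sc (\<tau> b) u0) + sc (- \<tau> b) (av u0))"
      by (intro Q_add Q_sc Q_gen u)
    then show ?thesis by (simp add: av_add av_sc)
  qed
  then obtain f where f: "\<And>b \<phi>. b \<in> Basis \<Longrightarrow> lin1 \<phi> \<Longrightarrow> ((\<lambda>z. \<phi> (f b z)) \<longlongrightarrow> \<phi> (av b)) (at z0)"
      "\<And>b v. b \<in> Basis \<Longrightarrow> \<exists>C. eventually (\<lambda>z. norm (\<beta> z (f b z) v) \<le> C) (at z0)"
    unfolding Q_def by metis
  let ?r = "\<lambda>v b. norm (representation Basis v b)"
  \<comment> \<open>\<open>S\<close> measures \<beta> on basis vectors. It will satisfy S \<le>
    constant + S / 2; the constant \<open>\<epsilon>\<close> below is the closeness of the families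
    to their limits that yields the factor 1/2.\<close>
  define S where "S z = (\<Sum>a\<in>Basis. \<Sum>b\<in>Basis. norm (\<beta> z a b))" for z
  have S0: "S z \<ge> 0" for z by (simp add: S_def sum_nonneg)
  have bil: "norm (\<beta> z x y) \<le> M * N * S z"
    if M: "\<And>a. a \<in> Basis \<Longrightarrow> ?r x a \<le> M" and N: "\<And>b. b \<in> Basis \<Longrightarrow> ?r y b \<le> N" and "M \<ge> 0" "N \<ge> 0" for x y z M N
  proof -
    have e1: "\<beta> z x y = (\<Sum>a\<in>Basis. representation Basis x a * \<beta> z a y)"
      by (rule lin1_expand[OF lin(1)])
    have e2: "\<beta> z a y = (\<Sum>b\<in>Basis. representation Basis y b * \<beta> z a b)" for a
      by (rule lin1_expand[OF lin(2)])
    have "\<beta> z x y = (\<Sum>a\<in>Basis. \<Sum>b\<in>Basis. representation Basis x a * (representation Basis y b * \<beta> z a b))"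
      unfolding e1 sum_distrib_left[symmetric] by (intro sum.cong refl arg_cong2[of _ _ _ _ "(*)"] e2)
    also have "norm \<dots> \<le> (\<Sum>a\<in>Basis. \<Sum>b\<in>Basis. norm (representation Basis x a * (representation Basis y b * \<beta> z a b)))"
      by (intro sum_norm_le order_refl)
    also have "\<dots> \<le> (\<Sum>a\<in>Basis. \<Sum>b\<in>Basis. M * (N * norm (\<beta> z a b)))"
      unfolding norm_mult using that by (intro sum_mono mult_mono) auto
    also have "\<dots> = M * N * S z" by (simp add: S_def sum_distrib_left mult.assoc)
    finally show ?thesis .
  qed
  define K where "K = 1 + (\<Sum>a\<in>Basis. ?r \<alpha> a)"
  have K1: "K \<ge> 1" by (simp add: K_def sum_nonneg)
  have Ka: "?r v a \<le> K" if "v \<in> insert \<alpha> Basis" "a \<in> Basis" for v a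
  proof (cases "v = \<alpha>")
    case True
    have "?r \<alpha> a \<le> (\<Sum>a\<in>Basis. ?r \<alpha> a)" using that finite_Basis by (intro member_le_sum) auto
    then show ?thesis using True by (simp add: K_def)
  next
    case False
    then show ?thesis using that K1 by (auto simp: rep_Basis)
  qed
  define cs where "cs = 1 + (\<Sum>a\<in>Basis. norm (c a))"
  have cs: "1 + norm (c a) \<le> cs" if "a \<in> Basis" for a
    using member_le_sum[OF that, of "\<lambda>a. norm (c a)"] finite_Basis by (simp add: cs_def)
  have cs1: "cs \<ge> 1" by (simp add: cs_def sum_nonneg)
  let ?d = "real (card Basis) ^ 2"
  define \<epsilon> where "\<epsilon> = 1 / (2 * (?d + 1) * cs * K)"
  have eps0: "\<epsilon> > 0" unfolding \<epsilon>_def using cs1 K1 by (intro divide_pos_pos mult_pos_pos) (auto simp: add_nonneg_pos)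
  have eps: "?d * cs * (\<epsilon> * K) \<le> 1 / 2"
  proof -
    have nz: "2 * (?d + 1) * cs * K \<noteq> 0" using cs1 K1 by (simp add: add_nonneg_eq_0_iff)
    have e1: "\<epsilon> * (2 * (?d + 1) * cs * K) = 1" unfolding \<epsilon>_def using nz by (metis nonzero_eq_divide_eq)
    have "cs * (\<epsilon> * K) \<ge> 0" using cs1 K1 eps0 by simp
    then have "?d * (cs * (\<epsilon> * K)) \<le> (?d + 1) * (cs * (\<epsilon> * K))" by (intro mult_right_mono) auto
    also have "(?d + 1) * (cs * (\<epsilon> * K)) = 1 / 2" using e1 by (simp add: algebra_simps)
    finally show ?thesis by (simp add: mult.assoc)
  qed
  have evE: "eventually (\<lambda>z. \<forall>b\<in>Basis. \<forall>a\<in>Basis. norm (representation Basis (f b z) a - representation Basis (av b) a) < \<epsilon>) (at z0)"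
  proof (intro eventually_ball_finite finite_Basis ballI)
    fix b a assume b: "b \<in> Basis"
    from tendstoD[OF f(1)[OF b lin1_rep] eps0]
    show "eventually (\<lambda>z. norm (representation Basis (f b z) a - representation Basis (av b) a) < \<epsilon>) (at z0)"
      by (simp add: dist_norm)
  qed
  obtain M where M: "eventually (\<lambda>z. \<forall>b\<in>Basis. \<forall>v\<in>insert \<alpha> Basis. norm (\<beta> z (f b z) v) \<le> M) (at z0)"
  proof -
    have "\<exists>C. \<forall>b\<in>Basis. \<forall>v. eventually (\<lambda>z. norm (\<beta> z (f b z) v) \<le> C b v) (at z0)" using f(2) by metis
    then obtain C where C: "\<And>b v. b \<in> Basis \<Longrightarrow> eventually (\<lambda>z. norm (\<beta> z (f b z) v) \<le> C b v) (at z0)" by blast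
    let ?M = "\<Sum>b\<in>Basis. \<Sum>v\<in>insert \<alpha> Basis. \<bar>C b v\<bar>"
    have CM: "C b v \<le> ?M" if "b \<in> Basis" "v \<in> insert \<alpha> Basis" for b v
    proof -
      have "\<bar>C b v\<bar> \<le> (\<Sum>v\<in>insert \<alpha> Basis. \<bar>C b v\<bar>)" using that finite_Basis by (intro member_le_sum) auto
      also have "\<dots> \<le> ?M" using that finite_Basis
        by (intro member_le_sum[of b Basis "\<lambda>b. \<Sum>v\<in>insert \<alpha> Basis. \<bar>C b v\<bar>"]) (auto intro!: sum_nonneg)
      finally show ?thesis by linarith
    qed
    have "eventually (\<lambda>z. \<forall>b\<in>Basis. \<forall>v\<in>insert \<alpha> Basis. norm (\<beta> z (f b z) v) \<le> ?M) (at z0)"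
    proof (intro eventually_ball_finite ballI)
      fix b v assume bv: "b \<in> Basis" "v \<in> insert \<alpha> Basis"
      show "eventually (\<lambda>z. norm (\<beta> z (f b z) v) \<le> ?M) (at z0)"
        using C[OF bv(1)] by (rule eventually_mono) (rule order_trans[OF _ CM[OF bv]])
    qed (use finite_Basis in auto)
    then show thesis using that by blast
  qed
  have "eventually (\<lambda>z. S z \<le> 2 * (?d * cs * \<bar>M\<bar>)) (at z0)"
    using evE M skew
  proof eventually_elim
    case (elim z)
    have 1: "norm (\<beta> z (av b) v) \<le> \<bar>M\<bar> + \<epsilon> * K * S z" if b: "b \<in> Basis" and v: "v \<in> insert \<alpha> Basis" for b v
    proof -
      have eq: "\<beta> z (av b) v = \<beta> z (f b z) v - \<beta> z (f b z - av b) v" by (simp add: lin1_diff[OF lin(1)])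
      have "norm (\<beta> z (av b) v) \<le> norm (\<beta> z (f b z) v) + norm (\<beta> z (f b z - av b) v)"
        unfolding eq by (rule norm_triangle_ineq4)
      moreover have "norm (\<beta> z (f b z - av b) v) \<le> \<epsilon> * K * S z"
      proof (rule bil)
        show "?r (f b z - av b) a \<le> \<epsilon>" if "a \<in> Basis" for a
          using elim(1) b that by (auto simp: lin1_diff[OF lin1_rep] less_imp_le)
      qed (use Ka[OF v] eps0 K1 in auto)
      moreover have "norm (\<beta> z (f b z) v) \<le> \<bar>M\<bar>" using elim(2) b v by fastforce
      ultimately show ?thesis by linarith
    qed
    \<comment> \<open>Split off the \<alpha> parts of \<open>a\<close> and \<open>b\<close>. As
      \<beta>(\<alpha>, \<alpha>) = 0, the form \<beta>(\<alpha>, b) only sees \<open>av b\<close>,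
      and skew-symmetry moves it to the first slot, where the previous bound applies.\<close>
    have 2: "norm (\<beta> z a b) \<le> cs * (\<bar>M\<bar> + \<epsilon> * K * S z)" if a: "a \<in> Basis" and b: "b \<in> Basis" for a b
    proof -
      have aa: "a = av a + sc (c a) \<alpha>" "b = av b + sc (c b) \<alpha>" using c[of a] c[of b] by (simp_all add: algebra_simps)
      have z0: "\<beta> z \<alpha> \<alpha> = 0" using elim(3)[rule_format, of \<alpha> \<alpha>] by simp
      have "\<beta> z a b = \<beta> z (av a) b + c a * \<beta> z \<alpha> b"
        by (subst aa(1)) (simp add: lin1_add[OF lin(1)] lin1_sc[OF lin(1)])
      moreover have "\<beta> z \<alpha> b = - \<beta> z (av b) \<alpha>"
      proof -
        have "\<beta> z \<alpha> b = \<beta> z \<alpha> (av b)"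
          by (subst aa(2)) (simp add: lin1_add[OF lin(2)] lin1_sc[OF lin(2)] z0)
        also have "\<dots> = - \<beta> z (av b) \<alpha>" by (rule elim(3)[rule_format])
        finally show ?thesis .
      qed
      ultimately have "norm (\<beta> z a b) \<le> norm (\<beta> z (av a) b) + norm (c a) * norm (\<beta> z (av b) \<alpha>)"
        using norm_triangle_ineq[of "\<beta> z (av a) b" "c a * \<beta> z \<alpha> b"] by (simp add: norm_mult)
      also have "\<dots> \<le> (\<bar>M\<bar> + \<epsilon> * K * S z) + norm (c a) * (\<bar>M\<bar> + \<epsilon> * K * S z)"
        using 1[of a b] 1[of b \<alpha>] a b by (intro add_mono mult_left_mono) auto
      also have "\<dots> = (1 + norm (c a)) * (\<bar>M\<bar> + \<epsilon> * K * S z)" by (simp add: algebra_simps)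
      also have "\<dots> \<le> cs * (\<bar>M\<bar> + \<epsilon> * K * S z)"
        using cs[OF a] S0[of z] eps0 K1 by (intro mult_right_mono) auto
      finally show ?thesis .
    qed
    have "S z \<le> (\<Sum>a\<in>Basis. \<Sum>b\<in>Basis. cs * (\<bar>M\<bar> + \<epsilon> * K * S z))"
      unfolding S_def[of z] by (intro sum_mono) (rule 2[unfolded S_def])
    also have "\<dots> = ?d * cs * \<bar>M\<bar> + ?d * cs * (\<epsilon> * K) * S z" by (simp add: power2_eq_square algebra_simps)
    also have "\<dots> \<le> ?d * cs * \<bar>M\<bar> + 1 / 2 * S z" using mult_right_mono[OF eps S0[of z]] by linarith
    finally show ?case by linarith
  qed
  moreover define Nv where "Nv = (\<Sum>a\<in>Basis. ?r v a)"
  moreover define Nw where "Nw = (\<Sum>a\<in>Basis. ?r w a)"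
  ultimately have "eventually (\<lambda>z. norm (\<beta> z v w) \<le> Nv * Nw * (2 * (?d * cs * \<bar>M\<bar>))) (at z0)"
  proof (elim eventually_mono)
    fix z assume S: "S z \<le> 2 * (?d * cs * \<bar>M\<bar>)"
    have n: "?r v a \<le> Nv" "?r w a \<le> Nw" if "a \<in> Basis" for a
      unfolding Nv_def Nw_def using that finite_Basis by (auto intro: member_le_sum)
    have n0: "Nv \<ge> 0" "Nw \<ge> 0" by (auto simp: Nv_def Nw_def sum_nonneg)
    have "norm (\<beta> z v w) \<le> Nv * Nw * S z" by (rule bil) (use n n0 in auto)
    also have "\<dots> \<le> Nv * Nw * (2 * (?d * cs * \<bar>M\<bar>))" using S n0 by (intro mult_left_mono) auto
    finally show "norm (\<beta> z v w) \<le> Nv * Nw * (2 * (?d * cs * \<bar>M\<bar>))" .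
  qed
  then show ?thesis by blast
qed

lemma moved_basis: "g \<in> G \<Longrightarrow> g \<noteq> id \<Longrightarrow> \<exists>x\<in>Basis. x - g x \<noteq> 0"
proof (rule ccontr)
  assume g: "g \<in> G" "g \<noteq> id" and "\<not> (\<exists>x\<in>Basis. x - g x \<noteq> 0)"
  then have z: "\<And>x. x \<in> Basis \<Longrightarrow> x - g x = 0" by blast
  have "g v = v" for v
  proof (rule pair_eqI)
    fix p
    have l: "lin1 (\<lambda>v. pair v p - pair (g v) p)" by (intro lin1_diff' pair_lin1 lin1_G[OF pair_lin1] g)
    have "pair v p - pair (g v) p = 0"
      by (rule lin1_zero[OF l]) (metis z eq_iff_diff_eq_0)
    then show "pair (g v) p = pair v p" by simp
  qed
  then show False using g(2) by (simp add: fun_eq_iff)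
qed

text \<open>\<open>Z\<close> collects the nonzero forms x - g x whose hyperplanes carry all possible
  poles. The bracket is shown to vanish at every point off these hyperplanes; cancelling the product
  of the forms gives the remaining points.\<close>

theorem good_vanish:
  assumes P: "good k m f P D"
  shows "D v p = 0"
proof -
  define Z where "Z = {l. \<exists>x\<in>Basis. \<exists>g\<in>G. l = x - g x \<and> l \<noteq> 0}"
  have "Z \<subseteq> (\<lambda>(x,g). x - g x) ` (Basis \<times> G)" by (auto simp: Z_def)
  then have finZ: "finite Z" using finite_Basis finite_G finite_subset by blast
  have Z0: "0 \<notin> Z" by (simp add: Z_def)
  have Dl: "lin1 (\<lambda>v. D v p)" for p using good_D(2)[OF P] .
  have nrm_nz: "nrm u \<chi> \<noteq> 0" if "\<And>g. g \<in> G - {id} \<Longrightarrow> pair (u - g u) \<chi> \<noteq> 0" for u \<chi>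
    unfolding nrm_def using that finite_G by simp
  have pt: "D v \<chi>0 = 0" if \<chi>0: "\<And>l. l \<in> Z \<Longrightarrow> pair l \<chi>0 \<noteq> 0" for v \<chi>0
  proof -
    \<comment> \<open>These forms exclude directions in which the line through
      \<open>\<chi>0\<close> meets two different hyperplanes at once: if l1 and l2 vanish at
      parameter z0, then l(\<chi>0) = - z0 l(\<eta>) for both, and the combination vanishes at
      \<eta>.\<close>
    define Z2 where "Z2 = {l. \<exists>l1\<in>Z. \<exists>l2\<in>Z. l = sc (pair l1 \<chi>0) l2 - sc (pair l2 \<chi>0) l1 \<and> (\<forall>z. l2 \<noteq> sc z l1)}"
    have "Z2 \<subseteq> (\<lambda>(l1,l2). sc (pair l1 \<chi>0) l2 - sc (pair l2 \<chi>0) l1) ` (Z \<times> Z)" by (auto simp: Z2_def)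
    then have finZ2: "finite Z2" using finZ finite_subset by blast
    have Z20: "0 \<notin> Z2"
    proof
      assume "0 \<in> Z2"
      then obtain l1 l2 where l: "l1 \<in> Z" "l2 \<in> Z" "sc (pair l1 \<chi>0) l2 = sc (pair l2 \<chi>0) l1" "\<And>z. l2 \<noteq> sc z l1"
        by (auto simp: Z2_def)
      have "sc (inverse (pair l1 \<chi>0)) (sc (pair l1 \<chi>0) l2) = sc (inverse (pair l1 \<chi>0) * pair l2 \<chi>0) l1"
        unfolding l(3) by simp
      then show False using l(4) \<chi>0[OF l(1)] by simp
    qed
    obtain \<eta> where \<eta>: "\<And>l. l \<in> Z \<union> Z2 \<Longrightarrow> pair l \<eta> \<noteq> 0"
      using avoid_points[of "Z \<union> Z2"] finZ finZ2 Z0 Z20 by blast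
    let ?A = "(\<lambda>g u. pair (u - g u) \<eta>) ` (G - {id}) \<union> (\<lambda>g u. pair (u - g u) \<chi>0) ` (G - {id})"
    have "\<exists>u0 \<tau>. \<forall>\<phi>\<in>?A. \<phi> u0 \<noteq> 0 \<and> (\<forall>b\<in>Basis. \<phi> (b + sc (\<tau> b) u0) \<noteq> 0)"
    proof (rule generic_family)
      show "finite ?A" using finite_G by simp
      fix \<phi> assume "\<phi> \<in> ?A"
      then obtain g \<chi> where g: "g \<in> G - {id}" "\<phi> = (\<lambda>u. pair (u - g u) \<chi>)" "\<chi> = \<eta> \<or> \<chi> = \<chi>0" by blast
      show "lin1 \<phi>" unfolding g(2) lin1_diff[OF pair_lin1] using g(1)
        by (intro lin1_diff' pair_lin1 lin1_G[OF pair_lin1]) auto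
      obtain x where x: "x \<in> Basis" "x - g x \<noteq> 0" using moved_basis g(1) by blast
      then have "x - g x \<in> Z" using g(1) by (auto simp: Z_def)
      then show "\<exists>v. \<phi> v \<noteq> 0" using g \<eta> \<chi>0 by auto
    qed
    then obtain u0 \<tau> where u': "\<forall>\<phi>\<in>?A. \<phi> u0 \<noteq> 0 \<and> (\<forall>b\<in>Basis. \<phi> (b + sc (\<tau> b) u0) \<noteq> 0)"
      by (elim exE)
    define ub where "ub b = b + sc (\<tau> b) u0" for b
    define U where "U = insert u0 (ub ` Basis)"
    have UA: "\<phi> x \<noteq> 0" if "x \<in> U" "\<phi> \<in> ?A" for x \<phi>
    proof -
      have "\<phi> u0 \<noteq> 0" "\<forall>b\<in>Basis. \<phi> (b + sc (\<tau> b) u0) \<noteq> 0" using bspec[OF u' that(2)] by simp_all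
      then show ?thesis using that(1) by (auto simp: U_def ub_def)
    qed
    have nU: "nrm x \<eta> \<noteq> 0" "nrm x \<chi>0 \<noteq> 0" if x: "x \<in> U" for x
      using UA[OF x] by (auto intro!: nrm_nz)
    \<comment> \<open>The formula from interpolation is used for the vectors of \<open>U\<close>
      only, where the denominator is not identically zero on the line; \<beta> extends it linearly
      through \<open>b = ub b - \<tau> b u0\<close>.\<close>
    define E where "E z w x = XX x w (ptl \<chi>0 z \<eta>) / nrm x (ptl \<chi>0 z \<eta>)" for z w x
    define \<beta> where "\<beta> z w v = (\<Sum>b\<in>Basis. representation Basis v b * (E z w (ub b) - \<tau> b * E z w u0))" for z w v
    have El: "lin1 (\<lambda>w. E z w x)" for z x
      unfolding E_def divide_inverse by (intro lin1_mult XX_lin)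
    have l1: "lin1 (\<lambda>w. \<beta> z w v)" for z v
      unfolding \<beta>_def by (intro lin1_sum' lin1_cmult lin1_diff' El)
    have l2: "lin1 (\<lambda>v. \<beta> z w v)" for z w
      unfolding \<beta>_def by (intro lin1_sum' lin1_mult lin1_rep)
    define ok where "ok z \<longleftrightarrow> (\<forall>x\<in>U. nrm x (ptl \<chi>0 z \<eta>) \<noteq> 0)" for z
    have okev: "eventually ok (at z0)" for z0
      unfolding ok_def
    proof (intro eventually_ball_finite ballI)
      show "finite U" using finite_Basis by (simp add: U_def)
      fix x assume x: "x \<in> U"
      obtain Q where Q: "\<And>z. poly Q z = nrm x (ptl \<chi>0 z \<eta>)"
        "int (card G) - 1 \<ge> 0 \<longrightarrow> Polynomial.coeff Q (nat (int (card G) - 1)) = nrm x \<eta>"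
        using hp_line[OF nrm_hp[of x], of \<chi>0 \<eta>] by blast
      have "int (card G) - 1 \<ge> 0" using card_G_id by (metis of_nat_0_le_iff)
      then have "Q \<noteq> 0" using Q(2) nU(1)[OF x] by auto
      from eventually_poly_nonzero[OF this, of z0] show "eventually (\<lambda>z. nrm x (ptl \<chi>0 z \<eta>) \<noteq> 0) (at z0)"
        unfolding Q .
    qed
    have gradE: "E z (grad f' (ptl \<chi>0 z \<eta>)) x = D' x (ptl \<chi>0 z \<eta>)"
      if "good k m' f' P' D'" "ok z" "x \<in> U" for m' f' P' D' z x
      unfolding E_def nrm_D[OF that(1), symmetric] using that(2,3) by (simp add: ok_def)
    have grad\<beta>: "\<beta> z (grad f' (ptl \<chi>0 z \<eta>)) v = D' v (ptl \<chi>0 z \<eta>)"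
      if g: "good k m' f' P' D'" "ok z" for m' f' P' D' z v
    proof -
      have l: "lin1 (\<lambda>v. D' v p)" for p using good_D(2)[OF g(1)] .
      have "\<beta> z (grad f' (ptl \<chi>0 z \<eta>)) v = (\<Sum>b\<in>Basis. representation Basis v b * D' b (ptl \<chi>0 z \<eta>))"
        unfolding \<beta>_def
        by (intro sum.cong refl) (simp add: gradE[OF g] U_def ub_def lin1_add[OF l] lin1_sc[OF l])
      then show ?thesis using lin1_expand[OF l, of v] by simp
    qed
    have spanz: "h v = 0" if "ok z" "lin1 h" "\<And>u j. h (grad (powf u (Suc j)) (ptl \<chi>0 z \<eta>)) = 0" for z h v
      using that(1) by (intro span_grads[OF that(2,3), of u0 \<tau>]) (auto simp: ok_def U_def ub_def)
    \<comment> \<open>Skew-symmetry is known on pairs of gradients of power sums, and these span V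
      at parameters with \<open>ok\<close>.\<close>
    have skew: "\<beta> z v w = - \<beta> z w v" if z: "ok z" for z v w
    proof -
      have 1: "\<beta> z v (grad (powf u (Suc j)) (ptl \<chi>0 z \<eta>)) + \<beta> z (grad (powf u (Suc j)) (ptl \<chi>0 z \<eta>)) v = 0" for u j v
      proof (rule spanz[OF z])
        show "lin1 (\<lambda>v. \<beta> z v (grad (powf u (Suc j)) (ptl \<chi>0 z \<eta>)) + \<beta> z (grad (powf u (Suc j)) (ptl \<chi>0 z \<eta>)) v)"
          using l1 l2 by (simp add: lin1_def algebra_simps)
        fix u' j'
        obtain P1 where P1: "good k (int (Suc j)) (powf u (Suc j)) P1 (DD u j)" using DD by blast
        obtain P2 where P2: "good k (int (Suc j')) (powf u' (Suc j')) P2 (DD u' j')" using DD by blast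
        show "\<beta> z (grad (powf u' (Suc j')) (ptl \<chi>0 z \<eta>)) (grad (powf u (Suc j)) (ptl \<chi>0 z \<eta>)) +
          \<beta> z (grad (powf u (Suc j)) (ptl \<chi>0 z \<eta>)) (grad (powf u' (Suc j')) (ptl \<chi>0 z \<eta>)) = 0"
          unfolding grad\<beta>[OF P1 z] grad\<beta>[OF P2 z] using good_skew[OF P1 P2] by simp
      qed
      have "\<beta> z v w + \<beta> z w v = 0"
      proof (rule spanz[OF z, of "\<lambda>w. \<beta> z v w + \<beta> z w v"])
        show "lin1 (\<lambda>w. \<beta> z v w + \<beta> z w v)" using l1 l2 by (simp add: lin1_def algebra_simps)
      qed (rule 1)
      then show ?thesis by (simp add: eq_neg_iff_add_eq_0)
    qed
    have \<beta>E: "\<beta> z w x = E z w x" if z: "ok z" and x: "x \<in> U" for z w x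
    proof -
      have "\<beta> z w x - E z w x = 0"
      proof (rule spanz[OF z, of "\<lambda>w. \<beta> z w x - E z w x"])
        show "lin1 (\<lambda>w. \<beta> z w x - E z w x)" by (intro lin1_diff' l1 El)
        fix u j
        obtain P1 where P1: "good k (int (Suc j)) (powf u (Suc j)) P1 (DD u j)" using DD by blast
        show "\<beta> z (grad (powf u (Suc j)) (ptl \<chi>0 z \<eta>)) x - E z (grad (powf u (Suc j)) (ptl \<chi>0 z \<eta>)) x = 0"
          by (simp add: grad\<beta>[OF P1 z] gradE[OF P1 z x])
      qed
      then show ?thesis by simp
    qed
    have bounded: "\<exists>C. eventually (\<lambda>z. norm (\<beta> z v w) \<le> C) (at z0)" for z0 v w
    proof -
      let ?p = "ptl \<chi>0 z0 \<eta>"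
      obtain \<alpha> where \<alpha>: "\<And>l. l \<in> Z \<Longrightarrow> pair l ?p = 0 \<Longrightarrow> \<exists>c. l = sc c \<alpha>"
      proof (cases "\<exists>l1\<in>Z. pair l1 ?p = 0")
        case True
        then obtain l1 where l1: "l1 \<in> Z" "pair l1 ?p = 0" by blast
        have "\<exists>c. l = sc c l1" if l: "l \<in> Z" "pair l ?p = 0" for l
        proof (rule ccontr)
          assume "\<nexists>c. l = sc c l1"
          then have "sc (pair l1 \<chi>0) l - sc (pair l \<chi>0) l1 \<in> Z2" using l l1 by (auto simp: Z2_def)
          then have "pair (sc (pair l1 \<chi>0) l - sc (pair l \<chi>0) l1) \<eta> \<noteq> 0" using \<eta> by blast
          moreover have "pair l1 \<chi>0 = - z0 * pair l1 \<eta>" "pair l \<chi>0 = - z0 * pair l \<eta>"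
            using l(2) l1(2) by (simp_all add: pair_ptl add_eq_0_iff2)
          ultimately show False by (simp add: lin1_diff[OF pair_lin1] lin1_sc[OF pair_lin1])
        qed
        then show thesis using that by blast
      next
        case False then show thesis using that by blast
      qed
      show ?thesis
      proof (rule bracket_bounded[OF l1 l2])
        show "eventually (\<lambda>z. \<forall>v w. \<beta> z v w = - \<beta> z w v) (at z0)"
          using okev[of z0] by (rule eventually_mono) (use skew in blast)
        show "eventually (\<lambda>z. \<forall>u j v. \<beta> z (grad (powf u (Suc j)) (ptl \<chi>0 z \<eta>)) v = DD u j v (ptl \<chi>0 z \<eta>)) (at z0)"
          using okev[of z0]
        proof (rule eventually_mono, intro allI)
          fix z u j v assume z: "ok z"
          obtain P1 where P1: "good k (int (Suc j)) (powf u (Suc j)) P1 (DD u j)" using DD by blast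
          show "\<beta> z (grad (powf u (Suc j)) (ptl \<chi>0 z \<eta>)) v = DD u j v (ptl \<chi>0 z \<eta>)" by (rule grad\<beta>[OF P1 z])
        qed
        fix h v assume h: "h \<in> G" and st: "\<And>v. pair (h v) ?p = pair v ?p"
        have "\<forall>x\<in>Basis. \<exists>c. x - h x = sc c \<alpha>"
        proof
          fix x assume x: "x \<in> Basis"
          show "\<exists>c. x - h x = sc c \<alpha>"
          proof (cases "x - h x = 0")
            case True then show ?thesis by (intro exI[of _ 0]) simp
          next
            case False
            then have "x - h x \<in> Z" using x h by (auto simp: Z_def)
            then show ?thesis using st by (intro \<alpha>) (simp_all add: lin1_diff[OF pair_lin1])
          qed
        qed
        then obtain c where c: "\<And>x. x \<in> Basis \<Longrightarrow> x - h x = sc (c x) \<alpha>" by metis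
        have "v - h v = sc (\<Sum>x\<in>Basis. representation Basis v x * c x) \<alpha>"
        proof (rule pair_eqI)
          fix q
          have l: "lin1 (\<lambda>v. pair (v - h v) q)" unfolding lin1_diff[OF pair_lin1]
            by (intro lin1_diff' pair_lin1 lin1_G[OF pair_lin1] h)
          show "pair (v - h v) q = pair (sc (\<Sum>x\<in>Basis. representation Basis v x * c x) \<alpha>) q"
            unfolding lin1_expand[OF l, of v] by (simp add: c lin1_sc[OF pair_lin1] sum_distrib_right mult.assoc)
        qed
        then show "\<exists>c. v - h v = sc c \<alpha>" by blast
      qed
    qed
    \<comment> \<open>On the line, \<open>nrm\<close> divides \<open>XX\<close> because \<beta> is
      bounded near every root. The divisor has its full degree |G| - 1 since
      \<open>nrm x \<eta> \<noteq> 0\<close>, which exceeds the degree |G| + 1 - k of the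
      dividend.\<close>
    have XX0: "XX x w \<chi>0 = 0" if x: "x \<in> U" for x w
    proof (cases "int (card G) + 1 - k < 0")
      case True then show ?thesis using hp_neg[OF XX_hp] by blast
    next
      case False
      obtain P1 where P1: "\<And>z. poly P1 z = XX x w (ptl \<chi>0 z \<eta>)" "Polynomial.degree P1 \<le> nat (int (card G) + 1 - k)"
        using hp_line[OF XX_hp[of x w], of \<chi>0 \<eta>] False by auto
      obtain Q where Q: "\<And>z. poly Q z = nrm x (ptl \<chi>0 z \<eta>)"
        "int (card G) - 1 \<ge> 0 \<longrightarrow> Polynomial.coeff Q (nat (int (card G) - 1)) = nrm x \<eta>"
        using hp_line[OF nrm_hp[of x], of \<chi>0 \<eta>] by blast
      have c: "int (card G) - 1 \<ge> 0" using card_G_id by (metis of_nat_0_le_iff)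
      then have cQ: "Polynomial.coeff Q (nat (int (card G) - 1)) \<noteq> 0" using Q(2) nU(1)[OF x] by auto
      have "Q dvd P1"
      proof (rule poly_bounded_dvd)
        show "Q \<noteq> 0" using cQ by auto
        fix z0
        obtain C where "eventually (\<lambda>z. norm (\<beta> z w x) \<le> C) (at z0)" using bounded by blast
        then have "eventually (\<lambda>z. norm (poly P1 z) \<le> C * norm (poly Q z)) (at z0)"
          using okev[of z0]
        proof eventually_elim
          case (elim z)
          have "XX x w (ptl \<chi>0 z \<eta>) = \<beta> z w x * nrm x (ptl \<chi>0 z \<eta>)"
            unfolding \<beta>E[OF elim(2) x] E_def using elim(2) x by (simp add: ok_def)
          then show ?case unfolding P1 Q using elim(1) by (simp add: norm_mult mult_right_mono)
        qed
        then show "\<exists>C. eventually (\<lambda>z. norm (poly P1 z) \<le> C * norm (poly Q z)) (at z0)" by blast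
      qed
      moreover have "Polynomial.degree P1 < Polynomial.degree Q"
        using P1(2) le_degree[OF cQ] k3 c False by linarith
      ultimately have "P1 = 0" using dvd_imp_degree_le[of Q P1] by fastforce
      then show ?thesis using P1(1)[of 0] by simp
    qed
    have "D x \<chi>0 = 0" if x: "x \<in> U" for x
      using nrm_D[OF P, of x \<chi>0] XX0[OF x] nU(2)[OF x] by simp
    note Dx = this
    have d1: "D u0 \<chi>0 = 0" by (rule Dx) (simp add: U_def)
    have d2: "D (b + sc (\<tau> b) u0) \<chi>0 = 0" if "b \<in> Basis" for b
      by (rule Dx) (use that in \<open>simp add: U_def ub_def\<close>)
    show ?thesis by (rule family_zero[OF Dl[of \<chi>0] d1 d2])
  qed
  obtain p1 where p1: "\<And>l. l \<in> Z \<Longrightarrow> pair l p1 \<noteq> 0" using avoid_points[OF finZ Z0] by blast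
  show ?thesis
  proof (rule hp_cancel[OF good_D(1)[OF P] hp_setprod[OF finZ hp_pair]])
    show "D v p * (\<Prod>l\<in>Z. pair l p) = 0" for p
    proof (cases "\<forall>l\<in>Z. pair l p \<noteq> 0")
      case True
      then have "D v p = 0" by (intro pt) blast
      then show ?thesis by (simp only: mult_zero_left)
    next
      case False
      then have "(\<Prod>l\<in>Z. pair l p) = 0" using finZ by (intro prod_zero) auto
      then show ?thesis by (simp only: mult_zero_right)
    qed
    show "(\<Prod>l\<in>Z. pair l p1) \<noteq> 0" using p1 finZ by simp
  qed
qed

end

end

subsection \<open>Central lifts and finiteness over the centre\<close>

context hecke_alg
begin

section \<open>The centre modulo J\<close>

definition cent :: "'v sk set" where "cent = {z \<in> FG. \<forall>x\<in>FG. z * x - x * z \<in> J}"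

lemma cent_FG: "z \<in> cent \<Longrightarrow> z \<in> FG" by (simp add: cent_def)
lemma cent_com: "z \<in> cent \<Longrightarrow> x \<in> FG \<Longrightarrow> z * x - x * z \<in> J" by (simp add: cent_def)
lemma cent_0: "0 \<in> cent" by (simp add: cent_def)
lemma cent_add: "z \<in> cent \<Longrightarrow> w \<in> cent \<Longrightarrow> z + w \<in> cent"
proof -
  assume zw: "z \<in> cent" "w \<in> cent"
  have "(z + w) * x - x * (z + w) \<in> J" if "x \<in> FG" for x
    using J_add[OF cent_com[OF zw(1) that] cent_com[OF zw(2) that]] by (simp add: algebra_simps)
  then show ?thesis using zw FG_add by (simp add: cent_def)
qed

lemma cent_from_generators:
  assumes P: "P \<in> FG" "comG P" and b: "\<And>v. brk P v \<in> J"
  shows "P \<in> cent"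
proof -
  have w: "P * MM w g - MM w g * P \<in> J" if g: "g \<in> G" for w g
  proof (induction w)
    case Nil
    have "MM [] g * P - P * MM [] g \<in> J" using P(2) g by (auto simp: comG_def)
    from J_uminus[OF this] show ?case by simp
  next
    case (Cons v w)
    have eq: "P * MM (v # w) g - MM (v # w) g * P = brk P v * MM w g + MM [v] id * (P * MM w g - MM w g * P)"
    proof -
      have "MM (v # w) g = MM [v] id * MM w g" by (simp add: MM_mult)
      then show ?thesis by (simp only:) (simp add: algebra_simps)
    qed
    show ?case unfolding eq using g by (intro J_add J_right[OF _ b] J_left[OF _ Cons.IH] FG_MM) auto
  qed
  have "P * x - x * P \<in> J" if x: "x \<in> FG" for x
  proof -
    have "P * x - x * P = (\<Sum>k\<in>keys x. CC (lookup x k) * (P * MM (wd k) (gp k) - MM (wd k) (gp k) * P))"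
      by (subst (1 2) sk_expand[of x])
        (simp add: sum_distrib_left sum_distrib_right sum_subtractf right_diff_distrib CC_move mult.assoc)
    also have "\<dots> \<in> J" using x by (intro J_sum J_CC w) (simp add: FG_def)
    finally show ?thesis .
  qed
  then show ?thesis using P by (simp add: cent_def)
qed

text \<open>The start is k = 3, as the bracket of degree -2 is given by \<open>\<kappa> id\<close>.
  Each vanishing bracket gains one degree, and when k exceeds m + 1 all commutators with vectors lie
  in \<open>J\<close>. The induction treats all invariants together because vanishing needs good
  lifts of the power sums.\<close>

lemma central_lift:
  assumes \<omega>: "\<And>u v. \<kappa> id u v = 0" and f: "hp m f" and inv: "Ginv f"
  shows "\<exists>P\<in>F m. (\<forall>h p. sg m P h p = (if h = id then f p else 0)) \<and> P \<in> cent"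
proof -
  have all: "hp m f \<Longrightarrow> Ginv f \<Longrightarrow> \<exists>P. plift (int k + 3) m f P" for k m f
  proof (induction k arbitrary: m f)
    case 0
    obtain P where P: "plift 2 m f P" "\<And>v p. sg (m - 1) (brk P v) id p = \<kappa> id (grad f p) v"
      using plift2[OF 0] by blast
    obtain P' where P': "good 2 m f P' (\<lambda>v p. sg (m + 1 - 2) (brk P v) id p)"
      using plift_good[OF P(1)] by auto
    have "sg (m + 1 - 2) (brk P v) id p = 0" for v p
    proof -
      have "m + 1 - 2 = m - 1" by simp
      then show ?thesis using P(2)[of v p] \<omega> by simp
    qed
    from good_zero_plift[OF P' this] show ?case by auto
  next
    case (Suc k)
    have g: "\<exists>P D. good (int k + 3) m f P D" if "hp m f" "Ginv f" for m f
    proof -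
      obtain P where "plift (int k + 3) m f P" using Suc.IH \<open>hp m f\<close> \<open>Ginv f\<close> by blast
      from plift_good[OF this] show ?thesis by auto
    qed
    obtain P D where P: "good (int k + 3) m f P D" using g[OF Suc.prems] by blast
    have "D v p = 0" for v p
      by (rule good_vanish[OF _ g P]) auto
    from good_zero_plift[OF P this] show ?case by (intro exI[of _ P]) (simp add: algebra_simps)
  qed
  obtain P where P: "plift (int (nat (m + 1)) + 3) m f P" using all[OF f inv] by blast
  have "m + 1 - (int (nat (m + 1)) + 3) < 0" by simp
  then have "brk P v \<in> J" for v using pliftD(3)[OF P, of v] F_neg by simp
  then have "P \<in> cent" using pliftD[OF P] F_FG by (intro cent_from_generators) auto
  then show ?thesis using pliftD[OF P] by (intro bexI[of _ P]) auto
qed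

section \<open>Polynomials as a finite module over the invariants\<close>

definition exps :: "('v \<Rightarrow> nat) set" where "exps = (Basis \<rightarrow>\<^sub>E {..<card G})"

definition mono :: "('v \<Rightarrow> nat) \<Rightarrow> ('v \<Rightarrow> complex) \<Rightarrow> complex" where
  "mono \<mu> p = (\<Prod>b\<in>Basis. pair b p ^ \<mu> b)"

lemma finite_exps: "finite exps" unfolding exps_def by (intro finite_PiE finite_Basis) auto

lemma mono_hp: "hp (int (sum \<mu> Basis)) (mono \<mu>)"
proof -
  have "hp (int (sum \<mu> A)) (\<lambda>p. \<Prod>b\<in>A. pair b p ^ \<mu> b)" if "finite A" for A :: "'v set"
    using that
  proof (induction A rule: finite_induct)
    case empty then show ?case using hp_const[of 1] by simp
  next
    case (insert x A) then show ?case
      using hp_mult[OF hp_pair_power[of "\<mu> x" x] insert.IH] by simp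
  qed
  then show ?thesis using finite_Basis unfolding mono_def[abs_def] by blast
qed

text \<open>Generation by the monomials with exponents below |G| over the invariants. The degrees of
  the coefficients are part of the statement because the central lifts are made for homogeneous
  invariants.\<close>

definition SP :: "int \<Rightarrow> (('v \<Rightarrow> complex) \<Rightarrow> complex) \<Rightarrow> bool" where
  "SP m f \<longleftrightarrow> (\<exists>r. (\<forall>\<mu>\<in>exps. hp (m - int (sum \<mu> Basis)) (r \<mu>) \<and> Ginv (r \<mu>))
     \<and> (\<forall>p. f p = (\<Sum>\<mu>\<in>exps. r \<mu> p * mono \<mu> p)))"

lemma Ginv_0: "Ginv (\<lambda>p. 0)" by (simp add: Ginv_def)
lemma Ginv_add: "Ginv f \<Longrightarrow> Ginv g \<Longrightarrow> Ginv (\<lambda>p. f p + g p)" by (simp add: Ginv_def)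
lemma Ginv_mult: "Ginv f \<Longrightarrow> Ginv g \<Longrightarrow> Ginv (\<lambda>p. f p * g p)" by (simp add: Ginv_def)
lemma Ginv_cmult: "Ginv f \<Longrightarrow> Ginv (\<lambda>p. z * f p)" by (simp add: Ginv_def)

lemma SP_0: "SP m (\<lambda>p. 0)"
  unfolding SP_def by (intro exI[of _ "\<lambda>\<mu> p. 0"]) (auto intro: hp_zero Ginv_0)
lemma SP_add: "SP m f \<Longrightarrow> SP m g \<Longrightarrow> SP m (\<lambda>p. f p + g p)"
proof -
  assume f: "SP m f" and g: "SP m g"
  from f obtain r where r0: "\<forall>\<mu>\<in>exps. hp (m - int (sum \<mu> Basis)) (r \<mu>) \<and> Ginv (r \<mu>)"
    "\<forall>p. f p = (\<Sum>\<mu>\<in>exps. r \<mu> p * mono \<mu> p)" unfolding SP_def by (elim exE conjE)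
  note r = conjunct1[OF bspec[OF r0(1)]] conjunct2[OF bspec[OF r0(1)]] spec[OF r0(2)]
  from g obtain s where s0: "\<forall>\<mu>\<in>exps. hp (m - int (sum \<mu> Basis)) (s \<mu>) \<and> Ginv (s \<mu>)"
    "\<forall>p. g p = (\<Sum>\<mu>\<in>exps. s \<mu> p * mono \<mu> p)" unfolding SP_def by (elim exE conjE)
  note s = conjunct1[OF bspec[OF s0(1)]] conjunct2[OF bspec[OF s0(1)]] spec[OF s0(2)]
  show ?thesis unfolding SP_def
    by (intro exI[of _ "\<lambda>\<mu> p. r \<mu> p + s \<mu> p"] conjI ballI allI hp_add Ginv_add)
      (simp_all add: r s distrib_right sum.distrib del: of_nat_sum)
qed
lemma SP_cmult: "SP m f \<Longrightarrow> SP m (\<lambda>p. z * f p)"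
proof -
  assume f: "SP m f"
  from f obtain r where r0: "\<forall>\<mu>\<in>exps. hp (m - int (sum \<mu> Basis)) (r \<mu>) \<and> Ginv (r \<mu>)"
    "\<forall>p. f p = (\<Sum>\<mu>\<in>exps. r \<mu> p * mono \<mu> p)" unfolding SP_def by (elim exE conjE)
  note r = conjunct1[OF bspec[OF r0(1)]] conjunct2[OF bspec[OF r0(1)]] spec[OF r0(2)]
  show ?thesis unfolding SP_def
    by (intro exI[of _ "\<lambda>\<mu> p. z * r \<mu> p"] conjI ballI allI hp_cmult Ginv_cmult)
      (simp_all add: r sum_distrib_left mult.assoc del: of_nat_sum)
qed
lemma SP_sum: "(\<And>i. i \<in> A \<Longrightarrow> SP m (f i)) \<Longrightarrow> SP m (\<lambda>p. \<Sum>i\<in>A. f i p)"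
  by (induction A rule: infinite_finite_induct) (auto intro: SP_0 SP_add)

lemma SP_term:
  assumes "\<mu> \<in> exps" "hp n r" "Ginv r" "m = n + int (sum \<mu> Basis)"
  shows "SP m (\<lambda>p. r p * mono \<mu> p)"
  unfolding SP_def
proof (intro exI[of _ "\<lambda>\<nu>. if \<nu> = \<mu> then r else (\<lambda>p. 0)"] conjI ballI allI)
  show "hp (m - int (sum \<nu> Basis)) (if \<nu> = \<mu> then r else (\<lambda>p. 0))" for \<nu>
    using assms(2,4) hp_zero by (cases "\<nu> = \<mu>") auto
  show "Ginv (if \<nu> = \<mu> then r else (\<lambda>p. 0))" for \<nu> using assms(3) Ginv_0 by auto
  fix p
  have "(\<Sum>\<nu>\<in>exps. (if \<nu> = \<mu> then r else (\<lambda>p. 0)) p * mono \<nu> p) = (\<Sum>\<nu>\<in>exps. if \<nu> = \<mu> then r p * mono \<mu> p else 0)"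
    by (intro sum.cong) auto
  then show "r p * mono \<mu> p = (\<Sum>\<nu>\<in>exps. (if \<nu> = \<mu> then r else (\<lambda>p. 0)) p * mono \<nu> p)"
    using assms(1) finite_exps by simp
qed

text \<open>Coefficients of the orbit polynomial of \<open>u\<close>, now with the root for
  \<open>g = id\<close>. They are invariant, and the polynomial is the equation of integral
  dependence of \<open>u\<close>.\<close>

definition ocf :: "'v \<Rightarrow> nat \<Rightarrow> ('v \<Rightarrow> complex) \<Rightarrow> complex" where
  "ocf u j p = Polynomial.coeff (\<Prod>g\<in>G. [:- pair (g u) p, 1:]) j"

lemma ocf_hp: "hp (int (card G) - int j) (ocf u j)"
  unfolding ocf_def[abs_def] by (rule coeff_hp[OF finite_G])

lemma ocf_inv: "Ginv (ocf u j)"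
  unfolding Ginv_def
proof (intro ballI allI)
  fix h p assume h: "h \<in> G"
  have "(\<Prod>g\<in>G. [:- pair (g u) (act h p), 1:]) = (\<Prod>g\<in>G. [:- pair ((h \<circ> g) u) p, 1:])"
    by (simp add: pair_act[OF h])
  also have "\<dots> = (\<Prod>g\<in>G. [:- pair (g u) p, 1:])"
    by (rule prod.reindex_bij_betw[OF left_bij[OF h], of "\<lambda>g. [:- pair (g u) p, 1:]"])
  finally show "ocf u j (act h p) = ocf u j p" by (simp add: ocf_def)
qed

lemma ocf_power: "pair u p ^ card G = (\<Sum>j<card G. - ocf u j p * pair u p ^ j)"
proof -
  let ?R = "\<Prod>g\<in>G. [:- pair (g u) p, 1:]"
  have d: "Polynomial.degree ?R = card G"
    using degree_prod_eq_sum_degree[of G "\<lambda>g. [:- pair (g u) p, 1:]"] by simp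
  have l: "Polynomial.coeff ?R (card G) = 1"
    using lead_coeff_prod[of "\<lambda>g. [:- pair (g u) p, 1:]" G] unfolding d by simp
  have "0 = poly ?R (pair u p)" using finite_G id_G unfolding poly_prod
    by (intro prod_zero[symmetric] bexI[of _ id]) auto
  also have "\<dots> = (\<Sum>j\<le>card G. ocf u j p * pair u p ^ j)" unfolding poly_altdef d ocf_def ..
  also have "\<dots> = (\<Sum>j<card G. ocf u j p * pair u p ^ j) + pair u p ^ card G"
    by (simp add: lessThan_Suc_atMost[symmetric] l ocf_def)
  finally have "pair u p ^ card G = - (\<Sum>j<card G. ocf u j p * pair u p ^ j)"
    by (metis add.commute eq_neg_iff_add_eq_0)
  then show ?thesis by (simp add: sum_negf)
qed

lemma mono_upd: "b \<in> Basis \<Longrightarrow> mono (\<mu>(b := i)) p = pair b p ^ i * (\<Prod>c\<in>Basis - {b}. pair c p ^ \<mu> c)"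
  unfolding mono_def by (subst prod.remove[of _ b]) (auto simp: finite_Basis intro!: prod.cong)

lemma sum_upd: "b \<in> Basis \<Longrightarrow> sum (\<mu>(b := i)) Basis = i + sum \<mu> (Basis - {b})"
  by (subst sum.remove[of _ b]) (auto simp: finite_Basis intro!: sum.cong)

text \<open>The exponent of \<open>b\<close> rises by one; if it reaches |G|, the orbit polynomial
  replaces the power by lower ones with invariant coefficients.\<close>

lemma SP_mult_basis: assumes f: "SP m f" and b: "b \<in> Basis" shows "SP (m + 1) (\<lambda>p. pair b p * f p)"
proof -
  from f obtain r where r0: "\<forall>\<mu>\<in>exps. hp (m - int (sum \<mu> Basis)) (r \<mu>) \<and> Ginv (r \<mu>)"
    "\<forall>p. f p = (\<Sum>\<mu>\<in>exps. r \<mu> p * mono \<mu> p)" unfolding SP_def by (elim exE conjE)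
  note r = conjunct1[OF bspec[OF r0(1)]] conjunct2[OF bspec[OF r0(1)]] spec[OF r0(2)]
  have t: "SP (m + 1) (\<lambda>p. pair b p * (r \<mu> p * mono \<mu> p))" if \<mu>: "\<mu> \<in> exps" for \<mu>
  proof -
    let ?rest = "\<lambda>p. \<Prod>c\<in>Basis - {b}. pair c p ^ \<mu> c"
    have m: "mono \<mu> p = pair b p ^ \<mu> b * ?rest p" for p using mono_upd[OF b, of \<mu> "\<mu> b" p] by simp
    have s: "sum \<mu> Basis = \<mu> b + sum \<mu> (Basis - {b})" using sum_upd[OF b, of \<mu> "\<mu> b"] by simp
    have upd: "\<mu>(b := i) \<in> exps" if "i < card G" for i using \<mu> b that by (auto simp: exps_def PiE_def extensional_def)
    have \<mu>b: "\<mu> b < card G" using \<mu> b by (auto simp: exps_def)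
    show ?thesis
    proof (cases "Suc (\<mu> b) < card G")
      case True
      have "SP (m + 1) (\<lambda>p. r \<mu> p * mono (\<mu>(b := Suc (\<mu> b))) p)"
        by (rule SP_term[OF upd[OF True] r(1)[OF \<mu>] r(2)[OF \<mu>]]) (unfold sum_upd[OF b] s, simp)
      then show ?thesis unfolding mono_upd[OF b] m by (simp add: mult_ac)
    next
      case False
      then have eqn: "card G = Suc (\<mu> b)" using \<mu>b by simp
      have "SP (m + 1) (\<lambda>p. \<Sum>j<card G. (-1) * ((r \<mu> p * ocf b j p) * mono (\<mu>(b := j)) p))"
      proof (intro SP_sum SP_cmult)
        fix j assume "j \<in> {..<card G}"
        then have j: "j < card G" by simp
        show "SP (m + 1) (\<lambda>p. (r \<mu> p * ocf b j p) * mono (\<mu>(b := j)) p)"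
          by (rule SP_term[OF upd[OF j] hp_mult[OF r(1)[OF \<mu>] ocf_hp] Ginv_mult[OF r(2)[OF \<mu>] ocf_inv]])
            (unfold sum_upd[OF b] s eqn, simp)
      qed
      moreover have "pair b p * (r \<mu> p * mono \<mu> p) = (\<Sum>j<card G. (-1) * ((r \<mu> p * ocf b j p) * mono (\<mu>(b := j)) p))" for p
      proof -
        have "pair b p * (r \<mu> p * mono \<mu> p) = r \<mu> p * ?rest p * pair b p ^ card G" by (simp add: m eqn mult_ac)
        also have "\<dots> = (\<Sum>j<card G. (-1) * ((r \<mu> p * ocf b j p) * mono (\<mu>(b := j)) p))"
          unfolding ocf_power mono_upd[OF b] sum_distrib_left by (intro sum.cong refl) simp
        finally show ?thesis .
      qed
      ultimately show ?thesis by simp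
    qed
  qed
  have "SP (m + 1) (\<lambda>p. \<Sum>\<mu>\<in>exps. pair b p * (r \<mu> p * mono \<mu> p))" by (intro SP_sum t)
  then show ?thesis by (simp add: r(3) sum_distrib_left)
qed

lemma SP_hp: "hp m f \<Longrightarrow> SP m f"
proof (induction rule: hp.induct)
  case (hp_prod w)
  show ?case
  proof (induction w)
    case Nil
    let ?\<mu> = "\<lambda>b. if b \<in> Basis then 0 else undefined"
    have "card G > 0" using finite_G id_G card_gt_0_iff by blast
    then have "?\<mu> \<in> exps" by (auto simp: exps_def)
    moreover have "sum ?\<mu> Basis = 0" by simp
    moreover have "mono ?\<mu> p = 1" for p unfolding mono_def by (intro prod.neutral) simp
    ultimately show ?case using SP_term[OF _ hp_const[of 1], of ?\<mu> 0] by (simp add: Ginv_def)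
  next
    case (Cons v w)
    have "SP (int (length w) + 1) (\<lambda>p. \<Sum>b\<in>Basis. representation Basis v b * (pair b p * (\<Prod>v\<leftarrow>w. pair v p)))"
      by (intro SP_sum SP_cmult SP_mult_basis Cons.IH)
    moreover have "(\<Sum>b\<in>Basis. representation Basis v b * (pair b p * (\<Prod>v\<leftarrow>w. pair v p))) = (\<Prod>v\<leftarrow>v # w. pair v p)" for p
      using lin1_expand[OF pair_lin1, of v p] by (simp add: sum_distrib_right mult.assoc)
    ultimately show ?case by (simp add: add.commute)
  qed
qed (auto intro: SP_0 SP_add SP_cmult)

lemma sg_id_mult:
  assumes "a \<in> F m" "b \<in> F n" "\<And>h p. sg m a h p = (if h = id then f p else 0)"
  shows "sg (m + n) (a * b) h p = f p * sg n b h p"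
proof -
  have "sg (m + n) (a * b) h p = (\<Sum>g\<in>G. if g = id then f p * sg n b h p else 0)"
    unfolding sg_mult[OF assms(1,2)] assms(3)
    by (intro sum.cong refl) (auto simp: hp_act_id[OF sg_hp[OF assms(2)]])
  then show ?thesis using finite_G by simp
qed

lemma FG_F: "x \<in> FG \<Longrightarrow> \<exists>m::nat. x \<in> F (int m - 1)"
proof -
  assume x: "x \<in> FG"
  let ?m = "Suc (Max (insert 0 ((\<lambda>k. length (wd k)) ` keys x)))"
  have "\<forall>k\<in>keys (x - 0). int (length (wd k)) \<le> int ?m - 1" by simp
  then have "x \<in> F (int ?m - 1)" using x unfolding F_def by (auto intro!: bexI[of _ 0])
  then show ?thesis by blast
qed

definition fin_cent :: bool where
  "fin_cent \<longleftrightarrow> (\<exists>(N::nat) Y. (\<forall>i<N. Y i \<in> FG) \<and>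
     (\<forall>x\<in>FG. \<exists>z. (\<forall>i<N. z i \<in> cent) \<and> x - (\<Sum>i<N. z i * Y i) \<in> J))"

text \<open>The generators lift the monomials with small exponents, placed at each group element.
  The symbol of \<open>x\<close> is a combination of these over the invariants; with central lifts
  of the coefficients the combination matches \<open>x\<close> up to lower degree.\<close>

theorem finite_over_cent:
  assumes \<omega>: "\<And>u v. \<kappa> id u v = 0"
  shows fin_cent
proof -
  define Y where "Y \<mu> g = (SOME a. a \<in> F (int (sum \<mu> Basis)) \<and> (\<forall>h p. sg (int (sum \<mu> Basis)) a h p = (if h = g then mono \<mu> p else 0)))" for \<mu> g
  have Y': "Y \<mu> g \<in> F (int (sum \<mu> Basis)) \<and> (\<forall>h p. sg (int (sum \<mu> Basis)) (Y \<mu> g) h p = (if h = g then mono \<mu> p else 0))" if "g \<in> G" for \<mu> g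
    unfolding Y_def by (rule someI_ex) (use hp_lift[OF mono_hp that, of \<mu>] in blast)
  have Y: "Y \<mu> g \<in> F (int (sum \<mu> Basis))" "sg (int (sum \<mu> Basis)) (Y \<mu> g) h p = (if h = g then mono \<mu> p else 0)" if "g \<in> G" for \<mu> g h p
    using Y'[OF that] by blast+
  let ?I = "exps \<times> G"
  have finI: "finite ?I" using finite_exps finite_G by simp
  \<comment> \<open>The index is shifted by one so that the induction starts at degree -1, that is,
    in \<open>J\<close>.\<close>
  have main: "x \<in> F (int m - 1) \<Longrightarrow> \<exists>z. (\<forall>i\<in>?I. z i \<in> cent) \<and> x - (\<Sum>(\<mu>,g)\<in>?I. z (\<mu>,g) * Y \<mu> g) \<in> J" for m x
  proof (induction m arbitrary: x)
    case 0
    then have "x \<in> J" using F_neg[of "-1"] by simp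
    then show ?case by (intro exI[of _ "\<lambda>i. 0"]) (simp add: cent_0 case_prod_beta)
  next
    case (Suc m)
    then have x: "x \<in> F (int m)" by simp
    have "\<forall>g. SP (int m) (sg (int m) x g)" using SP_hp[OF sg_hp[OF x]] by blast
    then have "\<forall>g. \<exists>r. (\<forall>\<mu>\<in>exps. hp (int m - int (sum \<mu> Basis)) (r \<mu>) \<and> Ginv (r \<mu>))
      \<and> (\<forall>p. sg (int m) x g p = (\<Sum>\<mu>\<in>exps. r \<mu> p * mono \<mu> p))" unfolding SP_def .
    from choice[OF this] obtain r where r': "\<forall>g. (\<forall>\<mu>\<in>exps. hp (int m - int (sum \<mu> Basis)) (r g \<mu>) \<and> Ginv (r g \<mu>))
      \<and> (\<forall>p. sg (int m) x g p = (\<Sum>\<mu>\<in>exps. r g \<mu> p * mono \<mu> p))" ..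
    have r: "hp (int m - int (sum \<mu> Basis)) (r g \<mu>)" "Ginv (r g \<mu>)" if "\<mu> \<in> exps" for g \<mu>
      using bspec[OF conjunct1[OF spec[OF r', of g]] that] by simp_all
    have rs: "sg (int m) x g p = (\<Sum>\<mu>\<in>exps. r g \<mu> p * mono \<mu> p)" for g p
      by (rule spec[OF conjunct2[OF spec[OF r', of g]]])
    have "\<forall>i\<in>?I. \<exists>P. P \<in> F (int m - int (sum (fst i) Basis)) \<and> (\<forall>h p. sg (int m - int (sum (fst i) Basis)) P h p
        = (if h = id then r (snd i) (fst i) p else 0)) \<and> P \<in> cent"
    proof
      fix i assume "i \<in> ?I"
      then have i: "fst i \<in> exps" by (simp add: mem_Times_iff)
      from central_lift[OF \<omega> r(1)[OF i] r(2)[OF i], of "snd i"]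
      show "\<exists>P. P \<in> F (int m - int (sum (fst i) Basis)) \<and> (\<forall>h p. sg (int m - int (sum (fst i) Basis)) P h p
        = (if h = id then r (snd i) (fst i) p else 0)) \<and> P \<in> cent" by blast
    qed
    from bchoice[OF this] obtain z where z': "\<forall>i\<in>?I. z i \<in> F (int m - int (sum (fst i) Basis)) \<and>
      (\<forall>h p. sg (int m - int (sum (fst i) Basis)) (z i) h p = (if h = id then r (snd i) (fst i) p else 0)) \<and> z i \<in> cent" ..
    have z: "z i \<in> F (int m - int (sum (fst i) Basis))"
      "sg (int m - int (sum (fst i) Basis)) (z i) h p = (if h = id then r (snd i) (fst i) p else 0)"
      "z i \<in> cent" if "i \<in> ?I" for i h p
      using bspec[OF z' that] by blast+
    let ?s = "\<Sum>(\<mu>,g)\<in>?I. z (\<mu>,g) * Y \<mu> g"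
    have zY: "z (\<mu>,g) * Y \<mu> g \<in> F (int m)" if "(\<mu>,g) \<in> ?I" for \<mu> g
      using F_mult[OF z(1)[OF that] Y(1)[of g \<mu>]] that by simp
    have s: "?s \<in> F (int m)" by (intro F_sum) (use zY in auto)
    have sgzY: "sg (int m) (z (\<mu>,g) * Y \<mu> g) h p = (if h = g then r g \<mu> p * mono \<mu> p else 0)"
      if i: "(\<mu>,g) \<in> ?I" for \<mu> g h p
    proof -
      have g: "g \<in> G" using i by simp
      have "sg ((int m - int (sum \<mu> Basis)) + int (sum \<mu> Basis)) (z (\<mu>,g) * Y \<mu> g) h p
        = r g \<mu> p * sg (int (sum \<mu> Basis)) (Y \<mu> g) h p"
        using sg_id_mult[OF z(1)[OF i, unfolded fst_conv] Y(1)[OF g, of \<mu>] z(2)[OF i, unfolded fst_conv snd_conv]] .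
      then show ?thesis by (simp add: Y(2)[OF g] del: of_nat_sum)
    qed
    have "x - ?s \<in> F (int m - 1)"
    proof (rule symbol_kernel[OF F_diff[OF x s]])
      fix h p assume h: "h \<in> G"
      have "sg (int m) ?s h p = (\<Sum>(\<mu>,g)\<in>?I. if h = g then r g \<mu> p * mono \<mu> p else 0)"
        unfolding sg_sum by (intro sum.cong refl) (auto simp: sgzY)
      also have "\<dots> = (\<Sum>\<mu>\<in>exps. \<Sum>g\<in>G. if h = g then r g \<mu> p * mono \<mu> p else 0)"
        by (rule sum.cartesian_product[symmetric])
      also have "\<dots> = (\<Sum>\<mu>\<in>exps. r h \<mu> p * mono \<mu> p)" using h finite_G by simp
      finally show "sg (int m) (x - ?s) h p = 0" by (simp add: sg_diff rs)
    qed
    from Suc.IH[OF this] obtain z' where z': "\<forall>i\<in>?I. z' i \<in> cent"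
      "x - ?s - (\<Sum>(\<mu>,g)\<in>?I. z' (\<mu>,g) * Y \<mu> g) \<in> J" by (elim exE conjE)
    have "x - (\<Sum>(\<mu>,g)\<in>?I. (z (\<mu>,g) + z' (\<mu>,g)) * Y \<mu> g) = x - ?s - (\<Sum>(\<mu>,g)\<in>?I. z' (\<mu>,g) * Y \<mu> g)"
      by (simp add: distrib_right sum.distrib case_prod_beta)
    then have "x - (\<Sum>(\<mu>,g)\<in>?I. (z (\<mu>,g) + z' (\<mu>,g)) * Y \<mu> g) \<in> J" using z'(2) by (simp only:)
    moreover have "\<forall>i\<in>?I. z i + z' i \<in> cent" using z'(1) z(3) cent_add by blast
    ultimately show ?case by (intro exI[of _ "\<lambda>i. z i + z' i"] conjI)
  qed
  obtain e where e: "bij_betw e {..<card ?I} ?I" using ex_bij_betw_nat_finite[OF finI] by (auto simp: atLeast0LessThan)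
  show ?thesis unfolding fin_cent_def
  proof (rule exI[of _ "card ?I"], rule exI[of _ "\<lambda>i. Y (fst (e i)) (snd (e i))"], intro conjI allI impI ballI)
    have eI: "e i \<in> ?I" if "i < card ?I" for i using bij_betwE[OF e] that by blast
    show "Y (fst (e i)) (snd (e i)) \<in> FG" if "i < card ?I" for i
      using F_FG[OF Y(1)] eI[OF that] by (simp add: mem_Times_iff)
    fix x assume "x \<in> FG"
    then obtain m where "x \<in> F (int m - 1)" using FG_F by blast
    from main[OF this] obtain z where z: "\<forall>i\<in>?I. z i \<in> cent" "x - (\<Sum>(\<mu>,g)\<in>?I. z (\<mu>,g) * Y \<mu> g) \<in> J"
      by (elim exE conjE)
    have "(\<Sum>i<card ?I. z (e i) * Y (fst (e i)) (snd (e i))) = (\<Sum>i\<in>?I. z i * Y (fst i) (snd i))"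
      by (rule sum.reindex_bij_betw[OF e])
    then have "x - (\<Sum>i<card ?I. z (e i) * Y (fst (e i)) (snd (e i))) \<in> J" using z(2) by (simp add: case_prod_beta)
    then show "\<exists>z. (\<forall>i<card ?I. z i \<in> cent) \<and> x - (\<Sum>i<card ?I. z i * Y (fst (e i)) (snd (e i))) \<in> J"
      using z(1) eI by (intro exI[of _ "\<lambda>i. z (e i)"] conjI allI impI) blast+
  qed
qed

end

subsection \<open>No polynomial identity when the scalar part is nonzero\<close>

context hecke_alg begin

section \<open>An invariant function with radial Hamiltonian field at \<chi>\<close>

lemma funpow_period:
  assumes "g \<in> G"
  shows "\<exists>e>0. g ^^ e = id"
proof -
  have in_G: "g ^^ i \<in> G" for i
  proof (induction i)
    case 0 show ?case by (simp only: funpow.simps id_G)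
  next
    case (Suc i) show ?case using comp_G[OF assms Suc] by (simp only: funpow.simps)
  qed
  have "\<not> inj (\<lambda>i. g ^^ i)"
  proof
    assume "inj (\<lambda>i. g ^^ i)"
    then have "finite (UNIV :: nat set)"
      by (rule finite_imageD[rotated]) (rule finite_subset[OF _ finite_G], use in_G in blast)
    then show False by simp
  qed
  then obtain i j where ij: "g ^^ i = g ^^ j" "i \<noteq> j" unfolding inj_def by blast
  have *: "g ^^ (j - i) = id" if "g ^^ i = g ^^ j" "i < j" for i j :: nat
  proof
    fix v
    have "g ^^ j = g ^^ (i + (j - i))" using that(2) by simp
    also have "\<dots> = g ^^ i \<circ> g ^^ (j - i)" by (rule funpow_add)
    finally have "g ^^ i = g ^^ i \<circ> g ^^ (j - i)" using that(1) by (simp only:)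
    from fun_cong[OF this, of v] have "(g ^^ i) ((g ^^ (j - i)) v) = (g ^^ i) v" by (simp only: o_apply)
    then show "(g ^^ (j - i)) v = id v"
      using bij_G[OF in_G[of i]] by (simp add: bij_is_inj inj_eq)
  qed
  show ?thesis
  proof (cases "i < j")
    case True then show ?thesis using *[OF ij(1)] by (intro exI[of _ "j - i"]) simp
  next
    case False
    then have "j < i" using ij(2) by simp
    then show ?thesis using *[OF ij(1)[symmetric]] by (intro exI[of _ "i - j"]) simp
  qed
qed

lemma uniform_period: "\<exists>e>0. \<forall>g\<in>G. g ^^ e = id"
proof -
  have "\<forall>g\<in>G. \<exists>e>0. g ^^ e = id" using funpow_period by blast
  from bchoice[OF this] obtain e where e: "\<forall>g\<in>G. e g > 0 \<and> g ^^ e g = id" ..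
  have "g ^^ (prod e G) = id" if "g \<in> G" for g
  proof -
    have "g ^^ (prod e G) = (g ^^ e g) ^^ (prod e (G - {g}))"
      unfolding funpow_mult by (simp add: prod.remove[OF finite_G that])
    also have "\<dots> = id" using bspec[OF e that] by (simp add: id_funpow)
    finally show ?thesis .
  qed
  then show ?thesis using e finite_G by (intro exI[of _ "prod e G"] conjI prod_pos) auto
qed

text \<open>If no such vector existed, the kernel of the transpose of \<open>g\<close> applied to
  \<chi> would lie in the kernel of \<chi>, and the two forms would be proportional.\<close>

lemma separate_line:
  assumes g: "g \<in> G" and u: "pair u \<chi> = 1" and n: "\<not> (\<exists>c. \<forall>v. pair (g v) \<chi> = c * pair v \<chi>)"
  shows "\<exists>v. pair v \<chi> = 1 \<and> pair (g v) \<chi> = 0"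
proof (rule ccontr)
  assume c: "\<not> ?thesis"
  have ker: "pair v \<chi> = 0" if "pair (g v) \<chi> = 0" for v
  proof (rule ccontr)
    assume nz: "pair v \<chi> \<noteq> 0"
    let ?v = "sc (1 / pair v \<chi>) v"
    have "pair ?v \<chi> = 1" using nz by (simp add: lin1_sc[OF pair_lin1])
    moreover have "pair (g ?v) \<chi> = 0" using that by (simp add: G_sc[OF g] lin1_sc[OF pair_lin1])
    ultimately show False using c by blast
  qed
  define w where "w = giv g u"
  have gw: "g w = u" unfolding w_def using inv_comp_G(2)[OF g] by (simp add: fun_eq_iff)
  have *: "pair v \<chi> = pair (g v) \<chi> * pair w \<chi>" for v
  proof -
    have "g (sc (- pair (g v) \<chi>) w + v) = sc (- pair (g v) \<chi>) u + g v" by (simp only: G_add[OF g] G_sc[OF g] gw)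
    then have "pair (g (sc (- pair (g v) \<chi>) w + v)) \<chi> = 0"
      by (simp add: lin1_diff[OF pair_lin1] lin1_sc[OF pair_lin1] u)
    from ker[OF this] show ?thesis by (simp add: lin1_diff[OF pair_lin1] lin1_sc[OF pair_lin1])
  qed
  have nz: "pair w \<chi> \<noteq> 0" using *[of u] u by auto
  have "pair (g v) \<chi> = (1 / pair w \<chi>) * pair v \<chi>" for v using *[of v] nz by (simp add: field_simps)
  then show False using n by blast
qed

text \<open>The orbit sum of \<open>h\<close>, the product of \<open>l\<close>, a power of
  \<open>u\<close> and squares of vectors \<open>b g\<close>. As l(\<chi>) = \<kappa>(l, l) = 0, the
  gradient of \<open>h\<close> at \<chi> is a multiple of \<open>l\<close>, whose field \<kappa>(l,
  -) is \<chi>. The squares kill the gradient at the translates of \<chi> off the line of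
  \<chi>.\<close>

lemma invariant_with_radial_field:
  assumes nz: "\<kappa> id l v0 \<noteq> 0"
  shows "\<exists>\<chi> m f c u. (\<forall>v. pair v \<chi> = \<kappa> id l v) \<and> hp (int m + 2) f \<and> m > 0 \<and> Ginv f \<and> c \<noteq> 0 \<and> pair u \<chi> = 1
    \<and> (\<forall>v. \<kappa> id (grad f \<chi>) v = c * pair v \<chi>)"
proof -
  define \<chi> where "\<chi> = (\<lambda>b. \<kappa> id l b)"
  have lk: "lin1 (\<kappa> id l)" by (intro lin1_I \<kappa>_add2 \<kappa>_sc2 id_G)
  have \<chi>: "pair v \<chi> = \<kappa> id l v" for v unfolding pair_def \<chi>_def by (rule lin1_expand[OF lk, symmetric])
  define u where "u = sc (1 / \<kappa> id l v0) v0"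
  have u: "pair u \<chi> = 1" unfolding u_def lin1_sc[OF pair_lin1] \<chi>[of v0] using nz by simp
  have l0: "pair l \<chi> = 0" unfolding \<chi> using \<kappa>_skew[OF id_G, of l l] by simp
  define H where "H = {g\<in>G. \<exists>c. \<forall>v. pair (g v) \<chi> = c * pair v \<chi>}"
  have "\<forall>g\<in>G - H. \<exists>b. pair b \<chi> = 1 \<and> pair (g b) \<chi> = 0" using separate_line[OF _ u] unfolding H_def by blast
  from bchoice[OF this] obtain b where b: "\<forall>g\<in>G - H. pair (b g) \<chi> = 1 \<and> pair (g (b g)) \<chi> = 0" ..
  obtain e where e: "e > 0" "\<forall>g\<in>G. g ^^ e = id" using uniform_period by blast
  define n where "n = card (G - H)"
  \<comment> \<open>\<open>M\<close> fills the total degree up to m + 2, where 2 n is the degree of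
    the squares. Since m is a multiple of the period \<open>e\<close>, an element of
    \<open>H\<close> scaling \<chi> by c contributes c^m = 1, so the contributions of
    \<open>H\<close> add up to |H|. The factor 2 n + 1 keeps the subtraction from being cut
    off.\<close>
  define M where "M = e * (2 * n + 1) + 1 - 2 * n"
  define m where "m = e * (2 * n + 1)"
  have "2 * n + 1 \<le> m" unfolding m_def using e(1) by (cases e) auto
  then have M: "1 + M + 2 * n = m + 2" unfolding M_def m_def[symmetric] by simp
  have m0: "m > 0" using e(1) by (simp add: m_def)
  define k where "k A p = pair l p * (pair u p ^ M * (\<Prod>g\<in>A. pair (b g) p ^ 2))" for A p
  have khp: "hp (1 + (int M + int (card A) * 2)) (k A)" if "finite A" for A
    unfolding k_def[abs_def] using hp_pair_power[of 2] that by (intro hp_mult hp_pair hp_pair_power hp_setprod) simp_all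
  define h where "h = k (G - H)"
  have hh: "hp (int m + 2) h"
  proof -
    have "1 + (int M + int (card (G - H)) * 2) = int m + 2" using M unfolding n_def by simp
    then show ?thesis using khp[of "G - H"] finite_G unfolding h_def by (simp add: add.commute)
  qed
  define f where "f p = (\<Sum>g\<in>G. h (act g p))" for p
  have fh: "hp (int m + 2) f" unfolding f_def[abs_def] by (intro hp_sum hp_act hh)
  have act2: "h (act g (act g' p)) = h (act (g' \<circ> g) p)" if "g \<in> G" "g' \<in> G" for g g' p
    by (rule hp_cong_pair[OF hh]) (simp add: pair_act that comp_G)
  have finv: "Ginv f" unfolding Ginv_def
  proof (intro ballI allI)
    fix g p assume g: "g \<in> G"
    have "f (act g p) = (\<Sum>s\<in>G. h (act (g \<circ> s) p))" unfolding f_def by (intro sum.cong refl act2 g)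
    also have "\<dots> = f p" unfolding f_def by (rule sum.reindex_bij_betw[OF left_bij[OF g]])
    finally show "f (act g p) = f p" .
  qed
  have off: "grad h (act g \<chi>) = 0" if g: "g \<in> G - H" for g
  proof -
    let ?q = "act g \<chi>"
    have gG: "g \<in> G" using g by simp
    have z: "pair (b g) ?q = 0" using bspec[OF b g] by (simp add: pair_act[OF gG])
    let ?A = "G - H - {g}"
    have finA: "finite ?A" using finite_G by simp
    have eq: "h = (\<lambda>p. k ?A p * (pair (b g) p * pair (b g) p))"
      unfolding h_def k_def using finite_G g by (simp add: prod.remove[OF _ g] power2_eq_square fun_eq_iff)
    have "has_grad h ?q (sc (pair (b g) ?q * pair (b g) ?q) (grad (k ?A) ?q)
      + sc (k ?A ?q) (sc (pair (b g) ?q) (b g) + sc (pair (b g) ?q) (b g)))"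
      unfolding eq by (intro has_grad_mult has_grad_pair hp_has_grad[OF khp[OF finA]])
    then have "has_grad h ?q 0" by (simp add: z)
    then show ?thesis by (rule gradI)
  qed
  \<comment> \<open>The point is c \<chi>. The factors of \<open>h\<close> other than
    \<open>l\<close> have degree m + 1 and give c^(m+1), and transporting \<open>l\<close> by
    \<open>g\<close> gives 1 / c.\<close>
  have on: "\<kappa> id (g (grad h (act g \<chi>))) v = pair v \<chi>" if g: "g \<in> H" for g v
  proof -
    let ?q = "act g \<chi>"
    have gG: "g \<in> G" using g by (simp add: H_def)
    obtain c where c: "\<forall>v. pair (g v) \<chi> = c * pair v \<chi>" using g unfolding H_def by blast
    have q: "pair v ?q = c * pair v \<chi>" for v using c by (simp add: pair_act[OF gG])
    have "pair ((g ^^ i) v) \<chi> = c ^ i * pair v \<chi>" for i v by (induction i) (simp_all add: c)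
    from this[of e u] have ce: "c ^ e = 1" using e(2) gG u by simp
    then have c0: "c \<noteq> 0" using e(1) by (auto simp: power_0_left)
    have eq: "h = (\<lambda>p. pair l p * (pair u p ^ M * (\<Prod>g\<in>G - H. pair (b g) p ^ 2)))" unfolding h_def k_def ..
    let ?F = "\<lambda>p. pair u p ^ M * (\<Prod>g\<in>G - H. pair (b g) p ^ 2)"
    have Fhp: "hp (int M + int (card (G - H)) * 2) ?F" using hp_pair_power[of 2] finite_G by (intro hp_mult hp_pair_power hp_setprod) simp_all
    have "has_grad h ?q (sc (?F ?q) l + sc (pair l ?q) (grad ?F ?q))"
      unfolding eq by (intro has_grad_mult has_grad_pair hp_has_grad[OF Fhp])
    moreover have "pair l ?q = 0" by (simp add: q l0)
    moreover have "?F ?q = c ^ (m + 1)"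
    proof -
      have "(\<Prod>g\<in>G - H. pair (b g) ?q ^ 2) = (\<Prod>g\<in>G - H. c ^ 2)" using b by (intro prod.cong refl) (simp add: q)
      then have "?F ?q = c ^ (M + 2 * n)" by (simp add: q u n_def power_add power_mult)
      moreover have "M + 2 * n = m + 1" using M by simp
      ultimately show ?thesis by simp
    qed
    ultimately have "has_grad h ?q (sc (c ^ (m + 1)) l)" by simp
    then have gr: "grad h ?q = sc (c ^ (m + 1)) l" by (rule gradI)
    have gg: "g (giv g v) = v" using inv_comp_G(2)[OF gG] by (simp add: fun_eq_iff)
    have "\<kappa> id (g l) (g (giv g v)) = \<kappa> id l (giv g v)"
      using \<kappa>_equiv[OF id_G gG, of l "giv g v"] inv_comp_G(2)[OF gG] by simp
    then have "\<kappa> id (g l) v = pair (giv g v) \<chi>" by (simp add: gg \<chi>)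
    also have "\<dots> = pair v \<chi> / c" using spec[OF c, of "giv g v"] c0 by (simp add: gg)
    finally have "\<kappa> id (g (grad h ?q)) v = c ^ (m + 1) * (pair v \<chi> / c)"
      by (simp only: gr G_sc[OF gG] \<kappa>_sc[OF id_G])
    also have "\<dots> = c ^ m * pair v \<chi>" using c0 by simp
    also have "c ^ m = 1" unfolding m_def by (simp only: power_mult ce power_one)
    finally show ?thesis by (simp only: mult_1_left)
  qed
  have "has_grad f \<chi> (\<Sum>g\<in>G. g (grad h (act g \<chi>)))"
    unfolding f_def[abs_def] by (rule has_grad_sum) (rule has_grad_act[OF _ hp_has_grad[OF hh]])
  then have gf: "grad f \<chi> = (\<Sum>g\<in>G. g (grad h (act g \<chi>)))" by (rule gradI)
  have "\<kappa> id (grad f \<chi>) v = of_nat (card H) * pair v \<chi>" for v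
  proof -
    have "\<kappa> id (grad f \<chi>) v = (\<Sum>g\<in>G. \<kappa> id (g (grad h (act g \<chi>))) v)"
      unfolding gf by (rule lin1_sum[OF lin1_\<kappa>[OF id_G]])
    also have "\<dots> = (\<Sum>g\<in>H. \<kappa> id (g (grad h (act g \<chi>))) v)"
    proof (rule sum.mono_neutral_right[OF finite_G])
      show "H \<subseteq> G" by (auto simp: H_def)
      show "\<forall>g\<in>G - H. \<kappa> id (g (grad h (act g \<chi>))) v = 0"
      proof
        fix g assume g: "g \<in> G - H"
        have "g 0 = 0" using G_sc[of g 0 0] g by simp
        then show "\<kappa> id (g (grad h (act g \<chi>))) v = 0" by (simp add: off[OF g] lin1_0[OF lin1_\<kappa>[OF id_G]])
      qed
    qed
    also have "\<dots> = of_nat (card H) * pair v \<chi>" by (simp add: on)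
    finally show ?thesis .
  qed
  moreover have "card H \<noteq> 0"
  proof -
    have "id \<in> H" unfolding H_def by (auto intro: exI[of _ 1])
    moreover have "finite H" using finite_G by (simp add: H_def)
    ultimately show ?thesis by auto
  qed
  ultimately show ?thesis using \<chi> fh m0 finv u
    by (intro exI[of _ \<chi>] exI[of _ m] exI[of _ f] exI[of _ "of_nat (card H)"] exI[of _ u] conjI allI) simp_all
qed

text \<open>Values at \<chi> are well defined modulo the left ideal of \<open>W\<close>. The symbol
  of \<open>q * W\<close> is that of \<open>q\<close> times \<open>f\<close>. If the degree of
  \<open>q\<close> is too large, cancelling \<open>f\<close> lowers it; if it fits, the symbol is a
  multiple of \<open>f\<close> and vanishes at \<chi>.\<close>

lemma st_symbol:
  assumes f: "hp m f" "Ginv f" "f \<chi> = 0" "f p1 \<noteq> 0"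
    and W: "W \<in> F m" "\<And>h p. sg m W h p = (if h = id then f p else 0)"
    and x: "x \<in> F n" and q: "q \<in> FG" and xq: "x - q * W \<in> J"
  shows "sg n x id \<chi> = 0"
proof -
  have finv: "f (act g p) = f p" if "g \<in> G" for g p using f(2) that unfolding Ginv_def by blast
  have sgm: "sg (j + m) (q * W) h p = sg j q h p * f p" if "q \<in> F j" "h \<in> G" for j h p
  proof -
    have "sg (j + m) (q * W) h p = (\<Sum>g\<in>G. sg j q g p * sg m W (giv g \<circ> h) (act g p))"
      by (rule sg_mult[OF that(1) W(1)])
    also have "\<dots> = (\<Sum>g\<in>G. if g = h then sg j q h p * f p else 0)"
    proof (intro sum.cong refl)
      fix g assume g: "g \<in> G"
      have "giv g \<circ> h = id \<longleftrightarrow> g = h"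
      proof
        assume "giv g \<circ> h = id"
        then have "g \<circ> (giv g \<circ> h) = g" by simp
        then show "g = h" by (simp only: o_assoc inv_comp_G(2)[OF g] id_o)
      qed (simp add: inv_comp_G(1)[OF that(2)])
      then show "sg j q g p * sg m W (giv g \<circ> h) (act g p) = (if g = h then sg j q h p * f p else 0)"
        by (auto simp: W(2) finv[OF that(2)])
    qed
    also have "\<dots> = sg j q h p * f p" using that(2) finite_G by simp
    finally show ?thesis .
  qed
  have sx: "sg n x h p = sg n (q * W) h p" for h p using sg_J[OF xq, of n h p] by (simp add: sg_diff)
  have "sg n (q * W) id \<chi> = 0" if "q \<in> F (int i - 1)" for i
    using that
  proof (induction i)
    case 0
    then have "q \<in> J" by (simp add: F_neg)
    then have "q * W \<in> J" by (rule J_right[OF F_FG[OF W(1)]])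
    then show ?case by (rule sg_J)
  next
    case (Suc i)
    then have qi: "q \<in> F (int i)" by simp
    consider "int i + m < n" | "int i + m = n" | "int i + m > n" by linarith
    then show ?case
    proof cases
      case 1 then show ?thesis by (rule sg_low[OF F_mult[OF qi W(1)]])
    next
      case 2 then show ?thesis using sgm[OF qi id_G, of \<chi>] by (simp add: f(3) id_def)
    next
      case 3
      have "x - (x - q * W) \<in> F n" by (rule F_diff[OF x J_F[OF xq]])
      then have qW: "q * W \<in> F n" by simp
      have "sg (int i) q h p = 0" if h: "h \<in> G" for h p
        by (rule hp_cancel[OF sg_hp[OF qi] f(1) _ f(4)]) (simp flip: sgm[OF qi h] add: sg_low[OF qW 3])
      then have "q \<in> F (int i - 1)" by (rule symbol_kernel[OF qi])
      then show ?thesis by (rule Suc.IH)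
    qed
  qed
  then show ?thesis using FG_F[OF q] sx by metis
qed

section \<open>Multiplication by W modulo the left ideal it generates\<close>

context
  fixes W :: "'v sk" and \<chi> u m f D c
  assumes m: "m > 0" and f: "hp (int m + 2) f" "Ginv f" and c: "c \<noteq> 0" and u: "pair u \<chi> = 1"
    and rad: "\<And>v. \<kappa> id (grad f \<chi>) v = c * pair v \<chi>" and f\<chi>: "f \<chi> = 0"
    and W: "good 2 (int m + 2) f W D" and D: "\<And>v. D v \<chi> = \<kappa> id (grad f \<chi>) v"
begin

text \<open>\<open>st n x z\<close>: modulo the left ideal generated by \<open>W\<close>, the element \<open>x\<close> has degree at most \<open>n\<close>
  and \<open>z\<close> is the value at \<open>\<chi>\<close> of its symbol at the identity.\<close>

definition st :: "int \<Rightarrow> 'v sk \<Rightarrow> complex \<Rightarrow> bool" where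
  "st n x z \<longleftrightarrow> (\<exists>y q. y \<in> F n \<and> q \<in> FG \<and> x - (y + q * W) \<in> J \<and> sg n y id \<chi> = z)"

lemma st_F: "x \<in> F n \<Longrightarrow> st n x (sg n x id \<chi>)"
  unfolding st_def by (intro exI[of _ x] exI[of _ 0]) simp

lemma st_add: assumes "st n x z" "st n x' z'" shows "st n (x + x') (z + z')"
proof -
  obtain y q where 1: "y \<in> F n" "q \<in> FG" "x - (y + q * W) \<in> J" "sg n y id \<chi> = z"
    using assms(1) unfolding st_def by (elim exE conjE)
  obtain y' q' where 2: "y' \<in> F n" "q' \<in> FG" "x' - (y' + q' * W) \<in> J" "sg n y' id \<chi> = z'"
    using assms(2) unfolding st_def by (elim exE conjE)
  have "(x + x') - ((y + y') + (q + q') * W) = (x - (y + q * W)) + (x' - (y' + q' * W))"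
    by (simp add: algebra_simps)
  also have "\<dots> \<in> J" by (rule J_add[OF 1(3) 2(3)])
  finally have J: "(x + x') - ((y + y') + (q + q') * W) \<in> J" .
  show ?thesis unfolding st_def
    by (rule exI[of _ "y + y'"], rule exI[of _ "q + q'"], intro conjI F_add FG_add 1(1,2) 2(1,2) J) (simp add: sg_add 1 2)
qed

lemma st_CC: assumes "st n x z" shows "st n (CC a * x) (a * z)"
proof -
  obtain y q where 1: "y \<in> F n" "q \<in> FG" "x - (y + q * W) \<in> J" "sg n y id \<chi> = z"
    using assms(1) unfolding st_def by (elim exE conjE)
  have "CC a * x - (CC a * y + (CC a * q) * W) = CC a * (x - (y + q * W))" by (simp add: algebra_simps)
  also have "\<dots> \<in> J" by (rule J_CC[OF 1(3)])
  finally have J: "CC a * x - (CC a * y + (CC a * q) * W) \<in> J" .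
  show ?thesis unfolding st_def
    by (rule exI[of _ "CC a * y"], rule exI[of _ "CC a * q"], intro conjI F_CC FG_mult FG_CC 1(1,2) J) (simp add: sg_CC 1)
qed

lemma st_0: "st n 0 0" using st_F[OF J_F[OF J_0], of n] by simp

lemma st_sum: "finite A \<Longrightarrow> (\<And>i. i \<in> A \<Longrightarrow> st n (x i) (z i)) \<Longrightarrow> st n (sum x A) (sum z A)"
  by (induction A rule: finite_induct) (simp_all add: st_0 st_add)

lemma st_raise: assumes "st n x z" "n < n'" shows "st n' x 0"
proof -
  obtain y q where 1: "y \<in> F n" "q \<in> FG" "x - (y + q * W) \<in> J" "sg n y id \<chi> = z"
    using assms(1) unfolding st_def by (elim exE conjE)
  show ?thesis unfolding st_def using assms(2) 1
    by (intro exI[of _ y] exI[of _ q] conjI F_mono[OF 1(1)] sg_low[OF 1(1)]) simp_all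
qed

lemma W_FG: "W \<in> FG" using F_FG[OF goodD(1)[OF W]] .

lemma st_J: assumes "st n x z" "x \<in> J" shows "z = 0"
proof -
  obtain y q where 1: "y \<in> F n" "q \<in> FG" "x - (y + q * W) \<in> J" "sg n y id \<chi> = z"
    using assms(1) unfolding st_def by (elim exE conjE)
  have "y - (- q) * W = x - (x - (y + q * W))" by (simp add: algebra_simps)
  also have "\<dots> \<in> J" by (rule J_diff[OF assms(2) 1(3)])
  finally have yq: "y - (- q) * W \<in> J" .
  have "\<exists>p. f p \<noteq> 0"
  proof (rule ccontr)
    assume "\<not> ?thesis"
    then have "f = (\<lambda>p. 0)" by auto
    then have "grad f \<chi> = 0" by (simp add: grad_zero)
    then show False using rad[of u] c u by (simp add: lin1_0[OF lin1_\<kappa>[OF id_G]])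
  qed
  then obtain p1 where p1: "f p1 \<noteq> 0" ..
  have "sg n y id \<chi> = 0"
    by (rule st_symbol[OF f f\<chi> p1 goodD(1,5)[OF W] 1(1) FG_uminus[OF 1(2)] yq])
  then show ?thesis using 1 by simp
qed

text \<open>An element of degree \<open>m\<close> with symbol 1 at \<chi>: subtracting a multiple of
  it from \<open>W\<close> shifts the eigenvalue and keeps the gain in degree.\<close>

definition U :: "'v sk" where "U = MM (replicate m u) id"

definition shift :: "complex \<Rightarrow> 'v sk" where "shift a = W - CC a * U"

lemma U_F: "U \<in> F (int m)" unfolding U_def by (rule F_MM) simp_all

lemma shift_FG: "shift a \<in> FG"
  unfolding shift_def by (intro FG_diff W_FG FG_mult FG_CC F_FG[OF U_F])

text \<open>W y = [W, y] + y W, and the last term is in the left ideal. At \<chi> the commutator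
  pairs the gradient of the symbol with c \<chi>, so Euler's identity yields c n. The degree grows
  by (m + 2) - 2 = m.\<close>

lemma st_shift:
  assumes "st n x z" shows "st (n + int m) (shift a * x) ((c * of_int n - a) * z)"
proof -
  obtain y q where 1: "y \<in> F n" "q \<in> FG" "x - (y + q * W) \<in> J" "sg n y id \<chi> = z"
    using assms(1) unfolding st_def by (elim exE conjE)
  let ?y = "(W * y - y * W) - CC a * (U * y)"
  let ?q = "y + shift a * q"
  have e: "int m + 2 + n - 2 = n + int m" by simp
  note gc = good_commutator[OF W 1(1), unfolded e]
  have Uy: "U * y \<in> F (n + int m)" using F_mult[OF U_F 1(1)] by (simp add: add.commute)
  have "sg (n + int m) (W * y - y * W) id \<chi> = c * (of_int n * z)"
    using gc by (simp add: D rad Euler[OF sg_hp[OF 1(1)]] 1(4))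
  moreover have "sg (int m + n) (U * y) id \<chi> = pair u \<chi> ^ m * sg n y id \<chi>"
    by (rule sg_id_mult[OF U_F 1(1)]) (simp add: U_def sg_MM)
  then have "sg (n + int m) (U * y) id \<chi> = z" by (simp only: add.commute[of n] u 1(4) power_one mult_1_left)
  ultimately have v: "sg (n + int m) ?y id \<chi> = (c * of_int n - a) * z"
    unfolding sg_diff[of _ "W * y - y * W"] sg_CC
    by (simp only: left_diff_distrib mult.assoc)
  have "shift a * x - (?y + ?q * W) = shift a * (x - (y + q * W))"
    by (simp add: shift_def algebra_simps)
  also have "\<dots> \<in> J" by (rule J_left[OF shift_FG 1(3)])
  finally have "shift a * x - (?y + ?q * W) \<in> J" .
  moreover have "?y \<in> F (n + int m)" by (rule F_diff[OF conjunct1[OF gc] F_CC[OF Uy]])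
  moreover have "?q \<in> FG" by (intro FG_add FG_mult shift_FG 1(2) F_FG[OF 1(1)])
  ultimately show ?thesis unfolding st_def using v
    by (intro exI[of _ ?y] exI[of _ ?q] conjI)
qed

section \<open>Operators that single out one degree\<close>

context
  fixes d :: nat
begin

text \<open>The term \<open>m * length js\<close> offsets the degree already gained by the factors
  to the right, so that on degree s m d the factor of \<open>j\<close> acts by c m d (s -
  j).\<close>

fun Op :: "nat list \<Rightarrow> 'v sk" where
  "Op [] = 1"
| "Op (j # js) = shift (c * of_nat (j * (m * d) + m * length js)) * Op js"

lemma Op_FG: "Op js \<in> FG" by (induction js) (simp_all add: FG_1 FG_mult shift_FG)

lemma st_Op:
  "st (int (s * (m * d))) x z \<Longrightarrow> st (int (s * (m * d) + m * length js)) (Op js * x)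
     ((\<Prod>j\<leftarrow>js. c * of_nat (m * d) * (of_nat s - of_nat j)) * z)"
proof (induction js)
  case Nil then show ?case
    by (simp only: Op.simps list.size list.map prod_list.Nil mult_0_right add_0_right mult_1_left)
next
  case (Cons j js)
  let ?n = "int (s * (m * d) + m * length js)"
  let ?P = "\<Prod>j\<leftarrow>js. c * of_nat (m * d) * (of_nat s - of_nat j)"
  have e: "(c * of_int ?n - c * of_nat (j * (m * d) + m * length js)) * (?P * z)
    = (\<Prod>j\<leftarrow>j # js. c * of_nat (m * d) * (of_nat s - of_nat j)) * z"
    by (simp add: algebra_simps)
  have n: "?n + int m = int (s * (m * d) + m * length (j # js))" by simp
  show ?case using st_shift[OF Cons.IH[OF Cons.prems], of "c * of_nat (j * (m * d) + m * length js)"]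
    unfolding e n by (simp only: Op.simps mult.assoc)
qed

text \<open>The index \<open>d\<close> is included so that \<open>d\<close> indices remain for each
  \<open>i < d\<close>; \<open>Op (others i)\<close> then raises the degree by exactly m d. Among
  the degrees s m d with s < d it annihilates all except s = i.\<close>

definition others :: "nat \<Rightarrow> nat list" where "others i = filter (\<lambda>j. j \<noteq> i) [0..<Suc d]"

definition eta :: "nat \<Rightarrow> nat \<Rightarrow> complex" where
  "eta i s = (\<Prod>j\<leftarrow>others i. c * of_nat (m * d) * (of_nat s - of_nat j))"

lemma length_others: "i < d \<Longrightarrow> length (others i) = d"
proof -
  assume "i < d"
  have "length (others i) = card (set (others i))" by (rule distinct_card[symmetric]) (simp add: others_def del: upt_Suc)
  also have "set (others i) = {..<Suc d} - {i}" by (auto simp: others_def simp del: upt_Suc)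
  finally show ?thesis using \<open>i < d\<close> by simp
qed

lemma eta_0: "s < d \<Longrightarrow> s \<noteq> i \<Longrightarrow> eta i s = 0"
  unfolding eta_def prod_list_zero_iff by (force simp: others_def simp del: upt_Suc)

lemma eta_nz: "i < d \<Longrightarrow> eta i i \<noteq> 0"
  unfolding eta_def prod_list_zero_iff using c m by (auto simp: others_def simp del: upt_Suc)

context
  fixes w0 :: "nat list"
  assumes w0: "length w0 = d"
begin

text \<open>In \<open>w0\<close> the letter at position \<open>j\<close> acts after the
  \<open>d - 1 - j\<close> letters to its right, hence in degree (d - 1 - j) m d. The sum lets the
  letter \<open>i\<close> act exactly in the degrees of its positions in \<open>w0\<close>.\<close>

definition subst :: "nat \<Rightarrow> 'v sk" where
  "subst i = (\<Sum>j\<in>{j. j < d \<and> w0 ! j = i}. Op (others (d - 1 - j)))"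

lemma subst_FG: "subst i \<in> FG" unfolding subst_def by (intro FG_sum Op_FG)

lemma st_subst:
  assumes x: "st (int (s * (m * d))) x z" and s: "s < d"
  shows "st (int (Suc s * (m * d))) (subst i * x) (if w0 ! (d - 1 - s) = i then eta s s * z else 0)"
proof -
  let ?A = "{j. j < d \<and> w0 ! j = i}"
  have "st (int (Suc s * (m * d))) (\<Sum>j\<in>?A. Op (others (d - 1 - j)) * x) (\<Sum>j\<in>?A. eta (d - 1 - j) s * z)"
  proof (rule st_sum)
    fix j assume "j \<in> ?A"
    then have "d - 1 - j < d" using s by simp
    then show "st (int (Suc s * (m * d))) (Op (others (d - 1 - j)) * x) (eta (d - 1 - j) s * z)"
      using st_Op[OF x, of "others (d - 1 - j)"] by (simp add: length_others eta_def add.commute)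
  qed simp
  then have A: "st (int (Suc s * (m * d))) (subst i * x) (\<Sum>j\<in>?A. eta (d - 1 - j) s * z)"
    unfolding subst_def sum_distrib_right .
  have "(\<Sum>j\<in>?A. eta (d - 1 - j) s * z) = (\<Sum>j\<in>?A. if j = d - 1 - s then eta s s * z else 0)"
  proof (intro sum.cong refl)
    fix j assume j: "j \<in> ?A"
    then have "j = d - 1 - s \<longleftrightarrow> d - 1 - j = s" using s by auto
    then show "eta (d - 1 - j) s * z = (if j = d - 1 - s then eta s s * z else 0)" using eta_0[OF s] by simp
  qed
  also have "\<dots> = (if w0 ! (d - 1 - s) = i then eta s s * z else 0)" using s by simp
  finally show ?thesis using A by (simp only:)
qed

text \<open>Letters act on 1 from right to left, each raising the degree by m d; the value at \<chi>
  survives only as long as the word read so far is a suffix of \<open>w0\<close>.\<close>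

lemma st_word:
  "length w \<le> d \<Longrightarrow> st (int (length w * (m * d))) (prod_list (map subst w))
     (if w = drop (d - length w) w0 then \<Prod>s<length w. eta s s else 0)"
proof (induction w)
  case Nil
  have dd: "drop d w0 = []" using w0 by simp
  have "st 0 1 (sg 0 1 id \<chi>)" using st_F[OF F_MM[OF id_G, of "[]" 0]] by (simp add: MM_one)
  moreover have "sg 0 1 id \<chi> = 1" using sg_MM[of "[]" 0 id id \<chi>] by (simp add: MM_one)
  ultimately have "st 0 1 1" by (simp only:)
  then show ?case
    by (simp only: list.size list.map prod_list.Nil mult_0 of_nat_0 lessThan_0 prod.empty diff_zero dd simp_thms if_True)
next
  case (Cons i w)
  let ?s = "length w"
  have s: "?s < d" using Cons.prems by simp
  have dr: "drop (d - length (i # w)) w0 = w0 ! (d - 1 - ?s) # drop (d - ?s) w0"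
  proof -
    have "drop (d - 1 - ?s) w0 = w0 ! (d - 1 - ?s) # drop (Suc (d - 1 - ?s)) w0"
      by (rule Cons_nth_drop_Suc[symmetric]) (use s w0 in simp)
    moreover have "Suc (d - 1 - ?s) = d - ?s" "d - length (i # w) = d - 1 - ?s" using s by simp_all
    ultimately show ?thesis by simp
  qed
  have "length w \<le> d" using s by simp
  note step = st_subst[OF Cons.IH[OF this] s, of i]
  have eq: "(if w0 ! (d - 1 - ?s) = i then eta ?s ?s * (if w = drop (d - ?s) w0 then \<Prod>s<?s. eta s s else 0) else 0)
    = (if i # w = w0 ! (d - 1 - ?s) # drop (d - ?s) w0 then \<Prod>s<length (i # w). eta s s else 0)"
    by (simp add: mult.commute eq_commute)
  show ?case using step unfolding dr eq by (simp only: list.map prod_list.Cons length_Cons)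
qed

end

end

text \<open>Shorter words stay in lower degree and other words of length \<open>d\<close> give 0, so
  the value in top degree is the coefficient 1 of \<open>w0\<close> times a product of nonzero
  factors.\<close>

lemma not_monic_identity:
  assumes fin: "finite {w. e w \<noteq> (0::complex)}" and mon: "nc_monic e"
    and id: "\<And>a. (\<And>i. a i \<in> FG) \<Longrightarrow> (\<Sum>w\<in>{w. e w \<noteq> 0}. CC (e w) * prod_list (map a w)) \<in> J"
  shows False
proof -
  obtain w0 where w0: "e w0 = 1" "\<And>w. e w \<noteq> 0 \<Longrightarrow> length w \<le> length w0" using mon unfolding nc_monic_def by blast
  define d where "d = length w0"
  have d: "length w0 = d" by (simp add: d_def)
  let ?E = "\<Prod>s<d. eta d s s"
  let ?S = "\<Sum>w\<in>{w. e w \<noteq> 0}. CC (e w) * prod_list (map (subst d w0) w)"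
  have "st (int (d * (m * d))) ?S (\<Sum>w\<in>{w. e w \<noteq> 0}. if w = w0 then ?E else 0)"
  proof (rule st_sum[OF fin])
    fix w assume "w \<in> {w. e w \<noteq> 0}"
    then have l: "length w \<le> d" using w0(2) d by simp
    note sw = st_word[OF d l]
    show "st (int (d * (m * d))) (CC (e w) * prod_list (map (subst d w0) w)) (if w = w0 then ?E else 0)"
    proof (cases "length w = d")
      case True
      then have "st (int (d * (m * d))) (prod_list (map (subst d w0) w)) (if w = w0 then ?E else 0)"
        using sw by (simp only: True diff_self_eq_0 drop_0)
      from st_CC[OF this, of "e w"] show ?thesis using w0(1) by (cases "w = w0") simp_all
    next
      case False
      then have "length w < d" using l by simp
      then have "length w * (m * d) < d * (m * d)" using m by simp
      then have "st (int (d * (m * d))) (prod_list (map (subst d w0) w)) 0" using st_raise[OF sw] by simp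
      from st_CC[OF this, of "e w"] show ?thesis using False d by auto
    qed
  qed
  moreover have "(\<Sum>w\<in>{w. e w \<noteq> 0}. if w = w0 then ?E else 0) = ?E" using w0(1) fin by simp
  ultimately have "st (int (d * (m * d))) ?S ?E" by simp
  then have "?E = 0" by (rule st_J) (rule id[OF subst_FG[OF d]])
  then show False using eta_nz by simp
qed

end

theorem monic_identity_imp_zero:
  assumes "finite {w. e w \<noteq> (0::complex)}" "nc_monic e"
    and "\<And>a. (\<And>i. a i \<in> FG) \<Longrightarrow> (\<Sum>w\<in>{w. e w \<noteq> 0}. CC (e w) * prod_list (map a w)) \<in> J"
  shows "\<kappa> id l v = 0"
proof (rule ccontr)
  assume "\<kappa> id l v \<noteq> 0"
  from invariant_with_radial_field[OF this] obtain \<chi> m f c u where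
    \<chi>: "\<forall>v. pair v \<chi> = \<kappa> id l v" and f: "hp (int m + 2) f" "m > 0" "Ginv f" and c: "c \<noteq> 0" and u: "pair u \<chi> = 1"
    and rad: "\<forall>v. \<kappa> id (grad f \<chi>) v = c * pair v \<chi>" by (elim exE conjE)
  \<comment> \<open>By Euler's identity f(\<chi>) is proportional to \<chi>(grad f) = \<kappa>(l,
    grad f) = - c \<chi>(l) = - c \<kappa>(l, l) = 0.\<close>
  have "of_int (int m + 2) * f \<chi> = pair (grad f \<chi>) \<chi>" by (rule Euler[OF f(1), symmetric])
  also have "\<dots> = - (c * \<kappa> id l l)"
    unfolding spec[OF \<chi>] using \<kappa>_skew[OF id_G, of l "grad f \<chi>"] spec[OF rad, of l] spec[OF \<chi>, of l] by simp
  also have "\<kappa> id l l = 0" using \<kappa>_skew[OF id_G, of l l] by simp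
  finally have "of_int (int m + 2) * f \<chi> = 0" by simp
  moreover have "of_int (int m + 2) \<noteq> (0::complex)" by (simp only: of_int_eq_0_iff)
  ultimately have f\<chi>: "f \<chi> = 0" by simp
  from plift2[OF f(1,3)] obtain P where P: "plift 2 (int m + 2) f P"
    "\<forall>v p. sg (int m + 2 - 1) (brk P v) id p = \<kappa> id (grad f p) v" by (elim exE conjE)
  from plift_good[OF P(1)] obtain W where
    W: "good 2 (int m + 2) f W (\<lambda>v p. sg (int m + 2 + 1 - 2) (brk P v) id p)" by auto
  define D where "D v p = sg (int m + 2 + 1 - 2) (brk P v) id p" for v p
  have WD: "good 2 (int m + 2) f W D" using W unfolding D_def[abs_def] .
  have D\<chi>: "D v \<chi> = \<kappa> id (grad f \<chi>) v" for v
    unfolding D_def using spec[OF spec[OF P(2), of v], of \<chi>] by (simp add: algebra_simps)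
  show False
  proof (rule not_monic_identity[where W = W and \<chi> = \<chi> and u = u and m = m and f = f and D = D and c = c and e = e])
    show "\<kappa> id (grad f \<chi>) v = c * pair v \<chi>" for v by (rule spec[OF rad])
    show "D v \<chi> = \<kappa> id (grad f \<chi>) v" for v by (rule D\<chi>)
    show "(\<Sum>w\<in>{w. e w \<noteq> 0}. CC (e w) * prod_list (map a w)) \<in> J" if "\<And>i. a i \<in> FG" for a
      by (rule assms(3)) (rule that)
  qed (rule f(2,1,3) c u f\<chi> WD assms(1,2))+
qed

end

subsection \<open>The standard identity of an algebra that is finite over its centre\<close>

text \<open>The standard polynomial in \<open>n\<close> noncommuting letters, as a coefficient
  function on words.\<close>

definition std_poly :: "nat \<Rightarrow> nat list \<Rightarrow> complex" where
  "std_poly n w = (\<Sum>\<sigma> | \<sigma> permutes {..<n}. if w = map \<sigma> [0..<n] then of_int (sign \<sigma>) else 0)"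

lemma map_permutes_inj: "inj_on (\<lambda>\<sigma>. map \<sigma> [0..<n]) {\<sigma>. \<sigma> permutes {..<n}}"
proof (rule inj_onI)
  fix \<sigma> \<tau> assume *: "\<sigma> \<in> {\<sigma>. \<sigma> permutes {..<n}}" "\<tau> \<in> {\<sigma>. \<sigma> permutes {..<n}}" and e: "map \<sigma> [0..<n] = map \<tau> [0..<n]"
  show "\<sigma> = \<tau>"
  proof
    fix i
    have "\<forall>x\<in>set [0..<n]. \<sigma> x = \<tau> x" using e unfolding map_eq_conv .
    then show "\<sigma> i = \<tau> i" using * by (cases "i < n") (simp_all add: permutes_not_in)
  qed
qed

lemma std_poly_perm: "\<sigma> permutes {..<n} \<Longrightarrow> std_poly n (map \<sigma> [0..<n]) = of_int (sign \<sigma>)"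
proof -
  assume s: "\<sigma> permutes {..<n}"
  have "std_poly n (map \<sigma> [0..<n]) = (\<Sum>\<tau> | \<tau> permutes {..<n}. if \<tau> = \<sigma> then of_int (sign \<sigma>) else 0)"
    unfolding std_poly_def using inj_onD[OF map_permutes_inj] s by (intro sum.cong refl) auto
  also have "\<dots> = of_int (sign \<sigma>)" using s finite_permutations[of "{..<n}"] by simp
  finally show ?thesis .
qed

lemma std_poly_support: "{w. std_poly n w \<noteq> 0} = (\<lambda>\<sigma>. map \<sigma> [0..<n]) ` {\<sigma>. \<sigma> permutes {..<n}}"
proof (intro equalityI subsetI)
  fix w assume "w \<in> {w. std_poly n w \<noteq> 0}"
  then have "std_poly n w \<noteq> 0" by simp
  then obtain \<sigma> where "\<sigma> \<in> {\<sigma>. \<sigma> permutes {..<n}}" "(if w = map \<sigma> [0..<n] then of_int (sign \<sigma>) else (0::complex)) \<noteq> 0"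
    unfolding std_poly_def by (rule sum.not_neutral_contains_not_neutral)
  then show "w \<in> (\<lambda>\<sigma>. map \<sigma> [0..<n]) ` {\<sigma>. \<sigma> permutes {..<n}}" by (auto split: if_splits)
next
  fix w assume "w \<in> (\<lambda>\<sigma>. map \<sigma> [0..<n]) ` {\<sigma>. \<sigma> permutes {..<n}}"
  then show "w \<in> {w. std_poly n w \<noteq> 0}" by (auto simp: std_poly_perm sign_def split: if_splits)
qed

lemma std_poly_finite: "finite {w. std_poly n w \<noteq> 0}"
  unfolding std_poly_support by (intro finite_imageI finite_permutations) simp

lemma std_poly_monic: "nc_monic (std_poly n)"
  unfolding nc_monic_def
proof (intro exI[of _ "map id [0..<n]"] conjI allI impI)
  show "std_poly n (map id [0..<n]) = 1" by (subst std_poly_perm) (simp_all add: permutes_id)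
  fix u assume "std_poly n u \<noteq> 0"
  then have "u \<in> (\<lambda>\<sigma>. map \<sigma> [0..<n]) ` {\<sigma>. \<sigma> permutes {..<n}}" unfolding std_poly_support[symmetric] by simp
  then show "length u \<le> length (map id [0..<n])" by auto
qed

section \<open>Alternating sums in the monoid algebra\<close>

definition alt :: "nat \<Rightarrow> (nat \<Rightarrow> 'v sk) \<Rightarrow> 'v::ab_group_add sk" where
  "alt n a = (\<Sum>\<sigma> | \<sigma> permutes {..<n}. CC (of_int (sign \<sigma>)) * prod_list (map (a \<circ> \<sigma>) [0..<n]))"

lemma std_poly_alt: "(\<Sum>w\<in>{w. std_poly n w \<noteq> 0}. CC (std_poly n w) * prod_list (map a w)) = alt n a"
  unfolding std_poly_support sum.reindex[OF map_permutes_inj] alt_def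
  by (intro sum.cong refl) (simp add: std_poly_perm)

text \<open>Composing with the transposition of \<open>i\<close> and \<open>j\<close> leaves every
  product unchanged and reverses every sign; division by 2 is carried out on coefficients.\<close>

lemma alt_equal_arguments:
  assumes ij: "i < n" "j < n" "i \<noteq> j" and a: "a i = a j"
  shows "alt n a = 0"
proof -
  let ?\<tau> = "transpose i j"
  have t: "?\<tau> permutes {..<n}" using ij by (intro permutes_swap_id) simp_all
  have at: "a \<circ> (?\<tau> \<circ> \<sigma>) = a \<circ> \<sigma>" for \<sigma> by (rule ext) (simp add: transpose_def a)
  have "alt n a = (\<Sum>\<sigma> | \<sigma> permutes {..<n}. CC (of_int (sign (?\<tau> \<circ> \<sigma>))) * prod_list (map (a \<circ> (?\<tau> \<circ> \<sigma>)) [0..<n]))"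
    unfolding alt_def by (rule setum_permutations_compose_left[OF t])
  also have "\<dots> = (\<Sum>\<sigma> | \<sigma> permutes {..<n}. - (CC (of_int (sign \<sigma>)) * prod_list (map (a \<circ> \<sigma>) [0..<n])))"
  proof (intro sum.cong refl)
    fix \<sigma> assume "\<sigma> \<in> {\<sigma>. \<sigma> permutes {..<n}}"
    then have s: "permutation \<sigma>" "permutation ?\<tau>"
      using t by (auto intro: permutation_permutes[THEN iffD2] finite_lessThan)
    have "sign (?\<tau> \<circ> \<sigma>) = - sign \<sigma>" using sign_compose[OF s(2,1)] ij(3) by (simp add: sign_swap_id)
    then show "CC (of_int (sign (?\<tau> \<circ> \<sigma>))) * prod_list (map (a \<circ> (?\<tau> \<circ> \<sigma>)) [0..<n])
      = - (CC (of_int (sign \<sigma>)) * prod_list (map (a \<circ> \<sigma>) [0..<n]))" unfolding at by (simp add: CC_uminus)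
  qed
  also have "\<dots> = - alt n a" unfolding alt_def by (rule sum_negf)
  finally have "alt n a + alt n a = 0" by (metis add.right_inverse)
  then have "lookup (alt n a) k + lookup (alt n a) k = 0" for k by (simp flip: lookup_add)
  then have "lookup (alt n a) k = 0" for k
    using mult_2[of "lookup (alt n a) k"] by (metis mult_eq_0_iff zero_neq_numeral)
  then show ?thesis by (intro poly_mapping_eqI) simp
qed

context hecke_alg begin

lemma FG_prod_list: "(\<And>x. x \<in> set xs \<Longrightarrow> x \<in> FG) \<Longrightarrow> prod_list xs \<in> FG"
  by (induction xs) (simp_all add: FG_1 FG_mult)

lemma product_slot:
  assumes s: "\<sigma> permutes {..<n}" and k: "k < n" and a: "\<And>i. a i \<in> FG"
  shows "\<exists>L R. L \<in> FG \<and> R \<in> FG \<and> (\<forall>y. prod_list (map (a(k := y) \<circ> \<sigma>) [0..<n]) = L * y * R)"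
proof -
  define p where "p = inv_into UNIV \<sigma> k"
  have \<sigma>p: "\<sigma> p = k" unfolding p_def using permutes_surj[OF s] by (simp add: surj_f_inv_f)
  have p: "p < n" using permutes_in_image[OF s, of p] k \<sigma>p by simp
  have ne: "\<sigma> i \<noteq> k" if "i \<noteq> p" for i using that \<sigma>p permutes_inj[OF s] by (metis injD)
  have split: "[0..<n] = [0..<p] @ p # [Suc p..<n]" using p upt_add_eq_append[of 0 p "n - p"] by (simp add: upt_conv_Cons)
  let ?L = "prod_list (map (a \<circ> \<sigma>) [0..<p])" and ?R = "prod_list (map (a \<circ> \<sigma>) [Suc p..<n])"
  have "prod_list (map (a(k := y) \<circ> \<sigma>) [0..<n]) = ?L * y * ?R" for y
  proof -
    have m: "map (a(k := y) \<circ> \<sigma>) [0..<p] = map (a \<circ> \<sigma>) [0..<p]"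
      "map (a(k := y) \<circ> \<sigma>) [Suc p..<n] = map (a \<circ> \<sigma>) [Suc p..<n]" using ne by auto
    show ?thesis unfolding split map_append list.map m by (simp add: \<sigma>p mult.assoc del: map_append)
  qed
  moreover have "?L \<in> FG" "?R \<in> FG" using a by (auto intro!: FG_prod_list)
  ultimately show ?thesis by blast
qed

text \<open>In each product the argument \<open>k\<close> occurs once, and its central coefficients
  can be moved to the front modulo \<open>J\<close>: the alternating sum is linear over the centre
  in each slot.\<close>

lemma alt_slot:
  assumes k: "k < n" and a: "\<And>i. a i \<in> FG" and Y: "\<And>j. j < N \<Longrightarrow> Y j \<in> FG" and z: "\<And>j. j < N \<Longrightarrow> z j \<in> cent"
    and ak: "a k - (\<Sum>j<N. z j * Y j) \<in> J"
  shows "alt n a - (\<Sum>j<N. z j * alt n (a(k := Y j))) \<in> J"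
proof -
  let ?P = "\<lambda>\<sigma> b. prod_list (map (b \<circ> \<sigma>) [0..<n])"
  have slot: "?P \<sigma> a - (\<Sum>j<N. z j * ?P \<sigma> (a(k := Y j))) \<in> J" if s: "\<sigma> permutes {..<n}" for \<sigma> :: "nat \<Rightarrow> nat"
  proof -
    obtain L R where LR: "L \<in> FG" "R \<in> FG" "\<forall>y. ?P \<sigma> (a(k := y)) = L * y * R"
      using product_slot[where \<sigma> = \<sigma> and a = a and n = n and k = k, OF s k a] by (elim exE conjE)
    have Pa: "?P \<sigma> a = L * a k * R" using spec[OF LR(3), of "a k"] by simp
    have PY: "?P \<sigma> (a(k := y)) = L * y * R" for y using LR(3) by simp
    have "L * (a k - (\<Sum>j<N. z j * Y j)) * R \<in> J" by (intro J_left J_right LR ak)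
    moreover have "(\<Sum>j<N. (z j * L - L * z j) * (Y j * R)) \<in> J"
      by (intro J_sum J_right cent_com FG_mult LR) (use Y z in auto)
    ultimately have "L * (a k - (\<Sum>j<N. z j * Y j)) * R - (\<Sum>j<N. (z j * L - L * z j) * (Y j * R)) \<in> J"
      by (rule J_diff)
    also have "L * (a k - (\<Sum>j<N. z j * Y j)) * R - (\<Sum>j<N. (z j * L - L * z j) * (Y j * R))
      = ?P \<sigma> a - (\<Sum>j<N. z j * ?P \<sigma> (a(k := Y j)))"
      unfolding Pa PY by (simp add: algebra_simps sum_distrib_left sum_distrib_right sum.distrib sum_subtractf)
    finally show ?thesis .
  qed
  have "(\<Sum>\<sigma> | \<sigma> permutes {..<n}. CC (of_int (sign \<sigma>)) * (?P \<sigma> a - (\<Sum>j<N. z j * ?P \<sigma> (a(k := Y j))))) \<in> J"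
    by (intro J_sum J_CC slot) simp
  also have "(\<Sum>\<sigma> | \<sigma> permutes {..<n}. CC (of_int (sign \<sigma>)) * (?P \<sigma> a - (\<Sum>j<N. z j * ?P \<sigma> (a(k := Y j)))))
    = alt n a - (\<Sum>\<sigma> | \<sigma> permutes {..<n}. \<Sum>j<N. z j * (CC (of_int (sign \<sigma>)) * ?P \<sigma> (a(k := Y j))))"
    unfolding alt_def right_diff_distrib sum_subtractf sum_distrib_left CC_move ..
  also have "(\<Sum>\<sigma> | \<sigma> permutes {..<n}. \<Sum>j<N. z j * (CC (of_int (sign \<sigma>)) * ?P \<sigma> (a(k := Y j))))
    = (\<Sum>j<N. z j * alt n (a(k := Y j)))"
    unfolding alt_def sum_distrib_left by (rule sum.swap)
  finally show ?thesis .
qed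

text \<open>With \<open>N\<close> generators and \<open>N + 1\<close> arguments, linearity over the
  centre replaces all arguments by generators, two of which coincide. The induction index
  \<open>k\<close> bounds the slots that may still hold arbitrary elements.\<close>

theorem fin_cent_imp_identity:
  assumes fin_cent
  shows "\<exists>n. \<forall>a. (\<forall>i. a i \<in> FG) \<longrightarrow> (\<Sum>w\<in>{w. std_poly n w \<noteq> 0}. CC (std_poly n w) * prod_list (map a w)) \<in> J"
proof -
  obtain N :: nat and Y where Y: "\<forall>i<N. Y i \<in> FG" and gen: "\<forall>x\<in>FG. \<exists>z. (\<forall>i<N. z i \<in> cent) \<and> x - (\<Sum>i<N. z i * Y i) \<in> J"
    using assms unfolding fin_cent_def by (elim exE conjE)
  have main: "alt (Suc N) a \<in> J"
    if "k \<le> Suc N" "\<And>i. a i \<in> FG" "\<And>i. k \<le> i \<Longrightarrow> i < Suc N \<Longrightarrow> \<exists>j<N. a i = Y j" for k a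
    using that
  proof (induction k arbitrary: a)
    case 0
    then have "a ` {..<Suc N} \<subseteq> Y ` {..<N}" by fast
    then have "card (a ` {..<Suc N}) \<le> card (Y ` {..<N})" by (intro card_mono) simp_all
    also have "\<dots> \<le> N" using card_image_le[of "{..<N}" Y] by simp
    finally have "\<not> inj_on a {..<Suc N}" by (intro pigeonhole) simp
    then obtain i j where "i < Suc N" "j < Suc N" "i \<noteq> j" "a i = a j" unfolding inj_on_def by blast
    then show ?case by (simp add: alt_equal_arguments)
  next
    case (Suc k)
    obtain z where z: "\<forall>i<N. z i \<in> cent" "a k - (\<Sum>i<N. z i * Y i) \<in> J"
      using bspec[OF gen Suc.prems(2)[of k]] by (elim exE conjE)
    have kN: "k < Suc N" using Suc.prems(1) by simp
    have Yi: "Y i \<in> FG" if "i < N" for i using Y that by blast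
    have zi: "z i \<in> cent" if "i < N" for i using z(1) that by blast
    have IH: "alt (Suc N) (a(k := Y j)) \<in> J" if j: "j < N" for j
    proof (rule Suc.IH)
      show "k \<le> Suc N" using kN by simp
      show "(a(k := Y j)) i \<in> FG" for i using Suc.prems(2) Yi[OF j] by simp
      show "\<exists>j'<N. (a(k := Y j)) i = Y j'" if i: "k \<le> i" "i < Suc N" for i
      proof (cases "i = k")
        case True then show ?thesis using j by auto
      next
        case False
        then show ?thesis using Suc.prems(3)[of i] i by simp
      qed
    qed
    have "(\<Sum>j<N. z j * alt (Suc N) (a(k := Y j))) \<in> J"
      by (rule J_sum) (use IH zi cent_FG J_left in simp)
    with alt_slot[where n = "Suc N" and k = k and a = a and Y = Y and z = z and N = N, OF kN Suc.prems(2) Yi zi z(2)]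
    have "(alt (Suc N) a - (\<Sum>j<N. z j * alt (Suc N) (a(k := Y j)))) + (\<Sum>j<N. z j * alt (Suc N) (a(k := Y j))) \<in> J"
      by (intro J_add)
    then show ?case by simp
  qed
  show ?thesis unfolding std_poly_alt
  proof (intro exI[of _ "Suc N"] allI impI)
    fix a :: "nat \<Rightarrow> 'v sk" assume a: "\<forall>i. a i \<in> FG"
    show "alt (Suc N) a \<in> J" by (rule main[of "Suc N"]) (use a in auto)
  qed
qed

end

subsection \<open>Algebras presented by the monoid algebra\<close>

text \<open>An algebra given as the image of a subalgebra of the monoid algebra under a map that
  respects all operations. Its ring axioms are inherited, so associativity of the concrete products
  and coset operations comes from the monoid algebra.\<close>

locale presented =
  fixes C :: "'v::ab_group_add sk set" and \<phi> :: "'v sk \<Rightarrow> 'b" and X :: "(complex, 'b) module"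
  assumes C_add: "a \<in> C \<Longrightarrow> b \<in> C \<Longrightarrow> a + b \<in> C" and C_mult: "a \<in> C \<Longrightarrow> b \<in> C \<Longrightarrow> a * b \<in> C"
    and C_CC: "CC z \<in> C"
    and \<phi>_carrier: "\<phi> ` C = carrier X"
    and \<phi>_add: "a \<in> C \<Longrightarrow> b \<in> C \<Longrightarrow> \<phi> (a + b) = \<phi> a \<oplus>\<^bsub>X\<^esub> \<phi> b"
    and \<phi>_mult: "a \<in> C \<Longrightarrow> b \<in> C \<Longrightarrow> \<phi> (a * b) = \<phi> a \<otimes>\<^bsub>X\<^esub> \<phi> b"
    and \<phi>_1: "\<phi> 1 = \<one>\<^bsub>X\<^esub>" and \<phi>_0: "\<phi> 0 = \<zero>\<^bsub>X\<^esub>"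
    and \<phi>_smult: "a \<in> C \<Longrightarrow> \<phi> (CC z * a) = z \<odot>\<^bsub>X\<^esub> \<phi> a"
begin

lemma C_0: "0 \<in> C" and C_1: "1 \<in> C" using C_CC[of 0] C_CC[of 1] by simp_all
lemma C_uminus: "a \<in> C \<Longrightarrow> - a \<in> C" using C_mult[OF C_CC[of "- 1"], of a] by (simp add: CC_uminus)
lemma C_diff: "a \<in> C \<Longrightarrow> b \<in> C \<Longrightarrow> a - b \<in> C" using C_add[OF _ C_uminus, of a b] by simp
lemma C_sum: "(\<And>i. i \<in> A \<Longrightarrow> f i \<in> C) \<Longrightarrow> sum f A \<in> C"
  by (induction A rule: infinite_finite_induct) (simp_all add: C_0 C_add)

lemma \<phi>_in: "a \<in> C \<Longrightarrow> \<phi> a \<in> carrier X" unfolding \<phi>_carrier[symmetric] by (rule imageI)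

lemma \<phi>_surj: "x \<in> carrier X \<Longrightarrow> \<exists>a\<in>C. x = \<phi> a" unfolding \<phi>_carrier[symmetric] by blast

lemma is_ring: "ring X"
proof (rule ringI)
  show "abelian_group X"
  proof (rule abelian_groupI)
    fix x y z assume x: "x \<in> carrier X" and y: "y \<in> carrier X" and z: "z \<in> carrier X"
    from \<phi>_surj[OF x] \<phi>_surj[OF y] \<phi>_surj[OF z] obtain a b c where
      abc: "a \<in> C" "b \<in> C" "c \<in> C" and e: "x = \<phi> a" "y = \<phi> b" "z = \<phi> c" by (elim bexE)
    show "x \<oplus>\<^bsub>X\<^esub> y \<in> carrier X" unfolding e \<phi>_add[OF abc(1,2), symmetric] by (intro \<phi>_in C_add abc)
    show "x \<oplus>\<^bsub>X\<^esub> y \<oplus>\<^bsub>X\<^esub> z = x \<oplus>\<^bsub>X\<^esub> (y \<oplus>\<^bsub>X\<^esub> z)"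
      unfolding e by (simp only: \<phi>_add[symmetric] abc C_add add.assoc)
    show "x \<oplus>\<^bsub>X\<^esub> y = y \<oplus>\<^bsub>X\<^esub> x"
      unfolding e using \<phi>_add[OF abc(1,2)] \<phi>_add[OF abc(2,1)] by (simp only: add.commute[of b a])
    show "\<zero>\<^bsub>X\<^esub> \<oplus>\<^bsub>X\<^esub> x = x" unfolding e \<phi>_0[symmetric] by (simp only: \<phi>_add[symmetric] abc C_0 add_0)
    have "\<phi> (- a) \<oplus>\<^bsub>X\<^esub> \<phi> a = \<zero>\<^bsub>X\<^esub>" unfolding \<phi>_0[symmetric]
      by (simp only: \<phi>_add[symmetric] abc C_uminus add.left_inverse)
    then show "\<exists>y\<in>carrier X. y \<oplus>\<^bsub>X\<^esub> x = \<zero>\<^bsub>X\<^esub>" unfolding e using \<phi>_in[OF C_uminus[OF abc(1)]] by blast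
  next
    show "\<zero>\<^bsub>X\<^esub> \<in> carrier X" unfolding \<phi>_0[symmetric] by (rule \<phi>_in[OF C_0])
  qed
  show "monoid X"
  proof (rule monoidI)
    fix x y z assume x: "x \<in> carrier X" and y: "y \<in> carrier X" and z: "z \<in> carrier X"
    from \<phi>_surj[OF x] \<phi>_surj[OF y] \<phi>_surj[OF z] obtain a b c where
      abc: "a \<in> C" "b \<in> C" "c \<in> C" and e: "x = \<phi> a" "y = \<phi> b" "z = \<phi> c" by (elim bexE)
    show "x \<otimes>\<^bsub>X\<^esub> y \<in> carrier X" unfolding e \<phi>_mult[OF abc(1,2), symmetric] by (intro \<phi>_in C_mult abc)
    show "x \<otimes>\<^bsub>X\<^esub> y \<otimes>\<^bsub>X\<^esub> z = x \<otimes>\<^bsub>X\<^esub> (y \<otimes>\<^bsub>X\<^esub> z)"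
      unfolding e by (simp only: \<phi>_mult[symmetric] abc C_mult mult.assoc)
    show "\<one>\<^bsub>X\<^esub> \<otimes>\<^bsub>X\<^esub> x = x" unfolding e \<phi>_1[symmetric] by (simp only: \<phi>_mult[symmetric] abc C_1 mult_1_left)
    show "x \<otimes>\<^bsub>X\<^esub> \<one>\<^bsub>X\<^esub> = x" unfolding e \<phi>_1[symmetric] by (simp only: \<phi>_mult[symmetric] abc C_1 mult_1_right)
  next
    show "\<one>\<^bsub>X\<^esub> \<in> carrier X" unfolding \<phi>_1[symmetric] by (rule \<phi>_in[OF C_1])
  qed
  fix x y z assume x: "x \<in> carrier X" and y: "y \<in> carrier X" and z: "z \<in> carrier X"
  from \<phi>_surj[OF x] \<phi>_surj[OF y] \<phi>_surj[OF z] obtain a b c where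
    abc: "a \<in> C" "b \<in> C" "c \<in> C" and e: "x = \<phi> a" "y = \<phi> b" "z = \<phi> c" by (elim bexE)
  show "(x \<oplus>\<^bsub>X\<^esub> y) \<otimes>\<^bsub>X\<^esub> z = x \<otimes>\<^bsub>X\<^esub> z \<oplus>\<^bsub>X\<^esub> y \<otimes>\<^bsub>X\<^esub> z"
    unfolding e by (simp only: \<phi>_mult[symmetric] \<phi>_add[symmetric] abc C_mult C_add distrib_right)
  show "z \<otimes>\<^bsub>X\<^esub> (x \<oplus>\<^bsub>X\<^esub> y) = z \<otimes>\<^bsub>X\<^esub> x \<oplus>\<^bsub>X\<^esub> z \<otimes>\<^bsub>X\<^esub> y"
    unfolding e by (simp only: \<phi>_mult[symmetric] \<phi>_add[symmetric] abc C_mult C_add distrib_left)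
qed

lemma \<phi>_uminus: "a \<in> C \<Longrightarrow> \<phi> (- a) = \<ominus>\<^bsub>X\<^esub> \<phi> a"
proof -
  assume a: "a \<in> C"
  interpret ring X by (rule is_ring)
  have "\<phi> (- a) \<oplus>\<^bsub>X\<^esub> \<phi> a = \<zero>\<^bsub>X\<^esub>" unfolding \<phi>_0[symmetric]
    by (simp only: \<phi>_add[symmetric] a C_uminus add.left_inverse)
  then show ?thesis using minus_equality[OF _ \<phi>_in[OF a] \<phi>_in[OF C_uminus[OF a]]] by simp
qed

lemma \<phi>_diff: "a \<in> C \<Longrightarrow> b \<in> C \<Longrightarrow> \<phi> (a - b) = \<phi> a \<ominus>\<^bsub>X\<^esub> \<phi> b"
  using \<phi>_add[OF _ C_uminus, of a b] by (simp add: \<phi>_uminus a_minus_def)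

lemma \<phi>_sum: "finite A \<Longrightarrow> (\<And>i. i \<in> A \<Longrightarrow> f i \<in> C) \<Longrightarrow> \<phi> (sum f A) = (\<Oplus>\<^bsub>X\<^esub>i\<in>A. \<phi> (f i))"
proof (induction A rule: finite_induct)
  interpret ring X by (rule is_ring)
  case empty show ?case by (simp add: \<phi>_0)
next
  interpret ring X by (rule is_ring)
  case (insert i A)
  have 1: "(\<Oplus>\<^bsub>X\<^esub>i\<in>insert i A. \<phi> (f i)) = \<phi> (f i) \<oplus>\<^bsub>X\<^esub> (\<Oplus>\<^bsub>X\<^esub>i\<in>A. \<phi> (f i))"
    by (rule finsum_insert) (use insert \<phi>_in in auto)
  have 2: "\<phi> (sum f A) = (\<Oplus>\<^bsub>X\<^esub>i\<in>A. \<phi> (f i))" by (rule insert.IH) (use insert.prems in simp)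
  have "\<phi> (f i + sum f A) = \<phi> (f i) \<oplus>\<^bsub>X\<^esub> \<phi> (sum f A)"
    by (rule \<phi>_add, rule insert.prems, simp, rule C_sum, rule insert.prems, simp)
  then show ?case unfolding 1 2[symmetric] using insert.hyps by simp
qed

lemma image_ideal:
  assumes K: "K \<subseteq> C" "0 \<in> K" and add: "\<And>a b. a \<in> K \<Longrightarrow> b \<in> K \<Longrightarrow> a + b \<in> K"
    and left: "\<And>a x. a \<in> K \<Longrightarrow> x \<in> C \<Longrightarrow> x * a \<in> K" and right: "\<And>a x. a \<in> K \<Longrightarrow> x \<in> C \<Longrightarrow> a * x \<in> K"
  shows "ideal (\<phi> ` K) X"
proof (rule idealI[OF is_ring])
  interpret ring X by (rule is_ring)
  have KC: "a \<in> C" if "a \<in> K" for a using K(1) that by blast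
  show "subgroup (\<phi> ` K) (add_monoid X)"
  proof
    show "\<phi> ` K \<subseteq> carrier (add_monoid X)" using \<phi>_in KC by auto
    show "x \<otimes>\<^bsub>add_monoid X\<^esub> y \<in> \<phi> ` K" if xy: "x \<in> \<phi> ` K" "y \<in> \<phi> ` K" for x y
    proof -
      obtain a b where ab: "a \<in> K" "b \<in> K" "x = \<phi> a" "y = \<phi> b" using xy by blast
      have "x \<oplus>\<^bsub>X\<^esub> y = \<phi> (a + b)" unfolding ab(3,4) by (rule \<phi>_add[OF KC KC, OF ab(1,2), symmetric])
      then show ?thesis using add[OF ab(1,2)] by simp
    qed
    show "\<one>\<^bsub>add_monoid X\<^esub> \<in> \<phi> ` K" using K(2) \<phi>_0 by (auto intro: rev_image_eqI)
    show "inv\<^bsub>add_monoid X\<^esub> x \<in> \<phi> ` K" if x: "x \<in> \<phi> ` K" for x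
    proof -
      obtain a where a: "a \<in> K" "x = \<phi> a" using x by blast
      have "inv\<^bsub>add_monoid X\<^esub> x = \<phi> (- a)" unfolding a(2) \<phi>_uminus[OF KC[OF a(1)]] a_inv_def ..
      moreover have "- a \<in> K" using left[OF a(1) C_CC[of "- 1"]] by (simp add: CC_uminus)
      ultimately show ?thesis by blast
    qed
  qed
  fix y x assume y: "y \<in> \<phi> ` K" and x: "x \<in> carrier X"
  obtain a where a: "a \<in> K" "y = \<phi> a" using y by blast
  obtain b where b: "b \<in> C" "x = \<phi> b" using \<phi>_surj[OF x] by blast
  show "x \<otimes>\<^bsub>X\<^esub> y \<in> \<phi> ` K"
    unfolding a(2) b(2) \<phi>_mult[OF b(1) KC[OF a(1)], symmetric] by (intro imageI left a b)
  show "y \<otimes>\<^bsub>X\<^esub> x \<in> \<phi> ` K"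
    unfolding a(2) b(2) \<phi>_mult[OF KC[OF a(1)] b(1), symmetric] by (intro imageI right a b)
qed

lemma coset_zero_iff:
  assumes I: "ideal I X" and x: "x \<in> carrier X"
  shows "I +>\<^bsub>X\<^esub> x = I \<longleftrightarrow> x \<in> I"
proof -
  interpret I: ideal I X by (rule I)
  show ?thesis using I.a_coset_join1[OF _ x I.a_subgroup] I.a_rcos_const by blast
qed

text \<open>Scalars act as multiplication by \<open>\<phi> (CC z)\<close>, which preserves the
  ideal; hence all members of a coset give the same term in the union that defines the scalar
  multiplication.\<close>

lemma quotient:
  assumes I: "ideal I X"
  shows "presented C (\<lambda>a. I +>\<^bsub>X\<^esub> \<phi> a) (quotient_algebra X I)"
proof -
  interpret I: ideal I X by (rule I)
  let ?Q = "quotient_algebra X I"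
  have car: "carrier ?Q = a_rcosets\<^bsub>X\<^esub> I" and add: "x \<oplus>\<^bsub>?Q\<^esub> y = x <+>\<^bsub>X\<^esub> y"
    and mult: "x \<otimes>\<^bsub>?Q\<^esub> y = rcoset_mult X I x y" and one: "\<one>\<^bsub>?Q\<^esub> = I +>\<^bsub>X\<^esub> \<one>\<^bsub>X\<^esub>"
    and zero: "\<zero>\<^bsub>?Q\<^esub> = I" and smult: "z \<odot>\<^bsub>?Q\<^esub> x = (\<Union>y\<in>x. I +>\<^bsub>X\<^esub> (z \<odot>\<^bsub>X\<^esub> y))" for x y z
    by (simp_all add: quotient_algebra_def FactRing_def)
  show ?thesis
  proof
    show "(\<lambda>a. I +>\<^bsub>X\<^esub> \<phi> a) ` C = carrier ?Q"
      unfolding car A_RCOSETS_def' \<phi>_carrier[symmetric] by auto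
    show "I +>\<^bsub>X\<^esub> \<phi> (a + b) = (I +>\<^bsub>X\<^esub> \<phi> a) \<oplus>\<^bsub>?Q\<^esub> (I +>\<^bsub>X\<^esub> \<phi> b)" if ab: "a \<in> C" "b \<in> C" for a b
      unfolding add \<phi>_add[OF ab] by (rule I.a_rcos_sum[OF \<phi>_in \<phi>_in, OF ab, symmetric])
    show "I +>\<^bsub>X\<^esub> \<phi> (a * b) = (I +>\<^bsub>X\<^esub> \<phi> a) \<otimes>\<^bsub>?Q\<^esub> (I +>\<^bsub>X\<^esub> \<phi> b)" if ab: "a \<in> C" "b \<in> C" for a b
      unfolding mult \<phi>_mult[OF ab] by (rule I.rcoset_mult_add[OF \<phi>_in \<phi>_in, OF ab, symmetric])
    show "I +>\<^bsub>X\<^esub> \<phi> 1 = \<one>\<^bsub>?Q\<^esub>" unfolding one \<phi>_1 ..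
    show "I +>\<^bsub>X\<^esub> \<phi> 0 = \<zero>\<^bsub>?Q\<^esub>" unfolding zero coset_zero_iff[OF I \<phi>_in[OF C_0]] by (simp add: \<phi>_0)
    show "I +>\<^bsub>X\<^esub> \<phi> (CC z * a) = z \<odot>\<^bsub>?Q\<^esub> (I +>\<^bsub>X\<^esub> \<phi> a)" if a: "a \<in> C" for a z
    proof -
      have sm: "z \<odot>\<^bsub>X\<^esub> x = \<phi> (CC z) \<otimes>\<^bsub>X\<^esub> x" if x: "x \<in> carrier X" for x
      proof -
        obtain b where b: "b \<in> C" "x = \<phi> b" using \<phi>_surj[OF x] by blast
        show ?thesis unfolding b(2) \<phi>_smult[OF b(1), symmetric] by (rule \<phi>_mult[OF C_CC b(1)])
      qed
      have za: "I +>\<^bsub>X\<^esub> (z \<odot>\<^bsub>X\<^esub> y) = I +>\<^bsub>X\<^esub> \<phi> (CC z * a)" if y: "y \<in> I +>\<^bsub>X\<^esub> \<phi> a" for y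
      proof -
        obtain i where i: "i \<in> I" "y = i \<oplus>\<^bsub>X\<^esub> \<phi> a" using y unfolding a_r_coset_def' by blast
        have ic: "i \<in> carrier X" using I.a_Hcarr[OF i(1)] .
        note zc = \<phi>_in[OF C_CC[of z]] and ac = \<phi>_in[OF a]
        have "z \<odot>\<^bsub>X\<^esub> y = \<phi> (CC z) \<otimes>\<^bsub>X\<^esub> i \<oplus>\<^bsub>X\<^esub> \<phi> (CC z * a)"
          unfolding i(2) sm[OF I.a_closed[OF ic ac]] \<phi>_mult[OF C_CC a] by (rule I.r_distr[OF ic ac zc])
        moreover have "\<phi> (CC z) \<otimes>\<^bsub>X\<^esub> i \<in> I" by (rule I.I_l_closed[OF i(1) zc])
        ultimately have "z \<odot>\<^bsub>X\<^esub> y \<in> I +>\<^bsub>X\<^esub> \<phi> (CC z * a)" unfolding a_r_coset_def' by blast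
        from I.a_repr_independence[OF this \<phi>_in[OF C_mult[OF C_CC a]] I.a_subgroup] show ?thesis by simp
      qed
      have "\<phi> a \<in> I +>\<^bsub>X\<^esub> \<phi> a" by (rule I.a_rcos_self[OF \<phi>_in[OF a]])
      then show ?thesis unfolding smult using za by blast
    qed
  qed (fact C_add C_mult C_CC)+
qed

end

subsection \<open>The free algebra\<close>

text \<open>Together with \<open>cut\<close> below it identifies finitely supported functions on
  words with the part of the monoid algebra at one group element.\<close>

definition emb :: "('v \<Rightarrow> 'v) \<Rightarrow> ('v list \<Rightarrow> complex) \<Rightarrow> 'v::ab_group_add sk" where
  "emb g f = (\<Sum>w | f w \<noteq> 0. CC (f w) * MM w g)"

lemma lookup_emb: "finite {w. f w \<noteq> 0} \<Longrightarrow> lookup (emb g f) (SK w h) = (if h = g then f w else 0)"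
proof -
  assume fin: "finite {w. f w \<noteq> 0}"
  have "lookup (emb g f) (SK w h) = (\<Sum>u | f u \<noteq> 0. if u = w then (if h = g then f w else 0) else 0)"
    unfolding emb_def lookup_sum by (intro sum.cong refl) (auto simp: CC_mult_lookup lookup_single when_def)
  then show ?thesis using fin by simp
qed

definition cut :: "('v \<Rightarrow> 'v) \<Rightarrow> 'v::ab_group_add sk \<Rightarrow> 'v list \<Rightarrow> complex" where
  "cut g a w = lookup a (SK w g)"

lemma finite_cut: "finite {w. cut g a w \<noteq> 0}"
proof (rule finite_subset)
  show "{w. cut g a w \<noteq> 0} \<subseteq> wd ` keys a"
    unfolding cut_def by (force simp: in_keys_iff intro: rev_image_eqI)
qed simp

lemma cut_emb: "finite {w. f w \<noteq> 0} \<Longrightarrow> cut h (emb g f) = (if h = g then f else (\<lambda>w. 0))"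
  unfolding cut_def by (rule ext) (simp add: lookup_emb)

lemma cut_add: "cut g (a + b) = (\<lambda>w. cut g a w + cut g b w)" by (simp add: cut_def lookup_add fun_eq_iff)
lemma cut_diff: "cut g (a - b) = (\<lambda>w. cut g a w - cut g b w)" by (simp add: cut_def lookup_minus fun_eq_iff)
lemma cut_CC: "cut g (CC z * a) = (\<lambda>w. z * cut g a w)" by (simp add: cut_def CC_mult_lookup fun_eq_iff)
lemma cut_0: "cut g 0 = (\<lambda>w. 0)" by (simp add: cut_def fun_eq_iff)
lemma cut_sum: "cut g (sum f A) = (\<lambda>w. \<Sum>i\<in>A. cut g (f i) w)" by (simp add: cut_def lookup_sum fun_eq_iff)
lemma cut_MM: "cut g (MM u h) = (\<lambda>w. if w = u \<and> g = h then 1 else 0)"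
  by (auto simp: cut_def lookup_single when_def fun_eq_iff)

lemma cut_word_mult:
  assumes g: "bij g"
  shows "cut k (MM u g * b) w = (\<Sum>i\<le>length w. if take i w = u \<and> i = length u
     then cut (giv g \<circ> k) b (map (giv g) (drop i w)) else 0)"
proof -
  let ?R = "\<lambda>b. \<Sum>i\<le>length w. if take i w = u \<and> i = length u then cut (giv g \<circ> k) b (map (giv g) (drop i w)) else 0"
  have inv: "giv g (g x) = x" "g (giv g x) = x" for x
    using g by (simp_all add: bij_is_inj bij_is_surj inv_f_f surj_f_inv_f)
  have gi: "map g (map (giv g) xs) = xs" "map (giv g) (map g xs) = xs" for xs by (induction xs) (simp_all add: inv)
  have mono: "cut k (MM u g * MM v h) w = ?R (MM v h)" for v h
  proof -
    have k: "k = g \<circ> h \<longleftrightarrow> giv g \<circ> k = h" by (auto simp: fun_eq_iff inv) (metis inv(2))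
    have *: "(w = u @ map g v) \<longleftrightarrow> (take (length u) w = u \<and> length u \<le> length w \<and> map (giv g) (drop (length u) w) = v)"
    proof
      assume "w = u @ map g v" then show "take (length u) w = u \<and> length u \<le> length w \<and> map (giv g) (drop (length u) w) = v"
        using gi(2)[of v] by simp
    next
      assume r: "take (length u) w = u \<and> length u \<le> length w \<and> map (giv g) (drop (length u) w) = v"
      then have "map g v = drop (length u) w" using gi(1)[of "drop (length u) w"] by simp
      then show "w = u @ map g v" using r append_take_drop_id[of "length u" w] by simp
    qed
    have "?R (MM v h) = (\<Sum>i\<le>length w. if i = length u then (if take (length u) w = u then
      cut (giv g \<circ> k) (MM v h) (map (giv g) (drop (length u) w)) else 0) else 0)"
      by (intro sum.cong refl) auto
    also have "\<dots> = (if length u \<le> length w \<and> take (length u) w = u then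
      cut (giv g \<circ> k) (MM v h) (map (giv g) (drop (length u) w)) else 0)" by simp
    also have "\<dots> = (if w = u @ map g v \<and> k = g \<circ> h then 1 else 0)" unfolding cut_MM * k by auto
    finally show ?thesis unfolding MM_mult cut_MM by simp
  qed
  have R_if: "(if P then cut h (\<Sum>k\<in>A. CC (c k) * MM (wd k) (gp k)) x else 0)
    = (\<Sum>k\<in>A. c k * (if P then cut h (MM (wd k) (gp k)) x else 0))" for P h x A c
    by (cases P) (simp_all only: cut_sum cut_CC if_True if_False mult_zero_right sum.neutral_const)
  have R_sum: "?R (\<Sum>k\<in>A. CC (c k) * MM (wd k) (gp k)) = (\<Sum>k\<in>A. c k * ?R (MM (wd k) (gp k)))" for A c
  proof -
    have "?R (\<Sum>k\<in>A. CC (c k) * MM (wd k) (gp k)) = (\<Sum>i\<le>length w. \<Sum>k'\<in>A. c k' * (if take i w = u \<and> i = length u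
      then cut (giv g \<circ> k) (MM (wd k') (gp k')) (map (giv g) (drop i w)) else 0))"
      by (intro sum.cong refl) (rule R_if)
    also have "\<dots> = (\<Sum>k'\<in>A. \<Sum>i\<le>length w. c k' * (if take i w = u \<and> i = length u
      then cut (giv g \<circ> k) (MM (wd k') (gp k')) (map (giv g) (drop i w)) else 0))" by (rule sum.swap)
    finally show ?thesis by (simp only: sum_distrib_left)
  qed
  have "cut k (MM u g * b) w = cut k (\<Sum>k'\<in>keys b. CC (lookup b k') * (MM u g * MM (wd k') (gp k'))) w"
    by (subst sk_expand[of b]) (simp only: sum_distrib_left CC_move)
  also have "\<dots> = (\<Sum>k'\<in>keys b. lookup b k' * cut k (MM u g * MM (wd k') (gp k')) w)"
    by (simp only: cut_sum cut_CC)
  also have "\<dots> = ?R (\<Sum>k'\<in>keys b. CC (lookup b k') * MM (wd k') (gp k'))" by (simp only: mono R_sum)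
  also have "\<dots> = ?R b" by (simp only: sk_expand[of b, symmetric])
  finally show ?thesis .
qed

text \<open>The product of the skew group algebra in coefficients: a word splits into a prefix from
  the factor at \<open>g\<close> and a suffix that \<open>g\<close> has moved, which is therefore
  pulled back by the inverse of \<open>g\<close>.\<close>

lemma cut_mult:
  assumes fin: "finite G" and bij: "\<And>g. g \<in> G \<Longrightarrow> bij g" and a: "\<forall>k\<in>keys a. gp k \<in> G"
  shows "cut k (a * b) w = (\<Sum>g\<in>G. \<Sum>i\<le>length w. cut g a (take i w) * cut (giv g \<circ> k) b (map (giv g) (drop i w)))"
proof -
  let ?R = "\<lambda>a. \<Sum>g\<in>G. \<Sum>i\<le>length w. cut g a (take i w) * cut (giv g \<circ> k) b (map (giv g) (drop i w))"
  have mono: "cut k (MM u h * b) w = ?R (MM u h)" if h: "h \<in> G" for u h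
  proof -
    have "?R (MM u h) = (\<Sum>g\<in>G. if g = h then (\<Sum>i\<le>length w. if take i w = u then
       cut (giv h \<circ> k) b (map (giv h) (drop i w)) else 0) else 0)"
      by (intro sum.cong refl) (auto simp: cut_MM intro!: sum.cong)
    also have "\<dots> = (\<Sum>i\<le>length w. if take i w = u then cut (giv h \<circ> k) b (map (giv h) (drop i w)) else 0)"
      using h fin by simp
    also have "\<dots> = cut k (MM u h * b) w" unfolding cut_word_mult[OF bij[OF h]] by (intro sum.cong refl) auto
    finally show ?thesis by simp
  qed
  have R_sum: "?R (\<Sum>k\<in>A. CC (c k) * MM (wd k) (gp k)) = (\<Sum>k\<in>A. c k * ?R (MM (wd k) (gp k)))" for A c
  proof -
    let ?t = "\<lambda>g i k'. c k' * (cut g (MM (wd k') (gp k')) (take i w) * cut (giv g \<circ> k) b (map (giv g) (drop i w)))"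
    have "?R (\<Sum>k\<in>A. CC (c k) * MM (wd k) (gp k)) = (\<Sum>g\<in>G. \<Sum>i\<le>length w. \<Sum>k'\<in>A. ?t g i k')"
      by (intro sum.cong refl) (simp only: cut_sum cut_CC sum_distrib_right mult.assoc)
    also have "\<dots> = (\<Sum>g\<in>G. \<Sum>k'\<in>A. \<Sum>i\<le>length w. ?t g i k')" by (intro sum.cong refl sum.swap)
    also have "\<dots> = (\<Sum>k'\<in>A. \<Sum>g\<in>G. \<Sum>i\<le>length w. ?t g i k')" by (rule sum.swap)
    finally show ?thesis by (simp only: sum_distrib_left)
  qed
  have "cut k (a * b) w = cut k (\<Sum>k'\<in>keys a. CC (lookup a k') * (MM (wd k') (gp k') * b)) w"
    by (subst sk_expand[of a]) (simp only: sum_distrib_right mult.assoc)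
  also have "\<dots> = (\<Sum>k'\<in>keys a. lookup a k' * cut k (MM (wd k') (gp k') * b) w)" by (simp only: cut_sum cut_CC)
  also have "\<dots> = (\<Sum>k'\<in>keys a. lookup a k' * ?R (MM (wd k') (gp k')))"
    by (intro sum.cong refl arg_cong2[where f = "(*)"] mono) (use a in blast)
  also have "\<dots> = ?R (\<Sum>k'\<in>keys a. CC (lookup a k') * MM (wd k') (gp k'))" by (simp only: R_sum)
  also have "\<dots> = ?R a" by (simp only: sk_expand[of a, symmetric])
  finally show ?thesis .
qed

definition words :: "'v::ab_group_add sk set" where "words = {a. \<forall>k\<in>keys a. gp k = id}"

lemma words_add: "a \<in> words \<Longrightarrow> b \<in> words \<Longrightarrow> a + b \<in> words"
  unfolding words_def using keys_add[of a b] by blast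
lemma words_CC: "CC z \<in> words" by (simp add: words_def CC_def zero_skw_def)
lemma words_mult: "a \<in> words \<Longrightarrow> b \<in> words \<Longrightarrow> a * b \<in> words"
  unfolding words_def using keys_mult[of a b] by (fastforce simp: plus_skw_def)
lemma words_MM: "MM w id \<in> words" by (simp add: words_def)
lemma words_sum: "(\<And>i. i \<in> A \<Longrightarrow> f i \<in> words) \<Longrightarrow> sum f A \<in> words"
  by (induction A rule: infinite_finite_induct) (simp_all add: words_add, simp_all add: words_def)
lemma words_emb: "emb id f \<in> words" unfolding emb_def by (intro words_sum words_mult words_CC words_MM)

lemma words_emb_cut: "a \<in> words \<Longrightarrow> emb id (cut id a) = a"
proof (rule poly_mapping_eqI)
  fix k assume a: "a \<in> words"
  show "lookup (emb id (cut id a)) k = lookup a k"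
  proof (cases k)
    case (SK w h)
    have "lookup a (SK w h) = 0" if "h \<noteq> id" using a that unfolding words_def by (force simp: in_keys_iff)
    then show ?thesis unfolding SK lookup_emb[OF finite_cut] by (auto simp: cut_def)
  qed
qed

lemma free_presented: "presented words (cut id) (free_algebra :: (complex, 'v::ab_group_add list \<Rightarrow> complex) module)"
proof
  show "cut id ` words = carrier (free_algebra :: (complex, 'v list \<Rightarrow> complex) module)"
  proof (intro equalityI subsetI)
    fix f assume "f \<in> cut id ` (words :: 'v sk set)"
    then show "f \<in> carrier free_algebra" using finite_cut by (auto simp: free_algebra_def)
  next
    fix f :: "'v list \<Rightarrow> complex" assume "f \<in> carrier free_algebra"
    then have "finite {w. f w \<noteq> 0}" by (simp add: free_algebra_def)
    from cut_emb[OF this, of id id] show "f \<in> cut id ` words" using words_emb[of f] by (auto intro: rev_image_eqI)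
  qed
  show "cut id (a * b) = cut id a \<otimes>\<^bsub>free_algebra\<^esub> cut id b" if "a \<in> words" "b \<in> words" for a b :: "'v sk"
  proof
    fix w
    have "\<forall>k\<in>keys a. gp k \<in> {id}" using that(1) by (simp add: words_def)
    from cut_mult[of "{id}", OF _ _ this, of id b w] show "cut id (a * b) w = (cut id a \<otimes>\<^bsub>free_algebra\<^esub> cut id b) w"
      by (simp add: free_algebra_def)
  qed
  show "cut id (1 :: 'v sk) = \<one>\<^bsub>free_algebra\<^esub>"
    unfolding MM_one[symmetric] cut_MM by (simp add: free_algebra_def fun_eq_iff)
qed (simp_all add: words_add words_mult words_CC cut_add cut_0 cut_CC free_algebra_def)

subsection \<open>The tensor algebra and the skew group algebra\<close>

context hecke_data begin

interpretation fr: presented words "cut id" "free_algebra :: (complex, 'v list \<Rightarrow> complex) module"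
  by (rule free_presented)

section \<open>The tensor algebra as a quotient of the words\<close>

abbreviation I0 :: "('v list \<Rightarrow> complex) set" where "I0 \<equiv> linearity_ideal sc"
abbreviation q :: "('v list \<Rightarrow> complex) \<Rightarrow> ('v list \<Rightarrow> complex) set" where "q f \<equiv> I0 +>\<^bsub>free_algebra\<^esub> f"

lemma letter_cut: "letter x = cut id (MM [x] id)"
  unfolding cut_MM by (simp add: letter_def fun_eq_iff)

lemma linear_generators:
  "letter (v + w) \<ominus>\<^bsub>free_algebra\<^esub> (letter v \<oplus>\<^bsub>free_algebra\<^esub> letter w) = cut id (MM [v + w] id - (MM [v] id + MM [w] id))"
  "letter (sc z v) \<ominus>\<^bsub>free_algebra\<^esub> (z \<odot>\<^bsub>free_algebra\<^esub> letter v) = cut id (MM [sc z v] id - CC z * MM [v] id)"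
  unfolding letter_cut
  by (simp_all only: fr.\<phi>_diff fr.\<phi>_add fr.\<phi>_smult words_MM words_add words_mult words_CC)

lemma I0_eq: "I0 = Idl\<^bsub>free_algebra\<^esub> ({cut id (MM [v + w] id - (MM [v] id + MM [w] id)) | v w. True} \<union>
    {cut id (MM [sc z v] id - CC z * MM [v] id) | z v. True})"
  unfolding linearity_ideal_def linear_generators ..

lemma gens_carrier: "{cut id (MM [v + w] id - (MM [v] id + MM [w] id)) | v w. True} \<union>
    {cut id (MM [sc z v] id - CC z * MM [v] id) | z v. True} \<subseteq> carrier (free_algebra :: (complex, 'v list \<Rightarrow> complex) module)"
  by (auto intro!: fr.\<phi>_in fr.C_diff fr.C_add fr.C_mult words_MM words_CC)

lemma I0_ideal: "ideal I0 free_algebra"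
  unfolding I0_eq by (rule ring.genideal_ideal[OF fr.is_ring gens_carrier])

lemma I0_gens: "cut id (MM [v + w] id - (MM [v] id + MM [w] id)) \<in> I0" "cut id (MM [sc z v] id - CC z * MM [v] id) \<in> I0"
  unfolding I0_eq by (rule subsetD[OF ring.genideal_self[OF fr.is_ring gens_carrier]], blast)+

text \<open>The induction principle for the linearity ideal: a property that is stable under the
  ideal operations need only be tested on the linearity relations.\<close>

lemma I0_sub:
  assumes K: "K \<subseteq> words" "0 \<in> K" "\<And>a b. a \<in> K \<Longrightarrow> b \<in> K \<Longrightarrow> a + b \<in> K"
    "\<And>a x. a \<in> K \<Longrightarrow> x \<in> words \<Longrightarrow> x * a \<in> K" "\<And>a x. a \<in> K \<Longrightarrow> x \<in> words \<Longrightarrow> a * x \<in> K"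
    and g: "\<And>v w. MM [v + w] id - (MM [v] id + MM [w] id) \<in> K" "\<And>z v. MM [sc z v] id - CC z * MM [v] id \<in> K"
    and f: "f \<in> I0"
  shows "\<exists>a\<in>K. f = cut id a"
proof -
  have "I0 \<subseteq> cut id ` K" unfolding I0_eq
    by (rule ring.genideal_minimal[OF fr.is_ring fr.image_ideal[OF K]]) (use g in blast)+
  then show ?thesis using f by blast
qed

lemma giv_map: "g \<in> G \<Longrightarrow> map g (map (giv g) w) = w" "g \<in> G \<Longrightarrow> map (giv g) (map g w) = w"
  using inv_comp_G[of g] by (simp_all del: map_map add: map_map[of _ _ w] o_def fun_eq_iff)

lemma shift_finite: assumes "g \<in> G" "finite {w. f w \<noteq> (0::complex)}" shows "finite {w. f (map (giv g) w) \<noteq> 0}"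
proof (rule finite_subset)
  show "{w. f (map (giv g) w) \<noteq> 0} \<subseteq> map g ` {w. f w \<noteq> 0}"
    using giv_map(1)[OF assms(1)] by (metis (no_types, lifting) imageI mem_Collect_eq subsetI)
qed (use assms in simp)

text \<open>The elements whose translate lies in \<open>I0\<close> form an ideal, and a linear
  \<open>g\<close> takes linearity relations to linearity relations.\<close>

lemma I0_act: assumes g: "g \<in> G" and f: "f \<in> I0" shows "(\<lambda>w. f (map (giv g) w)) \<in> I0"
proof -
  interpret I: ideal I0 "free_algebra :: (complex, 'v list \<Rightarrow> complex) module" by (rule I0_ideal)
  let ?s = "\<lambda>f w. f (map (giv g) w) :: complex"
  define K where "K = {a \<in> words. ?s (cut id a) \<in> I0}"
  have sc: "?s (cut id x) \<in> carrier free_algebra" for x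
    using shift_finite[OF g finite_cut[of id x]] by (simp add: free_algebra_def)
  have sm: "?s (cut id (x * a)) = ?s (cut id x) \<otimes>\<^bsub>free_algebra\<^esub> ?s (cut id a)" if "x \<in> words" "a \<in> words" for x a
    unfolding fr.\<phi>_mult[OF that] by (simp add: free_algebra_def fun_eq_iff take_map drop_map)
  have sa: "?s (cut id (x + a)) = ?s (cut id x) \<oplus>\<^bsub>free_algebra\<^esub> ?s (cut id a)" if "x \<in> words" "a \<in> words" for x a
    unfolding fr.\<phi>_add[OF that] by (simp add: free_algebra_def fun_eq_iff)
  have z: "?s (cut id 0) = \<zero>\<^bsub>free_algebra\<^esub>" by (simp add: cut_0 free_algebra_def)
  have w1: "map (giv g) w = [v] \<longleftrightarrow> w = [g v]" for v w
    using giv_map[OF g, of w] giv_map(2)[OF g, of "[v]"] by (auto simp del: map_map)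
  have l: "?s (cut id (MM [v] id)) = cut id (MM [g v] id)" for v unfolding cut_MM w1 ..
  have lw: "cut id (MM [v] id) (map (giv g) w) = cut id (MM [g v] id) w" for v w using fun_cong[OF l] .
  have "\<exists>a\<in>K. f = cut id a"
  proof (rule I0_sub[OF _ _ _ _ _ _ _ f])
    show "K \<subseteq> words" by (auto simp: K_def)
    show "0 \<in> K" unfolding K_def using z fr.C_0 I.additive_subgroup_axioms by (simp add: additive_subgroup.zero_closed)
    show "a + b \<in> K" if "a \<in> K" "b \<in> K" for a b
    proof -
      from that have ab: "a \<in> words" "b \<in> words" "?s (cut id a) \<in> I0" "?s (cut id b) \<in> I0" unfolding K_def by blast+
      show ?thesis unfolding K_def mem_Collect_eq sa[OF ab(1,2)] by (intro conjI words_add ab additive_subgroup.a_closed[OF I.additive_subgroup_axioms])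
    qed
    show "x * a \<in> K" "a * x \<in> K" if "a \<in> K" "x \<in> words" for a x
    proof -
      from that have ab: "a \<in> words" "?s (cut id a) \<in> I0" unfolding K_def by blast+
      show "x * a \<in> K" unfolding K_def mem_Collect_eq sm[OF that(2) ab(1)]
        by (intro conjI words_mult ab that(2) I.I_l_closed sc)
      show "a * x \<in> K" unfolding K_def mem_Collect_eq sm[OF ab(1) that(2)]
        by (intro conjI words_mult ab that(2) I.I_r_closed sc)
    qed
    show "MM [v + w] id - (MM [v] id + MM [w] id) \<in> K" for v w
      unfolding K_def using I0_gens(1)[of "g v" "g w"]
      by (simp add: fr.C_diff words_add words_MM cut_diff cut_add lw G_add[OF g])
    show "MM [sc z v] id - CC z * MM [v] id \<in> K" for z v
      unfolding K_def using I0_gens(2)[of z "g v"]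
      by (simp add: fr.C_diff words_mult words_CC words_MM cut_diff cut_CC lw G_sc[OF g])
  qed
  then show ?thesis unfolding K_def by blast
qed

lemma tensor_presented: "presented words (\<lambda>a. q (cut id a)) (tensor_algebra sc)"
  unfolding tensor_algebra_def by (rule fr.quotient[OF I0_ideal])

interpretation tp: presented words "\<lambda>a. q (cut id a)" "tensor_algebra sc"
  by (rule tensor_presented)

lemma fin_carrier: "f \<in> carrier free_algebra \<longleftrightarrow> finite {w. f w \<noteq> 0}" by (simp add: free_algebra_def)

lemma q_carrier: "finite {w. f w \<noteq> 0} \<Longrightarrow> q f \<in> carrier (tensor_algebra sc)"
  using tp.\<phi>_in[OF words_emb, of f] by (simp add: cut_emb)

lemma q_add: "finite {w. f w \<noteq> 0} \<Longrightarrow> finite {w. h w \<noteq> 0} \<Longrightarrow> q (\<lambda>w. f w + h w) = q f \<oplus>\<^bsub>tensor_algebra sc\<^esub> q h"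
  using tp.\<phi>_add[OF words_emb words_emb, of f h] by (simp add: cut_add cut_emb)

lemma q_CC: "finite {w. f w \<noteq> 0} \<Longrightarrow> q (\<lambda>w. z * f w) = z \<odot>\<^bsub>tensor_algebra sc\<^esub> q f"
  using tp.\<phi>_smult[OF words_emb, of z f] by (simp add: cut_CC cut_emb)

lemma q_mult: "finite {w. f w \<noteq> 0} \<Longrightarrow> finite {w. h w \<noteq> 0} \<Longrightarrow>
  q (\<lambda>w. \<Sum>i\<le>length w. f (take i w) * h (drop i w)) = q f \<otimes>\<^bsub>tensor_algebra sc\<^esub> q h"
  using tp.\<phi>_mult[OF words_emb words_emb, of f h] fr.\<phi>_mult[OF words_emb words_emb, of f h]
  by (simp add: cut_emb free_algebra_def)

lemma q_sum: "finite A \<Longrightarrow> (\<And>i. i \<in> A \<Longrightarrow> finite {w. f i w \<noteq> 0}) \<Longrightarrow>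
  q (\<lambda>w. \<Sum>i\<in>A. f i w) = (\<Oplus>\<^bsub>tensor_algebra sc\<^esub>i\<in>A. q (f i))"
proof -
  assume A: "finite A" "\<And>i. i \<in> A \<Longrightarrow> finite {w. f i w \<noteq> 0}"
  interpret T: ring "tensor_algebra sc" by (rule tp.is_ring)
  have "q (cut id (\<Sum>i\<in>A. emb id (f i))) = (\<Oplus>\<^bsub>tensor_algebra sc\<^esub>i\<in>A. q (cut id (emb id (f i))))"
    by (rule tp.\<phi>_sum[OF A(1) words_emb])
  also have "cut id (\<Sum>i\<in>A. emb id (f i)) = (\<lambda>w. \<Sum>i\<in>A. f i w)"
    unfolding cut_sum by (rule ext, rule sum.cong[OF refl]) (simp add: cut_emb A(2))
  also have "(\<Oplus>\<^bsub>tensor_algebra sc\<^esub>i\<in>A. q (cut id (emb id (f i)))) = (\<Oplus>\<^bsub>tensor_algebra sc\<^esub>i\<in>A. q (f i))"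
    by (rule T.finsum_cong') (simp_all add: A(2) q_carrier cut_emb)
  finally show ?thesis .
qed

lemma q_0: "q (\<lambda>w. 0) = \<zero>\<^bsub>tensor_algebra sc\<^esub>" using tp.\<phi>_0 by (simp add: cut_0)
lemma q_1: "q (\<lambda>w. if w = [] then 1 else 0) = \<one>\<^bsub>tensor_algebra sc\<^esub>"
  using tp.\<phi>_1 unfolding MM_one[symmetric] cut_MM by simp

lemma tensor_act_coset:
  assumes g: "g \<in> G" shows "tensor_act g (q f) = q (\<lambda>w. f (map (giv g) w))"
proof -
  have gg: "giv (giv g) = g" using bij_G[OF g] by (rule inv_inv_eq)
  have qf: "q f = (\<lambda>h w. h w + f w) ` I0" for f unfolding a_r_coset_def' by (auto simp: free_algebra_def)
  show ?thesis
  proof (intro equalityI subsetI)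
    fix x assume "x \<in> tensor_act g (q f)"
    then obtain h where h: "h \<in> I0" "x = (\<lambda>w. h (map (giv g) w) + f (map (giv g) w))"
      unfolding tensor_act_def qf by blast
    show "x \<in> q (\<lambda>w. f (map (giv g) w))" unfolding qf
      by (rule image_eqI[OF _ I0_act[OF g h(1)]]) (simp add: h(2))
  next
    fix x assume "x \<in> q (\<lambda>w. f (map (giv g) w))"
    then obtain h where h: "h \<in> I0" "x = (\<lambda>w. h w + f (map (giv g) w))" unfolding qf by blast
    have h': "(\<lambda>w. h (map g w)) \<in> I0" using I0_act[OF inv_G[OF g] h(1)] unfolding gg .
    have "x = (\<lambda>w. (\<lambda>w. h (map g w) + f w) (map (giv g) w))"
      unfolding h(2) using giv_map(1)[OF g] by (simp del: map_map)
    moreover have "(\<lambda>w. h (map g w) + f w) \<in> q f" unfolding qf by (rule image_eqI[OF _ h']) simp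
    ultimately show "x \<in> tensor_act g (q f)" unfolding tensor_act_def by (rule image_eqI)
  qed
qed

section \<open>The skew group algebra as an image of FG\<close>

definition \<Psi> :: "'v sk \<Rightarrow> ('v \<Rightarrow> 'v) \<Rightarrow> ('v list \<Rightarrow> complex) set" where
  "\<Psi> a = (\<lambda>g\<in>G. q (cut g a))"

lemma GL_inv: "g \<in> G \<Longrightarrow> inv\<^bsub>GL sc\<lparr>carrier := G\<rparr>\<^esub> g = giv g"
proof -
  assume g: "g \<in> G"
  have "(THE y. y \<in> G \<and> g \<circ> y = id \<and> y \<circ> g = id) = giv g"
  proof (rule the_equality)
    show "giv g \<in> G \<and> g \<circ> giv g = id \<and> giv g \<circ> g = id" using inv_G[OF g] inv_comp_G[OF g] by blast
    show "y = giv g" if "y \<in> G \<and> g \<circ> y = id \<and> y \<circ> g = id" for y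
    proof -
      have "y = (giv g \<circ> g) \<circ> y" unfolding inv_comp_G(1)[OF g] by simp
      also have "\<dots> = giv g" using that by (simp only: comp_assoc o_id)
      finally show ?thesis .
    qed
  qed
  then show ?thesis unfolding m_inv_def by (simp add: GL_def)
qed

lemma emb_FG: "g \<in> G \<Longrightarrow> emb g f \<in> FG"
  unfolding emb_def by (intro FG_sum FG_mult FG_CC FG_MM)

lemma skew_presented: "presented FG \<Psi> (skew_tensor_algebra sc G)"
proof
  note sd = skew_tensor_algebra_def skew_group_algebra_def
  interpret T: ring "tensor_algebra sc" by (rule tp.is_ring)
  show "\<Psi> ` FG = carrier (skew_tensor_algebra sc G)"
  proof (intro equalityI subsetI)
    fix x assume "x \<in> \<Psi> ` FG"
    then show "x \<in> carrier (skew_tensor_algebra sc G)"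
      by (auto simp: sd \<Psi>_def GL_def q_carrier finite_cut)
  next
    fix x assume "x \<in> carrier (skew_tensor_algebra sc G)"
    then have x: "x \<in> G \<rightarrow>\<^sub>E carrier (tensor_algebra sc)" by (simp add: sd)
    have "\<forall>g\<in>G. \<exists>a. a \<in> words \<and> x g = q (cut id a)" using tp.\<phi>_surj PiE_mem[OF x] by blast
    from bchoice[OF this] obtain a where a: "\<forall>g\<in>G. a g \<in> words \<and> x g = q (cut id (a g))" ..
    define c where "c = (\<Sum>g\<in>G. emb g (cut id (a g)))"
    have "cut h c = cut id (a h)" if h: "h \<in> G" for h
    proof -
      have "cut h c = (\<lambda>w. \<Sum>g\<in>G. if g = h then cut id (a h) w else 0)"
        unfolding c_def cut_sum by (rule ext, rule sum.cong[OF refl]) (simp add: cut_emb[OF finite_cut])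
      also have "\<dots> = cut id (a h)" using finite_G h by (intro ext) simp
      finally show ?thesis .
    qed
    then have "\<Psi> c = x" unfolding \<Psi>_def
      by (intro ext) (use a PiE_arb[OF x] in \<open>simp add: restrict_def\<close>)
    moreover have "c \<in> FG" unfolding c_def by (intro FG_sum emb_FG)
    ultimately show "x \<in> \<Psi> ` FG" by blast
  qed
  show "\<Psi> (a + b) = \<Psi> a \<oplus>\<^bsub>skew_tensor_algebra sc G\<^esub> \<Psi> b" for a b
    by (auto simp: sd \<Psi>_def GL_def restrict_def fun_eq_iff cut_add q_add finite_cut)
  show "\<Psi> (CC z * a) = z \<odot>\<^bsub>skew_tensor_algebra sc G\<^esub> \<Psi> a" for z a
    by (auto simp: sd \<Psi>_def GL_def restrict_def fun_eq_iff cut_CC q_CC finite_cut)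
  show "\<Psi> 0 = \<zero>\<^bsub>skew_tensor_algebra sc G\<^esub>"
    by (auto simp: sd \<Psi>_def GL_def restrict_def fun_eq_iff cut_0 q_0)
  show "\<Psi> 1 = \<one>\<^bsub>skew_tensor_algebra sc G\<^esub>"
  proof -
    have "q (cut g (MM [] id)) = (if g = id then \<one>\<^bsub>tensor_algebra sc\<^esub> else \<zero>\<^bsub>tensor_algebra sc\<^esub>)" for g
      by (cases "g = id") (simp_all add: cut_MM q_0 q_1)
    then show ?thesis unfolding MM_one[symmetric] by (simp add: sd \<Psi>_def GL_def)
  qed
  show "\<Psi> (a * b) = \<Psi> a \<otimes>\<^bsub>skew_tensor_algebra sc G\<^esub> \<Psi> b" if a: "a \<in> FG" and b: "b \<in> FG" for a b
  proof -
    have *: "(\<Oplus>\<^bsub>tensor_algebra sc\<^esub>g\<in>G. \<Psi> a g \<otimes>\<^bsub>tensor_algebra sc\<^esub>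
        tensor_act g (\<Psi> b (inv\<^bsub>GL sc\<lparr>carrier := G\<rparr>\<^esub> g \<circ> k))) = q (cut k (a * b))" if k: "k \<in> G" for k
    proof -
      let ?t = "\<lambda>g w. \<Sum>i\<le>length w. cut g a (take i w) * cut (giv g \<circ> k) b (map (giv g) (drop i w))"
      have trm: "\<Psi> a g \<otimes>\<^bsub>tensor_algebra sc\<^esub> tensor_act g (\<Psi> b (inv\<^bsub>GL sc\<lparr>carrier := G\<rparr>\<^esub> g \<circ> k)) = q (?t g)"
        if g: "g \<in> G" for g
      proof -
        have "\<Psi> b (inv\<^bsub>GL sc\<lparr>carrier := G\<rparr>\<^esub> g \<circ> k) = q (cut (giv g \<circ> k) b)"
          unfolding GL_inv[OF g] \<Psi>_def using comp_G[OF inv_G[OF g] k] by simp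
        then show ?thesis unfolding tensor_act_coset[OF g]
          using q_mult[OF finite_cut shift_finite[OF g finite_cut], of g a "giv g \<circ> k" b] g
          by (simp add: \<Psi>_def tensor_act_coset[OF g])
      qed
      have ft: "finite {w. ?t g w \<noteq> 0}" if g: "g \<in> G" for g
      proof -
        let ?f = "cut g a" and ?h = "\<lambda>w. cut (giv g \<circ> k) b (map (giv g) w)"
        have "?f \<in> carrier free_algebra" "?h \<in> carrier free_algebra"
          using finite_cut shift_finite[OF g finite_cut] by (simp_all add: fin_carrier)
        then have "?f \<otimes>\<^bsub>free_algebra\<^esub> ?h \<in> carrier free_algebra" by (rule monoid.m_closed[OF ring.is_monoid[OF fr.is_ring]])
        then show ?thesis by (simp add: free_algebra_def)
      qed
      have "(\<Oplus>\<^bsub>tensor_algebra sc\<^esub>g\<in>G. \<Psi> a g \<otimes>\<^bsub>tensor_algebra sc\<^esub>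
        tensor_act g (\<Psi> b (inv\<^bsub>GL sc\<lparr>carrier := G\<rparr>\<^esub> g \<circ> k))) = (\<Oplus>\<^bsub>tensor_algebra sc\<^esub>g\<in>G. q (?t g))"
        by (rule T.finsum_cong') (simp_all add: trm q_carrier[OF ft])
      also have "\<dots> = q (\<lambda>w. \<Sum>g\<in>G. ?t g w)" by (rule q_sum[OF finite_G ft, symmetric])
      also have "(\<lambda>w. \<Sum>g\<in>G. ?t g w) = cut k (a * b)"
        using a by (intro ext cut_mult[OF finite_G bij_G, symmetric]) (simp_all add: FG_def)
      finally show ?thesis .
    qed
    have "(\<Psi> a \<otimes>\<^bsub>skew_tensor_algebra sc G\<^esub> \<Psi> b) = (\<lambda>k\<in>G. \<Oplus>\<^bsub>tensor_algebra sc\<^esub>g\<in>G. \<Psi> a g \<otimes>\<^bsub>tensor_algebra sc\<^esub>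
        tensor_act g (\<Psi> b (inv\<^bsub>GL sc\<lparr>carrier := G\<rparr>\<^esub> g \<circ> k)))"
      by (simp add: sd GL_def)
    also have "\<dots> = \<Psi> (a * b)" unfolding \<Psi>_def[of "a * b"] by (rule restrict_ext) (rule *)
    finally show ?thesis by simp
  qed
qed (rule FG_add FG_mult FG_CC; assumption?)+

subsection \<open>The graded Hecke algebra as a quotient of the monoid algebra\<close>

interpretation sp: presented FG \<Psi> "skew_tensor_algebra sc G"
  by (rule skew_presented)

definition comel :: "'v \<Rightarrow> 'v \<Rightarrow> 'v sk" where
  "comel u v = MM [u] id * MM [v] id - MM [v] id * MM [u] id - (\<Sum>s\<in>G. CC (\<kappa> s u v) * MM [] s)"

lemma comel_FG: "comel u v \<in> FG"
  unfolding comel_def by (intro FG_diff FG_mult FG_MM FG_sum FG_CC id_G)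

definition hideal :: "(('v \<Rightarrow> 'v) \<Rightarrow> ('v list \<Rightarrow> complex) set) set" where
  "hideal = Idl\<^bsub>skew_tensor_algebra sc G\<^esub> {\<Psi> (comel u v) | u v. True}"

text \<open>The kernel of the map from \<open>FG\<close> to the graded Hecke algebra; it plays the
  part of \<open>J\<close>.\<close>

definition hker :: "'v sk set" where "hker = {a \<in> FG. \<Psi> a \<in> hideal}"

lemma comel_carrier: "{\<Psi> (comel u v) | u v. True} \<subseteq> carrier (skew_tensor_algebra sc G)"
  using sp.\<phi>_in[OF comel_FG] by blast

lemma hideal_ideal: "ideal hideal (skew_tensor_algebra sc G)"
  unfolding hideal_def by (rule ring.genideal_ideal[OF sp.is_ring comel_carrier])

lemma words_FG: "a \<in> words \<Longrightarrow> a \<in> FG" by (simp add: words_def FG_def)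

lemma emb_grp: "emb id f * MM [] g = emb g f"
  unfolding emb_def sum_distrib_right mult.assoc MM_mult by simp

lemma FG_decompose:
  assumes c: "c \<in> FG" shows "c = (\<Sum>g\<in>G. emb id (cut g c) * MM [] g)"
proof (rule poly_mapping_eqI)
  fix k
  show "lookup c k = lookup (\<Sum>g\<in>G. emb id (cut g c) * MM [] g) k"
  proof (cases k)
    case (SK w h)
    have z: "lookup c (SK w h) = 0" if "h \<notin> G" using c that unfolding FG_def by (force simp: in_keys_iff)
    have "lookup (\<Sum>g\<in>G. emb id (cut g c) * MM [] g) (SK w h) = (\<Sum>g\<in>G. if h = g then lookup c (SK w h) else 0)"
      unfolding emb_grp lookup_sum by (intro sum.cong refl) (auto simp: lookup_emb[OF finite_cut] cut_def)
    also have "\<dots> = lookup c (SK w h)" using finite_G z by (cases "h \<in> G") simp_all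
    finally show ?thesis unfolding SK by simp
  qed
qed

section \<open>Vanishing of the functionals on the defining ideal\<close>

context
  fixes \<Lambda> assumes \<Lambda>: "admissible \<Lambda>"
begin

text \<open>The largest two-sided ideal of \<open>FG\<close> in the kernel of the functional. With
  factors allowed on both sides it is an ideal by construction, so only the generators of the
  defining ideals have to be tested.\<close>

definition kil :: "'v sk set" where
  "kil = {a \<in> FG. \<forall>x\<in>FG. \<forall>y\<in>FG. lext (\<lambda>k. \<Lambda> (wd k) (gp k)) (x * a * y) = 0}"

lemma kilD: "a \<in> kil \<Longrightarrow> x \<in> FG \<Longrightarrow> y \<in> FG \<Longrightarrow> lext (\<lambda>k. \<Lambda> (wd k) (gp k)) (x * a * y) = 0"
  unfolding kil_def by blast
lemma kil_FG: "a \<in> kil \<Longrightarrow> a \<in> FG" unfolding kil_def by blast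

lemma kilI:
  assumes a: "a \<in> FG" and m: "\<And>p g r h. g \<in> G \<Longrightarrow> h \<in> G \<Longrightarrow> lext (\<lambda>k. \<Lambda> (wd k) (gp k)) (MM p g * a * MM r h) = 0"
  shows "a \<in> kil"
proof -
  let ?l = "lext (\<lambda>k. \<Lambda> (wd k) (gp k))"
  have 1: "?l (MM p g * a * y) = 0" if g: "g \<in> G" and y: "y \<in> FG" for p g y
  proof -
    have "?l (MM p g * a * y) = (\<Sum>k\<in>keys y. lookup y k * ?l (MM p g * a * MM (wd k) (gp k)))"
      by (subst sk_expand[of y]) (simp only: sum_distrib_left CC_move lext_sum lext_CC)
    also have "\<dots> = 0"
    proof (rule sum.neutral, rule ballI)
      fix k assume "k \<in> keys y"
      then have k: "gp k \<in> G" using y unfolding FG_def by blast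
      show "lookup y k * ?l (MM p g * a * MM (wd k) (gp k)) = 0" by (simp only: m[OF g k] mult_zero_right)
    qed
    finally show ?thesis .
  qed
  have "?l (x * a * y) = 0" if x: "x \<in> FG" and y: "y \<in> FG" for x y
  proof -
    have "?l (x * a * y) = (\<Sum>k\<in>keys x. lookup x k * ?l (MM (wd k) (gp k) * a * y))"
      by (subst sk_expand[of x]) (simp only: sum_distrib_right mult.assoc lext_sum lext_CC)
    also have "\<dots> = 0"
    proof (rule sum.neutral, rule ballI)
      fix k assume "k \<in> keys x"
      then have k: "gp k \<in> G" using x unfolding FG_def by blast
      show "lookup x k * ?l (MM (wd k) (gp k) * a * y) = 0" by (simp only: 1[OF k y] mult_zero_right)
    qed
    finally show ?thesis .
  qed
  then show ?thesis unfolding kil_def using a by blast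
qed

lemma kil_0: "0 \<in> kil" unfolding kil_def by simp
lemma kil_add: "a \<in> kil \<Longrightarrow> b \<in> kil \<Longrightarrow> a + b \<in> kil"
  unfolding kil_def by (simp add: FG_add distrib_left distrib_right lext_add)
lemma kil_left: assumes a: "a \<in> kil" and z: "z \<in> FG" shows "z * a \<in> kil"
proof -
  have "lext (\<lambda>k. \<Lambda> (wd k) (gp k)) (x * (z * a) * y) = 0" if "x \<in> FG" "y \<in> FG" for x y
    using kilD[OF a FG_mult[OF that(1) z] that(2)] by (simp only: mult.assoc)
  then show ?thesis unfolding kil_def using FG_mult[OF z kil_FG[OF a]] by blast
qed
lemma kil_right: assumes a: "a \<in> kil" and z: "z \<in> FG" shows "a * z \<in> kil"
proof -
  have "lext (\<lambda>k. \<Lambda> (wd k) (gp k)) (x * (a * z) * y) = 0" if "x \<in> FG" "y \<in> FG" for x y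
    using kilD[OF a that(1) FG_mult[OF z that(2)]] by (simp only: mult.assoc)
  then show ?thesis unfolding kil_def using FG_mult[OF kil_FG[OF a] z] by blast
qed
lemma kil_sum: "(\<And>i. i \<in> A \<Longrightarrow> f i \<in> kil) \<Longrightarrow> sum f A \<in> kil"
  by (induction A rule: infinite_finite_induct) (simp_all add: kil_0 kil_add)

lemma \<Lambda>_lin: "lin1 (\<lambda>v. \<Lambda> (xs @ v # ys) g)"
  using \<Lambda> mlinD unfolding admissible_def by blast

lemma kil_lin: "MM [v + w] id - (MM [v] id + MM [w] id) \<in> kil" "MM [sc z v] id - CC z * MM [v] id \<in> kil"
proof -
  have s: "MM p g * MM [v] id * MM r h = MM (p @ g v # map g r) (g \<circ> h)" for p r v and g h :: "'v \<Rightarrow> 'v"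
    by (simp add: MM_mult)
  have e: "MM p g * (CC z * MM [v] id) * MM r h = CC z * (MM p g * MM [v] id * MM r h)" for p g r h
    by (simp only: CC_move mult.assoc)
  show "MM [v + w] id - (MM [v] id + MM [w] id) \<in> kil"
  proof (rule kilI)
    fix p g r h assume "g \<in> G" "h \<in> G"
    then show "lext (\<lambda>k. \<Lambda> (wd k) (gp k)) (MM p g * (MM [v + w] id - (MM [v] id + MM [w] id)) * MM r h) = 0"
      unfolding left_diff_distrib right_diff_distrib distrib_left distrib_right s lext_diff lext_add
      by (simp add: G_add lin1_add[OF \<Lambda>_lin])
  qed (intro FG_diff FG_add FG_MM id_G)
  show "MM [sc z v] id - CC z * MM [v] id \<in> kil"
  proof (rule kilI)
    fix p g r h assume "g \<in> G" "h \<in> G"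
    then show "lext (\<lambda>k. \<Lambda> (wd k) (gp k)) (MM p g * (MM [sc z v] id - CC z * MM [v] id) * MM r h) = 0"
      unfolding left_diff_distrib right_diff_distrib e s lext_diff lext_CC
      by (simp add: G_sc lin1_sc[OF \<Lambda>_lin])
  qed (intro FG_diff FG_mult FG_CC FG_MM id_G)
qed

text \<open>Between two words, the generator becomes the relation \<open>comrel\<close> for
  \<open>g u\<close> and \<open>g v\<close>; conjugating the summation index by \<open>g\<close> and
  equivariance of \<kappa> match the two sums.\<close>

lemma kil_comel: "comel u v \<in> kil"
proof (rule kilI[OF comel_FG])
  fix p g r h assume g: "g \<in> G" and h: "h \<in> G"
  let ?l = "lext (\<lambda>k. \<Lambda> (wd k) (gp k))"
  have s2: "MM p g * (MM [u] id * MM [v] id) * MM r h = MM (p @ g u # g v # map g r) (g \<circ> h)" for u v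
    by (simp add: MM_mult)
  have sG: "MM p g * MM [] s * MM r h = MM (p @ map (g \<circ> s) r) (g \<circ> s \<circ> h)" for s
    by (simp add: MM_mult comp_assoc)
  have "MM p g * (\<Sum>s\<in>G. CC (\<kappa> s u v) * MM [] s) * MM r h = (\<Sum>s\<in>G. CC (\<kappa> s u v) * (MM p g * MM [] s * MM r h))"
    by (simp only: sum_distrib_left sum_distrib_right CC_move mult.assoc)
  then have "?l (MM p g * comel u v * MM r h) = \<Lambda> (p @ g u # g v # map g r) (g \<circ> h) - \<Lambda> (p @ g v # g u # map g r) (g \<circ> h)
    - (\<Sum>s\<in>G. \<kappa> s u v * \<Lambda> (p @ map (g \<circ> s) r) (g \<circ> s \<circ> h))"
    unfolding comel_def left_diff_distrib right_diff_distrib s2 lext_diff by (simp only: sG lext_sum lext_CC lext_single) simp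
  moreover have "\<Lambda> (p @ g u # g v # map g r) (g \<circ> h) - \<Lambda> (p @ g v # g u # map g r) (g \<circ> h)
    = (\<Sum>s\<in>G. \<kappa> s (g u) (g v) * \<Lambda> (p @ map s (map g r)) (s \<circ> (g \<circ> h)))"
  proof (rule comrelD)
    show "comrel (length (p @ g u # g v # map g r)) \<Lambda> \<Lambda>" using \<Lambda> unfolding admissible_def by blast
  qed (use comp_G g h in blast, rule refl)
  moreover have "\<dots> = (\<Sum>s\<in>G. \<kappa> (g \<circ> s \<circ> giv g) (g u) (g v) * \<Lambda> (p @ map (g \<circ> s \<circ> giv g) (map g r)) (g \<circ> s \<circ> giv g \<circ> (g \<circ> h)))"
    by (rule sum.reindex_bij_betw[OF conj_bij[OF g], symmetric])
  moreover have "\<dots> = (\<Sum>s\<in>G. \<kappa> s u v * \<Lambda> (p @ map (g \<circ> s) r) (g \<circ> s \<circ> h))"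
  proof (intro sum.cong refl)
    fix s assume s: "s \<in> G"
    have gg: "giv g (g x) = x" for x using inv_comp_G(1)[OF g] by (simp add: fun_eq_iff)
    have "map (g \<circ> s \<circ> giv g) (map g r) = map (g \<circ> s) r" by (simp add: gg)
    moreover have "g \<circ> s \<circ> giv g \<circ> (g \<circ> h) = g \<circ> s \<circ> h" by (simp add: fun_eq_iff gg)
    ultimately show "\<kappa> (g \<circ> s \<circ> giv g) (g u) (g v) * \<Lambda> (p @ map (g \<circ> s \<circ> giv g) (map g r)) (g \<circ> s \<circ> giv g \<circ> (g \<circ> h))
      = \<kappa> s u v * \<Lambda> (p @ map (g \<circ> s) r) (g \<circ> s \<circ> h)" by (simp only: \<kappa>_equiv[OF s g])
  qed
  ultimately show "?l (MM p g * comel u v * MM r h) = 0" by (simp only: diff_self)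
qed

text \<open>Every component of such an element lies in the linearity ideal, whose generators are in
  \<open>kil\<close> by multilinearity of the functional.\<close>

lemma \<Psi>_zero_kil:
  assumes c: "c \<in> FG" and z: "\<Psi> c = \<zero>\<^bsub>skew_tensor_algebra sc G\<^esub>"
  shows "c \<in> kil"
proof -
  have "emb id (cut g c) \<in> kil" if g: "g \<in> G" for g
  proof -
    have "\<Psi> c g = \<Psi> 0 g" unfolding z sp.\<phi>_0 ..
    then have "q (cut g c) = q (cut g 0)" using g by (simp add: \<Psi>_def)
    then have "q (cut g c) = I0"
      using fr.coset_zero_iff[OF I0_ideal, of "cut g 0"] ideal.axioms(1)[OF I0_ideal]
      by (simp add: cut_0 fin_carrier additive_subgroup.zero_closed[of I0 free_algebra, unfolded free_algebra_def, simplified] flip: free_algebra_def)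
    then have "cut g c \<in> I0" using fr.coset_zero_iff[OF I0_ideal, of "cut g c"] finite_cut[of g c] by (simp add: fin_carrier)
    then have "\<exists>a\<in>{a \<in> words. a \<in> kil}. cut g c = cut id a"
    proof (rule I0_sub[rotated -1])
      show "{a \<in> words. a \<in> kil} \<subseteq> words" by blast
      show "0 \<in> {a \<in> words. a \<in> kil}" using kil_0 fr.C_0 by blast
      show "a + b \<in> {a \<in> words. a \<in> kil}" if "a \<in> {a \<in> words. a \<in> kil}" "b \<in> {a \<in> words. a \<in> kil}" for a b
        using that kil_add words_add by blast
      show "x * a \<in> {a \<in> words. a \<in> kil}" if "a \<in> {a \<in> words. a \<in> kil}" "x \<in> words" for a x
        using that kil_left words_mult words_FG by blast
      show "a * x \<in> {a \<in> words. a \<in> kil}" if "a \<in> {a \<in> words. a \<in> kil}" "x \<in> words" for a x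
        using that kil_right words_mult words_FG by blast
      show "MM [v + w] id - (MM [v] id + MM [w] id) \<in> {a \<in> words. a \<in> kil}" for v w
        using kil_lin(1) fr.C_diff words_add words_MM by blast
      show "MM [sc z v] id - CC z * MM [v] id \<in> {a \<in> words. a \<in> kil}" for z v
        using kil_lin(2) fr.C_diff words_mult words_CC words_MM by blast
    qed
    then obtain a where "a \<in> words" "a \<in> kil" "cut g c = cut id a" by blast
    then show ?thesis by (simp add: words_emb_cut)
  qed
  then show ?thesis by (subst FG_decompose[OF c]) (intro kil_sum kil_right FG_MM)
qed

text \<open>By minimality \<open>hideal\<close> is inside the image of \<open>kil\<close>, and
  elements with the same image differ by the kernel of \<Psi>, which is in \<open>kil\<close> as
  well.\<close>

lemma hker_kil: assumes a: "a \<in> hker" shows "a \<in> kil"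
proof -
  have "ideal (\<Psi> ` kil) (skew_tensor_algebra sc G)"
    by (rule sp.image_ideal) (use kil_FG kil_0 kil_add kil_left kil_right in blast)+
  then have "hideal \<subseteq> \<Psi> ` kil" unfolding hideal_def
    by (rule ring.genideal_minimal[OF sp.is_ring]) (use kil_comel in blast)
  then obtain b where b: "b \<in> kil" "\<Psi> a = \<Psi> b" using a unfolding hker_def by blast
  have aF: "a \<in> FG" using a by (simp add: hker_def)
  interpret S: ring "skew_tensor_algebra sc G" by (rule sp.is_ring)
  have "\<Psi> (a - b) = \<zero>\<^bsub>skew_tensor_algebra sc G\<^esub>"
    unfolding sp.\<phi>_diff[OF aF kil_FG[OF b(1)]] b(2) a_minus_def by (rule S.r_neg[OF sp.\<phi>_in[OF kil_FG[OF b(1)]]])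
  then have "a - b \<in> kil" by (rule \<Psi>_zero_kil[OF FG_diff[OF aF kil_FG[OF b(1)]]])
  from kil_add[OF this b(1)] show ?thesis by simp
qed

end

lemma \<Psi>_vec_lin: "\<Psi> (MM [sc z u + v] id - (CC z * MM [u] id + MM [v] id)) = \<zero>\<^bsub>skew_tensor_algebra sc G\<^esub>"
proof -
  interpret I: ideal I0 "free_algebra :: (complex, 'v list \<Rightarrow> complex) module" by (rule I0_ideal)
  let ?a = "MM [sc z u + v] id - (MM [sc z u] id + MM [v] id)" and ?b = "MM [sc z u] id - CC z * MM [u] id"
  let ?x = "MM [sc z u + v] id - (CC z * MM [u] id + MM [v] id)"
  have x: "?x = ?a + ?b" by simp
  have "cut id ?x = cut id ?a \<oplus>\<^bsub>free_algebra\<^esub> cut id ?b"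
    unfolding x by (rule fr.\<phi>_add; intro fr.C_diff words_add words_mult words_MM words_CC)
  then have "cut id ?x \<in> I0" using additive_subgroup.a_closed[OF I.additive_subgroup_axioms I0_gens(1)[of "sc z u" v] I0_gens(2)[of z u]] by simp
  then have i: "q (cut id ?x) = I0" using I.a_rcos_const by blast
  have 0: "q (cut id 0) = I0" unfolding fr.\<phi>_0 by (rule I.a_rcos_const) (rule additive_subgroup.zero_closed[OF I.additive_subgroup_axioms])
  have n: "cut g ?x = cut g 0" if "g \<noteq> id" for g using that by (simp add: cut_diff cut_add cut_CC cut_MM cut_0)
  have "q (cut g ?x) = q (cut g 0)" for g using i 0 n[of g] by (cases "g = id") simp_all
  then have "\<Psi> ?x = \<Psi> 0" unfolding \<Psi>_def by simp
  then show ?thesis unfolding sp.\<phi>_0 .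
qed

theorem hecke_alg_hker: "hecke_alg sc Basis G \<kappa> hker"
proof
  interpret I: ideal hideal "skew_tensor_algebra sc G" by (rule hideal_ideal)
  have J: "a \<in> FG" "\<Psi> a \<in> hideal" if "a \<in> hker" for a using that unfolding hker_def by blast+
  have z: "\<zero>\<^bsub>skew_tensor_algebra sc G\<^esub> \<in> hideal" by (rule additive_subgroup.zero_closed[OF I.additive_subgroup_axioms])
  show "hker \<subseteq> FG" using J by blast
  show "0 \<in> hker" unfolding hker_def using z by (simp add: sp.\<phi>_0)
  show "a - b \<in> hker" if "a \<in> hker" "b \<in> hker" for a b
    unfolding hker_def mem_Collect_eq sp.\<phi>_diff[OF J(1) J(1), OF that] a_minus_def
    by (intro conjI FG_diff additive_subgroup.a_closed[OF I.additive_subgroup_axioms]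
      subgroup.m_inv_closed[OF I.a_subgroup, folded a_inv_def] J that)
  show "x * a \<in> hker" if "x \<in> FG" "a \<in> hker" for a x
    unfolding hker_def mem_Collect_eq sp.\<phi>_mult[OF that(1) J(1)[OF that(2)]]
    by (intro conjI FG_mult I.I_l_closed J that sp.\<phi>_in)
  show "a * x \<in> hker" if "x \<in> FG" "a \<in> hker" for a x
    unfolding hker_def mem_Collect_eq sp.\<phi>_mult[OF J(1)[OF that(2)] that(1)]
    by (intro conjI FG_mult I.I_r_closed J that sp.\<phi>_in)
  show "MM [sc z u + v] id - (CC z * MM [u] id + MM [v] id) \<in> hker" for z u v
    unfolding hker_def mem_Collect_eq \<Psi>_vec_lin by (intro conjI z FG_diff FG_add FG_mult FG_CC FG_MM id_G)
  show "MM [u] id * MM [v] id - MM [v] id * MM [u] id - (\<Sum>s\<in>G. CC (\<kappa> s u v) * MM [] s) \<in> hker" for u v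
  proof -
    have "\<Psi> (comel u v) \<in> hideal" unfolding hideal_def
      by (rule subsetD[OF ring.genideal_self[OF sp.is_ring comel_carrier]]) blast
    then show ?thesis unfolding comel_def[symmetric] hker_def using comel_FG by blast
  qed
  show "lext (\<lambda>k. \<Lambda> (wd k) (gp k)) a = 0" if "admissible \<Lambda>" "a \<in> hker" for \<Lambda> a
    using kilD[OF that(1) hker_kil[OF that] FG_1 FG_1] by simp
qed

lemma hecke_presented: "presented FG (\<lambda>a. hideal +>\<^bsub>skew_tensor_algebra sc G\<^esub> \<Psi> a) (quotient_algebra (skew_tensor_algebra sc G) hideal)"
  by (rule sp.quotient[OF hideal_ideal])

lemma hecke_kernel: "a \<in> FG \<Longrightarrow> hideal +>\<^bsub>skew_tensor_algebra sc G\<^esub> \<Psi> a = \<zero>\<^bsub>quotient_algebra (skew_tensor_algebra sc G) hideal\<^esub> \<longleftrightarrow> a \<in> hker"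
proof -
  assume a: "a \<in> FG"
  have z: "\<zero>\<^bsub>quotient_algebra (skew_tensor_algebra sc G) hideal\<^esub> = hideal"
    by (simp add: quotient_algebra_def FactRing_def)
  show ?thesis unfolding z sp.coset_zero_iff[OF hideal_ideal sp.\<phi>_in[OF a]] hker_def using a by blast
qed

lemma skew_vec_\<Psi>: "skew_vec sc G v = \<Psi> (MM [v] id)"
  unfolding skew_vec_def \<Psi>_def tensor_vec_def
  by (rule restrict_ext) (auto simp: letter_cut cut_MM q_0)

lemma skew_grp_\<Psi>: "skew_grp sc G g = \<Psi> (MM [] g)"
  unfolding skew_grp_def \<Psi>_def
  by (rule restrict_ext) (auto simp: cut_MM q_0 q_1)

end

subsection \<open>Transfer of the three conditions\<close>

context hecke_alg begin

context
  fixes \<Phi> :: "'v sk \<Rightarrow> 'b" and A :: "(complex, 'b) module"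
  assumes pr: "presented FG \<Phi> A" and ker: "\<And>a. a \<in> FG \<Longrightarrow> \<Phi> a = \<zero>\<^bsub>A\<^esub> \<longleftrightarrow> a \<in> J"
begin

interpretation pr: presented FG \<Phi> A by (rule pr)
interpretation A: ring A by (rule pr.is_ring)

lemma \<Phi>_eq_iff: assumes "a \<in> FG" "b \<in> FG" shows "\<Phi> a = \<Phi> b \<longleftrightarrow> a - b \<in> J"
proof
  assume "\<Phi> a = \<Phi> b"
  then have "\<Phi> (a - b) = \<zero>\<^bsub>A\<^esub>"
    unfolding pr.\<phi>_diff[OF assms] a_minus_def using A.r_neg[OF pr.\<phi>_in[OF assms(2)]] by simp
  then show "a - b \<in> J" using ker FG_diff[OF assms] by blast
next
  assume "a - b \<in> J"
  then have z: "\<Phi> (a - b) = \<zero>\<^bsub>A\<^esub>" using ker FG_diff[OF assms] by blast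
  have "\<Phi> ((a - b) + b) = \<Phi> (a - b) \<oplus>\<^bsub>A\<^esub> \<Phi> b" by (rule pr.\<phi>_add[OF FG_diff[OF assms] assms(2)])
  then show "\<Phi> a = \<Phi> b" unfolding z A.l_zero[OF pr.\<phi>_in[OF assms(2)]] by simp
qed

lemma word_eval_\<Phi>: "(\<And>i. a i \<in> FG) \<Longrightarrow> word_eval A (\<lambda>i. \<Phi> (a i)) w = \<Phi> (prod_list (map a w))"
proof (induction w)
  case Nil show ?case by (simp add: word_eval_def pr.\<phi>_1)
next
  case (Cons i w)
  have "prod_list (map a w) \<in> FG" by (rule FG_prod_list) (use Cons.prems in auto)
  then show ?case using Cons by (simp add: word_eval_def pr.\<phi>_mult)
qed

lemma nc_poly_eval_\<Phi>:
  assumes fin: "finite {w. e w \<noteq> 0}" and a: "\<And>i. a i \<in> FG"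
  shows "nc_poly_eval A e (\<lambda>i. \<Phi> (a i)) = \<Phi> (\<Sum>w\<in>{w. e w \<noteq> 0}. CC (e w) * prod_list (map a w))"
proof -
  have p: "prod_list (map a w) \<in> FG" for w by (rule FG_prod_list) (use a in auto)
  have "\<Phi> (\<Sum>w\<in>{w. e w \<noteq> 0}. CC (e w) * prod_list (map a w))
    = (\<Oplus>\<^bsub>A\<^esub>w\<in>{w. e w \<noteq> 0}. \<Phi> (CC (e w) * prod_list (map a w)))"
    by (rule pr.\<phi>_sum[OF fin]) (intro FG_mult FG_CC p)
  also have "\<dots> = nc_poly_eval A e (\<lambda>i. \<Phi> (a i))"
    unfolding nc_poly_eval_def
  proof (rule A.finsum_cong')
    have c: "\<Phi> (CC (e w) * prod_list (map a w)) = e w \<odot>\<^bsub>A\<^esub> word_eval A (\<lambda>i. \<Phi> (a i)) w" for w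
      unfolding word_eval_\<Phi>[OF a] by (rule pr.\<phi>_smult[OF p])
    show "\<Phi> (CC (e w) * prod_list (map a w)) = e w \<odot>\<^bsub>A\<^esub> word_eval A (\<lambda>i. \<Phi> (a i)) w" for w by (rule c)
    show "(\<lambda>w. e w \<odot>\<^bsub>A\<^esub> word_eval A (\<lambda>i. \<Phi> (a i)) w) \<in> {w. e w \<noteq> 0} \<rightarrow> carrier A"
      unfolding c[symmetric] by (intro funcsetI pr.\<phi>_in FG_mult FG_CC p)
  qed simp
  finally show ?thesis by simp
qed

lemma eval_sum_FG: "(\<And>i. a i \<in> FG) \<Longrightarrow> (\<Sum>w\<in>{w. e w \<noteq> 0}. CC (e w) * prod_list (map a w)) \<in> FG"
  by (intro FG_sum FG_mult FG_CC FG_prod_list) auto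

lemma PI_iff: "PI_algebra A \<longleftrightarrow> (\<exists>e. finite {w. e w \<noteq> 0} \<and> nc_monic e \<and>
   (\<forall>a. (\<forall>i. a i \<in> FG) \<longrightarrow> (\<Sum>w\<in>{w. e w \<noteq> 0}. CC (e w) * prod_list (map a w)) \<in> J))"
proof -
  have pq: "(\<forall>a. (\<forall>i. a i \<in> carrier A) \<longrightarrow> nc_poly_eval A e a = \<zero>\<^bsub>A\<^esub>) \<longleftrightarrow>
     (\<forall>a. (\<forall>i. a i \<in> FG) \<longrightarrow> (\<Sum>w\<in>{w. e w \<noteq> 0}. CC (e w) * prod_list (map a w)) \<in> J)"
    if fin: "finite {w. e w \<noteq> 0}" for e :: "nat list \<Rightarrow> complex"
  proof (intro iffI allI impI)
    fix a :: "nat \<Rightarrow> 'v sk" assume h: "\<forall>a. (\<forall>i. a i \<in> carrier A) \<longrightarrow> nc_poly_eval A e a = \<zero>\<^bsub>A\<^esub>" and a: "\<forall>i. a i \<in> FG"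
    have a': "a i \<in> FG" for i using a ..
    have "\<forall>i. \<Phi> (a i) \<in> carrier A" using pr.\<phi>_in[OF a'] by blast
    with spec[OF h, of "\<lambda>i. \<Phi> (a i)"] have "nc_poly_eval A e (\<lambda>i. \<Phi> (a i)) = \<zero>\<^bsub>A\<^esub>" by (rule mp)
    then show "(\<Sum>w\<in>{w. e w \<noteq> 0}. CC (e w) * prod_list (map a w)) \<in> J"
      unfolding nc_poly_eval_\<Phi>[where a = a, OF fin a'] ker[OF eval_sum_FG[where a = a, OF a']] .
  next
    fix b :: "nat \<Rightarrow> 'b" assume h: "\<forall>a. (\<forall>i. a i \<in> FG) \<longrightarrow> (\<Sum>w\<in>{w. e w \<noteq> 0}. CC (e w) * prod_list (map a w)) \<in> J"
      and b: "\<forall>i. b i \<in> carrier A"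
    have "\<forall>i. \<exists>a. a \<in> FG \<and> b i = \<Phi> a"
    proof
      fix i show "\<exists>a. a \<in> FG \<and> b i = \<Phi> a" using pr.\<phi>_surj[OF spec[OF b, of i]] by blast
    qed
    from choice[OF this] obtain a where a: "\<forall>i. a i \<in> FG \<and> b i = \<Phi> (a i)" ..
    have a': "a i \<in> FG" for i using spec[OF a, of i] by (rule conjunct1)
    have be: "b = (\<lambda>i. \<Phi> (a i))"
    proof
      fix i show "b i = \<Phi> (a i)" using spec[OF a, of i] by (rule conjunct2)
    qed
    have "(\<Sum>w\<in>{w. e w \<noteq> 0}. CC (e w) * prod_list (map a w)) \<in> J" by (rule mp[OF spec[OF h]]) (intro allI a')
    then show "nc_poly_eval A e b = \<zero>\<^bsub>A\<^esub>"
      unfolding be nc_poly_eval_\<Phi>[where a = a, OF fin a'] ker[OF eval_sum_FG[where a = a, OF a']] .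
  qed
  have c: "e \<in> carrier free_algebra \<longleftrightarrow> finite {w. e w \<noteq> 0}" for e :: "nat list \<Rightarrow> complex"
    by (simp add: free_algebra_def)
  show ?thesis unfolding PI_algebra_def Bex_def c
    by (rule iff_exI, rule conj_cong[OF refl], rule conj_cong[OF refl], rule pq, assumption)
qed

lemma centre_iff: assumes z: "z \<in> FG" shows "\<Phi> z \<in> ring_centre A \<longleftrightarrow> z \<in> cent"
proof -
  have e: "\<Phi> z \<otimes>\<^bsub>A\<^esub> \<Phi> x = \<Phi> x \<otimes>\<^bsub>A\<^esub> \<Phi> z \<longleftrightarrow> z * x - x * z \<in> J" if "x \<in> FG" for x
    unfolding pr.\<phi>_mult[OF z that, symmetric] pr.\<phi>_mult[OF that z, symmetric]
    by (rule \<Phi>_eq_iff) (intro FG_mult z that)+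
  show ?thesis unfolding ring_centre_def cent_def mem_Collect_eq pr.\<phi>_carrier[symmetric]
    using e z by auto
qed

lemma finite_over_centre_iff: "finite_over_centre A \<longleftrightarrow> fin_cent"
proof
  assume "finite_over_centre A"
  then obtain S where S: "finite S" "S \<subseteq> carrier A" and
    gen: "\<forall>x\<in>carrier A. \<exists>z\<in>S \<rightarrow> ring_centre A. x = (\<Oplus>\<^bsub>A\<^esub>y\<in>S. z y \<otimes>\<^bsub>A\<^esub> y)"
    unfolding finite_over_centre_def by (elim exE conjE)
  obtain e where e: "bij_betw e {..<card S} S" using ex_bij_betw_nat_finite[OF S(1)] by (auto simp: atLeast0LessThan)
  have "\<forall>y\<in>S. \<exists>a. a \<in> FG \<and> y = \<Phi> a" using S(2) pr.\<phi>_surj by blast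
  from bchoice[OF this] obtain r where r: "\<forall>y\<in>S. r y \<in> FG \<and> y = \<Phi> (r y)" ..
  show fin_cent unfolding fin_cent_def
  proof (rule exI[of _ "card S"], rule exI[of _ "\<lambda>i. r (e i)"], intro conjI allI impI ballI)
    show "r (e i) \<in> FG" if "i < card S" for i using r bij_betwE[OF e] that by blast
    fix x assume x: "x \<in> FG"
    obtain z where z: "z \<in> S \<rightarrow> ring_centre A" "\<Phi> x = (\<Oplus>\<^bsub>A\<^esub>y\<in>S. z y \<otimes>\<^bsub>A\<^esub> y)"
      using bspec[OF gen pr.\<phi>_in[OF x]] by (elim bexE)
    have "\<forall>y\<in>S. \<exists>a. a \<in> FG \<and> z y = \<Phi> a"
      using funcset_mem[OF z(1)] pr.\<phi>_surj unfolding ring_centre_def by blast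
    from bchoice[OF this] obtain c where c: "\<forall>y\<in>S. c y \<in> FG \<and> z y = \<Phi> (c y)" ..
    have cc: "c y \<in> cent" if y: "y \<in> S" for y
      using centre_iff[of "c y"] bspec[OF c y] funcset_mem[OF z(1) y] by simp
    have s: "(\<Sum>i<card S. c (e i) * r (e i)) = (\<Sum>y\<in>S. c y * r y)" by (rule sum.reindex_bij_betw[OF e])
    have "\<Phi> (\<Sum>y\<in>S. c y * r y) = (\<Oplus>\<^bsub>A\<^esub>y\<in>S. \<Phi> (c y * r y))"
      by (rule pr.\<phi>_sum[OF S(1)]) (use c r FG_mult in blast)
    also have "\<dots> = (\<Oplus>\<^bsub>A\<^esub>y\<in>S. z y \<otimes>\<^bsub>A\<^esub> y)"
    proof (rule A.finsum_cong')
      show "(\<lambda>y. z y \<otimes>\<^bsub>A\<^esub> y) \<in> S \<rightarrow> carrier A"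
        using funcset_mem[OF z(1)] S(2) A.m_closed unfolding ring_centre_def by blast
      fix y assume y: "y \<in> S"
      have "\<Phi> (c y * r y) = \<Phi> (c y) \<otimes>\<^bsub>A\<^esub> \<Phi> (r y)" using pr.\<phi>_mult bspec[OF c y] bspec[OF r y] by blast
      then show "\<Phi> (c y * r y) = z y \<otimes>\<^bsub>A\<^esub> y" using bspec[OF c y] bspec[OF r y] by simp
    qed simp
    finally have "\<Phi> x = \<Phi> (\<Sum>i<card S. c (e i) * r (e i))" unfolding s z(2) by simp
    moreover have "(\<Sum>i<card S. c (e i) * r (e i)) \<in> FG" unfolding s by (rule FG_sum) (use c r FG_mult in blast)
    ultimately have "x - (\<Sum>i<card S. c (e i) * r (e i)) \<in> J" using \<Phi>_eq_iff[OF x] by blast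
    then show "\<exists>z. (\<forall>i<card S. z i \<in> cent) \<and> x - (\<Sum>i<card S. z i * r (e i)) \<in> J"
      using cc bij_betwE[OF e] by (intro exI[of _ "\<lambda>i. c (e i)"] conjI allI impI) blast+
  qed
next
  assume fin_cent
  then obtain N :: nat and Y where Y: "\<forall>i<N. Y i \<in> FG"
    and gen: "\<forall>x\<in>FG. \<exists>z. (\<forall>i<N. z i \<in> cent) \<and> x - (\<Sum>i<N. z i * Y i) \<in> J"
    unfolding fin_cent_def by (elim exE conjE)
  define S where "S = (\<lambda>i. \<Phi> (Y i)) ` {..<N}"
  have finS: "finite S" by (simp add: S_def)
  have SA: "S \<subseteq> carrier A" unfolding S_def using Y pr.\<phi>_in by blast
  have "\<forall>y\<in>S. \<exists>a. a \<in> FG \<and> y = \<Phi> a" using SA pr.\<phi>_surj by blast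
  from bchoice[OF this] obtain r where r: "\<forall>y\<in>S. r y \<in> FG \<and> y = \<Phi> (r y)" ..
  show "finite_over_centre A" unfolding finite_over_centre_def
  proof (rule exI[of _ S], intro conjI finS SA ballI)
    fix x assume "x \<in> carrier A"
    then obtain a where a: "a \<in> FG" "x = \<Phi> a" using pr.\<phi>_surj by blast
    obtain z where z: "\<forall>i<N. z i \<in> cent" "a - (\<Sum>i<N. z i * Y i) \<in> J" using bspec[OF gen a(1)] by (elim exE conjE)
    \<comment> \<open>Several indices may give the same element of \<open>S\<close>, so the central
      coefficients are added up over each fibre.\<close>
    let ?I = "\<lambda>y. {i. i \<in> {..<N} \<and> \<Phi> (Y i) = y}"
    let ?z = "\<lambda>y. \<Sum>i\<in>?I y. z i"
    have zc: "?z y \<in> cent" for y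
    proof -
      have "sum z B \<in> cent" if "B \<subseteq> {..<N}" for B
        using finite_subset[OF that finite_lessThan] that
        by (induction B rule: finite_induct) (use z(1) in \<open>simp_all add: cent_0 cent_add\<close>)
      from this[of "?I y"] show ?thesis by auto
    qed
    have zY: "(\<Sum>i<N. z i * Y i) \<in> FG" by (rule FG_sum) (use Y z(1) cent_FG FG_mult in blast)
    have zr: "(\<Sum>y\<in>S. ?z y * r y) \<in> FG" by (rule FG_sum) (use r cent_FG[OF zc] FG_mult in blast)
    have "(\<Sum>i<N. z i * Y i) = (\<Sum>y\<in>S. \<Sum>i\<in>?I y. z i * Y i)"
      unfolding S_def by (rule sum.image_gen) simp
    then have "(\<Sum>i<N. z i * Y i) - (\<Sum>y\<in>S. ?z y * r y) = (\<Sum>y\<in>S. \<Sum>i\<in>?I y. z i * (Y i - r y))"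
      by (simp add: sum_subtractf right_diff_distrib sum_distrib_right)
    also have "\<dots> \<in> J"
    proof (intro J_sum J_left)
      fix y i assume y: "y \<in> S" and i: "i \<in> ?I y"
      show "z i \<in> FG" using z(1) i cent_FG by blast
      have "\<Phi> (Y i) = \<Phi> (r y)" using i bspec[OF r y] by simp
      then show "Y i - r y \<in> J" using \<Phi>_eq_iff[of "Y i" "r y"] Y i bspec[OF r y] by simp
    qed
    finally have "(\<Sum>i<N. z i * Y i) - (\<Sum>y\<in>S. ?z y * r y) \<in> J" .
    from J_add[OF z(2) this] have "a - (\<Sum>y\<in>S. ?z y * r y) \<in> J" by simp
    then have "x = \<Phi> (\<Sum>y\<in>S. ?z y * r y)" unfolding a(2) using \<Phi>_eq_iff[OF a(1) zr] by blast
    also have "\<dots> = (\<Oplus>\<^bsub>A\<^esub>y\<in>S. \<Phi> (?z y * r y))"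
      by (rule pr.\<phi>_sum[OF finS]) (use r cent_FG[OF zc] FG_mult in blast)
    also have "\<dots> = (\<Oplus>\<^bsub>A\<^esub>y\<in>S. \<Phi> (?z y) \<otimes>\<^bsub>A\<^esub> y)"
    proof (rule A.finsum_cong')
      show "(\<lambda>y. \<Phi> (?z y) \<otimes>\<^bsub>A\<^esub> y) \<in> S \<rightarrow> carrier A"
        using SA A.m_closed pr.\<phi>_in[OF cent_FG[OF zc]] by blast
      fix y assume y: "y \<in> S"
      have "\<Phi> (?z y * r y) = \<Phi> (?z y) \<otimes>\<^bsub>A\<^esub> \<Phi> (r y)" using pr.\<phi>_mult[OF cent_FG[OF zc]] bspec[OF r y] by blast
      then show "\<Phi> (?z y * r y) = \<Phi> (?z y) \<otimes>\<^bsub>A\<^esub> y" using bspec[OF r y] by simp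
    qed simp
    finally show "\<exists>z\<in>S \<rightarrow> ring_centre A. x = (\<Oplus>\<^bsub>A\<^esub>y\<in>S. z y \<otimes>\<^bsub>A\<^esub> y)"
      using centre_iff[OF cent_FG[OF zc]] zc by (intro bexI[of _ "\<lambda>y. \<Phi> (?z y)"]) auto
  qed
qed

theorem presented_equivalences:
  "(PI_algebra A \<longleftrightarrow> finite_over_centre A) \<and> (finite_over_centre A \<longleftrightarrow> (\<forall>u v. \<kappa> id u v = 0))"
proof -
  have ba: "PI_algebra A" if fin_cent
  proof -
    from fin_cent_imp_identity[OF that] obtain n where
      n: "\<forall>a. (\<forall>i. a i \<in> FG) \<longrightarrow> (\<Sum>w\<in>{w. std_poly n w \<noteq> 0}. CC (std_poly n w) * prod_list (map a w)) \<in> J" ..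
    show ?thesis unfolding PI_iff by (intro exI[of _ "std_poly n"] conjI std_poly_finite std_poly_monic n)
  qed
  have ac: "\<kappa> id u v = 0" if PI: "PI_algebra A" for u v
  proof -
    from PI obtain e where e: "finite {w. e w \<noteq> 0}" "nc_monic e"
      "\<forall>a. (\<forall>i. a i \<in> FG) \<longrightarrow> (\<Sum>w\<in>{w. e w \<noteq> 0}. CC (e w) * prod_list (map a w)) \<in> J"
      unfolding PI_iff by (elim exE conjE)
    show ?thesis by (rule monic_identity_imp_zero[OF e(1,2)]) (use e(3) in blast)
  qed
  have cb: "fin_cent" if "\<forall>u v. \<kappa> id u v = 0" by (rule finite_over_cent) (use that in blast)
  show ?thesis unfolding finite_over_centre_iff using ba ac cb by blast
qed

end

end

subsection \<open>Special bireflections and the structure constants\<close>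

lemma det_mod_conj_imp:
  assumes add: "\<And>u v. g (u + v) = g u + g v" and scl: "\<And>z v. g (sc z v) = sc z (g v)" and bij: "bij g"
    and ex: "\<exists>xs M. basis_mod sc W xs \<and> matrix_mod sc W xs x M \<and> d = Determinant.det M"
  shows "\<exists>xs M. basis_mod sc (g ` W) xs \<and> matrix_mod sc (g ` W) xs (g \<circ> x \<circ> giv g) M \<and> d = Determinant.det M"
proof -
  obtain xs M where b: "basis_mod sc W xs" and m: "matrix_mod sc W xs x M" and d: "d = Determinant.det M"
    using ex by (elim exE conjE)
  have inv: "giv g (g v) = v" "g (giv g v) = v" for v
    using bij by (simp_all add: bij_is_inj bij_is_surj inv_f_f surj_f_inv_f)
  have im: "g v \<in> g ` W \<longleftrightarrow> v \<in> W" for v using bij by (simp add: inj_image_mem_iff bij_is_inj)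
  have g0: "g 0 = 0" using add[of 0 0] by simp
  have gd: "g (u - v) = g u - g v" for u v using add[of "u - v" v] by (simp add: algebra_simps)
  have gs: "g (sum f A) = (\<Sum>i\<in>A. g (f i))" for f and A :: "nat set"
    by (induction A rule: infinite_finite_induct) (simp_all add: g0 add)
  have s: "(\<Sum>i<length (map g xs). sc (a i) (map g xs ! i)) = g (\<Sum>i<length xs. sc (a i) (xs ! i))" for a
    by (simp add: gs scl)
  have "basis_mod sc (g ` W) (map g xs)"
    unfolding basis_mod_def s im
  proof (intro conjI allI impI)
    show "a i = 0" if "(\<Sum>i<length xs. sc (a i) (xs ! i)) \<in> W" "i < length (map g xs)" for a i
      using b that unfolding basis_mod_def by simp
    fix v
    have "\<exists>a. giv g v - (\<Sum>i<length xs. sc (a i) (xs ! i)) \<in> W" using b unfolding basis_mod_def by blast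
    then obtain a where "giv g v - (\<Sum>i<length xs. sc (a i) (xs ! i)) \<in> W" ..
    then have "g (giv g v - (\<Sum>i<length xs. sc (a i) (xs ! i))) \<in> g ` W" unfolding im .
    then show "\<exists>a. v - g (\<Sum>i<length xs. sc (a i) (xs ! i)) \<in> g ` W" unfolding gd inv by blast
  qed
  moreover have "matrix_mod sc (g ` W) (map g xs) (g \<circ> x \<circ> giv g) M"
    unfolding matrix_mod_def
  proof (intro conjI allI impI)
    show "M \<in> carrier_mat (length (map g xs)) (length (map g xs))" using m unfolding matrix_mod_def by simp
    fix j assume j: "j < length (map g xs)"
    then have "x (xs ! j) - (\<Sum>i<length xs. sc (M $$ (i, j)) (xs ! i)) \<in> W" using m unfolding matrix_mod_def by simp
    then have "g (x (xs ! j) - (\<Sum>i<length xs. sc (M $$ (i, j)) (xs ! i))) \<in> g ` W" unfolding im .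
    then show "(g \<circ> x \<circ> giv g) (map g xs ! j) - (\<Sum>i<length (map g xs). sc (M $$ (i, j)) (map g xs ! i)) \<in> g ` W"
      unfolding s gd using j by (simp add: inv)
  qed
  ultimately show ?thesis using d by blast
qed

text \<open>Bases and matrices are carried over by \<open>g\<close> and back by its inverse, so both
  definite descriptions have the same defining property.\<close>

lemma det_mod_conj:
  assumes add: "\<And>u v. g (u + v) = g u + g v" and scl: "\<And>z v. g (sc z v) = sc z (g v)" and bij: "bij g"
  shows "det_mod sc (g ` W) (g \<circ> x \<circ> giv g) = det_mod sc W x"
proof -
  have inv: "giv g (g v) = v" "g (giv g v) = v" for v
    using bij by (simp_all add: bij_is_inj bij_is_surj inv_f_f surj_f_inv_f)
  have add': "giv g (u + v) = giv g u + giv g v" for u v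
    using add[of "giv g u" "giv g v"] inv(1)[of "giv g u + giv g v"] by (simp add: inv)
  have scl': "giv g (sc z v) = sc z (giv g v)" for z v
    using scl[of z "giv g v"] inv(1)[of "sc z (giv g v)"] by (simp add: inv)
  have gg: "giv (giv g) = g" using bij by (rule inv_inv_eq)
  have W: "giv g ` g ` W = W" by (auto simp: inv image_iff)
  have x: "giv g \<circ> (g \<circ> x \<circ> giv g) \<circ> g = x" by (simp add: fun_eq_iff inv)
  let ?P = "\<lambda>W x d. \<exists>xs M. basis_mod sc W xs \<and> matrix_mod sc W xs x M \<and> d = Determinant.det M"
  have "?P (g ` W) (g \<circ> x \<circ> giv g) d = ?P W x d" for d
    using det_mod_conj_imp[where g = g and sc = sc and W = W and x = x and d = d, OF add scl bij]
      det_mod_conj_imp[where g = "giv g" and sc = sc and W = "g ` W" and x = "g \<circ> x \<circ> giv g" and d = d,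
        OF add' scl' bij_imp_bij_inv[OF bij]]
    unfolding gg W x by blast
  then show ?thesis unfolding det_mod_def by simp
qed

text \<open>Three vectors in a plane are dependent, so one of d u, d v, d w lies in the span of the
  others. As the kernel of \<open>d\<close> is in the radical, \<open>B\<close> obeys the same
  linear relation and the cyclic sum cancels; by cyclic symmetry one case is enough.\<close>

lemma rank_two_jacobi:
  assumes fd: "finite_dimensional_vector_space sc Basis"
    and dadd: "\<And>u v. d (u + v) = d u + d v" and dsc: "\<And>z v. d (sc z v) = sc z (d v)"
    and badd: "\<And>u v w. B (u + v) w = B u w + B v w" and bsc: "\<And>z v w. B (sc z v) w = z * B v w"
    and skew: "\<And>v w. B v w = - (B w v :: complex)" and rad: "\<And>v w. d v = 0 \<Longrightarrow> B v w = 0"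
    and dim: "vector_space.dim sc (range d) = 2"
  shows "sc (B u v) (d w) + sc (B v w) (d u) + sc (B w u) (d v) = 0"
proof -
  interpret finite_dimensional_vector_space sc Basis by (rule fd)
  have main: "sc (B u v) (d w) + sc (B v w) (d u) + sc (B w u) (d v) = 0" if dw: "d w \<in> span {d u, d v}" for u v w
  proof -
    obtain k where "d w - sc k (d u) \<in> span {d v}" using dw unfolding span_breakdown_eq by blast
    then obtain l where "d w - sc k (d u) - sc l (d v) \<in> span {}" unfolding span_breakdown_eq[of _ _ "{}"] by blast
    then have e: "d w = sc k (d u) + sc l (d v)" by (simp add: algebra_simps)
    define r where "r = w - (sc k u + sc l v)"
    have w: "w = (sc k u + sc l v) + r" by (simp add: r_def)
    have "d w = (sc k (d u) + sc l (d v)) + d r" by (subst w) (simp only: dadd dsc)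
    then have r0: "d r = 0" using e by simp
    have B: "B w x = k * B u x + l * B v x" for x
      by (subst w) (simp add: badd bsc rad[OF r0])
    have z: "B x x = 0" for x using skew[of x x] by simp
    have 1: "B w u = - (l * B u v)" unfolding B z using skew[of v u] by simp
    have 2: "B v w = - (k * B u v)" using skew[of v w] unfolding B z by simp
    show ?thesis unfolding 1 2 e by (simp add: algebra_simps scale_right_distrib)
  qed
  consider "d w \<in> span {d u, d v}" | "d u \<in> span {d v, d w}" | "d v \<in> span {d w, d u}"
    | "d w \<notin> span {d u, d v}" "d u \<notin> span {d v, d w}" "d v \<notin> span {d w, d u}" by blast
  then show ?thesis
  proof cases
    case 1 then show ?thesis by (rule main)
  next
    case 2 from main[OF 2] show ?thesis by (simp add: algebra_simps)
  next
    case 3 from main[OF 3] show ?thesis by (simp add: algebra_simps)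
  next
    case 4
    have v: "d v \<notin> span {}" using 4(3) span_zero[of "{d w, d u}"] by auto
    have "d u \<notin> span {d v}" using 4(2) span_mono[of "{d v}" "{d v, d w}"] by blast
    then have "independent {d w, d u, d v}"
      using 4(1) v by (intro independent_insertI independent_empty) simp_all
    then have "card {d w, d u, d v} \<le> dim (range d)" by (rule independent_card_le_dim[rotated]) auto
    moreover have "d w \<noteq> d u" "d w \<noteq> d v" "d u \<noteq> d v"
      using 4 span_base[of "d w" "{d u, d v}"] span_base[of "d u" "{d v, d w}"] by auto
    then have "card {d w, d u, d v} = 3" by simp
    ultimately show ?thesis using dim by simp
  qed
qed

section \<open>From the parameters t and c to the structure constants\<close>

locale hecke_parameters =
  fixes sc :: "complex \<Rightarrow> 'v::ab_group_add \<Rightarrow> 'v" and Basis :: "'v set" and G :: "('v \<Rightarrow> 'v) set"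
    and N :: nat and b :: "nat \<Rightarrow> 'v \<Rightarrow> 'v \<Rightarrow> complex" and \<Omega> :: "('v \<Rightarrow> 'v) \<Rightarrow> 'v \<Rightarrow> 'v \<Rightarrow> complex"
    and t :: "nat \<Rightarrow> complex" and c :: "('v \<Rightarrow> 'v) \<Rightarrow> complex"
  assumes fd: "finite_dimensional_vector_space sc Basis"
    and sub: "subgroup G (GL sc)" and fin: "finite G"
    and forms: "invariant_form_basis sc G N b"
    and compat: "compatible_forms sc G \<Omega>"
    and inv_c: "conjugation_invariant sc G c"
begin

abbreviation SB :: "('v \<Rightarrow> 'v) set" where "SB \<equiv> special_bireflections sc G"

text \<open>All of \<kappa> as one family of scalar forms indexed by G; the identity is not a
  bireflection, so the two parts never compete for a coefficient.\<close>

definition kap :: "('v \<Rightarrow> 'v) \<Rightarrow> 'v \<Rightarrow> 'v \<Rightarrow> complex" where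
  "kap s v w = (if s = id then \<Sum>i=1..N. t i * b i v w else if s \<in> SB then c s * \<Omega> s v w else 0)"

interpretation V: finite_dimensional_vector_space sc Basis by (rule fd)

lemma G_linear: "g \<in> G \<Longrightarrow> Vector_Spaces.linear sc sc g" and G_bij: "g \<in> G \<Longrightarrow> bij g"
  using subgroup.mem_carrier[OF sub, of g] by (simp_all add: GL_def)

lemma G_plus: "g \<in> G \<Longrightarrow> g (u + v) = g u + g v" and G_scale: "g \<in> G \<Longrightarrow> g (sc z v) = sc z (g v)"
  using G_linear[of g] unfolding Vector_Spaces.linear_iff by simp_all

lemma G_id: "id \<in> G" using subgroup.one_closed[OF sub] by (simp add: GL_def)
lemma G_comp: "g \<in> G \<Longrightarrow> h \<in> G \<Longrightarrow> g \<circ> h \<in> G" using subgroup.m_closed[OF sub, of g h] by (simp add: GL_def)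

lemma giv_simps: "g \<in> G \<Longrightarrow> giv g (g v) = v" "g \<in> G \<Longrightarrow> g (giv g v) = v"
  using G_bij[of g] by (simp_all add: bij_is_inj bij_is_surj inv_f_f surj_f_inv_f)

lemma G_giv: "g \<in> G \<Longrightarrow> giv g \<in> G"
proof -
  assume g: "g \<in> G"
  have "m_inv (GL sc) g = giv g" unfolding m_inv_def
  proof (rule the_equality)
    have "Vector_Spaces.linear sc sc (giv g)"
      by (rule V.inj_linear_imp_inv_linear[OF G_linear[OF g] bij_is_inj[OF G_bij[OF g]]])
    then show "giv g \<in> carrier (GL sc) \<and> g \<otimes>\<^bsub>GL sc\<^esub> giv g = \<one>\<^bsub>GL sc\<^esub> \<and> giv g \<otimes>\<^bsub>GL sc\<^esub> g = \<one>\<^bsub>GL sc\<^esub>"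
      using bij_imp_bij_inv[OF G_bij[OF g]] by (simp add: GL_def fun_eq_iff giv_simps g)
    show "y = giv g" if "y \<in> carrier (GL sc) \<and> g \<otimes>\<^bsub>GL sc\<^esub> y = \<one>\<^bsub>GL sc\<^esub> \<and> y \<otimes>\<^bsub>GL sc\<^esub> g = \<one>\<^bsub>GL sc\<^esub>" for y
    proof
      fix v
      have "g \<circ> y = id" using that by (simp add: GL_def)
      then have "g (y v) = v" by (simp add: fun_eq_iff)
      then show "y v = giv g v" using giv_simps(1)[OF g, of "y v"] by simp
    qed
  qed
  then show ?thesis using subgroup.m_inv_closed[OF sub g] by simp
qed

lemma id_not_SB: "id \<notin> SB" by (simp add: special_bireflections_def bireflections_def)
lemma SB_G: "s \<in> SB \<Longrightarrow> s \<in> G" by (simp add: special_bireflections_def bireflections_def)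

lemma giv_giv: "g \<in> G \<Longrightarrow> giv (giv g) = g" using inv_inv_eq[OF G_bij] .

lemma g_diff: "g \<in> G \<Longrightarrow> g (u - v) = g u - g v"
  using G_plus[of g "u - v" v] by (simp add: algebra_simps)

text \<open>Conjugation by \<open>g\<close> transports the image of 1 - s, the fixed space, the
  centraliser and the determinants on the quotient.\<close>

lemma SB_conj:
  assumes s: "s \<in> SB" and g: "g \<in> G"
  shows "g \<circ> s \<circ> giv g \<in> SB"
proof -
  let ?s = "g \<circ> s \<circ> giv g"
  have sG: "s \<in> G" using SB_G[OF s] .
  have s': "s \<noteq> id" "V.dim (range (\<lambda>v. v - s v)) = 2" "\<And>x. x \<in> centraliser G s \<Longrightarrow> det_mod sc (fixed_space s) x = 1"
    using s by (simp_all add: special_bireflections_def bireflections_def)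
  have bk: "giv g \<circ> ?s \<circ> g = s" by (simp add: fun_eq_iff giv_simps[OF g])
  have G': "?s \<in> G" by (intro G_comp G_giv g sG)
  have ne: "?s \<noteq> id"
  proof
    assume i: "?s = id"
    have "s = giv g \<circ> g" using bk unfolding i by (simp only: o_id)
    also have "\<dots> = id" by (simp add: fun_eq_iff giv_simps[OF g])
    finally show False using s'(1) by simp
  qed
  have "range (\<lambda>v. v - ?s v) = g ` range (\<lambda>v. v - s v)"
  proof (intro equalityI subsetI)
    fix x assume "x \<in> range (\<lambda>v. v - ?s v)"
    then obtain v where "x = v - ?s v" by blast
    then have "x = g (giv g v - s (giv g v))" by (simp add: g_diff[OF g] giv_simps[OF g])
    then show "x \<in> g ` range (\<lambda>v. v - s v)" by blast
  next
    fix x assume "x \<in> g ` range (\<lambda>v. v - s v)"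
    then obtain v where "x = g (v - s v)" by blast
    then have "x = g v - ?s (g v)" by (simp add: g_diff[OF g] giv_simps[OF g])
    then show "x \<in> range (\<lambda>v. v - ?s v)" by blast
  qed
  moreover have "V.dim (g ` range (\<lambda>v. v - s v)) = V.dim (range (\<lambda>v. v - s v))"
  proof -
    interpret P: finite_dimensional_vector_space_pair_1 sc Basis sc by unfold_locales
    show ?thesis by (rule P.dim_image_eq[OF G_linear[OF g]])
      (rule inj_on_subset[OF bij_is_inj[OF G_bij[OF g]] subset_UNIV])
  qed
  ultimately have dim: "V.dim (range (\<lambda>v. v - ?s v)) = 2" using s'(2) by simp
  have fx: "fixed_space ?s = g ` fixed_space s"
  proof (intro equalityI subsetI)
    fix x assume "x \<in> fixed_space ?s"
    then have "x = g (s (giv g x))" by (simp add: fixed_space_def)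
    then have "giv g x = s (giv g x)" using giv_simps(1)[OF g, of "s (giv g x)"] by simp
    then have "giv g x \<in> fixed_space s" by (simp add: fixed_space_def)
    then show "x \<in> g ` fixed_space s" by (rule rev_image_eqI) (simp add: giv_simps[OF g])
  next
    fix x assume "x \<in> g ` fixed_space s"
    then obtain y where "y \<in> fixed_space s" and xy: "x = g y" by blast
    then have "s y = y" by (simp add: fixed_space_def)
    then show "x \<in> fixed_space ?s" unfolding xy by (simp add: fixed_space_def giv_simps[OF g])
  qed
  have "det_mod sc (fixed_space ?s) x = 1" if x: "x \<in> centraliser G ?s" for x
  proof -
    let ?x = "giv g \<circ> x \<circ> g"
    have xG: "x \<in> G" and com: "x \<circ> ?s = ?s \<circ> x" using x by (simp_all add: centraliser_def)
    have "?x \<circ> s = giv g \<circ> (x \<circ> ?s) \<circ> g" by (simp add: fun_eq_iff giv_simps[OF g])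
    also have "\<dots> = s \<circ> ?x" unfolding com by (simp add: fun_eq_iff giv_simps[OF g])
    finally have "?x \<in> centraliser G s" by (simp add: centraliser_def G_comp G_giv g xG)
    then have 1: "det_mod sc (fixed_space s) ?x = 1" by (rule s'(3))
    have xx: "g \<circ> ?x \<circ> giv g = x" by (simp add: fun_eq_iff giv_simps[OF g])
    from det_mod_conj[where g = g and sc = sc and W = "fixed_space s" and x = ?x, OF G_plus[OF g] G_scale[OF g] G_bij[OF g]]
    show ?thesis unfolding fx xx 1 .
  qed
  then show ?thesis unfolding special_bireflections_def bireflections_def using G' ne dim by blast
qed

lemma
  assumes s: "s \<in> SB"
  shows \<Omega>_skew: "skew_form sc (\<Omega> s)" and \<Omega>_rad: "form_radical (\<Omega> s) = fixed_space s"
    and \<Omega>_equiv: "g \<in> G \<Longrightarrow> \<Omega> (giv g \<circ> s \<circ> g) v w = \<Omega> s (g v) (g w)"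
proof -
  note c = bspec[OF compat[unfolded compatible_forms_def] s]
  show "skew_form sc (\<Omega> s)" by (rule conjunct1[OF c])
  show "form_radical (\<Omega> s) = fixed_space s" using c by (elim conjE)
  show "\<Omega> (giv g \<circ> s \<circ> g) v w = \<Omega> s (g v) (g w)" if "g \<in> G"
  proof -
    have "\<forall>g\<in>G. \<forall>v w. \<Omega> (giv g \<circ> s \<circ> g) v w = \<Omega> s (g v) (g w)" using c by (elim conjE)
    then show ?thesis using that by blast
  qed
qed

lemma skew_formD:
  assumes "skew_form sc B"
  shows "B (u + v) w = B u w + B v w" "B (sc z v) w = z * B v w" "B v w = - B w v"
proof -
  have lin: "Vector_Spaces.linear sc (*) (\<lambda>v. B v w)" and sk: "\<forall>v w. B v w = - B w v"
    using assms unfolding skew_form_def by blast+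
  have "(\<forall>x y. B (x + y) w = B x w + B y w) \<and> (\<forall>c x. B (sc c x) w = c * B x w)"
    using lin unfolding Vector_Spaces.linear_iff by blast
  then show "B (u + v) w = B u w + B v w" "B (sc z v) w = z * B v w" by blast+
  show "B v w = - B w v" by (rule spec[OF spec[OF sk]])
qed

lemma b_inv: "i \<in> {1..N} \<Longrightarrow> b i \<in> invariant_skew_forms sc G"
  using forms unfolding invariant_form_basis_def by blast

lemma b_skew: "i \<in> {1..N} \<Longrightarrow> skew_form sc (b i)"
  and b_G: "i \<in> {1..N} \<Longrightarrow> g \<in> G \<Longrightarrow> b i (g v) (g w) = b i v w"
  using b_inv[of i] unfolding invariant_skew_forms_def by blast+

text \<open>The Jacobi condition is trivial at the identity, where s w - w = 0. At a bireflection it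
  is the rank two identity, the radical of \<open>\<Omega> s\<close> being the kernel of 1 -
  s.\<close>

lemma hecke_data_kap: "hecke_data sc Basis G kap"
proof
  show "kap s (u + v) w = kap s u w + kap s v w" for s u v w
    by (auto simp: kap_def skew_formD(1)[OF \<Omega>_skew] skew_formD(1)[OF b_skew] distrib_left simp flip: sum.distrib)
  show "kap s (sc z v) w = z * kap s v w" for s z v w
    by (auto simp: kap_def skew_formD(2)[OF \<Omega>_skew] skew_formD(2)[OF b_skew] sum_distrib_left mult.left_commute)
  show "kap s v w = - kap s w v" for s v w
  proof -
    have "(\<Sum>i=1..N. t i * b i v w) = - (\<Sum>i=1..N. t i * b i w v)"
      unfolding sum_negf[symmetric] by (intro sum.cong refl) (simp add: skew_formD(3)[OF b_skew, of _ v w])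
    moreover have "s \<in> SB \<Longrightarrow> \<Omega> s v w = - \<Omega> s w v" by (rule skew_formD(3)[OF \<Omega>_skew])
    ultimately show ?thesis by (simp add: kap_def)
  qed
  show "kap (g \<circ> s \<circ> giv g) (g v) (g w) = kap s v w" if s: "s \<in> G" and g: "g \<in> G" for s g v w
  proof -
    have bk: "giv g \<circ> (g \<circ> s \<circ> giv g) \<circ> g = s" by (simp add: fun_eq_iff giv_simps[OF g])
    have idc: "g \<circ> id \<circ> giv g = id" "giv g \<circ> id \<circ> g = id" by (simp_all add: fun_eq_iff giv_simps[OF g])
    show ?thesis
    proof (cases "s = id")
      case True
      have "(\<Sum>i=1..N. t i * b i (g v) (g w)) = (\<Sum>i=1..N. t i * b i v w)"
        by (intro sum.cong refl) (simp add: b_G[OF _ g])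
      then show ?thesis unfolding True idc(1) by (simp add: kap_def)
    next
      case False
      have ne: "g \<circ> s \<circ> giv g \<noteq> id" using bk False idc(2) by metis
      show ?thesis
      proof (cases "s \<in> SB")
        case True
        have c: "c (giv (giv g) \<circ> s \<circ> giv g) = c s"
          using inv_c True G_giv[OF g] unfolding conjugation_invariant_def by blast
        have "\<Omega> (giv (giv g) \<circ> s \<circ> giv g) (g v) (g w) = \<Omega> s (giv g (g v)) (giv g (g w))"
          by (rule \<Omega>_equiv[OF True G_giv[OF g]])
        then show ?thesis using c ne False True SB_conj[OF True g] unfolding giv_giv[OF g] giv_simps[OF g]
          by (simp add: kap_def)
      next
        case nS: False
        have "g \<circ> s \<circ> giv g \<notin> SB"
        proof
          assume "g \<circ> s \<circ> giv g \<in> SB"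
          from SB_conj[OF this G_giv[OF g]] have "giv g \<circ> (g \<circ> s \<circ> giv g) \<circ> g \<in> SB" unfolding giv_giv[OF g] .
          then show False using nS unfolding bk by blast
        qed
        then show ?thesis using ne False nS by (simp add: kap_def)
      qed
    qed
  qed
  show "sc (kap s u v) (s w - w) + sc (kap s v w) (s u - u) + sc (kap s w u) (s v - v) = 0" if s: "s \<in> G" for s u v w
  proof (cases "s \<in> SB")
    case True
    let ?d = "\<lambda>v. v - s v"
    have "sc (\<Omega> s u v) (?d w) + sc (\<Omega> s v w) (?d u) + sc (\<Omega> s w u) (?d v) = 0"
    proof (rule rank_two_jacobi[OF fd])
      show "?d (u + v) = ?d u + ?d v" for u v by (simp add: G_plus[OF s])
      show "?d (sc z v) = sc z (?d v)" for z v by (simp add: G_scale[OF s] V.scale_right_diff_distrib)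
      show "\<Omega> s v w = 0" if "?d v = 0" for v w
      proof -
        have "v \<in> form_radical (\<Omega> s)" unfolding \<Omega>_rad[OF True] fixed_space_def using that by simp
        then show ?thesis unfolding form_radical_def by blast
      qed
      show "V.dim (range ?d) = 2" using True by (simp add: special_bireflections_def bireflections_def)
    qed (rule skew_formD[OF \<Omega>_skew[OF True]])+
    then have "sc (- c s) (sc (\<Omega> s u v) (?d w) + sc (\<Omega> s v w) (?d u) + sc (\<Omega> s w u) (?d v)) = 0" by simp
    moreover have "s \<noteq> id" using True id_not_SB by blast
    then have k: "kap s x y = c s * \<Omega> s x y" for x y using True by (simp add: kap_def)
    have m: "s x - x = - ?d x" for x by simp
    have "sc (kap s u v) (s w - w) + sc (kap s v w) (s u - u) + sc (kap s w u) (s v - v)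
      = sc (- c s) (sc (\<Omega> s u v) (?d w) + sc (\<Omega> s v w) (?d u) + sc (\<Omega> s w u) (?d v))"
      unfolding k m by (simp only: V.scale_right_distrib V.scale_scale V.scale_minus_right V.scale_minus_left mult_minus_left)
    ultimately show ?thesis by simp
  next
    case False then show ?thesis by (cases "s = id") (simp_all add: kap_def)
  qed
qed (rule fin G_id G_comp G_giv G_bij G_plus G_scale; assumption)+

interpretation hd: hecke_data sc Basis G kap by (rule hecke_data_kap)

lemma hecke_kappa_\<Psi>: "hecke_kappa sc G N b \<Omega> t c v w = hd.\<Psi> (\<Sum>s\<in>G. CC (kap s v w) * MM [] s)"
proof -
  interpret sp: presented hd.FG hd.\<Psi> "skew_tensor_algebra sc G" by (rule hd.skew_presented)
  interpret S: ring "skew_tensor_algebra sc G" by (rule sp.is_ring)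
  let ?T = "\<Sum>i=1..N. t i * b i v w"
  have SBG: "SB \<subseteq> G" using SB_G by blast
  have finS: "finite SB" using finite_subset[OF SBG fin] .
  have mF: "CC z * MM [] s \<in> hd.FG" if "s \<in> G" for z s by (intro hd.FG_mult hd.FG_CC hd.FG_MM that)
  have sF: "(\<Sum>s\<in>SB. CC (c s * \<Omega> s v w) * MM [] s) \<in> hd.FG" by (rule hd.FG_sum) (rule mF[OF SB_G])
  have "(\<Sum>s\<in>G. CC (kap s v w) * MM [] s) = (\<Sum>s\<in>insert id SB. CC (kap s v w) * MM [] s)"
    by (rule sum.mono_neutral_right[OF fin]) (use SBG G_id in \<open>auto simp: kap_def\<close>)
  also have "\<dots> = CC ?T * MM [] id + (\<Sum>s\<in>SB. CC (c s * \<Omega> s v w) * MM [] s)"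
  proof -
    have "(\<Sum>s\<in>SB. CC (kap s v w) * MM [] s) = (\<Sum>s\<in>SB. CC (c s * \<Omega> s v w) * MM [] s)"
      by (intro sum.cong refl) (use id_not_SB in \<open>auto simp: kap_def\<close>)
    then show ?thesis unfolding sum.insert[OF finS id_not_SB] by (simp add: kap_def)
  qed
  finally have e: "(\<Sum>s\<in>G. CC (kap s v w) * MM [] s) = CC ?T * MM [] id + (\<Sum>s\<in>SB. CC (c s * \<Omega> s v w) * MM [] s)" .
  have 1: "hd.\<Psi> (CC ?T * MM [] id + (\<Sum>s\<in>SB. CC (c s * \<Omega> s v w) * MM [] s)) = hd.\<Psi> (CC ?T * MM [] id) \<oplus>\<^bsub>skew_tensor_algebra sc G\<^esub>
    hd.\<Psi> (\<Sum>s\<in>SB. CC (c s * \<Omega> s v w) * MM [] s)"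
    by (rule sp.\<phi>_add[OF mF[OF G_id] sF])
  have "hd.\<Psi> (\<Sum>s\<in>SB. CC (c s * \<Omega> s v w) * MM [] s)
    = (\<Oplus>\<^bsub>skew_tensor_algebra sc G\<^esub>s\<in>SB. hd.\<Psi> (CC (c s * \<Omega> s v w) * MM [] s))"
    by (rule sp.\<phi>_sum[OF finS]) (rule mF[OF SB_G])
  also have "\<dots> = (\<Oplus>\<^bsub>skew_tensor_algebra sc G\<^esub>s\<in>SB. (c s * \<Omega> s v w) \<odot>\<^bsub>skew_tensor_algebra sc G\<^esub> skew_grp sc G s)"
  proof (rule S.finsum_cong')
    have sm: "hd.\<Psi> (CC (c s * \<Omega> s v w) * MM [] s) = (c s * \<Omega> s v w) \<odot>\<^bsub>skew_tensor_algebra sc G\<^esub> skew_grp sc G s"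
      if "s \<in> SB" for s
      unfolding hd.skew_grp_\<Psi> by (rule sp.\<phi>_smult[OF hd.FG_MM[OF SB_G[OF that]]])
    then show "hd.\<Psi> (CC (c s * \<Omega> s v w) * MM [] s) = (c s * \<Omega> s v w) \<odot>\<^bsub>skew_tensor_algebra sc G\<^esub> skew_grp sc G s"
      if "s \<in> SB" for s using that .
    show "(\<lambda>s. (c s * \<Omega> s v w) \<odot>\<^bsub>skew_tensor_algebra sc G\<^esub> skew_grp sc G s) \<in> SB \<rightarrow> carrier (skew_tensor_algebra sc G)"
    proof (rule funcsetI)
      fix s assume s: "s \<in> SB"
      show "(c s * \<Omega> s v w) \<odot>\<^bsub>skew_tensor_algebra sc G\<^esub> skew_grp sc G s \<in> carrier (skew_tensor_algebra sc G)"
        unfolding sm[OF s, symmetric] by (rule sp.\<phi>_in[OF mF[OF SB_G[OF s]]])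
    qed
  qed simp
  finally have 2: "hd.\<Psi> (\<Sum>s\<in>SB. CC (c s * \<Omega> s v w) * MM [] s)
    = (\<Oplus>\<^bsub>skew_tensor_algebra sc G\<^esub>s\<in>SB. (c s * \<Omega> s v w) \<odot>\<^bsub>skew_tensor_algebra sc G\<^esub> skew_grp sc G s)" .
  have 3: "hd.\<Psi> (CC ?T * MM [] id) = ?T \<odot>\<^bsub>skew_tensor_algebra sc G\<^esub> skew_grp sc G id"
    unfolding hd.skew_grp_\<Psi> by (rule sp.\<phi>_smult[OF hd.FG_MM[OF G_id]])
  show ?thesis unfolding hecke_kappa_def e 1 2 3 ..
qed

lemma hecke_algebra_eq: "graded_hecke_algebra sc G N b \<Omega> t c = quotient_algebra (skew_tensor_algebra sc G) hd.hideal"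
proof -
  interpret sp: presented hd.FG hd.\<Psi> "skew_tensor_algebra sc G" by (rule hd.skew_presented)
  have V: "MM [v] id \<in> hd.FG" for v by (rule hd.FG_MM[OF G_id])
  have K: "(\<Sum>s\<in>G. CC (kap s v w) * MM [] s) \<in> hd.FG" for v w by (intro hd.FG_sum hd.FG_mult hd.FG_CC hd.FG_MM)
  have "(skew_vec sc G v \<otimes>\<^bsub>skew_tensor_algebra sc G\<^esub> skew_vec sc G w
      \<ominus>\<^bsub>skew_tensor_algebra sc G\<^esub> skew_vec sc G w \<otimes>\<^bsub>skew_tensor_algebra sc G\<^esub> skew_vec sc G v)
      \<ominus>\<^bsub>skew_tensor_algebra sc G\<^esub> hecke_kappa sc G N b \<Omega> t c v w = hd.\<Psi> (hd.comel v w)" for v w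
    unfolding hd.skew_vec_\<Psi> hecke_kappa_\<Psi> hd.comel_def
    by (simp only: sp.\<phi>_diff sp.\<phi>_mult V K hd.FG_mult hd.FG_diff)
  then show ?thesis unfolding graded_hecke_algebra_def hd.hideal_def Let_def by simp
qed

text \<open>Linear independence of the forms \<open>b i\<close> turns vanishing of the scalar part
  into vanishing of its coefficients.\<close>

lemma kap_id_zero_iff: "(\<forall>u v. kap id u v = 0) \<longleftrightarrow> (\<forall>i\<in>{1..N}. t i = 0)"
proof
  assume "\<forall>u v. kap id u v = 0"
  then have "\<forall>v w. (\<Sum>i=1..N. t i * b i v w) = 0" by (simp add: kap_def)
  moreover have "\<forall>a. (\<forall>v w. (\<Sum>i=1..N. a i * b i v w) = 0) \<longrightarrow> (\<forall>i\<in>{1..N}. a i = 0)"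
    using forms unfolding invariant_form_basis_def by blast
  ultimately show "\<forall>i\<in>{1..N}. t i = 0" by blast
next
  assume "\<forall>i\<in>{1..N}. t i = 0"
  then show "\<forall>u v. kap id u v = 0" by (simp add: kap_def)
qed

theorem equivalences:
  "(PI_algebra (graded_hecke_algebra sc G N b \<Omega> t c) \<longleftrightarrow> finite_over_centre (graded_hecke_algebra sc G N b \<Omega> t c)) \<and>
   (finite_over_centre (graded_hecke_algebra sc G N b \<Omega> t c) \<longleftrightarrow> (\<forall>i\<in>{1..N}. t i = 0))"
proof -
  interpret ha: hecke_alg sc Basis G kap hd.hker by (rule hd.hecke_alg_hker)
  show ?thesis unfolding hecke_algebra_eq kap_id_zero_iff[symmetric]
    by (rule ha.presented_equivalences[OF hd.hecke_presented hd.hecke_kernel])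
qed

end

theorem corollary6p5:
  fixes sc :: "complex \<Rightarrow> 'v::ab_group_add \<Rightarrow> 'v" and Basis :: "'v set"
    and G :: "('v \<Rightarrow> 'v) set"
    and N :: nat and b :: "nat \<Rightarrow> 'v \<Rightarrow> 'v \<Rightarrow> complex"
    and \<Omega> :: "('v \<Rightarrow> 'v) \<Rightarrow> 'v \<Rightarrow> 'v \<Rightarrow> complex"
    and t :: "nat \<Rightarrow> complex" and c :: "('v \<Rightarrow> 'v) \<Rightarrow> complex"
  defines "A \<equiv> graded_hecke_algebra sc G N b \<Omega> t c"
  assumes "finite_dimensional_vector_space sc Basis"
    and "subgroup G (GL sc)" and "finite G"
    and "invariant_form_basis sc G N b"
    and "compatible_forms sc G \<Omega>"
    and "conjugation_invariant sc G c"
  shows "(PI_algebra A \<longleftrightarrow> finite_over_centre A) \<and>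
         (finite_over_centre A \<longleftrightarrow> (\<forall>i\<in>{1..N}. t i = 0))"
proof -
  have par: "hecke_parameters sc Basis G N b \<Omega> c"
    by (rule hecke_parameters.intro[OF assms(2-7)])
  show ?thesis unfolding A_def by (rule hecke_parameters.equivalences[OF par])
qed

end
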